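(* Let $(\eta,\beta)\in Z^1_c(Q;\hat V)\times Z^2(Q;V)$ be a compatible pair of cocycles with $\eta$ essentially bijective, let $G$ be the extension of $V$ by $Q$ defined by $\beta$, let $b\colon Q\times Q\to\mathbb T$ be a Borel map with $\psi=\partial b$, and let $\pi\colon G\to U(L^2(Q))$ be the projective unitary representation $$(\pi(q,v)\varphi)(q_0)=e^{-i\langle\eta(q_0),v\rangle}\,b(q_0^{-1},q)\,\varphi(q^{-1}q_0).$$ Then the pair $(B(L^2(Q)),\mathrm{Ad}\,\pi)$ is a $G$-Galois object.
   Context: Groups. $Q$ and $V$ are second countable locally compact groups, $V$ is abelian (written additively), and $Q$ acts on $V$ through a continuous homomorphism $Q\to\mathrm{Aut}(V)$. $\hat V$ is the Pontryagin dual (written additively), the pairing of $\hat V$ and $V$ is written $e^{i\langle\xi,v\rangle}\in\mathbb T$ (notation only), and $Q$ acts on $\hat V$ by the dual action $e^{i\langle q^\flat\xi,v\rangle}=e^{i\langle\xi,q^{-1}v\rangle}$. Cohomology is Moore cohomology with Borel cochains. $\beta\in Z^2(Q;V)$ is a Borel map $Q\times Q\to V$ with $\beta(q_1,q_2)+\beta(q_1q_2,q_3)=q_1\beta(q_2,q_3)+\beta(q_1,q_2q_3)$; $G$ is $Q\times V$ as a Borel space, with product $(q_1,v_1)(q_2,v_2)=(q_1q_2,v_1+q_1v_2+\beta(q_1,q_2))$ and the corresponding second countable locally compact group topology. Cocycles. $Z^1_c(Q;\hat V)$ is the set of continuous maps $\eta\colon Q\to\hat V$ with $\eta(q_1q_2)=\eta(q_1)+q_1^\flat\eta(q_2)$.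 $\eta$ is essentially bijective if it is a measure class isomorphism $Q\to\hat V$ (with respect to Haar measures; i.e. after removing null sets it is a Borel isomorphism preserving null sets in both directions). Put $\psi(q_1,q_2,q_3):=e^{i\langle\eta(q_1^{-1}),\beta(q_2,q_3)\rangle}\in Z^3(Q;\mathbb T)$. The pair $(\eta,\beta)$ is compatible if $[\psi]=[1]$ in $H^3(Q;\mathbb T)$. The coboundary convention is $(\partial b)(q_1,q_2,q_3)=\dfrac{b(q_2,q_3)\,b(q_1,q_2q_3)}{b(q_1,q_2)\,b(q_1q_2,q_3)}$. Measures. $|q|=|q|_V$ is defined by $\int_V f(qv)\,dv=|q|^{-1}\int_V f(v)\,dv$. $dq$ is a left Haar measure on $Q$ and $\Delta_Q$ the modular function; left Haar measure and modular function of $G$ are $d(q,v)=|q|^{-1}dq\,dv$ and $\Delta(q,v)=\Delta_Q(q)/|q|$. Given a Haar measure $d\xi$ on $\hat V$, $dq$ is normalized by $\int_Q f(\eta(q))\,|q|^{-1}dq=\int_{\hat V}f(\xi)\,d\xi$ for positive Borel $f$, and $dv$ is normalized so that the Fourier transform is unitary $L^2(V)\to L^2(\hat V)$. Galois objects. $\pi$ is irreducible and square-integrable, with Duflo--Moore operator $D$ equal to multiplication by $\Delta^{-1}|_Q=|\cdot|\Delta_Q^{-1}$. On $\mathcal N:=B(L^2(Q))$ consider the weight $\tilde\varphi:=\mathrm{Tr}(D^{1/2}\,\cdot\,D^{1/2})$; then $\tilde\varphi(T)1=\int_G(\mathrm{Ad}\,\pi(g))(T)\,dg$ for $T\in\mathcal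 N_+$. Let $\tilde\Lambda\colon\mathfrak N_{\tilde\varphi}\to L^2(\mathcal N,\tilde\varphi)$ be the GNS-map, $\mathfrak N_{\tilde\varphi}=\{T:\tilde\varphi(T^*T)<\infty\}$. The Galois map is the isometry $\mathcal G\colon L^2(\mathcal N,\tilde\varphi)\otimes L^2(\mathcal N,\tilde\varphi)\to L^2(G;L^2(\mathcal N,\tilde\varphi))$ given by $\mathcal G(\tilde\Lambda(S)\otimes\tilde\Lambda(T))(g):=\tilde\Lambda(\pi(g)S\pi(g)^*T)$. The pair $(\mathcal N,\mathrm{Ad}\,\pi)$ is called a $G$-Galois object if $\mathcal G$ is unitary. *)

theory Defs
  imports "HOL-Analysis.Analysis"
begin

text \<open>
  The group Q is written additively although it need not be commutative: the library class
  \<^class>\<open>topological_group_add\<close> does not assume commutativity. So \<open>q\<^sub>1 + q\<^sub>2\<close>, \<open>- q\<close> and \<open>0\<close>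
  stand for the product, the inverse and the unit of Q. Cochains are curried functions.
\<close>


section \<open>The Pontryagin dual\<close>

definition is_character :: "('v::topological_ab_group_add \<Rightarrow> complex) \<Rightarrow> bool" where
  "is_character k \<longleftrightarrow>
     continuous_on UNIV k \<and> (\<forall>v. cmod (k v) = 1) \<and> (\<forall>v w. k (v + w) = k v * k w)"

text \<open>\<open>pairing \<xi> v\<close> is the number written \<open>e\<^bsup>i\<langle>\<xi>,v\<rangle>\<^esup>\<close> on paper.\<close>

typedef (overloaded) ('v::topological_ab_group_add) pdual = "{k::'v \<Rightarrow> complex. is_character k}"
  morphisms pairing Abs_pdual
  by (rule exI[of _ "\<lambda>_. 1"]) (simp add: is_character_def)

lemma is_character_pairing: "is_character (pairing \<xi>)"
  using pairing[of \<xi>] by simp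

lemma is_character_one: "is_character (\<lambda>_. 1)"
  by (simp add: is_character_def)

lemma is_character_mult:
  "is_character k \<Longrightarrow> is_character h \<Longrightarrow> is_character (\<lambda>v. k v * h v)"
  by (auto simp: is_character_def norm_mult intro!: continuous_intros)

lemma is_character_cnj: "is_character k \<Longrightarrow> is_character (\<lambda>v. cnj (k v))"
  by (auto simp: is_character_def intro!: continuous_intros)

instantiation pdual :: (topological_ab_group_add) ab_group_add
begin

definition zero_pdual :: "'a pdual" where
  "0 = Abs_pdual (\<lambda>_. 1)"

definition plus_pdual :: "'a pdual \<Rightarrow> 'a pdual \<Rightarrow> 'a pdual" where
  "\<xi> + \<zeta> = Abs_pdual (\<lambda>v. pairing \<xi> v * pairing \<zeta> v)"

definition uminus_pdual :: "'a pdual \<Rightarrow> 'a pdual" where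
  "- \<xi> = Abs_pdual (\<lambda>v. cnj (pairing \<xi> v))"

definition minus_pdual :: "'a pdual \<Rightarrow> 'a pdual \<Rightarrow> 'a pdual" where
  "\<xi> - \<zeta> = \<xi> + - (\<zeta> :: 'a pdual)"

lemma pairing_zero: "pairing (0 :: 'a pdual) v = 1"
  by (simp add: zero_pdual_def Abs_pdual_inverse is_character_one)

lemma pairing_plus: "pairing (\<xi> + \<zeta> :: 'a pdual) v = pairing \<xi> v * pairing \<zeta> v"
  by (simp add: plus_pdual_def Abs_pdual_inverse is_character_mult is_character_pairing)

lemma pairing_uminus: "pairing (- \<xi> :: 'a pdual) v = cnj (pairing \<xi> v)"
  by (simp add: uminus_pdual_def Abs_pdual_inverse is_character_cnj is_character_pairing)

lemma pdual_eqI: "(\<And>v. pairing \<xi> v = pairing \<zeta> v) \<Longrightarrow> \<xi> = (\<zeta> :: 'a pdual)"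
  by (simp add: pairing_inject[symmetric] fun_eq_iff)

instance
proof
  fix \<xi> \<zeta> \<theta> :: "'a pdual"
  show "\<xi> + \<zeta> + \<theta> = \<xi> + (\<zeta> + \<theta>)" by (rule pdual_eqI) (simp add: pairing_plus)
  show "\<xi> + \<zeta> = \<zeta> + \<xi>" by (rule pdual_eqI) (simp add: pairing_plus)
  show "0 + \<xi> = \<xi>" by (rule pdual_eqI) (simp add: pairing_plus pairing_zero)
  show "- \<xi> + \<xi> = 0"
  proof (rule pdual_eqI)
    fix v
    have "cmod (pairing \<xi> v) = 1"
      using is_character_pairing[of \<xi>] by (simp add: is_character_def)
    then show "pairing (- \<xi> + \<xi>) v = pairing 0 v"
      by (metis complex_norm_square mult.commute of_real_1 one_power2 pairing_plus
          pairing_uminus pairing_zero)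
  qed
  show "\<xi> - \<zeta> = \<xi> + - \<zeta>" by (rule minus_pdual_def)
qed

end

text \<open>The compact-open topology.\<close>

instantiation pdual :: (topological_ab_group_add) topological_space
begin

definition open_pdual :: "'a pdual set \<Rightarrow> bool" where
  "open_pdual =
     generate_topology {{\<xi>. pairing \<xi> ` K \<subseteq> W} | K W. compact (K :: 'a set) \<and> open (W :: complex set)}"

instance
  by standard (auto simp: open_pdual_def intro: generate_topology.intros)

end


section \<open>Actions, cocycles and the extension\<close>

text \<open>
  For locally compact groups, homomorphisms \<open>Q \<rightarrow> Aut(V)\<close> that are continuous for the usual group
  topology of \<open>Aut(V)\<close> are the same thing as jointly continuous actions by automorphisms.
\<close>

definition continuous_group_action ::
    "('q::topological_group_add \<Rightarrow> 'v::topological_ab_group_add \<Rightarrow> 'v) \<Rightarrow> bool" where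
  "continuous_group_action act \<longleftrightarrow>
     (\<forall>v. act 0 v = v) \<and> (\<forall>p q v. act (p + q) v = act p (act q v)) \<and>
     (\<forall>q v w. act q (v + w) = act q v + act q w) \<and>
     continuous_on UNIV (\<lambda>(q, v). act q v)"

definition dual_act ::
    "('q::topological_group_add \<Rightarrow> 'v::topological_ab_group_add \<Rightarrow> 'v) \<Rightarrow> 'q \<Rightarrow> 'v pdual \<Rightarrow> 'v pdual" where
  "dual_act act q \<xi> = Abs_pdual (\<lambda>v. pairing \<xi> (act (- q) v))"

definition Z1c ::
    "('q::topological_group_add \<Rightarrow> 'v::topological_ab_group_add \<Rightarrow> 'v) \<Rightarrow> ('q \<Rightarrow> 'v pdual) set" where
  "Z1c act = {\<eta>. continuous_on UNIV \<eta> \<and>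
     (\<forall>q\<^sub>1 q\<^sub>2. \<eta> (q\<^sub>1 + q\<^sub>2) = \<eta> q\<^sub>1 + dual_act act q\<^sub>1 (\<eta> q\<^sub>2))}"

definition Z2 ::
    "('q::topological_group_add \<Rightarrow> 'v::topological_ab_group_add \<Rightarrow> 'v) \<Rightarrow> ('q \<Rightarrow> 'q \<Rightarrow> 'v) set" where
  "Z2 act = {\<beta>. (\<lambda>(q\<^sub>1, q\<^sub>2). \<beta> q\<^sub>1 q\<^sub>2) \<in> borel_measurable (borel \<Otimes>\<^sub>M borel) \<and>
     (\<forall>q\<^sub>1 q\<^sub>2 q\<^sub>3. \<beta> q\<^sub>1 q\<^sub>2 + \<beta> (q\<^sub>1 + q\<^sub>2) q\<^sub>3 = act q\<^sub>1 (\<beta> q\<^sub>2 q\<^sub>3) + \<beta> q\<^sub>1 (q\<^sub>2 + q\<^sub>3))}"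

definition circle_cochain2 :: "('q::topological_group_add \<Rightarrow> 'q \<Rightarrow> complex) \<Rightarrow> bool" where
  "circle_cochain2 b \<longleftrightarrow>
     (\<lambda>(q\<^sub>1, q\<^sub>2). b q\<^sub>1 q\<^sub>2) \<in> borel_measurable (borel \<Otimes>\<^sub>M borel) \<and> (\<forall>q\<^sub>1 q\<^sub>2. cmod (b q\<^sub>1 q\<^sub>2) = 1)"

definition coboundary2 ::
    "('q::topological_group_add \<Rightarrow> 'q \<Rightarrow> complex) \<Rightarrow> 'q \<Rightarrow> 'q \<Rightarrow> 'q \<Rightarrow> complex" where
  "coboundary2 b q\<^sub>1 q\<^sub>2 q\<^sub>3 = (b q\<^sub>2 q\<^sub>3 * b q\<^sub>1 (q\<^sub>2 + q\<^sub>3)) / (b q\<^sub>1 q\<^sub>2 * b (q\<^sub>1 + q\<^sub>2) q\<^sub>3)"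

definition psi_cocycle ::
    "('q::topological_group_add \<Rightarrow> 'v::topological_ab_group_add pdual) \<Rightarrow> ('q \<Rightarrow> 'q \<Rightarrow> 'v)
      \<Rightarrow> 'q \<Rightarrow> 'q \<Rightarrow> 'q \<Rightarrow> complex" where
  "psi_cocycle \<eta> \<beta> q\<^sub>1 q\<^sub>2 q\<^sub>3 = pairing (\<eta> (- q\<^sub>1)) (\<beta> q\<^sub>2 q\<^sub>3)"

definition compatible_pair ::
    "('q::topological_group_add \<Rightarrow> 'v::topological_ab_group_add pdual) \<Rightarrow> ('q \<Rightarrow> 'q \<Rightarrow> 'v) \<Rightarrow> bool" where
  "compatible_pair \<eta> \<beta> \<longleftrightarrow> (\<exists>b. circle_cochain2 b \<and> psi_cocycle \<eta> \<beta> = coboundary2 b)"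

fun ext_mult ::
    "('q::topological_group_add \<Rightarrow> 'v::topological_ab_group_add \<Rightarrow> 'v) \<Rightarrow> ('q \<Rightarrow> 'q \<Rightarrow> 'v)
      \<Rightarrow> 'q \<times> 'v \<Rightarrow> 'q \<times> 'v \<Rightarrow> 'q \<times> 'v" where
  "ext_mult act \<beta> (q\<^sub>1, v\<^sub>1) (q\<^sub>2, v\<^sub>2) = (q\<^sub>1 + q\<^sub>2, v\<^sub>1 + act q\<^sub>1 v\<^sub>2 + \<beta> q\<^sub>1 q\<^sub>2)"


section \<open>Haar measures\<close>

text \<open>On second countable locally compact Hausdorff groups regularity is automatic.\<close>

definition left_haar :: "'g::{topological_space, group_add} measure \<Rightarrow> bool" where
  "left_haar \<mu> \<longleftrightarrow> sets \<mu> = sets borel \<and>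
     (\<forall>g. \<forall>A\<in>sets borel. emeasure \<mu> ((\<lambda>x. g + x) ` A) = emeasure \<mu> A) \<and>
     (\<forall>K. compact K \<longrightarrow> emeasure \<mu> K < \<infinity>) \<and> emeasure \<mu> UNIV \<noteq> 0"

text \<open>Convention: \<open>\<integral> f(q p) dq = \<Delta>(p)\<^sup>-\<^sup>1 \<integral> f(q) dq\<close> for the left Haar measure \<open>dq\<close>.\<close>

definition modular_fun :: "'g::{topological_space, group_add} measure \<Rightarrow> 'g \<Rightarrow> real" where
  "modular_fun \<mu> p = (THE c. 0 < c \<and> (\<forall>f\<in>borel_measurable borel.
     (\<integral>\<^sup>+x. f (x + p) \<partial>\<mu>) = ennreal (inverse c) * (\<integral>\<^sup>+x. f x \<partial>\<mu>)))"

definition act_modulus ::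
    "'v::topological_ab_group_add measure \<Rightarrow> ('q::topological_group_add \<Rightarrow> 'v \<Rightarrow> 'v) \<Rightarrow> 'q \<Rightarrow> real" where
  "act_modulus \<nu> act q = (THE c. 0 < c \<and> (\<forall>f\<in>borel_measurable borel.
     (\<integral>\<^sup>+v. f (act q v) \<partial>\<nu>) = ennreal (inverse c) * (\<integral>\<^sup>+v. f v \<partial>\<nu>)))"

definition ext_haar ::
    "('q::topological_group_add \<Rightarrow> 'v::topological_ab_group_add \<Rightarrow> 'v) \<Rightarrow> 'q measure \<Rightarrow> 'v measure
      \<Rightarrow> ('q \<times> 'v) measure" where
  "ext_haar act \<mu> \<nu> = density (\<mu> \<Otimes>\<^sub>M \<nu>) (\<lambda>(q, v). ennreal (inverse (act_modulus \<nu> act q)))"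

definition measure_class_iso :: "'a measure \<Rightarrow> 'b measure \<Rightarrow> ('a \<Rightarrow> 'b) \<Rightarrow> bool" where
  "measure_class_iso M N f \<longleftrightarrow> (\<exists>A\<in>null_sets M. \<exists>B\<in>null_sets N.
     bij_betw f (space M - A) (space N - B) \<and>
     f \<in> measurable (restrict_space M (space M - A)) (restrict_space N (space N - B)) \<and>
     the_inv_into (space M - A) f
       \<in> measurable (restrict_space N (space N - B)) (restrict_space M (space M - A)) \<and>
     (\<forall>E\<in>sets M. E \<subseteq> space M - A \<longrightarrow> (emeasure M E = 0 \<longleftrightarrow> emeasure N (f ` E) = 0)))"


section \<open>Hilbert spaces and operators\<close>

text \<open>
  Complex Hilbert spaces are given by explicit carriers and operations; the inner product is linear
  in the first variable. The constructions below start from a space with a merely positive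
  semidefinite form and then pass to equivalence classes.
\<close>

record 'a hspace =
  hcar :: "'a set"
  hzero :: 'a
  hadd :: "'a \<Rightarrow> 'a \<Rightarrow> 'a"
  hscale :: "complex \<Rightarrow> 'a \<Rightarrow> 'a"
  hinner :: "'a \<Rightarrow> 'a \<Rightarrow> complex"

definition hnorm :: "'a hspace \<Rightarrow> 'a \<Rightarrow> real" where
  "hnorm H x = sqrt (Re (hinner H x x))"

definition hdist :: "'a hspace \<Rightarrow> 'a \<Rightarrow> 'a \<Rightarrow> real" where
  "hdist H x y = hnorm H (hadd H x (hscale H (- 1) y))"

definition complex_hspace :: "complex hspace" where
  "complex_hspace =
     \<lparr>hcar = UNIV, hzero = 0, hadd = (+), hscale = (*), hinner = (\<lambda>x y. x * cnj y)\<rparr>"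

text \<open>The quotient of \<open>H\<close> by an equivalence relation compatible with all operations.\<close>

definition hquot :: "'a hspace \<Rightarrow> ('a \<times> 'a) set \<Rightarrow> 'a set hspace" where
  "hquot H r = (let cl = (\<lambda>x. r `` {x}); rep = (\<lambda>X. SOME x. x \<in> X) in
     \<lparr>hcar = hcar H // r,
      hzero = cl (hzero H),
      hadd = (\<lambda>X Y. cl (hadd H (rep X) (rep Y))),
      hscale = (\<lambda>c X. cl (hscale H c (rep X))),
      hinner = (\<lambda>X Y. hinner H (rep X) (rep Y))\<rparr>)"

definition cauchy_space :: "'a hspace \<Rightarrow> (nat \<Rightarrow> 'a) hspace" where
  "cauchy_space H =
     \<lparr>hcar = {x. (\<forall>n. x n \<in> hcar H) \<and> (\<forall>e>0. \<exists>N. \<forall>m\<ge>N. \<forall>n\<ge>N. hdist H (x m) (x n) < e)},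
      hzero = (\<lambda>_. hzero H),
      hadd = (\<lambda>x y n. hadd H (x n) (y n)),
      hscale = (\<lambda>c x n. hscale H c (x n)),
      hinner = (\<lambda>x y. lim (\<lambda>n. hinner H (x n) (y n)))\<rparr>"

definition cauchy_rel :: "'a hspace \<Rightarrow> ((nat \<Rightarrow> 'a) \<times> (nat \<Rightarrow> 'a)) set" where
  "cauchy_rel H = {(x, y). x \<in> hcar (cauchy_space H) \<and> y \<in> hcar (cauchy_space H) \<and>
     (\<lambda>n. hdist H (x n) (y n)) \<longlonglongrightarrow> 0}"

text \<open>Separation and completion of a space with a positive semidefinite form.\<close>

definition hcompletion :: "'a hspace \<Rightarrow> (nat \<Rightarrow> 'a) set hspace" where
  "hcompletion H = hquot (cauchy_space H) (cauchy_rel H)"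

definition hembed :: "'a hspace \<Rightarrow> 'a \<Rightarrow> (nat \<Rightarrow> 'a) set" where
  "hembed H x = cauchy_rel H `` {\<lambda>_. x}"

text \<open>
  Square-integrable \<open>H\<close>-valued functions. Measurability is weak measurability, which for separable
  \<open>H\<close> is the same as strong measurability.
\<close>

definition sqint_space :: "'x measure \<Rightarrow> 'h hspace \<Rightarrow> ('x \<Rightarrow> 'h) hspace" where
  "sqint_space M H =
     \<lparr>hcar = {f. (\<forall>x\<in>space M. f x \<in> hcar H) \<and>
                 (\<forall>h\<in>hcar H. (\<lambda>x. hinner H (f x) h) \<in> borel_measurable M) \<and>
                 (\<integral>\<^sup>+x. ennreal ((hnorm H (f x))\<^sup>2) \<partial>M) < \<infinity>},
      hzero = (\<lambda>_. hzero H),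
      hadd = (\<lambda>f g x. hadd H (f x) (g x)),
      hscale = (\<lambda>c f x. hscale H c (f x)),
      hinner = (\<lambda>f g. \<integral>x. hinner H (f x) (g x) \<partial>M)\<rparr>"

definition ae_rel :: "'x measure \<Rightarrow> 'h hspace \<Rightarrow> (('x \<Rightarrow> 'h) \<times> ('x \<Rightarrow> 'h)) set" where
  "ae_rel M H = {(f, g). f \<in> hcar (sqint_space M H) \<and> g \<in> hcar (sqint_space M H) \<and>
     (AE x in M. f x = g x)}"

definition L2 :: "'x measure \<Rightarrow> 'h hspace \<Rightarrow> ('x \<Rightarrow> 'h) set hspace" where
  "L2 M H = hquot (sqint_space M H) (ae_rel M H)"

definition L2_class :: "'x measure \<Rightarrow> 'h hspace \<Rightarrow> ('x \<Rightarrow> 'h) \<Rightarrow> ('x \<Rightarrow> 'h) set" where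
  "L2_class M H f = ae_rel M H `` {f}"

text \<open>
  The Hilbert space tensor product: finitely supported functions on \<open>H \<times> K\<close> are formal linear
  combinations of elementary tensors, and the vectors that vanish in the algebraic tensor product
  are null vectors of the form below.
\<close>

definition formal_tensors :: "'a hspace \<Rightarrow> 'b hspace \<Rightarrow> ('a \<times> 'b \<Rightarrow> complex) hspace" where
  "formal_tensors H K =
     \<lparr>hcar = {c. finite {p. c p \<noteq> 0} \<and> {p. c p \<noteq> 0} \<subseteq> hcar H \<times> hcar K},
      hzero = (\<lambda>_. 0),
      hadd = (\<lambda>c d p. c p + d p),
      hscale = (\<lambda>a c p. a * c p),
      hinner = (\<lambda>c d. \<Sum>p | c p \<noteq> 0. \<Sum>p' | d p' \<noteq> 0.
        c p * cnj (d p') * (hinner H (fst p) (fst p') * hinner K (snd p) (snd p')))\<rparr>"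

definition htensor :: "'a hspace \<Rightarrow> 'b hspace \<Rightarrow> (nat \<Rightarrow> 'a \<times> 'b \<Rightarrow> complex) set hspace" where
  "htensor H K = hcompletion (formal_tensors H K)"

definition elem_tensor ::
    "'a hspace \<Rightarrow> 'b hspace \<Rightarrow> 'a \<Rightarrow> 'b \<Rightarrow> (nat \<Rightarrow> 'a \<times> 'b \<Rightarrow> complex) set" where
  "elem_tensor H K x y = hembed (formal_tensors H K) (\<lambda>p. if p = (x, y) then 1 else 0)"

definition hlinear :: "'a hspace \<Rightarrow> 'b hspace \<Rightarrow> ('a \<Rightarrow> 'b) \<Rightarrow> bool" where
  "hlinear H K A \<longleftrightarrow> (\<forall>x\<in>hcar H. A x \<in> hcar K) \<and>
     (\<forall>x\<in>hcar H. \<forall>y\<in>hcar H. A (hadd H x y) = hadd K (A x) (A y)) \<and>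
     (\<forall>c. \<forall>x\<in>hcar H. A (hscale H c x) = hscale K c (A x))"

definition hunitary :: "'a hspace \<Rightarrow> 'b hspace \<Rightarrow> ('a \<Rightarrow> 'b) \<Rightarrow> bool" where
  "hunitary H K U \<longleftrightarrow> hlinear H K U \<and> U ` hcar H = hcar K \<and>
     (\<forall>x\<in>hcar H. \<forall>y\<in>hcar H. hinner K (U x) (U y) = hinner H x y)"

text \<open>\<open>B(H)\<close>; operators are \<^const>\<open>undefined\<close> outside the carrier, so that equality is equality on it.\<close>

definition bounded_ops :: "'a hspace \<Rightarrow> ('a \<Rightarrow> 'a) set" where
  "bounded_ops H = {A \<in> extensional (hcar H). hlinear H H A \<and>
     (\<exists>C. \<forall>x\<in>hcar H. hnorm H (A x) \<le> C * hnorm H x)}"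

definition op_adj :: "'a hspace \<Rightarrow> ('a \<Rightarrow> 'a) \<Rightarrow> 'a \<Rightarrow> 'a" where
  "op_adj H A = (THE B. B \<in> bounded_ops H \<and>
     (\<forall>x\<in>hcar H. \<forall>y\<in>hcar H. hinner H (A x) y = hinner H x (B y)))"

definition op_comp :: "'a hspace \<Rightarrow> ('a \<Rightarrow> 'a) \<Rightarrow> ('a \<Rightarrow> 'a) \<Rightarrow> 'a \<Rightarrow> 'a" where
  "op_comp H A B = (\<lambda>x\<in>hcar H. A (B x))"

definition op_add :: "'a hspace \<Rightarrow> ('a \<Rightarrow> 'a) \<Rightarrow> ('a \<Rightarrow> 'a) \<Rightarrow> 'a \<Rightarrow> 'a" where
  "op_add H A B = (\<lambda>x\<in>hcar H. hadd H (A x) (B x))"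

definition op_scale :: "'a hspace \<Rightarrow> complex \<Rightarrow> ('a \<Rightarrow> 'a) \<Rightarrow> 'a \<Rightarrow> 'a" where
  "op_scale H c A = (\<lambda>x\<in>hcar H. hscale H c (A x))"

definition op_Ad :: "'a hspace \<Rightarrow> ('a \<Rightarrow> 'a) \<Rightarrow> ('a \<Rightarrow> 'a) \<Rightarrow> 'a \<Rightarrow> 'a" where
  "op_Ad H U T = op_comp H U (op_comp H T (op_adj H U))"

definition orthonormal_basis :: "'a hspace \<Rightarrow> 'a set \<Rightarrow> bool" where
  "orthonormal_basis H E \<longleftrightarrow> E \<subseteq> hcar H \<and>
     (\<forall>e\<in>E. \<forall>f\<in>E. hinner H e f = (if e = f then 1 else 0)) \<and>
     (\<forall>x\<in>hcar H. (\<forall>e\<in>E. hinner H x e = 0) \<longrightarrow> x = hzero H)"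

text \<open>The trace of a positive operator (independent of the basis).\<close>

definition pos_trace :: "'a hspace \<Rightarrow> ('a \<Rightarrow> 'a) \<Rightarrow> ennreal" where
  "pos_trace H A = (let E = (SOME E. orthonormal_basis H E) in
     \<integral>\<^sup>+e. ennreal (Re (hinner H (A e) e)) \<partial>count_space E)"

text \<open>The operator on \<open>L\<^sup>2(M)\<close> induced by a map of functions.\<close>

definition L2_op :: "'x measure \<Rightarrow> (('x \<Rightarrow> complex) \<Rightarrow> 'x \<Rightarrow> complex)
    \<Rightarrow> ('x \<Rightarrow> complex) set \<Rightarrow> ('x \<Rightarrow> complex) set" where
  "L2_op M F = (\<lambda>X\<in>hcar (L2 M complex_hspace). L2_class M complex_hspace (F (SOME f. f \<in> X)))"

text \<open>
  The weight \<open>Tr(D\<^sup>1\<^sup>/\<^sup>2 \<cdot> D\<^sup>1\<^sup>/\<^sup>2)\<close> on the positive part of \<open>B(L\<^sup>2(M))\<close>, where \<open>D\<close> is the possibly unbounded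
  operator of multiplication by \<open>d > 0\<close>. As usual for unbounded \<open>D\<close>, it is defined as the increasing limit
  of \<open>Tr(D\<^sub>\<epsilon>\<^sup>1\<^sup>/\<^sup>2 \<cdot> D\<^sub>\<epsilon>\<^sup>1\<^sup>/\<^sup>2)\<close> with the bounded operators \<open>D\<^sub>\<epsilon> = D (1 + \<epsilon> D)\<^sup>-\<^sup>1\<close> as \<open>\<epsilon> \<down> 0\<close>.
\<close>

definition trace_weight :: "'x measure \<Rightarrow> ('x \<Rightarrow> real)
    \<Rightarrow> (('x \<Rightarrow> complex) set \<Rightarrow> ('x \<Rightarrow> complex) set) \<Rightarrow> ennreal" where
  "trace_weight M d T = (SUP \<epsilon>\<in>{0<..}.
     let H = L2 M complex_hspace;
         R = L2_op M (\<lambda>f x. complex_of_real (sqrt (d x / (1 + \<epsilon> * d x))) * f x)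
     in pos_trace H (op_comp H R (op_comp H T R)))"


section \<open>GNS construction and Galois objects\<close>

text \<open>
  \<open>weight_domain H \<phi>\<close> is \<open>{T. \<phi>(T\<^sup>* T) < \<infinity>}\<close>. Its form \<open>\<langle>S, T\<rangle> = \<phi>(T\<^sup>* S)\<close> is obtained from the
  values of \<open>\<phi>\<close> on positive operators by polarization.
\<close>

definition weight_domain :: "'a hspace \<Rightarrow> (('a \<Rightarrow> 'a) \<Rightarrow> ennreal) \<Rightarrow> ('a \<Rightarrow> 'a) set" where
  "weight_domain H \<phi> = {T \<in> bounded_ops H. \<phi> (op_comp H (op_adj H T) T) < \<infinity>}"

definition weight_form ::
    "'a hspace \<Rightarrow> (('a \<Rightarrow> 'a) \<Rightarrow> ennreal) \<Rightarrow> ('a \<Rightarrow> 'a) \<Rightarrow> ('a \<Rightarrow> 'a) \<Rightarrow> complex" where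
  "weight_form H \<phi> S T = (1 / 4) * (\<Sum>k<4. \<i> ^ k * complex_of_real (enn2real
     (let A = op_add H S (op_scale H (\<i> ^ k) T) in \<phi> (op_comp H (op_adj H A) A))))"

definition weight_space :: "'a hspace \<Rightarrow> (('a \<Rightarrow> 'a) \<Rightarrow> ennreal) \<Rightarrow> ('a \<Rightarrow> 'a) hspace" where
  "weight_space H \<phi> =
     \<lparr>hcar = weight_domain H \<phi>,
      hzero = (\<lambda>x\<in>hcar H. hzero H),
      hadd = op_add H,
      hscale = op_scale H,
      hinner = weight_form H \<phi>\<rparr>"

definition gns_space ::
    "'a hspace \<Rightarrow> (('a \<Rightarrow> 'a) \<Rightarrow> ennreal) \<Rightarrow> (nat \<Rightarrow> 'a \<Rightarrow> 'a) set hspace" where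
  "gns_space H \<phi> = hcompletion (weight_space H \<phi>)"

definition gns_map ::
    "'a hspace \<Rightarrow> (('a \<Rightarrow> 'a) \<Rightarrow> ennreal) \<Rightarrow> ('a \<Rightarrow> 'a) \<Rightarrow> (nat \<Rightarrow> 'a \<Rightarrow> 'a) set" where
  "gns_map H \<phi> T = hembed (weight_space H \<phi>) T"

text \<open>
  Projective unitary representations of a group with multiplication \<open>gmul\<close> whose underlying Borel
  space is that of \<open>m\<close>. They are what makes \<open>Ad \<pi>\<close> an action of the group on \<open>B(H)\<close>.
\<close>

definition projective_unitary_rep ::
    "('g \<Rightarrow> 'g \<Rightarrow> 'g) \<Rightarrow> 'g measure \<Rightarrow> 'a hspace \<Rightarrow> ('g \<Rightarrow> 'a \<Rightarrow> 'a) \<Rightarrow> bool" where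
  "projective_unitary_rep gmul m H \<pi> \<longleftrightarrow>
     (\<forall>g. \<pi> g \<in> bounded_ops H \<and> hunitary H H (\<pi> g)) \<and>
     (\<forall>g h. \<exists>\<omega>. cmod \<omega> = 1 \<and> op_comp H (\<pi> g) (\<pi> h) = op_scale H \<omega> (\<pi> (gmul g h))) \<and>
     (\<forall>x\<in>hcar H. \<forall>y\<in>hcar H. (\<lambda>g. hinner H (\<pi> g x) y) \<in> borel_measurable m)"

text \<open>
  \<open>is_galois_map m H \<phi> \<pi> U\<close>: the isometry \<open>U\<close> on \<open>L\<^sup>2(B(H), \<phi>) \<otimes> L\<^sup>2(B(H), \<phi>)\<close> is the one determined by
  \<open>U (\<Lambda> S \<otimes> \<Lambda> T) (g) = \<Lambda> (\<pi>(g) S \<pi>(g)\<^sup>* T)\<close>.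
\<close>

definition is_galois_map ::
    "'g measure \<Rightarrow> 'a hspace \<Rightarrow> (('a \<Rightarrow> 'a) \<Rightarrow> ennreal) \<Rightarrow> ('g \<Rightarrow> 'a \<Rightarrow> 'a)
      \<Rightarrow> ((nat \<Rightarrow> (nat \<Rightarrow> 'a \<Rightarrow> 'a) set \<times> (nat \<Rightarrow> 'a \<Rightarrow> 'a) set \<Rightarrow> complex) set
           \<Rightarrow> ('g \<Rightarrow> (nat \<Rightarrow> 'a \<Rightarrow> 'a) set) set) \<Rightarrow> bool" where
  "is_galois_map m H \<phi> \<pi> U \<longleftrightarrow> (let L = gns_space H \<phi>; \<Lambda> = gns_map H \<phi> in
     hlinear (htensor L L) (L2 m L) U \<and>
     (\<forall>x\<in>hcar (htensor L L). hnorm (L2 m L) (U x) = hnorm (htensor L L) x) \<and>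
     (\<forall>S\<in>weight_domain H \<phi>. \<forall>T\<in>weight_domain H \<phi>.
        (\<lambda>g. \<Lambda> (op_comp H (op_Ad H (\<pi> g) S) T)) \<in> hcar (sqint_space m L) \<and>
        U (elem_tensor L L (\<Lambda> S) (\<Lambda> T)) = L2_class m L (\<lambda>g. \<Lambda> (op_comp H (op_Ad H (\<pi> g) S) T))))"

text \<open>
  The pair \<open>(B(H), Ad \<pi>)\<close> is a Galois object for the group with multiplication \<open>gmul\<close> and left Haar
  measure \<open>m\<close>, with respect to the weight \<open>\<phi>\<close>.
\<close>

definition galois_object ::
    "('g \<Rightarrow> 'g \<Rightarrow> 'g) \<Rightarrow> 'g measure \<Rightarrow> 'a hspace \<Rightarrow> (('a \<Rightarrow> 'a) \<Rightarrow> ennreal) \<Rightarrow> ('g \<Rightarrow> 'a \<Rightarrow> 'a) \<Rightarrow> bool" where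
  "galois_object gmul m H \<phi> \<pi> \<longleftrightarrow> projective_unitary_rep gmul m H \<pi> \<and>
     (\<exists>U. is_galois_map m H \<phi> \<pi> U \<and>
       hunitary (htensor (gns_space H \<phi>) (gns_space H \<phi>)) (L2 m (gns_space H \<phi>)) U)"


section \<open>Normalizations and the representation\<close>

definition fourier :: "'v::topological_ab_group_add measure \<Rightarrow> ('v \<Rightarrow> complex) \<Rightarrow> 'v pdual \<Rightarrow> complex" where
  "fourier \<nu> f \<xi> = (\<integral>v. cnj (pairing \<xi> v) * f v \<partial>\<nu>)"

definition fourier_unitary ::
    "'v::topological_ab_group_add measure \<Rightarrow> 'v pdual measure \<Rightarrow> bool" where
  "fourier_unitary \<nu> \<sigma> \<longleftrightarrow>
     (\<exists>U. hunitary (L2 \<nu> complex_hspace) (L2 \<sigma> complex_hspace) U \<and>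
       (\<forall>f\<in>hcar (sqint_space \<nu> complex_hspace). integrable \<nu> f \<longrightarrow>
          fourier \<nu> f \<in> hcar (sqint_space \<sigma> complex_hspace) \<and>
          U (L2_class \<nu> complex_hspace f) = L2_class \<sigma> complex_hspace (fourier \<nu> f)))"

definition haar_normalized ::
    "('q::topological_group_add \<Rightarrow> 'v::topological_ab_group_add \<Rightarrow> 'v) \<Rightarrow> ('q \<Rightarrow> 'v pdual)
      \<Rightarrow> 'q measure \<Rightarrow> 'v measure \<Rightarrow> 'v pdual measure \<Rightarrow> bool" where
  "haar_normalized act \<eta> \<mu> \<nu> \<sigma> \<longleftrightarrow> (\<forall>f\<in>borel_measurable borel.
     (\<integral>\<^sup>+q. f (\<eta> q) * ennreal (inverse (act_modulus \<nu> act q)) \<partial>\<mu>) = (\<integral>\<^sup>+\<xi>. f \<xi> \<partial>\<sigma>))"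

fun cocycle_rep ::
    "'q::topological_group_add measure \<Rightarrow> ('q \<Rightarrow> 'v::topological_ab_group_add pdual)
      \<Rightarrow> ('q \<Rightarrow> 'q \<Rightarrow> complex) \<Rightarrow> 'q \<times> 'v \<Rightarrow> ('q \<Rightarrow> complex) set \<Rightarrow> ('q \<Rightarrow> complex) set" where
  "cocycle_rep \<mu> \<eta> b (q, v) =
     L2_op \<mu> (\<lambda>f q\<^sub>0. cnj (pairing (\<eta> q\<^sub>0) v) * b (- q\<^sub>0) q * f (- q + q\<^sub>0))"

text \<open>The density \<open>\<Delta>\<^sup>-\<^sup>1|\<^sub>Q\<close> of the Duflo--Moore operator.\<close>

definition duflo_moore_density ::
    "('q::topological_group_add \<Rightarrow> 'v::topological_ab_group_add \<Rightarrow> 'v) \<Rightarrow> 'q measure \<Rightarrow> 'v measure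
      \<Rightarrow> 'q \<Rightarrow> real" where
  "duflo_moore_density act \<mu> \<nu> q = act_modulus \<nu> act q / modular_fun \<mu> q"

end

theory Submission
  imports Defs
begin

text \<open>
  The matrix coefficient \<open>\<langle>c, \<pi>(q,v) e\<rangle>\<close> is the inverse Fourier transform on \<open>V\<close>, read on \<open>Q\<close> through \<open>\<eta>\<close>,
  of the kernel \<open>k(q,z) = c(z) cnj (b(-z,q)) cnj (e(-q+z))\<close>. Plancherel's theorem and the change of
  variables \<open>(q,z) \<mapsto> (z,-q+z)\<close> therefore give the orthogonality relations
  \<open>\<integral> \<langle>c, \<pi>(g) e\<rangle> cnj \<langle>c', \<pi>(g) e'\<rangle> dg = \<langle>c,c'\<rangle> \<langle>D\<^sup>1\<^sup>/\<^sup>2 e', D\<^sup>1\<^sup>/\<^sup>2 e\<rangle>\<close>, and essential bijectivity of \<open>\<eta>\<close>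
  makes the coefficients total in \<open>L\<^sup>2(G)\<close>.
  
  The operators \<open>|a\<rangle>\<langle>b|\<close> with \<open>b\<close> in the domain of \<open>D\<^sup>1\<^sup>/\<^sup>2\<close> have total image in the GNS space, and the Galois map
  sends \<open>\<Lambda> |a\<rangle>\<langle>b| \<otimes> \<Lambda> |c\<rangle>\<langle>e|\<close> to \<open>g \<mapsto> \<langle>c, \<pi>(g) b\<rangle> \<Lambda> |\<pi>(g) a\<rangle>\<langle>e|\<close>. The orthogonality relations make it
  isometric on these vectors; totality of the coefficients makes their images total. Finite rank
  approximation then gives the formula for the Galois map on all \<open>\<Lambda> S \<otimes> \<Lambda> T\<close>.
\<close>

text \<open>The Fourier transform is given as a unitary whose integral formula is known for
  integrable functions only, and it takes values on the dual, while kernels live on Q. Functions are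
  therefore carried across \<open>\<eta>\<close>, which is invertible up to null sets, and the
  inverse transform is identified by testing against indicators. The weight is a supremum of traces
  with bounded cut-offs of an unbounded density. Since an operator and its adjoint have the same
  Hilbert-Schmidt norm, it becomes a sum of squared norms of D^(1/2) applied to adjoint images of
  basis vectors, which is visibly a Hilbert space norm. The unitary is built from inner products of
  rank one operators, so its value on a general pair is an abstract limit. That limit is the
  prescribed function of g because a convergent sequence in L2 has a subsequence converging almost
  everywhere. Compatibility is what makes products of the operators close up to a phase: the
  coboundary of \<open>b\<close> compensates the pairing of \<open>\<eta>\<close> with
  \<open>\<beta>\<close>.\<close>

abbreviation "\<C> \<equiv> complex_hspace"

abbreviation "sqint M K \<equiv> hcar (sqint_space M K)"

abbreviation "borel2 \<equiv> borel \<Otimes>\<^sub>M borel"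

lemmas int_cong = Bochner_Integration.integral_cong[OF refl]

section \<open>Inner product spaces with explicit carriers\<close>

definition hdiff :: "'a hspace => 'a => 'a => 'a" where
  "hdiff H x y = hadd H x (hscale H (- 1) y)"

definition htends :: "'a hspace => (nat => 'a) => 'a => bool" where
  "htends H X x \<longleftrightarrow> (\<lambda>n. hdist H (X n) x) \<longlonglongrightarrow> 0"

definition hcauchy :: "'a hspace => (nat => 'a) => bool" where
  "hcauchy H X \<longleftrightarrow> (\<forall>e>0. \<exists>N. \<forall>m\<ge>N. \<forall>n\<ge>N. hdist H (X m) (X n) < e)"

lemma hdist_hdiff: "hdist H x y = hnorm H (hdiff H x y)"
  by (simp add: hdist_def hdiff_def)

text \<open>
  The vector space axioms are not required: in a separated space every vector identity
  can be checked by taking inner products.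
\<close>

locale semi_inner_space =
  fixes H :: "'a hspace"
  assumes zero_car [simp]: "hzero H \<in> hcar H"
    and add_car [simp]: "x \<in> hcar H ==> y \<in> hcar H ==> hadd H x y \<in> hcar H"
    and scale_car [simp]: "x \<in> hcar H ==> hscale H c x \<in> hcar H"
    and inner_zero_left [simp]: "z \<in> hcar H ==> hinner H (hzero H) z = 0"
    and inner_add_left:
      "x \<in> hcar H ==> y \<in> hcar H ==> z \<in> hcar H ==>
        hinner H (hadd H x y) z = hinner H x z + hinner H y z"
    and inner_scale_left:
      "x \<in> hcar H ==> z \<in> hcar H ==> hinner H (hscale H c x) z = c * hinner H x z"
    and inner_cnj: "x \<in> hcar H ==> y \<in> hcar H ==> cnj (hinner H x y) = hinner H y x"
    and inner_pos: "x \<in> hcar H ==> 0 \<le> Re (hinner H x x)"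
begin

lemma inner_zero_right [simp]: "z \<in> hcar H ==> hinner H z (hzero H) = 0"
  by (metis complex_cnj_zero inner_cnj inner_zero_left zero_car)

lemma inner_add_right:
  "x \<in> hcar H ==> y \<in> hcar H ==> z \<in> hcar H ==>
    hinner H x (hadd H y z) = hinner H x y + hinner H x z"
  using inner_add_left[of y z x] inner_cnj[of "hadd H y z" x] inner_cnj[of y x] inner_cnj[of z x]
  by simp

lemma inner_scale_right:
  "x \<in> hcar H ==> z \<in> hcar H ==> hinner H x (hscale H c z) = cnj c * hinner H x z"
  using inner_scale_left[of z x c] inner_cnj[of "hscale H c z" x] inner_cnj[of z x] by simp

lemma diff_car [simp]: "x \<in> hcar H ==> y \<in> hcar H ==> hdiff H x y \<in> hcar H"
  by (simp add: hdiff_def)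

lemma inner_diff_left:
  "x \<in> hcar H ==> y \<in> hcar H ==> z \<in> hcar H ==>
    hinner H (hdiff H x y) z = hinner H x z - hinner H y z"
  by (simp add: hdiff_def inner_add_left inner_scale_left)

lemma inner_diff_right:
  "x \<in> hcar H ==> y \<in> hcar H ==> z \<in> hcar H ==>
    hinner H z (hdiff H x y) = hinner H z x - hinner H z y"
  by (simp add: hdiff_def inner_add_right inner_scale_right)

lemmas inner_simps = inner_add_left inner_add_right inner_scale_left inner_scale_right
  inner_diff_left inner_diff_right

lemma norm_nonneg [simp]: "x \<in> hcar H ==> 0 \<le> hnorm H x"
  by (simp add: hnorm_def inner_pos)

lemma norm_sq: "x \<in> hcar H ==> (hnorm H x)\<^sup>2 = Re (hinner H x x)"
  by (simp add: hnorm_def inner_pos)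

lemma inner_self: "x \<in> hcar H ==> hinner H x x = complex_of_real ((hnorm H x)\<^sup>2)"
  using inner_cnj[of x x] by (simp add: norm_sq complex_eq_iff)

lemma norm_zero [simp]: "hnorm H (hzero H) = 0"
  by (simp add: hnorm_def)

lemma norm_sq_add:
  "x \<in> hcar H ==> y \<in> hcar H ==>
    (hnorm H (hadd H x y))\<^sup>2 = (hnorm H x)\<^sup>2 + (hnorm H y)\<^sup>2 + 2 * Re (hinner H x y)"
  using inner_cnj[of x y, THEN arg_cong[of _ _ Re]] by (simp add: norm_sq inner_simps)

lemma norm_sq_diff:
  "x \<in> hcar H ==> y \<in> hcar H ==>
    (hnorm H (hdiff H x y))\<^sup>2 = (hnorm H x)\<^sup>2 + (hnorm H y)\<^sup>2 - 2 * Re (hinner H x y)"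
  using inner_cnj[of x y, THEN arg_cong[of _ _ Re]] by (simp add: norm_sq inner_simps)

lemma norm_scale: "x \<in> hcar H ==> hnorm H (hscale H c x) = cmod c * hnorm H x"
proof -
  assume x: "x \<in> hcar H"
  have "hinner H (hscale H c x) (hscale H c x) = c * (cnj c * hinner H x x)"
    using x by (simp add: inner_simps)
  also have "... = complex_of_real ((cmod c * hnorm H x)\<^sup>2)"
    using x by (simp only: inner_self mult.assoc[symmetric] complex_norm_square[symmetric] power_mult_distrib of_real_mult)
  finally have "(hnorm H (hscale H c x))\<^sup>2 = (cmod c * hnorm H x)\<^sup>2"
    using x by (simp add: norm_sq)
  then show ?thesis
    using x by (simp add: power2_eq_iff_nonneg)
qed

text \<open>Substitute for rearranging vectors. An identity such as x - z = (x - y) + (y - z) need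
  not hold between elements of a space that is not separated, but both sides have the same inner
  products and hence the same norm.\<close>

lemma norm_eq_of_inner_eq:
  assumes "u \<in> hcar H" "v \<in> hcar H" "\<And>w. w \<in> hcar H ==> hinner H u w = hinner H v w"
  shows "hnorm H u = hnorm H v"
  using assms(3)[of u] assms(3)[of v] inner_cnj[of u v] assms(1,2)
  by (metis hnorm_def inner_cnj)

lemma cauchy_schwarz:
  assumes x: "x \<in> hcar H" and y: "y \<in> hcar H"
  shows "cmod (hinner H x y) \<le> hnorm H x * hnorm H y"
proof -
  let ?c = "hinner H x y" and ?a = "(hnorm H x)\<^sup>2" and ?b = "(hnorm H y)\<^sup>2"
  \<comment> \<open>Expansion of the squared norm of x - t <x,y> y. The scalar carries the phase of
    <x,y>, so a real parameter t is enough, and t stays free for the case that y has norm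
    zero.\<close>
  have key: "0 \<le> ?a - 2 * t * (cmod ?c)\<^sup>2 + t\<^sup>2 * (cmod ?c)\<^sup>2 * ?b" for t :: real
  proof -
    let ?s = "complex_of_real t * ?c"
    have "Re (hinner H x (hscale H ?s y)) = t * (cmod ?c)\<^sup>2"
    proof -
      have "hinner H x (hscale H ?s y) = complex_of_real t * (cnj ?c * ?c)"
        using x y by (simp add: inner_simps)
      also have "... = complex_of_real (t * (cmod ?c)\<^sup>2)"
        by (simp add: mult.commute flip: complex_norm_square)
      finally show ?thesis by simp
    qed
    moreover have "(hnorm H (hscale H ?s y))\<^sup>2 = t\<^sup>2 * (cmod ?c)\<^sup>2 * ?b"
      using y by (simp add: norm_scale norm_mult power_mult_distrib)
    ultimately have "(hnorm H (hdiff H x (hscale H ?s y)))\<^sup>2 = ?a - 2 * t * (cmod ?c)\<^sup>2 + t\<^sup>2 * (cmod ?c)\<^sup>2 * ?b"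
      using x y by (simp add: norm_sq_diff)
    then show ?thesis by (metis zero_le_power2)
  qed
  have "(cmod ?c)\<^sup>2 \<le> (hnorm H x * hnorm H y)\<^sup>2"
  proof (cases "?b = 0")
    case True
    have "cmod ?c = 0"
    proof (rule ccontr)
      assume "cmod ?c \<noteq> 0"
      then have pos: "0 < (cmod ?c)\<^sup>2" by simp
      \<comment> \<open>If y has norm zero, the quadratic in \<open>key\<close> is linear in t, and
        this t gives it the value -1.\<close>
      have "2 * ((?a + 1) / (2 * (cmod ?c)\<^sup>2)) * (cmod ?c)\<^sup>2 = ?a + 1"
        using pos by (simp add: field_simps)
      with key[of "(?a + 1) / (2 * (cmod ?c)\<^sup>2)"] True show False by simp
    qed
    then show ?thesis by simp
  next
    case False
    then have b: "0 < ?b" by (metis zero_le_power2 order_le_imp_less_or_eq)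
    have "(1 / ?b)\<^sup>2 * (cmod ?c)\<^sup>2 * ?b = (cmod ?c)\<^sup>2 / ?b"
      using b by (simp only: power2_eq_square[of "1 / ?b"] times_divide_eq_left times_divide_eq_right) simp
    then have "0 \<le> ?a - (cmod ?c)\<^sup>2 / ?b"
      using key[of "1 / ?b"] by simp
    then show ?thesis using b by (simp add: field_simps power_mult_distrib)
  qed
  then show ?thesis
    using x y by (meson mult_nonneg_nonneg norm_nonneg power2_le_imp_le)
qed

lemma norm_triangle:
  assumes x: "x \<in> hcar H" and y: "y \<in> hcar H"
  shows "hnorm H (hadd H x y) \<le> hnorm H x + hnorm H y"
proof -
  have "Re (hinner H x y) \<le> hnorm H x * hnorm H y"
    using cauchy_schwarz[OF x y] complex_Re_le_cmod order_trans by blast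
  then have "(hnorm H (hadd H x y))\<^sup>2 \<le> (hnorm H x + hnorm H y)\<^sup>2"
    using x y by (simp add: norm_sq_add power2_sum)
  then show ?thesis
    by (rule power2_le_imp_le) (use x y in simp)
qed

lemma dist_nonneg [simp]: "x \<in> hcar H ==> y \<in> hcar H ==> 0 \<le> hdist H x y"
  by (simp add: hdist_hdiff)

lemma dist_self [simp]: "x \<in> hcar H ==> hdist H x x = 0"
  using norm_sq_diff[of x x] norm_sq[of x] by (simp add: hdist_hdiff)

lemma dist_commute: "x \<in> hcar H ==> y \<in> hcar H ==> hdist H x y = hdist H y x"
proof -
  assume "x \<in> hcar H" "y \<in> hcar H"
  then have "(hdist H x y)\<^sup>2 = (hdist H y x)\<^sup>2"
    using inner_cnj[of x y, THEN arg_cong[of _ _ Re]] by (simp add: hdist_hdiff norm_sq_diff)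
  then show ?thesis
    using \<open>x \<in> hcar H\<close> \<open>y \<in> hcar H\<close> by (simp add: power2_eq_iff_nonneg)
qed

lemma dist_triangle:
  assumes "x \<in> hcar H" "y \<in> hcar H" "z \<in> hcar H"
  shows "hdist H x z \<le> hdist H x y + hdist H y z"
proof -
  have "hnorm H (hdiff H x z) = hnorm H (hadd H (hdiff H x y) (hdiff H y z))"
    using assms by (intro norm_eq_of_inner_eq) (auto simp: inner_simps)
  also have "... \<le> hnorm H (hdiff H x y) + hnorm H (hdiff H y z)"
    using assms by (intro norm_triangle) auto
  finally show ?thesis by (simp add: hdist_hdiff)
qed

lemma dist_add:
  assumes "x \<in> hcar H" "y \<in> hcar H" "x' \<in> hcar H" "y' \<in> hcar H"
  shows "hdist H (hadd H x y) (hadd H x' y') \<le> hdist H x x' + hdist H y y'"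
proof -
  have "hdist H (hadd H x y) (hadd H x' y') = hnorm H (hadd H (hdiff H x x') (hdiff H y y'))"
    unfolding hdist_hdiff using assms by (intro norm_eq_of_inner_eq) (auto simp: inner_simps)
  also have "... \<le> hdist H x x' + hdist H y y'"
    unfolding hdist_hdiff using assms by (intro norm_triangle) auto
  finally show ?thesis .
qed

lemma dist_scale:
  assumes "x \<in> hcar H" "y \<in> hcar H"
  shows "hdist H (hscale H c x) (hscale H c y) = cmod c * hdist H x y"
proof -
  have "hdist H (hscale H c x) (hscale H c y) = hnorm H (hscale H c (hdiff H x y))"
    unfolding hdist_hdiff using assms by (intro norm_eq_of_inner_eq) (auto simp: inner_simps algebra_simps)
  then show ?thesis using assms by (simp add: norm_scale hdist_hdiff)
qed

lemma norm_le_dist: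
  assumes "x \<in> hcar H" "y \<in> hcar H"
  shows "hnorm H x \<le> hdist H x y + hnorm H y"
proof -
  have "hnorm H x = hnorm H (hadd H (hdiff H x y) y)"
    using assms by (intro norm_eq_of_inner_eq) (auto simp: inner_simps)
  also have "... \<le> hdist H x y + hnorm H y"
    unfolding hdist_hdiff using assms by (intro norm_triangle) auto
  finally show ?thesis .
qed

lemma dist_zero [simp]: "x \<in> hcar H ==> hdist H x (hzero H) = hnorm H x"
  unfolding hdist_hdiff by (intro norm_eq_of_inner_eq) (auto simp: inner_simps)

text \<open>Apart from distances, only norms of the primed vectors occur. With these as limits, the
  bound tends to zero without a separate boundedness argument for the sequences.\<close>

lemma inner_diff_bound:
  assumes "x \<in> hcar H" "y \<in> hcar H" "x' \<in> hcar H" "y' \<in> hcar H"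
  shows "cmod (hinner H x y - hinner H x' y') \<le>
    hdist H x x' * (hdist H y y' + hnorm H y') + hnorm H x' * hdist H y y'"
proof -
  have "hinner H x y - hinner H x' y' = hinner H (hdiff H x x') y + hinner H x' (hdiff H y y')"
    using assms by (simp add: inner_simps)
  also have "cmod ... \<le> hnorm H (hdiff H x x') * hnorm H y + hnorm H x' * hnorm H (hdiff H y y')"
    using assms by (intro norm_triangle_le add_mono cauchy_schwarz) auto
  also have "... \<le> hdist H x x' * (hdist H y y' + hnorm H y') + hnorm H x' * hdist H y y'"
    using assms norm_le_dist[of y y'] by (simp add: mult_left_mono hdist_hdiff[symmetric])
  finally show ?thesis .
qed

lemma inner_tendsto:
  assumes car: "\<And>n. X n \<in> hcar H" "\<And>n. Y n \<in> hcar H" "x \<in> hcar H" "y \<in> hcar H"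
    and lim: "htends H X x" "htends H Y y"
  shows "(\<lambda>n. hinner H (X n) (Y n)) \<longlonglongrightarrow> hinner H x y"
proof -
  have "(\<lambda>n. hdist H (X n) x * (hdist H (Y n) y + hnorm H y) + hnorm H x * hdist H (Y n) y)
      \<longlonglongrightarrow> 0 * (0 + hnorm H y) + hnorm H x * 0"
    using lim unfolding htends_def by (intro tendsto_add tendsto_mult tendsto_const)
  then have "(\<lambda>n. hdist H (X n) x * (hdist H (Y n) y + hnorm H y) + hnorm H x * hdist H (Y n) y) \<longlonglongrightarrow> 0"
    by simp
  then have "(\<lambda>n. hinner H (X n) (Y n) - hinner H x y) \<longlonglongrightarrow> 0"
    by (rule Lim_null_comparison[rotated]) (use car inner_diff_bound in auto)
  then show ?thesis using LIM_zero_iff by blast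
qed

lemma htends_const [simp]: "x \<in> hcar H ==> htends H (\<lambda>_. x) x"
  by (simp add: htends_def)

lemma norm_tendsto:
  assumes "\<And>n. X n \<in> hcar H" "x \<in> hcar H" "htends H X x"
  shows "(\<lambda>n. hnorm H (X n)) \<longlonglongrightarrow> hnorm H x"
  unfolding hnorm_def using inner_tendsto[OF assms(1,1,2,2,3,3)]
  by (intro tendsto_real_sqrt tendsto_Re)

lemma htends_add:
  assumes car: "\<And>n. X n \<in> hcar H" "\<And>n. Y n \<in> hcar H" "x \<in> hcar H" "y \<in> hcar H"
    and lim: "htends H X x" "htends H Y y"
  shows "htends H (\<lambda>n. hadd H (X n) (Y n)) (hadd H x y)"
  unfolding htends_def
proof (rule Lim_null_comparison[where g = "\<lambda>n. hdist H (X n) x + hdist H (Y n) y"])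
  show "(\<lambda>n. hdist H (X n) x + hdist H (Y n) y) \<longlonglongrightarrow> 0"
    using tendsto_add[OF lim[unfolded htends_def]] by simp
qed (use car dist_add in auto)

lemma htends_scale:
  assumes car: "\<And>n. X n \<in> hcar H" "x \<in> hcar H" and lim: "htends H X x"
  shows "htends H (\<lambda>n. hscale H c (X n)) (hscale H c x)"
  using lim tendsto_mult_left[of "\<lambda>n. hdist H (X n) x" 0 sequentially "cmod c"] car
  by (simp add: htends_def dist_scale)

lemma htends_diff:
  assumes car: "\<And>n. X n \<in> hcar H" "\<And>n. Y n \<in> hcar H" "x \<in> hcar H" "y \<in> hcar H"
    and lim: "htends H X x" "htends H Y y"
  shows "htends H (\<lambda>n. hdiff H (X n) (Y n)) (hdiff H x y)"
  unfolding hdiff_def using htends_add[OF _ _ _ _ _ htends_scale] assms by simp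

lemma htends_imp_hcauchy:
  assumes car: "\<And>n. X n \<in> hcar H" "x \<in> hcar H" and lim: "htends H X x"
  shows "hcauchy H X"
  unfolding hcauchy_def
proof (intro allI impI)
  fix e :: real assume "e > 0"
  then obtain N where N: "\<And>n. n \<ge> N ==> hdist H (X n) x < e / 2"
    using order_tendstoD(2)[OF lim[unfolded htends_def], of "e / 2"]
    by (auto simp: eventually_sequentially)
  have "hdist H (X m) (X n) < e" if "m \<ge> N" "n \<ge> N" for m n
    using dist_triangle[OF car(1,2,1), of m n] N[OF that(1)] N[OF that(2)]
      dist_commute[OF car, of n] by linarith
  then show "\<exists>N. \<forall>m\<ge>N. \<forall>n\<ge>N. hdist H (X m) (X n) < e" by blast
qed

text \<open>Finite sums are described through their inner products, because \<open>hadd\<close> is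
  not known to be associative or commutative on elements.\<close>

lemma lincomb_ex:
  assumes "finite F" "\<And>i. i \<in> F ==> x i \<in> hcar H"
  shows "\<exists>u\<in>hcar H. \<forall>z\<in>hcar H. hinner H u z = (\<Sum>i\<in>F. c i * hinner H (x i) z)"
  using assms
proof (induction F rule: finite_induct)
  case empty
  then show ?case by (intro bexI[of _ "hzero H"]) auto
next
  case (insert j F)
  then obtain u where "u \<in> hcar H" "\<forall>z\<in>hcar H. hinner H u z = (\<Sum>i\<in>F. c i * hinner H (x i) z)"
    by auto
  then show ?case
    using insert by (intro bexI[of _ "hadd H (hscale H (c j) (x j)) u"]) (auto simp: inner_simps)
qed

end

lemma hcauchy_if_dist_le:
  assumes "\<And>m n. hdist H (X m) (X n) \<le> f m + f n" "f \<longlonglongrightarrow> (0::real)"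
  shows "hcauchy H X"
  unfolding hcauchy_def
proof (intro allI impI)
  fix e :: real assume "e > 0"
  then obtain N where N: "\<And>n. n \<ge> N ==> f n < e / 2"
    using order_tendstoD(2)[OF assms(2), of "e / 2"] by (auto simp: eventually_sequentially)
  have "hdist H (X m) (X n) < e" if "m \<ge> N" "n \<ge> N" for m n
    using assms(1)[of m n] N[OF that(1)] N[OF that(2)] by linarith
  then show "\<exists>N. \<forall>m\<ge>N. \<forall>n\<ge>N. hdist H (X m) (X n) < e" by blast
qed

text \<open>First variation: a quadratic with its minimum at t = 0 has no linear term. The test
  value is t = - r / (a + 1), where the 1 avoids a division by zero for a = 0.\<close>

lemma quadratic_nonneg_imp_zero:
  fixes a r :: real
  assumes "\<And>t. 0 \<le> t\<^sup>2 * a + 2 * t * r" "0 \<le> a"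
  shows "r = 0"
proof -
  have "0 \<le> (- r / (a + 1))\<^sup>2 * a + 2 * (- r / (a + 1)) * r" by (rule assms)
  also have "... \<le> (- r / (a + 1))\<^sup>2 * (a + 1) + 2 * (- r / (a + 1)) * r"
    by (intro add_right_mono mult_left_mono) auto
  also have "... = - (r\<^sup>2 / (a + 1))"
    using assms(2) by (simp add: power2_eq_square)
  finally have "r\<^sup>2 / (a + 1) \<le> 0" by simp
  then have "r\<^sup>2 \<le> 0" using assms(2) by (simp add: divide_le_0_iff)
  then show ?thesis by simp
qed

section \<open>Complete separated spaces and the Riesz representation theorem\<close>

locale hilbert = semi_inner_space +
  assumes dist_eq_0: "x \<in> hcar H ==> y \<in> hcar H ==> hdist H x y = 0 ==> x = y"
    and complete: "(\<And>n. X n \<in> hcar H) ==> hcauchy H X ==> \<exists>x\<in>hcar H. htends H X x"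
begin

lemma eqI:
  assumes "x \<in> hcar H" "y \<in> hcar H" "\<And>w. w \<in> hcar H ==> hinner H x w = hinner H y w"
  shows "x = y"
proof (rule dist_eq_0)
  have "hnorm H (hdiff H x y) = hnorm H (hzero H)"
    using assms by (intro norm_eq_of_inner_eq) (auto simp: inner_simps)
  then show "hdist H x y = 0" by (simp add: hdist_hdiff)
qed (use assms in auto)

lemma norm_eq_0: "x \<in> hcar H ==> hnorm H x = 0 \<longleftrightarrow> x = hzero H"
  using dist_eq_0[of x "hzero H"] by auto

lemma eq_zeroI: "x \<in> hcar H ==> hinner H x x = 0 ==> x = hzero H"
  by (metis Re_complex_of_real hnorm_def norm_eq_0 of_real_0 real_sqrt_zero)

lemma scale_one [simp]: "x \<in> hcar H ==> hscale H 1 x = x"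
  by (rule eqI) (auto simp: inner_simps)

lemma scale_zero [simp]: "x \<in> hcar H ==> hscale H 0 x = hzero H"
  by (rule eqI) (auto simp: inner_simps)

lemma htends_unique:
  assumes car: "\<And>n. X n \<in> hcar H" "x \<in> hcar H" "y \<in> hcar H" and lim: "htends H X x" "htends H X y"
  shows "x = y"
proof (rule eqI)
  fix w assume "w \<in> hcar H"
  then have "(\<lambda>n. hinner H (X n) w) \<longlonglongrightarrow> hinner H x w" "(\<lambda>n. hinner H (X n) w) \<longlonglongrightarrow> hinner H y w"
    using assms by (auto intro!: inner_tendsto)
  then show "hinner H x w = hinner H y w" by (rule LIMSEQ_unique)
qed (use car in auto)

text \<open>Variational proof. The functional J(x) = |x|^2 - 2 Re f(x) is bounded below, a
  minimizing sequence is Cauchy by the parallelogram identity, and the vanishing first variation at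
  the limit says that the limit represents f. No orthogonal projection has to be available
  beforehand; projections are obtained from this result in \<open>total_dense\<close>.\<close>

lemma riesz:
  fixes f :: "'a => complex"
  assumes add: "\<And>x y. x \<in> hcar H ==> y \<in> hcar H ==> f (hadd H x y) = f x + f y"
    and scale: "\<And>c x. x \<in> hcar H ==> f (hscale H c x) = c * f x"
    and bound: "\<And>x. x \<in> hcar H ==> cmod (f x) \<le> C * hnorm H x"
  shows "\<exists>y\<in>hcar H. \<forall>x\<in>hcar H. f x = hinner H x y"
proof -
  define J where "J x = (hnorm H x)\<^sup>2 - 2 * Re (f x)" for x
  have f_diff: "f (hdiff H x y) = f x - f y" if "x \<in> hcar H" "y \<in> hcar H" for x y
    using that by (simp add: hdiff_def add scale)
  have J_ge: "- C\<^sup>2 \<le> J x" if "x \<in> hcar H" for x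
  proof -
    have "Re (f x) \<le> C * hnorm H x"
      using bound[OF that] complex_Re_le_cmod order_trans by blast
    moreover have "0 \<le> (hnorm H x - C)\<^sup>2" by simp
    ultimately show ?thesis by (simp add: J_def power2_diff mult.commute mult.left_commute)
  qed
  define m where "m = Inf (J ` hcar H)"
  have bdd: "bdd_below (J ` hcar H)"
    using J_ge by (intro bdd_belowI[of _ "- C\<^sup>2"]) auto
  have ne: "J ` hcar H \<noteq> {}" using zero_car by blast
  have m_le: "m \<le> J x" if "x \<in> hcar H" for x
    unfolding m_def using that bdd by (intro cInf_lower) auto
  have "\<exists>x\<in>hcar H. J x < m + 1 / real (Suc n)" for n
    using cInf_lessD[OF ne, of "m + 1 / real (Suc n)"] by (auto simp: m_def)
  then obtain X where X: "\<And>n. X n \<in> hcar H" "\<And>n. J (X n) < m + 1 / real (Suc n)"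
    by metis
  \<comment> \<open>Two points whose J-values p and q are within 1/c and 1/d of the infimum m have
    squared distance D at most 2/c + 2/d, because J of their midpoint is (p + q)/2 - D/4 and cannot
    be below m.\<close>
  have arith: "D \<le> 2 / c + 2 / d"
    if "m \<le> (p + q) / 2 - D / 4" "p < m + 1 / c" "q < m + 1 / d" for p q c d D :: real
  proof -
    have "D \<le> 2 * (1 / c) + 2 * (1 / d)" using that by argo
    then show ?thesis by simp
  qed
  have dist_le: "hdist H (X n) (X k) \<le> sqrt (2 / real (Suc n)) + sqrt (2 / real (Suc k))" for n k
  proof -
    let ?w = "hscale H (1 / 2) (hadd H (X n) (X k))"
    have "m \<le> J ?w" by (intro m_le) (use X in auto)
    also have "J ?w = (J (X n) + J (X k)) / 2 - (hdist H (X n) (X k))\<^sup>2 / 4"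
    proof -
      have "(hnorm H ?w)\<^sup>2 = ((hnorm H (X n))\<^sup>2 + (hnorm H (X k))\<^sup>2 + 2 * Re (hinner H (X n) (X k))) / 4"
        using X by (simp add: norm_scale power_mult_distrib norm_sq_add norm_divide power_divide)
      moreover have "Re (f ?w) = (Re (f (X n)) + Re (f (X k))) / 2"
        using X by (simp add: add scale)
      moreover have "(hdist H (X n) (X k))\<^sup>2 = (hnorm H (X n))\<^sup>2 + (hnorm H (X k))\<^sup>2 - 2 * Re (hinner H (X n) (X k))"
        using X by (simp add: hdist_hdiff norm_sq_diff)
      ultimately show ?thesis by (simp add: J_def field_simps)
    qed
    finally have "(hdist H (X n) (X k))\<^sup>2 \<le> 2 / real (Suc n) + 2 / real (Suc k)"
      using X(2)[of n] X(2)[of k] by (rule arith)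
    then have "hdist H (X n) (X k) \<le> sqrt (2 / real (Suc n) + 2 / real (Suc k))"
      by (rule real_le_rsqrt)
    also have "... \<le> sqrt (2 / real (Suc n)) + sqrt (2 / real (Suc k))"
      by (rule sqrt_add_le_add_sqrt) auto
    finally show ?thesis .
  qed
  have "(\<lambda>n. sqrt (2 / real (Suc n))) \<longlonglongrightarrow> sqrt 0"
    by (intro tendsto_real_sqrt lim_const_over_n[THEN LIMSEQ_Suc])
  then have "hcauchy H X"
    by (intro hcauchy_if_dist_le[OF dist_le]) simp
  then obtain y where y: "y \<in> hcar H" "htends H X y"
    using complete X(1) by blast
  have f_lim: "(\<lambda>n. f (X n)) \<longlonglongrightarrow> f y"
  proof -
    have lim0: "(\<lambda>n. C * hdist H (X n) y) \<longlonglongrightarrow> 0"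
      using tendsto_mult_left[OF y(2)[unfolded htends_def], of C] by simp
    have "norm (f (X n) - f y) \<le> C * hdist H (X n) y" for n
      using bound[OF diff_car[OF X(1) y(1)], of n] X(1) y(1) by (simp add: f_diff hdist_hdiff)
    then have "(\<lambda>n. f (X n) - f y) \<longlonglongrightarrow> 0"
      by (intro Lim_null_comparison[OF always_eventually lim0]) simp
    then show ?thesis using LIM_zero_iff by blast
  qed
  have J_lim: "(\<lambda>n. J (X n)) \<longlonglongrightarrow> J y"
    unfolding J_def using f_lim norm_tendsto[OF X(1) y]
    by (intro tendsto_diff tendsto_power tendsto_mult_left tendsto_Re)
  have m_lim: "(\<lambda>n. m + 1 / real (Suc n)) \<longlonglongrightarrow> m"
    using tendsto_add[OF tendsto_const lim_const_over_n[THEN LIMSEQ_Suc, of 1], of m] by simp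
  have "J y \<le> m"
    by (rule LIMSEQ_le[OF J_lim m_lim]) (intro exI allI impI less_imp_le X(2))
  have Re_eq: "Re (f h) = Re (hinner H h y)" if h: "h \<in> hcar H" for h
  proof -
    have "0 \<le> t\<^sup>2 * (hnorm H h)\<^sup>2 + 2 * t * (Re (hinner H h y) - Re (f h))" for t
    proof -
      have "J y \<le> J (hadd H y (hscale H (of_real t) h))"
        using \<open>J y \<le> m\<close> m_le[of "hadd H y (hscale H (of_real t) h)"] y h by auto
      moreover have "Re (hinner H y h) = Re (hinner H h y)"
        using inner_cnj[of y h, THEN arg_cong[of _ _ Re]] y h by simp
      ultimately show ?thesis
        using y h by (simp add: J_def norm_sq_add norm_scale power_mult_distrib add scale inner_simps algebra_simps)
    qed
    from quadratic_nonneg_imp_zero[OF this] have "Re (hinner H h y) - Re (f h) = 0" by simp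
    then show ?thesis by simp
  qed
  have "f x = hinner H x y" if x: "x \<in> hcar H" for x
  proof (rule complex_eqI)
    show "Re (f x) = Re (hinner H x y)" by (rule Re_eq[OF x])
    \<comment> \<open>The variation gives real parts only; the imaginary part of f at x is its real
      part at -i x.\<close>
    show "Im (f x) = Im (hinner H x y)"
      using Re_eq[of "hscale H (- \<i>) x"] x y by (simp add: scale inner_simps)
  qed
  with y show ?thesis by blast
qed

end

subsection \<open>Total families and isometries\<close>

inductive_set hspan :: "'a hspace => 'a set => 'a set" for H S where
  zero: "hzero H \<in> hspan H S"
| base: "s \<in> S ==> s \<in> hspan H S"
| add: "x \<in> hspan H S ==> y \<in> hspan H S ==> hadd H x y \<in> hspan H S"
| scale: "x \<in> hspan H S ==> hscale H c x \<in> hspan H S"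

text \<open>Totality is expressed by a vanishing orthogonal complement, the form that can be checked
  by integrals. Density of the span follows by \<open>total_dense\<close>.\<close>

definition htotal :: "'a hspace => 'a set => bool" where
  "htotal H S \<longleftrightarrow> S \<subseteq> hcar H \<and> (\<forall>x\<in>hcar H. (\<forall>s\<in>S. hinner H x s = 0) \<longrightarrow> x = hzero H)"

lemma (in semi_inner_space) hspan_car:
  assumes "x \<in> hspan H S" "S \<subseteq> hcar H" shows "x \<in> hcar H"
  using assms by induction auto

lemma hspan_inner_zero:
  assumes "semi_inner_space H" "S \<subseteq> hcar H" "x \<in> hcar H" "\<And>s. s \<in> S ==> hinner H s x = 0" "y \<in> hspan H S"
  shows "hinner H y x = 0"
proof -
  interpret semi_inner_space H by fact
  show ?thesis using assms(5)
    by induction (use assms hspan_car in \<open>auto simp: inner_simps\<close>)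
qed

lemma hnorm_carrier [simp]: "hnorm (H\<lparr>hcar := M\<rparr>) = hnorm H"
  by (simp add: hnorm_def fun_eq_iff)

lemma hdist_carrier [simp]: "hdist (H\<lparr>hcar := M\<rparr>) = hdist H"
  by (simp add: hdist_def fun_eq_iff)

lemma hcauchy_carrier [simp]: "hcauchy (H\<lparr>hcar := M\<rparr>) = hcauchy H"
  by (simp add: hcauchy_def fun_eq_iff)

lemma htends_carrier [simp]: "htends (H\<lparr>hcar := M\<rparr>) = htends H"
  by (simp add: htends_def fun_eq_iff)

text \<open>Makes the closed span a Hilbert space of its own, so that \<open>riesz\<close> can be
  applied inside it.\<close>

lemma (in hilbert) hilbert_closure_span:
  assumes S: "S \<subseteq> hcar H"
  shows "hilbert (H\<lparr>hcar := {x\<in>hcar H. \<forall>e>0. \<exists>y\<in>hspan H S. hdist H x y < e}\<rparr>)" (is "hilbert (H\<lparr>hcar := ?M\<rparr>)")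
proof -
  have span_car: "x \<in> hspan H S ==> x \<in> hcar H" for x
    using hspan_car S by blast
  have MI: "x \<in> ?M" if "x \<in> hspan H S" for x
  proof -
    have "\<exists>y\<in>hspan H S. hdist H x y < e" if "e > 0" for e
      using \<open>x \<in> hspan H S\<close> that dist_self[OF span_car[OF \<open>x \<in> hspan H S\<close>]] by force
    then show ?thesis using span_car[OF that] by simp
  qed
  have add: "hadd H x y \<in> ?M" if "x \<in> ?M" "y \<in> ?M" for x y
  proof -
    have "\<exists>z\<in>hspan H S. hdist H (hadd H x y) z < e" if "e > 0" for e
    proof -
      have "e / 2 > 0" using that by simp
      then obtain x' y' where xy: "x' \<in> hspan H S" "hdist H x x' < e / 2"
        "y' \<in> hspan H S" "hdist H y y' < e / 2"
        using \<open>x \<in> ?M\<close> \<open>y \<in> ?M\<close> by blast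
      have "hdist H (hadd H x y) (hadd H x' y') \<le> hdist H x x' + hdist H y y'"
        using \<open>x \<in> ?M\<close> \<open>y \<in> ?M\<close> xy span_car by (intro dist_add) auto
      then have "hdist H (hadd H x y) (hadd H x' y') < e" using xy by linarith
      then show ?thesis using hspan.add[OF xy(1,3)] by blast
    qed
    then show ?thesis using that by auto
  qed
  have scale: "hscale H c x \<in> ?M" if "x \<in> ?M" for x c
  proof -
    have "\<exists>z\<in>hspan H S. hdist H (hscale H c x) z < e" if "e > 0" for e
    proof -
      have "e / (cmod c + 1) > 0" using that by (simp add: add_nonneg_pos)
      then obtain x' where x': "x' \<in> hspan H S" "hdist H x x' < e / (cmod c + 1)"
        using \<open>x \<in> ?M\<close> by blast
      have "hdist H (hscale H c x) (hscale H c x') = cmod c * hdist H x x'"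
        using \<open>x \<in> ?M\<close> x' span_car by (intro dist_scale) auto
      also have "... \<le> (cmod c + 1) * hdist H x x'"
        using \<open>x \<in> ?M\<close> x' span_car by (intro mult_right_mono) auto
      also have "... < e"
        using x'(2) pos_less_divide_eq[of "cmod c + 1"] by (simp add: add_nonneg_pos mult.commute)
      finally show ?thesis using hspan.scale[OF x'(1)] by blast
    qed
    then show ?thesis using that by auto
  qed
  have complete: "\<exists>x\<in>?M. htends H X x" if X: "\<And>n. X n \<in> ?M" "hcauchy H X" for X
  proof -
    obtain x where x: "x \<in> hcar H" "htends H X x"
      using complete[of X] X by blast
    have "\<exists>y\<in>hspan H S. hdist H x y < e" if "e > 0" for e
    proof -
      obtain n where n: "hdist H (X n) x < e / 2"
        using eventually_happens[OF order_tendstoD(2)[OF x(2)[unfolded htends_def], of "e / 2"]] \<open>e > 0\<close>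
        by auto
      have "e / 2 > 0" using that by simp
      then obtain y where y: "y \<in> hspan H S" "hdist H (X n) y < e / 2"
        using X(1)[of n] by blast
      have car: "X n \<in> hcar H" "y \<in> hcar H" using X(1)[of n] y span_car by auto
      have "hdist H x y \<le> hdist H (X n) x + hdist H (X n) y"
        using dist_triangle[OF x(1) car] dist_commute[OF car(1) x(1)] by simp
      then have "hdist H x y < e" using n y(2) by linarith
      then show ?thesis using y(1) by blast
    qed
    then show ?thesis using x by blast
  qed
  show ?thesis
  proof unfold_locales
    show "hzero (H\<lparr>hcar := ?M\<rparr>) \<in> hcar (H\<lparr>hcar := ?M\<rparr>)"
      using MI[OF hspan.zero] by simp
  next
    fix X assume "\<And>n. X n \<in> hcar (H\<lparr>hcar := ?M\<rparr>)" "hcauchy (H\<lparr>hcar := ?M\<rparr>) X"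
    then show "\<exists>x\<in>hcar (H\<lparr>hcar := ?M\<rparr>). htends (H\<lparr>hcar := ?M\<rparr>) X x"
      using complete[of X] by simp
  qed (use add scale in \<open>auto simp: inner_simps inner_cnj inner_pos dist_eq_0\<close>)
qed

text \<open>The projection p of x to the closed span is the Riesz representative of m \<mapsto> <m,
  x> on that span. The difference x - p is orthogonal to S and therefore zero.\<close>

lemma (in hilbert) total_dense:
  assumes S: "htotal H S" and x: "x \<in> hcar H" and e: "e > 0"
  shows "\<exists>y\<in>hspan H S. hdist H x y < e"
proof -
  let ?M = "{x\<in>hcar H. \<forall>e>0. \<exists>y\<in>hspan H S. hdist H x y < e}"
  have Sc: "S \<subseteq> hcar H" using S by (simp add: htotal_def)
  interpret M: hilbert "H\<lparr>hcar := ?M\<rparr>" by (rule hilbert_closure_span[OF Sc])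
  have "\<exists>p\<in>hcar (H\<lparr>hcar := ?M\<rparr>). \<forall>m\<in>hcar (H\<lparr>hcar := ?M\<rparr>). hinner H m x = hinner (H\<lparr>hcar := ?M\<rparr>) m p"
  proof (rule M.riesz)
    show "cmod (hinner H m x) \<le> hnorm H x * hnorm (H\<lparr>hcar := ?M\<rparr>) m" if "m \<in> hcar (H\<lparr>hcar := ?M\<rparr>)" for m
      using cauchy_schwarz[of m x] that x by (simp add: mult.commute)
  qed (use x in \<open>auto simp: inner_simps\<close>)
  then obtain p where p: "p \<in> ?M" "\<And>m. m \<in> ?M ==> hinner H m x = hinner H m p"
    by auto
  have "hinner H (hdiff H x p) s = 0" if "s \<in> S" for s
  proof -
    have s: "s \<in> hcar H" using that Sc by auto
    then have "s \<in> ?M"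
      by (intro CollectI conjI allI impI bexI[of _ s]) (use that hspan.base in simp_all)
    then have "hinner H s (hdiff H x p) = 0" using p s x by (simp add: inner_simps)
    then show ?thesis using inner_cnj[of s "hdiff H x p"] s x p(1) by simp
  qed
  then have "hdiff H x p = hzero H"
    using S x p(1) unfolding htotal_def by auto
  then have "hdist H x p = 0" by (simp add: hdist_hdiff)
  then have "x = p" using dist_eq_0 x p(1) by blast
  then show ?thesis using p(1) e by blast
qed

lemma (in hilbert) total_approx:
  assumes "htotal H S" "x \<in> hcar H"
  shows "\<exists>X. (\<forall>n. X n \<in> hspan H S) \<and> htends H X x"
proof -
  have S: "S \<subseteq> hcar H" using assms by (simp add: htotal_def)
  have "\<exists>y\<in>hspan H S. hdist H x y < 1 / real (Suc n)" for n
    by (rule total_dense[OF assms]) simp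
  then obtain X where X: "\<And>n. X n \<in> hspan H S" "\<And>n. hdist H x (X n) < 1 / real (Suc n)"
    by metis
  have "hdist H (X n) x \<le> 1 / real (Suc n)" for n
    using X(2)[of n] dist_commute[OF assms(2) hspan_car[OF X(1) S], of n] by simp
  moreover have "0 \<le> hdist H (X n) x" for n
    by (rule dist_nonneg[OF hspan_car[OF X(1) S] assms(2)])
  ultimately have "htends H X x"
    unfolding htends_def
    by (intro tendsto_sandwich[OF _ _ tendsto_const lim_const_over_n[THEN LIMSEQ_Suc, of 1]]
        always_eventually) auto
  then show ?thesis using X(1) by blast
qed

text \<open>The functional is represented by a vector orthogonal to a total set. This is how
  vanishing is extended from generators to all vectors, one variable at a time.\<close>

lemma (in hilbert) functional_eq_zero:
  assumes add: "\<And>x y. x \<in> hcar H ==> y \<in> hcar H ==> f (hadd H x y) = f x + f y"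
    and scale: "\<And>c x. x \<in> hcar H ==> f (hscale H c x) = c * f x"
    and bound: "\<And>x. x \<in> hcar H ==> cmod (f x) \<le> C * hnorm H x"
    and S: "htotal H S" "\<And>s. s \<in> S ==> f s = 0" and x: "x \<in> hcar H"
  shows "f x = 0"
proof -
  obtain y where y: "y \<in> hcar H" "\<And>x. x \<in> hcar H ==> f x = hinner H x y"
    using riesz[of f C, OF add scale bound] by blast
  have "hinner H y s = 0" if "s \<in> S" for s
  proof -
    have s: "s \<in> hcar H" using that S(1) by (auto simp: htotal_def)
    have "hinner H s y = 0" using y(2)[OF s] S(2)[OF that] by simp
    then show ?thesis using inner_cnj[OF s y(1)] by simp
  qed
  then have "y = hzero H" using S(1) y(1) by (simp add: htotal_def)
  then show ?thesis using y x by simp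
qed

text \<open>Pairs of linear combinations with the same coefficients. Working with a relation
  postpones the question whether the second entry is a function of the first; equality of inner
  products answers it later.\<close>

inductive_set pspan :: "'a hspace => 'b hspace => ('a \<times> 'b) set => ('a \<times> 'b) set" for H K S where
  zero: "(hzero H, hzero K) \<in> pspan H K S"
| base: "p \<in> S ==> p \<in> pspan H K S"
| add: "p \<in> pspan H K S ==> q \<in> pspan H K S ==>
    (hadd H (fst p) (fst q), hadd K (snd p) (snd q)) \<in> pspan H K S"
| scale: "p \<in> pspan H K S ==> (hscale H c (fst p), hscale K c (snd p)) \<in> pspan H K S"

lemma pspan_swap: "p \<in> pspan H K S ==> prod.swap p \<in> pspan K H (prod.swap ` S)"
proof (induction rule: pspan.induct)
  case (add p q) then show ?case using pspan.add[OF add.IH] by simp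
next
  case (scale p c) then show ?case using pspan.scale[OF scale.IH] by simp
qed (auto intro: pspan.zero[of K H] pspan.base)

lemma hspan_pspan:
  assumes "u \<in> hspan H (fst ` S)" shows "\<exists>p\<in>pspan H K S. fst p = u"
  using assms
proof induction
  case zero then show ?case using pspan.zero by force
next
  case (base s) then show ?case using pspan.base by force
next
  case (add x y)
  then obtain p q where "p \<in> pspan H K S" "fst p = x" "q \<in> pspan H K S" "fst q = y" by blast
  then show ?case by (intro bexI[OF _ pspan.add[of p H K S q]]) simp_all
next
  case (scale x c)
  then obtain p where "p \<in> pspan H K S" "fst p = x" by blast
  then show ?case by (intro bexI[OF _ pspan.scale[of p H K S c]]) simp_all
qed

text \<open>Two families, indexed by the pairs in \<open>S\<close>, with equal Gram matrices. This
  is all the data from which an isometry can be extended.\<close>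

locale hilbert_pair = H: hilbert H + K: hilbert K
  for H :: "'a hspace" and K :: "'b hspace" and S :: "('a \<times> 'b) set" +
  assumes S_car: "S \<subseteq> hcar H \<times> hcar K"
    and S_isometric: "p \<in> S ==> q \<in> S ==> hinner H (fst p) (fst q) = hinner K (snd p) (snd q)"
begin

lemma pspan_car: "p \<in> pspan H K S ==> fst p \<in> hcar H \<and> snd p \<in> hcar K"
  by (induction rule: pspan.induct) (use S_car in auto)

lemma pspan_isometric:
  assumes "p \<in> pspan H K S" "q \<in> pspan H K S"
  shows "hinner H (fst p) (fst q) = hinner K (snd p) (snd q)"
proof -
  have *: "hinner H (fst p) (fst q) = hinner K (snd p) (snd q)" if "p \<in> pspan H K S" "q \<in> S" for p q
    using that(1)
  proof (induction rule: pspan.induct)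
    case (base p) then show ?case using S_isometric that(2) by blast
  qed (use that(2) S_car pspan_car in \<open>auto simp: H.inner_simps K.inner_simps mem_Times_iff\<close>)
  show ?thesis using assms(2)
  proof (induction rule: pspan.induct)
    case (base q) then show ?case using * assms(1) by blast
  qed (use assms(1) pspan_car in \<open>auto simp: H.inner_simps K.inner_simps\<close>)
qed

lemma pspan_diff:
  assumes "p \<in> pspan H K S" "q \<in> pspan H K S"
  shows "(hdiff H (fst p) (fst q), hdiff K (snd p) (snd q)) \<in> pspan H K S"
  using pspan.add[OF assms(1) pspan.scale[OF assms(2), of "- 1"]] by (simp add: hdiff_def)

lemma pspan_dist:
  assumes "p \<in> pspan H K S" "q \<in> pspan H K S"
  shows "hdist H (fst p) (fst q) = hdist K (snd p) (snd q)"
  using pspan_isometric[OF pspan_diff[OF assms] pspan_diff[OF assms]]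
  by (simp add: hdist_hdiff hnorm_def)

text \<open>The closure of \<open>pspan\<close>; it turns out to be the graph of the extended
  isometry.\<close>

definition graph :: "'a => 'b => bool" where
  "graph u w \<longleftrightarrow> u \<in> hcar H \<and> w \<in> hcar K \<and>
     (\<exists>P. (\<forall>n. P n \<in> pspan H K S) \<and> htends H (\<lambda>n. fst (P n)) u \<and> htends K (\<lambda>n. snd (P n)) w)"

lemma graph_inner:
  assumes "graph u w" "graph u' w'"
  shows "hinner H u u' = hinner K w w'"
proof -
  obtain P where P: "\<And>n. P n \<in> pspan H K S" "htends H (\<lambda>n. fst (P n)) u" "htends K (\<lambda>n. snd (P n)) w"
    using assms(1) by (auto simp: graph_def)
  obtain P' where P': "\<And>n. P' n \<in> pspan H K S" "htends H (\<lambda>n. fst (P' n)) u'" "htends K (\<lambda>n. snd (P' n)) w'"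
    using assms(2) by (auto simp: graph_def)
  have car: "u \<in> hcar H" "u' \<in> hcar H" "w \<in> hcar K" "w' \<in> hcar K"
    using assms by (auto simp: graph_def)
  have "(\<lambda>n. hinner H (fst (P n)) (fst (P' n))) \<longlonglongrightarrow> hinner H u u'"
    by (rule H.inner_tendsto) (use P P' car pspan_car in auto)
  moreover have "(\<lambda>n. hinner K (snd (P n)) (snd (P' n))) \<longlonglongrightarrow> hinner K w w'"
    by (rule K.inner_tendsto) (use P P' car pspan_car in auto)
  ultimately show ?thesis
    using pspan_isometric[OF P(1) P'(1)] LIMSEQ_unique by simp
qed

lemma graph_add:
  assumes "graph u w" "graph u' w'"
  shows "graph (hadd H u u') (hadd K w w')"
proof -
  obtain P where P: "\<And>n. P n \<in> pspan H K S" "htends H (\<lambda>n. fst (P n)) u" "htends K (\<lambda>n. snd (P n)) w"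
    using assms(1) by (auto simp: graph_def)
  obtain P' where P': "\<And>n. P' n \<in> pspan H K S" "htends H (\<lambda>n. fst (P' n)) u'" "htends K (\<lambda>n. snd (P' n)) w'"
    using assms(2) by (auto simp: graph_def)
  have car: "u \<in> hcar H" "u' \<in> hcar H" "w \<in> hcar K" "w' \<in> hcar K"
    using assms by (auto simp: graph_def)
  have "htends H (\<lambda>n. hadd H (fst (P n)) (fst (P' n))) (hadd H u u')"
    by (rule H.htends_add) (use P P' car pspan_car in auto)
  moreover have "htends K (\<lambda>n. hadd K (snd (P n)) (snd (P' n))) (hadd K w w')"
    by (rule K.htends_add) (use P P' car pspan_car in auto)
  ultimately show ?thesis
    unfolding graph_def using car pspan.add[OF P(1) P'(1)]
    by (intro conjI exI[of _ "\<lambda>n. (hadd H (fst (P n)) (fst (P' n)), hadd K (snd (P n)) (snd (P' n)))"]) auto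
qed

lemma graph_scale:
  assumes "graph u w"
  shows "graph (hscale H c u) (hscale K c w)"
proof -
  obtain P where P: "\<And>n. P n \<in> pspan H K S" "htends H (\<lambda>n. fst (P n)) u" "htends K (\<lambda>n. snd (P n)) w"
    using assms(1) by (auto simp: graph_def)
  have car: "u \<in> hcar H" "w \<in> hcar K"
    using assms by (auto simp: graph_def)
  have "htends H (\<lambda>n. hscale H c (fst (P n))) (hscale H c u)"
    by (rule H.htends_scale) (use P car pspan_car in auto)
  moreover have "htends K (\<lambda>n. hscale K c (snd (P n))) (hscale K c w)"
    by (rule K.htends_scale) (use P car pspan_car in auto)
  ultimately show ?thesis
    unfolding graph_def using car pspan.scale[OF P(1)]
    by (intro conjI exI[of _ "\<lambda>n. (hscale H c (fst (P n)), hscale K c (snd (P n)))"]) auto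
qed

lemma graph_base: "p \<in> S ==> graph (fst p) (snd p)"
  unfolding graph_def using S_car by (auto intro!: exI[of _ "\<lambda>_. p"] pspan.base)

lemma graph_left_total:
  assumes "htotal H (fst ` S)" "u \<in> hcar H"
  shows "\<exists>w. graph u w"
proof -
  obtain X where X: "\<And>n. X n \<in> hspan H (fst ` S)" "htends H X u"
    using H.total_approx[OF assms] by blast
  have "\<forall>n. \<exists>p\<in>pspan H K S. fst p = X n"
    using hspan_pspan[OF X(1)] by blast
  then obtain P where P: "\<And>n. P n \<in> pspan H K S" "\<And>n. fst (P n) = X n"
    by metis
  have X_eq: "X = (\<lambda>n. fst (P n))" using P(2) by auto
  have "hcauchy H X"
    by (rule H.htends_imp_hcauchy[OF _ assms(2) X(2)]) (metis P pspan_car)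
  then have "hcauchy K (\<lambda>n. snd (P n))"
    unfolding hcauchy_def using pspan_dist[OF P(1) P(1)] P(2) by simp
  then obtain w where "w \<in> hcar K" "htends K (\<lambda>n. snd (P n)) w"
    using K.complete[of "\<lambda>n. snd (P n)"] P(1) pspan_car by blast
  then show ?thesis
    using X(2) P(1) assms(2) unfolding graph_def X_eq by blast
qed

text \<open>The hypotheses are symmetric in the two spaces, so this is the left totality of the
  swapped family.\<close>

lemma graph_right_total:
  assumes "htotal K (snd ` S)" "w \<in> hcar K"
  shows "\<exists>u. graph u w"
proof -
  interpret swap: hilbert_pair K H "prod.swap ` S"
    by unfold_locales (use S_car S_isometric in auto)
  have eq: "fst ` prod.swap ` S = snd ` S"
    by (simp add: image_image)
  obtain u where "swap.graph w u"
    using swap.graph_left_total[unfolded eq, OF assms] by blast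
  then obtain P where P: "\<And>n. P n \<in> pspan K H (prod.swap ` S)" "w \<in> hcar K" "u \<in> hcar H"
    "htends K (\<lambda>n. fst (P n)) w" "htends H (\<lambda>n. snd (P n)) u"
    by (auto simp: swap.graph_def)
  have "prod.swap (P n) \<in> pspan H K S" for n
    using pspan_swap[OF P(1)[of n]] by (simp add: image_image)
  then have "graph u w"
    unfolding graph_def using P by (intro conjI exI[of _ "\<lambda>n. prod.swap (P n)"]) auto
  then show ?thesis by blast
qed

lemma graph_unique:
  assumes "graph u w" "graph u w'"
  shows "w = w'"
proof (rule K.dist_eq_0)
  have car: "w \<in> hcar K" "w' \<in> hcar K" using assms by (auto simp: graph_def)
  have "hinner K (hdiff K w w') (hdiff K w w') = 0"
    using car graph_inner[OF assms(1) assms(1)] graph_inner[OF assms(2) assms(2)]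
      graph_inner[OF assms(1) assms(2)] graph_inner[OF assms(2) assms(1)]
    by (simp add: K.inner_simps)
  then show "hdist K w w' = 0" by (simp add: hdist_hdiff hnorm_def)
qed (use assms in \<open>auto simp: graph_def\<close>)

text \<open>Preservation of inner products by \<open>graph\<close> gives both single-valuedness and
  isometry. Totality on the left gives the domain, and totality on the right gives
  surjectivity.\<close>

theorem isometry_extension:
  assumes tot: "htotal H (fst ` S)"
  obtains U where "hlinear H K U"
    "\<And>u v. u \<in> hcar H ==> v \<in> hcar H ==> hinner K (U u) (U v) = hinner H u v"
    "\<And>p. p \<in> S ==> U (fst p) = snd p"
    "htotal K (snd ` S) ==> U ` hcar H = hcar K"
proof
  define U where "U u = (SOME w. graph u w)" for u
  have U: "graph u (U u)" if "u \<in> hcar H" for u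
    unfolding U_def using graph_left_total[OF tot that] by (rule someI_ex)
  have U_eq: "U u = w" if "graph u w" for u w
    using graph_unique[OF that] U[of u] that by (auto simp: graph_def)
  show "hlinear H K U"
    unfolding hlinear_def using U U_eq graph_add graph_scale by (auto simp: graph_def)
  show "hinner K (U u) (U v) = hinner H u v" if "u \<in> hcar H" "v \<in> hcar H" for u v
    using graph_inner[OF U[OF that(1)] U[OF that(2)]] by simp
  show "U (fst p) = snd p" if "p \<in> S" for p
    using U_eq[OF graph_base[OF that]] .
  show "U ` hcar H = hcar K" if tot': "htotal K (snd ` S)"
  proof
    show "U ` hcar H \<subseteq> hcar K" using U by (auto simp: graph_def)
    show "hcar K \<subseteq> U ` hcar H"
    proof
      fix w assume "w \<in> hcar K"
      then obtain u where "graph u w" using graph_right_total[OF tot'] by blast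
      then show "w \<in> U ` hcar H" using U_eq[of u w] by (auto simp: graph_def)
    qed
  qed
qed

end

lemma unitary_image_total:
  assumes "hilbert H" "hilbert K" "hunitary H K U" "htotal H S"
  shows "htotal K (U ` S)"
proof -
  interpret H: hilbert H by fact
  interpret K: hilbert K by fact
  show ?thesis
    unfolding htotal_def
  proof (intro conjI ballI impI)
    show "U ` S \<subseteq> hcar K"
      using assms(3,4) by (auto simp: hunitary_def htotal_def)
    fix y assume y: "y \<in> hcar K" "\<forall>s\<in>U ` S. hinner K y s = 0"
    obtain x where x: "x \<in> hcar H" "y = U x"
      using y(1) assms(3) unfolding hunitary_def by (metis imageE)
    have "hinner H x s = 0" if "s \<in> S" for s
      using y(2) that x assms(3,4) unfolding hunitary_def htotal_def by (metis imageI subsetD)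
    then have "x = hzero H" using assms(4) x(1) by (auto simp: htotal_def)
    then have "hinner K y y = 0"
      using assms(3) x by (simp add: hunitary_def)
    then show "y = hzero K" by (rule K.eq_zeroI[OF y(1)])
  qed
qed

subsection \<open>Quotients and completions\<close>

text \<open>One relation for the two quotients in use: equality almost everywhere and equivalence of
  Cauchy sequences are both distance zero in a suitable space, see \<open>ae_rel_null\<close> and
  \<open>cauchy_rel_null\<close>.\<close>

definition null_rel :: "'a hspace => ('a \<times> 'a) set" where
  "null_rel H = {(x, y). x \<in> hcar H \<and> y \<in> hcar H \<and> hdist H x y = 0}"

context semi_inner_space
begin

lemma inner_null_cong:
  assumes "x \<in> hcar H" "y \<in> hcar H" "x' \<in> hcar H" "y' \<in> hcar H" "hdist H x x' = 0" "hdist H y y' = 0"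
  shows "hinner H x y = hinner H x' y'"
  using inner_diff_bound[OF assms(1-4)] assms(5,6) by simp

lemma equiv_null_rel: "equiv (hcar H) (null_rel H)"
proof (rule equivI)
  show "null_rel H \<subseteq> hcar H \<times> hcar H" by (auto simp: null_rel_def)
  show "refl_on (hcar H) (null_rel H)" by (auto simp: refl_on_def null_rel_def)
  show "sym (null_rel H)" using dist_commute by (auto simp: sym_def null_rel_def)
  show "trans (null_rel H)"
  proof (rule transI)
    fix x y z assume "(x, y) \<in> null_rel H" "(y, z) \<in> null_rel H"
    then have "x \<in> hcar H" "z \<in> hcar H" "hdist H x z \<le> 0"
      using dist_triangle[of x y z] by (auto simp: null_rel_def)
    moreover from this have "hdist H x z = 0"
      by (metis dist_nonneg order_antisym)
    ultimately show "(x, z) \<in> null_rel H"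
      by (auto simp: null_rel_def)
  qed
qed

abbreviation "cls x \<equiv> null_rel H `` {x}"
abbreviation "Q \<equiv> hquot H (null_rel H)"

lemma cls_eq_iff: "x \<in> hcar H ==> y \<in> hcar H ==> cls x = cls y \<longleftrightarrow> hdist H x y = 0"
  using eq_equiv_class_iff[OF equiv_null_rel, of x y] by (simp add: null_rel_def)

lemma cls_rep:
  assumes "x \<in> hcar H"
  shows "(SOME y. y \<in> cls x) \<in> hcar H" "hdist H x (SOME y. y \<in> cls x) = 0"
proof -
  have "x \<in> cls x" using assms by (simp add: null_rel_def)
  then have "(SOME y. y \<in> cls x) \<in> cls x" by (rule someI)
  then show "(SOME y. y \<in> cls x) \<in> hcar H" "hdist H x (SOME y. y \<in> cls x) = 0"
    by (auto simp: null_rel_def)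
qed

lemma hcar_quot: "hcar Q = cls ` hcar H"
  by (auto simp: hquot_def Let_def quotient_def)

lemma quot_zero: "hzero Q = cls (hzero H)"
  by (simp add: hquot_def Let_def)

lemma quot_add:
  assumes "x \<in> hcar H" "y \<in> hcar H"
  shows "hadd Q (cls x) (cls y) = cls (hadd H x y)"
proof -
  let ?x = "SOME z. z \<in> cls x" and ?y = "SOME z. z \<in> cls y"
  note r = cls_rep[OF assms(1)] cls_rep[OF assms(2)]
  have "hdist H (hadd H x y) (hadd H ?x ?y) \<le> 0"
    using dist_add[OF assms r(1,3)] r(2,4) by simp
  then have "hdist H (hadd H x y) (hadd H ?x ?y) = 0"
    using assms r by (simp add: order_antisym)
  then have "cls (hadd H x y) = cls (hadd H ?x ?y)"
    using assms r by (simp add: cls_eq_iff)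
  then show ?thesis by (simp add: hquot_def Let_def)
qed

lemma quot_scale:
  assumes "x \<in> hcar H"
  shows "hscale Q c (cls x) = cls (hscale H c x)"
proof -
  let ?x = "SOME z. z \<in> cls x"
  note r = cls_rep[OF assms(1)]
  have "hdist H (hscale H c x) (hscale H c ?x) = 0"
    using dist_scale[OF assms r(1)] r(2) by simp
  then have "cls (hscale H c x) = cls (hscale H c ?x)"
    using assms r by (simp add: cls_eq_iff)
  then show ?thesis by (simp add: hquot_def Let_def)
qed

lemma quot_inner:
  assumes "x \<in> hcar H" "y \<in> hcar H"
  shows "hinner Q (cls x) (cls y) = hinner H x y"
proof -
  note r = cls_rep[OF assms(1)] cls_rep[OF assms(2)]
  show ?thesis
    using inner_null_cong[OF assms r(1,3) r(2,4)] by (simp add: hquot_def Let_def)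
qed

lemma semi_inner_space_quot: "semi_inner_space Q"
proof
  show "hzero Q \<in> hcar Q" by (auto simp: hcar_quot quot_zero)
  show "hadd Q x y \<in> hcar Q" if "x \<in> hcar Q" "y \<in> hcar Q" for x y
    using that by (auto simp: hcar_quot quot_add)
  show "hscale Q c x \<in> hcar Q" if "x \<in> hcar Q" for x c
    using that by (auto simp: hcar_quot quot_scale)
  show "hinner Q (hzero Q) z = 0" if "z \<in> hcar Q" for z
    using that by (auto simp: hcar_quot quot_zero quot_inner)
  show "hinner Q (hadd Q x y) z = hinner Q x z + hinner Q y z"
    if "x \<in> hcar Q" "y \<in> hcar Q" "z \<in> hcar Q" for x y z
    using that by (auto simp: hcar_quot quot_add quot_inner inner_simps)
  show "hinner Q (hscale Q c x) z = c * hinner Q x z" if "x \<in> hcar Q" "z \<in> hcar Q" for x z c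
    using that by (auto simp: hcar_quot quot_scale quot_inner inner_simps)
  show "cnj (hinner Q x y) = hinner Q y x" if "x \<in> hcar Q" "y \<in> hcar Q" for x y
    using that by (auto simp: hcar_quot quot_inner inner_cnj)
  show "0 \<le> Re (hinner Q x x)" if "x \<in> hcar Q" for x
    using that by (auto simp: hcar_quot quot_inner inner_pos)
qed

lemma quot_dist:
  assumes "x \<in> hcar H" "y \<in> hcar H"
  shows "hdist Q (cls x) (cls y) = hdist H x y"
  using assms by (simp add: hdist_def hnorm_def quot_add quot_scale quot_inner)

lemma quot_norm: "x \<in> hcar H ==> hnorm Q (cls x) = hnorm H x"
  by (simp add: hnorm_def quot_inner)

lemma hilbert_quot:
  assumes complete: "\<And>X. (\<And>n. X n \<in> hcar H) ==> hcauchy H X ==> \<exists>x\<in>hcar H. htends H X x"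
  shows "hilbert Q"
proof -
  interpret Q: semi_inner_space Q by (rule semi_inner_space_quot)
  show ?thesis
  proof
    show "x = y" if "x \<in> hcar Q" "y \<in> hcar Q" "hdist Q x y = 0" for x y
    proof -
      note xy = that
      obtain a b where "a \<in> hcar H" "x = cls a" "b \<in> hcar H" "y = cls b"
        using xy(1,2) by (auto simp: hcar_quot)
      then show ?thesis using xy(3) by (simp only: quot_dist cls_eq_iff)
    qed
    fix X assume X: "\<And>n. X n \<in> hcar Q" "hcauchy Q X"
    have "\<forall>n. \<exists>y\<in>hcar H. X n = cls y" using X(1) by (auto simp: hcar_quot)
    then obtain Y where Y: "\<And>n. Y n \<in> hcar H" "\<And>n. X n = cls (Y n)" by metis
    have "hcauchy H Y" using X(2) Y by (simp add: hcauchy_def quot_dist)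
    then obtain y where y: "y \<in> hcar H" "htends H Y y" using complete[of Y] Y(1) by blast
    then have "htends Q X (cls y)" using Y by (simp add: htends_def quot_dist)
    then show "\<exists>x\<in>hcar Q. htends Q X x" using y(1) by (auto simp: hcar_quot)
  qed
qed

text \<open>Has exactly the shape of \<open>weight_form\<close>, which will thereby be recognized as
  an inner product. It also reduces statements on inner products to statements on norms.\<close>

lemma polarization:
  assumes "x \<in> hcar H" "y \<in> hcar H"
  shows "hinner H x y = (1 / 4) * (\<Sum>k<4. \<i> ^ k *
    complex_of_real ((hnorm H (hadd H x (hscale H (\<i> ^ k) y)))\<^sup>2))"
proof -
  have eq: "complex_of_real ((hnorm H (hadd H x (hscale H c y)))\<^sup>2) =
      hinner H x x + c * cnj c * hinner H y y + cnj c * hinner H x y + c * hinner H y x" for c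
    unfolding inner_self[OF add_car[OF assms(1) scale_car[OF assms(2)]], symmetric]
    using assms by (simp add: inner_simps algebra_simps)
  show ?thesis
    unfolding eq by (simp add: lessThan_nat_numeral lessThan_Suc algebra_simps numeral_eq_Suc)
qed

lemma hcauchy_add:
  assumes "\<And>n. x n \<in> hcar H" "\<And>n. y n \<in> hcar H" "hcauchy H x" "hcauchy H y"
  shows "hcauchy H (\<lambda>n. hadd H (x n) (y n))"
  unfolding hcauchy_def
proof (intro allI impI)
  fix e :: real assume "e > 0"
  then have "e / 2 > 0" by simp
  then obtain M N where MN: "\<And>m n. m \<ge> M ==> n \<ge> M ==> hdist H (x m) (x n) < e / 2"
    "\<And>m n. m \<ge> N ==> n \<ge> N ==> hdist H (y m) (y n) < e / 2"
    using assms(3,4) unfolding hcauchy_def by meson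
  have "hdist H (hadd H (x m) (y m)) (hadd H (x n) (y n)) < e"
    if "m \<ge> max M N" "n \<ge> max M N" for m n
    using dist_add[OF assms(1,2,1,2), of m m n n] MN(1)[of m n] MN(2)[of m n] that by simp
  then show "\<exists>N. \<forall>m\<ge>N. \<forall>n\<ge>N. hdist H (hadd H (x m) (y m)) (hadd H (x n) (y n)) < e" by blast
qed

lemma hcauchy_scale:
  assumes "\<And>n. x n \<in> hcar H" "hcauchy H x"
  shows "hcauchy H (\<lambda>n. hscale H c (x n))"
  unfolding hcauchy_def
proof (intro allI impI)
  fix e :: real assume "e > 0"
  have pos: "cmod c + 1 > 0" by (simp add: add_nonneg_pos)
  then have "e / (cmod c + 1) > 0" using \<open>e > 0\<close> by simp
  then obtain N where N: "\<And>m n. m \<ge> N ==> n \<ge> N ==> hdist H (x m) (x n) < e / (cmod c + 1)"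
    using assms(2) unfolding hcauchy_def by meson
  have "hdist H (hscale H c (x m)) (hscale H c (x n)) < e" if "m \<ge> N" "n \<ge> N" for m n
  proof -
    have "hdist H (hscale H c (x m)) (hscale H c (x n)) = cmod c * hdist H (x m) (x n)"
      by (rule dist_scale[OF assms(1,1)])
    also have "... \<le> (cmod c + 1) * hdist H (x m) (x n)"
      using assms(1) by (intro mult_right_mono) auto
    also have "... < e"
      using N[OF that] pos_less_divide_eq[OF pos] by (simp add: mult.commute)
    finally show ?thesis .
  qed
  then show "\<exists>N. \<forall>m\<ge>N. \<forall>n\<ge>N. hdist H (hscale H c (x m)) (hscale H c (x n)) < e" by blast
qed

lemma hcauchy_norm_convergent:
  assumes "\<And>n. x n \<in> hcar H" "hcauchy H x"
  shows "convergent (\<lambda>n. hnorm H (x n))"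
proof -
  have "\<bar>hnorm H (x m) - hnorm H (x n)\<bar> \<le> hdist H (x m) (x n)" for m n
    using norm_le_dist[OF assms(1,1), of m n] norm_le_dist[OF assms(1,1), of n m]
      dist_commute[OF assms(1,1), of m n] by linarith
  then have "Cauchy (\<lambda>n. hnorm H (x n))"
    using assms(2) unfolding hcauchy_def Cauchy_def dist_real_def by (meson le_less_trans)
  then show ?thesis by (simp add: Cauchy_convergent_iff)
qed

section \<open>Cauchy sequences and the completion\<close>

lemma hcar_cauchy_space: "hcar (cauchy_space H) = {x. (\<forall>n. x n \<in> hcar H) \<and> hcauchy H x}"
  by (simp add: cauchy_space_def hcauchy_def)

lemma cauchy_space_simps:
  "hzero (cauchy_space H) = (\<lambda>_. hzero H)"
  "hadd (cauchy_space H) x y = (\<lambda>n. hadd H (x n) (y n))"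
  "hscale (cauchy_space H) c x = (\<lambda>n. hscale H c (x n))"
  "hdiff (cauchy_space H) x y = (\<lambda>n. hdiff H (x n) (y n))"
  by (simp_all add: cauchy_space_def hdiff_def)

text \<open>Norms of Cauchy sequences converge by the reverse triangle inequality, and polarization
  transfers this to inner products. Only then does the \<open>lim\<close> in
  \<open>cauchy_space\<close> have a meaning.\<close>

lemma cauchy_space_inner_lim:
  assumes "x \<in> hcar (cauchy_space H)" "y \<in> hcar (cauchy_space H)"
  shows "(\<lambda>n. hinner H (x n) (y n)) \<longlonglongrightarrow> hinner (cauchy_space H) x y"
proof -
  have x: "\<And>n. x n \<in> hcar H" "hcauchy H x" and y: "\<And>n. y n \<in> hcar H" "hcauchy H y"
    using assms by (auto simp: hcar_cauchy_space)
  have "\<exists>l. (\<lambda>n. complex_of_real ((hnorm H (hadd H (x n) (hscale H c (y n))))\<^sup>2)) \<longlonglongrightarrow> l" for c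
  proof -
    have "convergent (\<lambda>n. hnorm H (hadd H (x n) (hscale H c (y n))))"
      using x y by (intro hcauchy_norm_convergent hcauchy_add hcauchy_scale) auto
    then obtain l where "(\<lambda>n. hnorm H (hadd H (x n) (hscale H c (y n)))) \<longlonglongrightarrow> l"
      by (auto simp: convergent_def)
    from tendsto_of_real[OF tendsto_power[OF this]] show ?thesis by blast
  qed
  then obtain l where l: "\<And>c. (\<lambda>n. complex_of_real ((hnorm H (hadd H (x n) (hscale H c (y n))))\<^sup>2)) \<longlonglongrightarrow> l c"
    by metis
  have "(\<lambda>n. hinner H (x n) (y n)) \<longlonglongrightarrow> (1 / 4) * (\<Sum>k<4. \<i> ^ k * l (\<i> ^ k))"
    unfolding polarization[OF x(1) y(1)] by (intro tendsto_mult tendsto_const tendsto_sum l)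
  then show ?thesis
    by (auto simp: cauchy_space_def convergent_LIMSEQ_iff[symmetric] convergent_def)
qed

lemma cauchy_space_inner_eqI:
  assumes "x \<in> hcar (cauchy_space H)" "y \<in> hcar (cauchy_space H)"
    "(\<lambda>n. hinner H (x n) (y n)) \<longlonglongrightarrow> l"
  shows "hinner (cauchy_space H) x y = l"
  using LIMSEQ_unique[OF cauchy_space_inner_lim[OF assms(1,2)] assms(3)] .

lemma semi_inner_space_cauchy: "semi_inner_space (cauchy_space H)"
proof
  let ?C = "cauchy_space H"
  show z: "hzero ?C \<in> hcar ?C"
    by (simp add: hcar_cauchy_space cauchy_space_simps hcauchy_def)
  show a: "hadd ?C x y \<in> hcar ?C" if "x \<in> hcar ?C" "y \<in> hcar ?C" for x y
    using that by (auto simp: hcar_cauchy_space cauchy_space_simps intro!: hcauchy_add)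
  show s: "hscale ?C c x \<in> hcar ?C" if "x \<in> hcar ?C" for x c
    using that by (auto simp: hcar_cauchy_space cauchy_space_simps intro!: hcauchy_scale)
  show "hinner ?C (hzero ?C) x = 0" if x: "x \<in> hcar ?C" for x
    by (rule cauchy_space_inner_eqI[OF z x])
      (use x in \<open>auto simp: cauchy_space_simps hcar_cauchy_space\<close>)
  show "hinner ?C (hadd ?C x y) w = hinner ?C x w + hinner ?C y w"
    if x: "x \<in> hcar ?C" and y: "y \<in> hcar ?C" and w: "w \<in> hcar ?C" for x y w
  proof (rule cauchy_space_inner_eqI[OF a[OF x y] w])
    have "(\<lambda>n. hinner H (x n) (w n) + hinner H (y n) (w n)) \<longlonglongrightarrow> hinner ?C x w + hinner ?C y w"
      by (intro tendsto_add cauchy_space_inner_lim x y w)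
    then show "(\<lambda>n. hinner H (hadd ?C x y n) (w n)) \<longlonglongrightarrow> hinner ?C x w + hinner ?C y w"
      using x y w by (simp add: cauchy_space_simps hcar_cauchy_space inner_simps)
  qed
  show "hinner ?C (hscale ?C c x) w = c * hinner ?C x w"
    if x: "x \<in> hcar ?C" and w: "w \<in> hcar ?C" for x w c
  proof (rule cauchy_space_inner_eqI[OF s[OF x] w])
    have "(\<lambda>n. c * hinner H (x n) (w n)) \<longlonglongrightarrow> c * hinner ?C x w"
      by (intro tendsto_mult tendsto_const cauchy_space_inner_lim x w)
    then show "(\<lambda>n. hinner H (hscale ?C c x n) (w n)) \<longlonglongrightarrow> c * hinner ?C x w"
      using x w by (simp add: cauchy_space_simps hcar_cauchy_space inner_simps)
  qed
  show "cnj (hinner ?C x y) = hinner ?C y x" if x: "x \<in> hcar ?C" and y: "y \<in> hcar ?C" for x y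
  proof (rule sym, rule cauchy_space_inner_eqI[OF y x])
    have "(\<lambda>n. cnj (hinner H (x n) (y n))) \<longlonglongrightarrow> cnj (hinner ?C x y)"
      by (intro tendsto_cnj cauchy_space_inner_lim x y)
    then show "(\<lambda>n. hinner H (y n) (x n)) \<longlonglongrightarrow> cnj (hinner ?C x y)"
      using x y by (simp add: hcar_cauchy_space inner_cnj)
  qed
  show "0 \<le> Re (hinner ?C x x)" if x: "x \<in> hcar ?C" for x
  proof (rule LIMSEQ_le_const[OF tendsto_Re[OF cauchy_space_inner_lim[OF x x]]])
    show "\<exists>N. \<forall>n\<ge>N. 0 \<le> Re (hinner H (x n) (x n))"
      using x by (auto simp: hcar_cauchy_space intro!: inner_pos)
  qed
qed

lemma cauchy_space_dist_lim:
  assumes x: "x \<in> hcar (cauchy_space H)" and y: "y \<in> hcar (cauchy_space H)"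
  shows "(\<lambda>n. hdist H (x n) (y n)) \<longlonglongrightarrow> hdist (cauchy_space H) x y"
proof -
  interpret C: semi_inner_space "cauchy_space H" by (rule semi_inner_space_cauchy)
  have "(\<lambda>n. sqrt (Re (hinner H (hdiff (cauchy_space H) x y n) (hdiff (cauchy_space H) x y n))))
      \<longlonglongrightarrow> hdist (cauchy_space H) x y"
    unfolding hdist_hdiff hnorm_def
    by (intro tendsto_real_sqrt tendsto_Re cauchy_space_inner_lim C.diff_car x y)
  then show ?thesis by (simp add: cauchy_space_simps hdist_hdiff hnorm_def)
qed

lemma cauchy_rel_null: "cauchy_rel H = null_rel (cauchy_space H)"
proof -
  have "(\<lambda>n. hdist H (x n) (y n)) \<longlonglongrightarrow> 0 \<longleftrightarrow> hdist (cauchy_space H) x y = 0"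
    if "x \<in> hcar (cauchy_space H)" "y \<in> hcar (cauchy_space H)" for x y
    using cauchy_space_dist_lim[OF that] LIMSEQ_unique by metis
  then show ?thesis by (auto simp: cauchy_rel_def null_rel_def)
qed

lemma const_in_cauchy: "x \<in> hcar H ==> (\<lambda>_. x) \<in> hcar (cauchy_space H)"
  by (simp add: hcar_cauchy_space hcauchy_def)

lemma cauchy_const_dist:
  assumes "x \<in> hcar H" "y \<in> hcar H"
  shows "hdist (cauchy_space H) (\<lambda>_. x) (\<lambda>_. y) = hdist H x y"
  using LIMSEQ_unique[OF cauchy_space_dist_lim[OF const_in_cauchy const_in_cauchy] tendsto_const] assms
  by blast

lemma cauchy_space_dist_le:
  assumes x: "x \<in> hcar (cauchy_space H)" and y: "y \<in> hcar (cauchy_space H)"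
    and le: "\<And>n. n \<ge> N ==> hdist H (x n) (y n) \<le> e"
  shows "hdist (cauchy_space H) x y \<le> e"
  by (rule LIMSEQ_le_const2[OF cauchy_space_dist_lim[OF x y]]) (use le in blast)

lemma const_tends:
  assumes x: "x \<in> hcar (cauchy_space H)"
  shows "htends (cauchy_space H) (\<lambda>n _. x n) x"
proof -
  interpret C: semi_inner_space "cauchy_space H" by (rule semi_inner_space_cauchy)
  have car: "\<And>n. x n \<in> hcar H" and cau: "hcauchy H x"
    using x by (auto simp: hcar_cauchy_space)
  show ?thesis
    unfolding htends_def
  proof (rule LIMSEQ_I)
    fix e :: real assume "e > 0"
    then have "e / 2 > 0" by simp
    then obtain N where N: "\<And>m n. m \<ge> N ==> n \<ge> N ==> hdist H (x m) (x n) < e / 2"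
      using cau unfolding hcauchy_def by meson
    have "norm (hdist (cauchy_space H) (\<lambda>_. x n) x - 0) < e" if "n \<ge> N" for n
    proof -
      have "hdist (cauchy_space H) (\<lambda>_. x n) x \<le> e / 2"
        by (rule cauchy_space_dist_le[OF const_in_cauchy[OF car] x, of N]) (use N that in \<open>auto intro: less_imp_le\<close>)
      then show ?thesis
        using \<open>e > 0\<close> C.dist_nonneg[OF const_in_cauchy[OF car] x, of n] by simp
    qed
    then show "\<exists>N. \<forall>n\<ge>N. norm (hdist (cauchy_space H) (\<lambda>_. x n) x - 0) < e" by blast
  qed
qed

text \<open>Diagonal argument: each sequence X n is within 1/(n+1) of the constant sequence with
  value y n, one of its own late terms. The sequence y is Cauchy in \<open>H\<close>, and as a point
  of the space of Cauchy sequences it is the limit.\<close>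

lemma cauchy_space_complete:
  assumes X: "\<And>n. X n \<in> hcar (cauchy_space H)" "hcauchy (cauchy_space H) X"
  shows "\<exists>x\<in>hcar (cauchy_space H). htends (cauchy_space H) X x"
proof -
  let ?C = "cauchy_space H"
  interpret C: semi_inner_space ?C by (rule semi_inner_space_cauchy)
  have Xc: "\<And>n j. X n j \<in> hcar H" and Xcau: "\<And>n. hcauchy H (X n)"
    using X(1) by (auto simp: hcar_cauchy_space)
  have "\<exists>k. hdist ?C (X n) (\<lambda>_. X n k) \<le> 1 / real (Suc n)" for n
  proof -
    have "1 / real (Suc n) > 0" by simp
    then obtain N where N: "\<And>j k. j \<ge> N ==> k \<ge> N ==> hdist H (X n j) (X n k) < 1 / real (Suc n)"
      using Xcau[of n] unfolding hcauchy_def by meson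
    have "hdist ?C (X n) (\<lambda>_. X n N) \<le> 1 / real (Suc n)"
      by (rule cauchy_space_dist_le[OF X(1) const_in_cauchy[OF Xc], of N]) (use N in \<open>auto intro: less_imp_le\<close>)
    then show ?thesis by blast
  qed
  then obtain k where k: "\<And>n. hdist ?C (X n) (\<lambda>_. X n (k n)) \<le> 1 / real (Suc n)" by metis
  define y where "y n = X n (k n)" for n
  have yc: "y n \<in> hcar H" for n by (simp add: y_def Xc)
  have k': "hdist ?C (X n) (\<lambda>_. y n) \<le> 1 / real (Suc n)" for n using k by (simp add: y_def)
  have inv0: "(\<lambda>n. 1 / real (Suc n)) \<longlonglongrightarrow> 0"
    by (rule lim_const_over_n[THEN LIMSEQ_Suc, of 1])
  have "hcauchy H y"
    unfolding hcauchy_def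
  proof (intro allI impI)
    fix e :: real assume "e > 0"
    then have e: "e / 3 > 0" by simp
    then obtain N where N: "\<And>m n. m \<ge> N ==> n \<ge> N ==> hdist ?C (X m) (X n) < e / 3"
      using X(2) unfolding hcauchy_def by meson
    obtain M where M: "\<And>n. n \<ge> M ==> 1 / real (Suc n) < e / 3"
      using order_tendstoD(2)[OF inv0 e] by (auto simp only: eventually_sequentially)
    have "hdist H (y m) (y n) < e" if "m \<ge> max M N" "n \<ge> max M N" for m n
    proof -
      have c: "(\<lambda>_. y m) \<in> hcar ?C" "(\<lambda>_. y n) \<in> hcar ?C" using const_in_cauchy yc by auto
      have "hdist H (y m) (y n) = hdist ?C (\<lambda>_. y m) (\<lambda>_. y n)"
        by (simp add: cauchy_const_dist yc)
      also have "... \<le> hdist ?C (\<lambda>_. y m) (X m) + (hdist ?C (X m) (X n) + hdist ?C (X n) (\<lambda>_. y n))"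
        using C.dist_triangle[OF c(1) X(1) c(2), of m] C.dist_triangle[OF X(1) X(1) c(2), of m n] by simp
      also have "hdist ?C (\<lambda>_. y m) (X m) = hdist ?C (X m) (\<lambda>_. y m)"
        by (rule C.dist_commute[OF c(1) X(1)])
      finally show ?thesis
        using k'[of m] k'[of n] M[of m] M[of n] N[of m n] that by (simp del: of_nat_Suc)
    qed
    then show "\<exists>N. \<forall>m\<ge>N. \<forall>n\<ge>N. hdist H (y m) (y n) < e" by blast
  qed
  then have y: "y \<in> hcar ?C" using yc by (simp add: hcar_cauchy_space)
  have "htends ?C X y"
    unfolding htends_def
  proof (rule tendsto_sandwich[OF _ _ tendsto_const])
    show "(\<lambda>n. 1 / real (Suc n) + hdist ?C (\<lambda>_. y n) y) \<longlonglongrightarrow> 0"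
      using tendsto_add[OF inv0 const_tends[OF y, unfolded htends_def]] by simp
    show "\<forall>\<^sub>F n in sequentially. hdist ?C (X n) y \<le> 1 / real (Suc n) + hdist ?C (\<lambda>_. y n) y"
    proof (rule always_eventually, rule allI)
      fix n
      show "hdist ?C (X n) y \<le> 1 / real (Suc n) + hdist ?C (\<lambda>_. y n) y"
        using C.dist_triangle[OF X(1) const_in_cauchy[OF yc] y, of n n] k'[of n] by linarith
    qed
    show "\<forall>\<^sub>F n in sequentially. 0 \<le> hdist ?C (X n) y"
      by (simp add: X(1) y)
  qed
  then show ?thesis using y by blast
qed

lemma hilbert_completion: "hilbert (hcompletion H)"
  unfolding hcompletion_def cauchy_rel_null
  by (rule semi_inner_space.hilbert_quot[OF semi_inner_space_cauchy cauchy_space_complete])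

lemma hembed_car: "x \<in> hcar H ==> hembed H x \<in> hcar (hcompletion H)"
  unfolding hembed_def hcompletion_def cauchy_rel_null
  using semi_inner_space.hcar_quot[OF semi_inner_space_cauchy] const_in_cauchy by blast

lemma hembed_inner:
  assumes "x \<in> hcar H" "y \<in> hcar H"
  shows "hinner (hcompletion H) (hembed H x) (hembed H y) = hinner H x y"
  unfolding hembed_def hcompletion_def cauchy_rel_null
    semi_inner_space.quot_inner[OF semi_inner_space_cauchy const_in_cauchy[OF assms(1)] const_in_cauchy[OF assms(2)]]
  by (rule cauchy_space_inner_eqI[OF const_in_cauchy[OF assms(1)] const_in_cauchy[OF assms(2)] tendsto_const])

lemma hembed_zero: "hembed H (hzero H) = hzero (hcompletion H)"
  unfolding hembed_def hcompletion_def cauchy_rel_null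
    semi_inner_space.quot_zero[OF semi_inner_space_cauchy] cauchy_space_simps ..

lemma hembed_add:
  assumes "x \<in> hcar H" "y \<in> hcar H"
  shows "hembed H (hadd H x y) = hadd (hcompletion H) (hembed H x) (hembed H y)"
  unfolding hembed_def hcompletion_def cauchy_rel_null
    semi_inner_space.quot_add[OF semi_inner_space_cauchy const_in_cauchy[OF assms(1)] const_in_cauchy[OF assms(2)]]
    cauchy_space_simps ..

lemma hembed_scale:
  assumes "x \<in> hcar H"
  shows "hembed H (hscale H c x) = hscale (hcompletion H) c (hembed H x)"
  unfolding hembed_def hcompletion_def cauchy_rel_null
    semi_inner_space.quot_scale[OF semi_inner_space_cauchy const_in_cauchy[OF assms(1)]]
    cauchy_space_simps ..

lemma hembed_diff:
  assumes "x \<in> hcar H" "y \<in> hcar H"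
  shows "hembed H (hdiff H x y) = hdiff (hcompletion H) (hembed H x) (hembed H y)"
  using assms by (simp add: hdiff_def hembed_add hembed_scale)

lemma hembed_norm: "x \<in> hcar H ==> hnorm (hcompletion H) (hembed H x) = hnorm H x"
  by (simp add: hnorm_def hembed_inner)

lemma hembed_dist:
  "x \<in> hcar H ==> y \<in> hcar H ==> hdist (hcompletion H) (hembed H x) (hembed H y) = hdist H x y"
  by (simp add: hdist_hdiff hembed_diff[symmetric] hembed_norm)

text \<open>A class in the completion is the limit of the embedded terms of any sequence
  representing it, so a vector orthogonal to the embedded space is orthogonal to itself.\<close>

lemma hembed_total: "htotal (hcompletion H) (hembed H ` hcar H)"
  unfolding htotal_def
proof (intro conjI ballI impI)
  interpret C: semi_inner_space "cauchy_space H" by (rule semi_inner_space_cauchy)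
  interpret K: hilbert "hcompletion H" by (rule hilbert_completion)
  show "hembed H ` hcar H \<subseteq> hcar (hcompletion H)" using hembed_car by auto
  fix z assume z: "z \<in> hcar (hcompletion H)" "\<forall>s\<in>hembed H ` hcar H. hinner (hcompletion H) z s = 0"
  obtain x where x: "x \<in> hcar (cauchy_space H)" "z = null_rel (cauchy_space H) `` {x}"
    using z(1) unfolding hcompletion_def cauchy_rel_null C.hcar_quot by blast
  have xc: "x n \<in> hcar H" for n using x(1) by (auto simp: hcar_cauchy_space)
  have "htends (hcompletion H) (\<lambda>n. hembed H (x n)) z"
    using const_tends[OF x(1)] x xc
    unfolding htends_def hembed_def hcompletion_def cauchy_rel_null
    by (simp add: C.quot_dist const_in_cauchy)
  then have "(\<lambda>n. hinner (hcompletion H) z (hembed H (x n))) \<longlonglongrightarrow> hinner (hcompletion H) z z"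
    using z(1) xc hembed_car by (intro K.inner_tendsto) auto
  then have "(\<lambda>n. 0) \<longlonglongrightarrow> hinner (hcompletion H) z z" using z(2) xc by simp
  then have "hinner (hcompletion H) z z = 0" using LIMSEQ_unique tendsto_const by blast
  then show "z = hzero (hcompletion H)" by (rule K.eq_zeroI[OF z(1)])
qed

end

subsection \<open>Bounded operators and adjoints\<close>

lemma bounded_opsD:
  assumes "A \<in> bounded_ops H"
  shows "A \<in> extensional (hcar H)" "\<And>x. x \<in> hcar H ==> A x \<in> hcar H"
    "\<And>x y. x \<in> hcar H ==> y \<in> hcar H ==> A (hadd H x y) = hadd H (A x) (A y)"
    "\<And>c x. x \<in> hcar H ==> A (hscale H c x) = hscale H c (A x)"
  using assms by (auto simp: bounded_ops_def hlinear_def)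

lemma bounded_ops_bound:
  assumes "semi_inner_space H" "A \<in> bounded_ops H"
  obtains C where "C \<ge> 0" "\<And>x. x \<in> hcar H ==> hnorm H (A x) \<le> C * hnorm H x"
proof -
  interpret semi_inner_space H by fact
  obtain C where C: "\<And>x. x \<in> hcar H ==> hnorm H (A x) \<le> C * hnorm H x"
    using assms by (auto simp: bounded_ops_def)
  have "hnorm H (A x) \<le> max C 0 * hnorm H x" if "x \<in> hcar H" for x
    using C[OF that] mult_right_mono[of C "max C 0" "hnorm H x"] that by simp
  then show ?thesis using that[of "max C 0"] by simp
qed

lemma bounded_opsI:
  assumes "A \<in> extensional (hcar H)" "\<And>x. x \<in> hcar H ==> A x \<in> hcar H"
    "\<And>x y. x \<in> hcar H ==> y \<in> hcar H ==> A (hadd H x y) = hadd H (A x) (A y)"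
    "\<And>c x. x \<in> hcar H ==> A (hscale H c x) = hscale H c (A x)"
    "\<And>x. x \<in> hcar H ==> hnorm H (A x) \<le> C * hnorm H x"
  shows "A \<in> bounded_ops H"
proof -
  have "\<exists>C. \<forall>x\<in>hcar H. hnorm H (A x) \<le> C * hnorm H x" using assms(5) by blast
  then show ?thesis using assms(1-4) by (auto simp: bounded_ops_def hlinear_def)
qed

context hilbert
begin

lemma add_commute4:
  assumes "a \<in> hcar H" "b \<in> hcar H" "c \<in> hcar H" "d \<in> hcar H"
  shows "hadd H (hadd H a b) (hadd H c d) = hadd H (hadd H a c) (hadd H b d)"
  by (rule eqI) (use assms in \<open>auto simp: inner_simps\<close>)

lemma scale_add:
  "a \<in> hcar H ==> b \<in> hcar H ==> hscale H c (hadd H a b) = hadd H (hscale H c a) (hscale H c b)"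
  by (rule eqI) (auto simp: inner_simps algebra_simps)

lemma scale_scale: "a \<in> hcar H ==> hscale H c (hscale H d a) = hscale H (c * d) a"
  by (rule eqI) (auto simp: inner_simps)

lemma op_eqI:
  assumes "A \<in> bounded_ops H" "B \<in> bounded_ops H" "\<And>x. x \<in> hcar H ==> A x = B x"
  shows "A = B"
  using assms by (intro extensionalityI[of A "hcar H"]) (auto dest: bounded_opsD(1))

lemma op_add_bounded:
  assumes A: "A \<in> bounded_ops H" and B: "B \<in> bounded_ops H"
  shows "op_add H A B \<in> bounded_ops H"
proof -
  note a = bounded_opsD[OF A] and b = bounded_opsD[OF B]
  obtain C where C: "\<And>x. x \<in> hcar H ==> hnorm H (A x) \<le> C * hnorm H x"
    using bounded_ops_bound[OF semi_inner_space_axioms A] by blast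
  obtain D where D: "\<And>x. x \<in> hcar H ==> hnorm H (B x) \<le> D * hnorm H x"
    using bounded_ops_bound[OF semi_inner_space_axioms B] by blast
  show ?thesis
  proof (rule bounded_opsI[where C = "C + D"])
    fix x assume x: "x \<in> hcar H"
    show "hnorm H (op_add H A B x) \<le> (C + D) * hnorm H x"
      using norm_triangle[OF a(2)[OF x] b(2)[OF x]] C[OF x] D[OF x] x
      by (simp add: op_add_def algebra_simps)
  qed (auto simp: op_add_def a b add_commute4 scale_add)
qed

lemma op_scale_bounded:
  assumes A: "A \<in> bounded_ops H"
  shows "op_scale H c A \<in> bounded_ops H"
proof -
  note a = bounded_opsD[OF A]
  obtain C where C: "\<And>x. x \<in> hcar H ==> hnorm H (A x) \<le> C * hnorm H x"
    using bounded_ops_bound[OF semi_inner_space_axioms A] by blast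
  show ?thesis
  proof (rule bounded_opsI[where C = "cmod c * C"])
    fix x assume x: "x \<in> hcar H"
    show "hnorm H (op_scale H c A x) \<le> cmod c * C * hnorm H x"
      using C[OF x] x by (simp add: op_scale_def norm_scale a mult.assoc mult_left_mono)
  qed (auto simp: op_scale_def a scale_add scale_scale mult.commute)
qed

lemma op_comp_bounded:
  assumes A: "A \<in> bounded_ops H" and B: "B \<in> bounded_ops H"
  shows "op_comp H A B \<in> bounded_ops H"
proof -
  note a = bounded_opsD[OF A] and b = bounded_opsD[OF B]
  obtain C where C: "C \<ge> 0" "\<And>x. x \<in> hcar H ==> hnorm H (A x) \<le> C * hnorm H x"
    using bounded_ops_bound[OF semi_inner_space_axioms A] by blast
  obtain D where D: "\<And>x. x \<in> hcar H ==> hnorm H (B x) \<le> D * hnorm H x"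
    using bounded_ops_bound[OF semi_inner_space_axioms B] by blast
  show ?thesis
  proof (rule bounded_opsI[where C = "C * D"])
    fix x assume x: "x \<in> hcar H"
    have "hnorm H (A (B x)) \<le> C * hnorm H (B x)" by (rule C(2)[OF b(2)[OF x]])
    also have "... \<le> C * (D * hnorm H x)" by (rule mult_left_mono[OF D[OF x] C(1)])
    finally show "hnorm H (op_comp H A B x) \<le> C * D * hnorm H x"
      using x by (simp add: op_comp_def mult.assoc)
  qed (auto simp: op_comp_def a b)
qed

lemma op_zero_bounded: "(\<lambda>x\<in>hcar H. hzero H) \<in> bounded_ops H"
  by (rule bounded_opsI[where C = 0]) (auto intro!: eqI simp: inner_simps)

text \<open>Riesz for each fixed second argument. The bound for the adjoint B comes from |B x|^2 =
  Re <A (B x), x>, divided by |B x| when that is nonzero.\<close>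

lemma adjoint_ex:
  assumes A: "A \<in> bounded_ops H"
  shows "\<exists>B\<in>bounded_ops H. \<forall>x\<in>hcar H. \<forall>y\<in>hcar H. hinner H (A x) y = hinner H x (B y)"
proof -
  note a = bounded_opsD[OF A]
  obtain C where C: "C \<ge> 0" "\<And>x. x \<in> hcar H ==> hnorm H (A x) \<le> C * hnorm H x"
    using bounded_ops_bound[OF semi_inner_space_axioms A] by blast
  have "\<exists>z\<in>hcar H. \<forall>x\<in>hcar H. hinner H (A x) y = hinner H x z" if y: "y \<in> hcar H" for y
  proof (rule riesz)
    fix x assume x: "x \<in> hcar H"
    have "cmod (hinner H (A x) y) \<le> hnorm H (A x) * hnorm H y"
      by (rule cauchy_schwarz[OF a(2)[OF x] y])
    also have "... \<le> (C * hnorm H x) * hnorm H y"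
      by (rule mult_right_mono[OF C(2)[OF x]]) (use y in simp)
    finally show "cmod (hinner H (A x) y) \<le> (C * hnorm H y) * hnorm H x"
      by (simp add: algebra_simps)
  qed (use y in \<open>auto simp: a inner_simps\<close>)
  then obtain g where g: "\<And>y. y \<in> hcar H ==> g y \<in> hcar H"
    "\<And>x y. x \<in> hcar H ==> y \<in> hcar H ==> hinner H (A x) y = hinner H x (g y)"
    by metis
  have g': "hinner H (g y) x = hinner H y (A x)" if "x \<in> hcar H" "y \<in> hcar H" for x y
    using g(2)[OF that, THEN arg_cong[of _ _ cnj]] inner_cnj[OF a(2)[OF that(1)] that(2)]
      inner_cnj[OF that(1) g(1)[OF that(2)]] by simp
  define B where "B = restrict g (hcar H)"
  have Bb: "B \<in> bounded_ops H"
  proof (rule bounded_opsI[where C = C])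
    fix x y assume xy: "x \<in> hcar H" "y \<in> hcar H"
    show "B (hadd H x y) = hadd H (B x) (B y)"
      by (rule eqI) (use xy in \<open>auto simp: B_def g g' inner_simps a\<close>)
  next
    fix x c assume x: "x \<in> hcar H"
    show "B (hscale H c x) = hscale H c (B x)"
      by (rule eqI) (use x in \<open>auto simp: B_def g g' inner_simps a\<close>)
    have "(hnorm H (g x))\<^sup>2 = Re (hinner H (A (g x)) x)"
      using x g by (simp add: norm_sq)
    also have "... \<le> hnorm H (A (g x)) * hnorm H x"
      using cauchy_schwarz[OF a(2)[OF g(1)[OF x]] x] complex_Re_le_cmod order_trans by blast
    also have "... \<le> C * hnorm H (g x) * hnorm H x"
      by (rule mult_right_mono[OF C(2)[OF g(1)[OF x]]]) (use x in simp)
    finally have le: "hnorm H (g x) * hnorm H (g x) \<le> hnorm H (g x) * (C * hnorm H x)"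
      by (simp add: power2_eq_square algebra_simps)
    show "hnorm H (B x) \<le> C * hnorm H x"
    proof (cases "hnorm H (g x) = 0")
      case True then show ?thesis using C(1) x by (simp add: B_def)
    next
      case False
      then have "hnorm H (g x) > 0" using norm_nonneg[OF g(1)[OF x]] by simp
      then show ?thesis using le x by (simp add: B_def)
    qed
  qed (auto simp: B_def g)
  have BB: "\<forall>x\<in>hcar H. \<forall>y\<in>hcar H. hinner H (A x) y = hinner H x (B y)"
  proof (intro ballI)
    fix x y assume "x \<in> hcar H" "y \<in> hcar H"
    then show "hinner H (A x) y = hinner H x (B y)" unfolding B_def restrict_def by (simp only: g(2) if_True)
  qed
  show ?thesis
    by (rule bexI[where P = "\<lambda>B. \<forall>x\<in>hcar H. \<forall>y\<in>hcar H. hinner H (A x) y = hinner H x (B y)", OF BB Bb])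
qed

text \<open>Justifies the definite description in \<open>op_adj\<close>: inner products determine
  the values on the carrier, and extensionality fixes the operator outside it.\<close>

lemma op_adjI:
  assumes "A \<in> bounded_ops H" "B \<in> bounded_ops H"
    "\<And>x y. x \<in> hcar H ==> y \<in> hcar H ==> hinner H (A x) y = hinner H x (B y)"
  shows "op_adj H A = B"
  unfolding op_adj_def
proof (rule the_equality)
  fix B' assume B': "B' \<in> bounded_ops H \<and> (\<forall>x\<in>hcar H. \<forall>y\<in>hcar H. hinner H (A x) y = hinner H x (B' y))"
  show "B' = B"
  proof (rule op_eqI)
    fix y assume y: "y \<in> hcar H"
    have car: "B' y \<in> hcar H" "B y \<in> hcar H"
      by (rule bounded_opsD(2)[OF conjunct1[OF B'] y], rule bounded_opsD(2)[OF assms(2) y])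
    show "B' y = B y"
    proof (rule eqI[OF car])
      fix w assume w: "w \<in> hcar H"
      have "hinner H w (B' y) = hinner H w (B y)"
        using conjunct2[OF B', rule_format, OF w y] assms(3)[OF w y] by simp
      then show "hinner H (B' y) w = hinner H (B y) w"
        using inner_cnj[OF w car(1)] inner_cnj[OF w car(2)] by simp
    qed
  qed (rule conjunct1[OF B'], rule assms(2))
qed (intro conjI ballI assms)

lemma op_adj_spec:
  assumes A: "A \<in> bounded_ops H"
  shows "op_adj H A \<in> bounded_ops H \<and>
    (\<forall>x\<in>hcar H. \<forall>y\<in>hcar H. hinner H (A x) y = hinner H x (op_adj H A y))"
proof -
  obtain B where B: "B \<in> bounded_ops H"
    and BB: "\<forall>x\<in>hcar H. \<forall>y\<in>hcar H. hinner H (A x) y = hinner H x (B y)"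
    using adjoint_ex[OF A] by (elim bexE)
  have "op_adj H A = B" by (rule op_adjI[OF A B]) (use BB in simp)
  then show ?thesis using B BB by simp
qed

lemma op_adj_bounded: "A \<in> bounded_ops H ==> op_adj H A \<in> bounded_ops H"
  by (rule conjunct1[OF op_adj_spec])

lemma op_adj_inner:
  assumes "A \<in> bounded_ops H" "x \<in> hcar H" "y \<in> hcar H"
  shows "hinner H (A x) y = hinner H x (op_adj H A y)"
  by (rule conjunct2[OF op_adj_spec[OF assms(1)], rule_format, OF assms(2,3)])

lemma op_adj_inner':
  assumes "A \<in> bounded_ops H" "x \<in> hcar H" "y \<in> hcar H"
  shows "hinner H (op_adj H A x) y = hinner H x (A y)"
  using op_adj_inner[OF assms(1,3,2), THEN arg_cong[of _ _ cnj]] assms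
  by (simp add: inner_cnj bounded_opsD(2) op_adj_bounded)

lemma op_adj_comp:
  assumes "A \<in> bounded_ops H" "B \<in> bounded_ops H"
  shows "op_adj H (op_comp H A B) = op_comp H (op_adj H B) (op_adj H A)"
proof (rule op_adjI[OF op_comp_bounded[OF assms] op_comp_bounded])
  show "hinner H (op_comp H A B x) y = hinner H x (op_comp H (op_adj H B) (op_adj H A) y)" if "x \<in> hcar H" "y \<in> hcar H" for x y
    using that assms bounded_opsD(2)[OF assms(1)] bounded_opsD(2)[OF assms(2)]
    by (simp add: op_comp_def op_adj_inner bounded_opsD(2) op_adj_bounded inner_simps)
qed (use assms op_adj_bounded in auto)

lemma op_adj_add:
  assumes "A \<in> bounded_ops H" "B \<in> bounded_ops H"
  shows "op_adj H (op_add H A B) = op_add H (op_adj H A) (op_adj H B)"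
proof (rule op_adjI[OF op_add_bounded[OF assms] op_add_bounded])
  show "hinner H (op_add H A B x) y = hinner H x (op_add H (op_adj H A) (op_adj H B) y)" if "x \<in> hcar H" "y \<in> hcar H" for x y
    using that assms bounded_opsD(2)[OF assms(1)] bounded_opsD(2)[OF assms(2)]
    by (simp add: op_add_def op_adj_inner bounded_opsD(2) op_adj_bounded inner_simps)
qed (use assms op_adj_bounded in auto)

lemma op_adj_scale:
  assumes "A \<in> bounded_ops H"
  shows "op_adj H (op_scale H c A) = op_scale H (cnj c) (op_adj H A)"
proof (rule op_adjI[OF op_scale_bounded[OF assms] op_scale_bounded])
  show "hinner H (op_scale H c A x) y = hinner H x (op_scale H (cnj c) (op_adj H A) y)" if "x \<in> hcar H" "y \<in> hcar H" for x y
    using that assms bounded_opsD(2)[OF assms(1)]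
    by (simp add: op_scale_def op_adj_inner bounded_opsD(2) op_adj_bounded inner_simps)
qed (use assms op_adj_bounded in auto)

lemma unitary_adj:
  assumes U: "U \<in> bounded_ops H" "hunitary H H U" and x: "x \<in> hcar H"
  shows "op_adj H U (U x) = x" "U (op_adj H U x) = x"
proof -
  have iso: "hinner H (U x) (U y) = hinner H x y" if "x \<in> hcar H" "y \<in> hcar H" for x y
    using U(2) that by (auto simp: hunitary_def)
  have left: "op_adj H U (U x) = x" if "x \<in> hcar H" for x
  proof (rule eqI)
    fix w assume "w \<in> hcar H"
    then show "hinner H (op_adj H U (U x)) w = hinner H x w"
      using that U(1) by (simp add: op_adj_inner' bounded_opsD iso)
  qed (use that U(1) op_adj_bounded in \<open>auto simp: bounded_opsD\<close>)
  then show "op_adj H U (U x) = x" using x .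
  obtain y where "y \<in> hcar H" "x = U y"
    using U(2) x unfolding hunitary_def by (metis imageE)
  then show "U (op_adj H U x) = x" using left by simp
qed

subsection \<open>Orthonormal bases\<close>

text \<open>Zorn's lemma. A nonzero vector orthogonal to a maximal orthonormal set could be
  normalized and adjoined.\<close>

lemma orthonormal_basis_ex: "\<exists>E. orthonormal_basis H E"
proof -
  let ?O = "{E. E \<subseteq> hcar H \<and> (\<forall>e\<in>E. \<forall>f\<in>E. hinner H e f = (if e = f then 1 else 0))}"
  have "\<exists>M\<in>?O. \<forall>X\<in>?O. M \<subseteq> X \<longrightarrow> X = M"
  proof (rule subset_Zorn')
    fix C assume C: "subset.chain ?O C"
    show "\<Union>C \<in> ?O"
    proof (intro CollectI conjI ballI)
      show "\<Union>C \<subseteq> hcar H" using C by (auto simp: subset_chain_def)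
      fix e f assume "e \<in> \<Union>C" "f \<in> \<Union>C"
      then obtain X Y where XY: "X \<in> C" "e \<in> X" "Y \<in> C" "f \<in> Y" by blast
      then have "X \<subseteq> Y \<or> Y \<subseteq> X" using C by (auto simp: subset_chain_def)
      moreover have "X \<in> ?O" "Y \<in> ?O" using C XY by (auto simp: subset_chain_def)
      ultimately show "hinner H e f = (if e = f then 1 else 0)" using XY by blast
    qed
  qed
  then obtain E where E: "E \<in> ?O" and max': "\<forall>X\<in>?O. E \<subseteq> X \<longrightarrow> X = E"
    by (elim bexE)
  have "x = hzero H" if x: "x \<in> hcar H" "\<forall>e\<in>E. hinner H x e = 0" for x
  proof (rule ccontr)
    assume "x \<noteq> hzero H"
    then have n: "hnorm H x > 0" using norm_eq_0[OF x(1)] norm_nonneg[OF x(1)] by linarith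
    let ?u = "hscale H (1 / complex_of_real (hnorm H x)) x"
    have u: "?u \<in> hcar H" using x by simp
    have uu: "hinner H ?u ?u = 1"
      using x n by (simp add: inner_scale_left inner_scale_right inner_self[OF x(1)] power2_eq_square)
    have ue: "hinner H ?u e = 0" "hinner H e ?u = 0" if "e \<in> E" for e
    proof -
      have e: "e \<in> hcar H" using E that by auto
      show "hinner H ?u e = 0" using x that e by (simp add: inner_simps)
      then show "hinner H e ?u = 0" using inner_cnj[OF u e] by simp
    qed
    have "insert ?u E \<in> ?O" using E u uu ue by auto
    from bspec[OF max' this] have "insert ?u E = E" by (rule mp) (rule subset_insertI)
    then have "?u \<in> E" by (rule subst) (rule insertI1)
    from ue(1)[OF this] show False using uu by simp
  qed
  then have "orthonormal_basis H E" using E unfolding orthonormal_basis_def by blast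
  then show ?thesis by (rule exI)
qed

lemma orthonormal_basis_some: "orthonormal_basis H (SOME E. orthonormal_basis H E)"
  by (rule someI_ex[OF orthonormal_basis_ex])

lemma orthonormal_basis_total: "orthonormal_basis H E ==> htotal H E"
  by (auto simp: orthonormal_basis_def htotal_def)

text \<open>Locates the finite part of the basis on which a given vector of the span depends,
  without writing the vector as a finite sum. Partial sums in \<open>parseval\<close> are compared
  from this finite set on.\<close>

lemma hspan_finite_support:
  assumes "u \<in> hspan H E" "E \<subseteq> hcar H"
  shows "\<exists>F. finite F \<and> F \<subseteq> E \<and> (\<forall>z\<in>hcar H. (\<forall>e\<in>F. hinner H e z = 0) \<longrightarrow> hinner H u z = 0)"
  using assms(1)
proof induction
  case zero then show ?case by (intro exI[of _ "{}"]) auto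
next
  case (base s) then show ?case by (intro exI[of _ "{s}"]) auto
next
  case (add x y)
  then obtain F G where "finite F" "F \<subseteq> E" "\<forall>z\<in>hcar H. (\<forall>e\<in>F. hinner H e z = 0) \<longrightarrow> hinner H x z = 0"
    "finite G" "G \<subseteq> E" "\<forall>z\<in>hcar H. (\<forall>e\<in>G. hinner H e z = 0) \<longrightarrow> hinner H y z = 0" by auto
  then show ?case
    using add.hyps hspan_car[OF _ assms(2)] by (intro exI[of _ "F \<union> G"]) (auto simp: inner_simps)
next
  case (scale x c)
  then obtain F where "finite F" "F \<subseteq> E" "\<forall>z\<in>hcar H. (\<forall>e\<in>F. hinner H e z = 0) \<longrightarrow> hinner H x z = 0"
    by auto
  then show ?case
    using scale.hyps hspan_car[OF _ assms(2)] by (intro exI[of _ F]) (auto simp: inner_simps)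
qed

text \<open>Best approximation. Let u in the span approximate x and let p be the partial sum over a
  finite F that contains the support of u. Then r = x - p is orthogonal to both u and p, so <r,r> =
  <x - u, r>, and r is no longer than x - u.\<close>

theorem parseval:
  assumes E: "orthonormal_basis H E" and x: "x \<in> hcar H" and y: "y \<in> hcar H"
  shows "((\<lambda>e. hinner H x e * hinner H e y) has_sum hinner H x y) E"
proof -
  have Ec: "E \<subseteq> hcar H" and on: "\<And>e f. e \<in> E ==> f \<in> E ==> hinner H e f = (if e = f then 1 else 0)"
    using E by (auto simp: orthonormal_basis_def)
  have key: "\<exists>F0. finite F0 \<and> F0 \<subseteq> E \<and> (\<forall>F. finite F \<and> F0 \<subseteq> F \<and> F \<subseteq> E \<longrightarrow>
      cmod ((\<Sum>e\<in>F. hinner H x e * hinner H e y) - hinner H x y) \<le> d * hnorm H y)" if "d > 0" for d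
  proof -
    obtain u where u: "u \<in> hspan H E" "hdist H x u < d"
      using total_dense[OF orthonormal_basis_total[OF E] x \<open>d > 0\<close>] by blast
    obtain F0 where F0: "finite F0" "F0 \<subseteq> E"
      "\<And>z. z \<in> hcar H ==> (\<forall>e\<in>F0. hinner H e z = 0) ==> hinner H u z = 0"
      using hspan_finite_support[OF u(1) Ec] by blast
    have uc: "u \<in> hcar H" by (rule hspan_car[OF u(1) Ec])
    have "cmod ((\<Sum>e\<in>F. hinner H x e * hinner H e y) - hinner H x y) \<le> d * hnorm H y"
      if F: "finite F" "F0 \<subseteq> F" "F \<subseteq> E" for F
    proof -
      obtain p where p: "p \<in> hcar H" "\<And>z. z \<in> hcar H ==> hinner H p z = (\<Sum>e\<in>F. hinner H x e * hinner H e z)"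
        using lincomb_ex[of F "\<lambda>e. e" "\<lambda>e. hinner H x e"] F Ec by blast
      let ?r = "hdiff H x p"
      have r: "?r \<in> hcar H" using x p(1) by simp
      have er: "hinner H e ?r = 0" if e: "e \<in> F" for e
      proof -
        have ec: "e \<in> hcar H" using e F Ec by auto
        have "hinner H p e = (\<Sum>f\<in>F. if f = e then hinner H x f else 0)"
          unfolding p(2)[OF ec]
        proof (intro sum.cong refl)
          fix f assume "f \<in> F"
          then have "hinner H f e = (if f = e then 1 else 0)" using F(3) e by (intro on) auto
          then show "hinner H x f * hinner H f e = (if f = e then hinner H x f else 0)" by simp
        qed
        also have "... = hinner H x e" using F(1) e by simp
        finally have "hinner H ?r e = 0" using x p(1) ec by (simp add: inner_simps)
        then show ?thesis using inner_cnj[OF r ec] by simp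
      qed
      have "hinner H u ?r = 0" using F0(3)[OF r] er F(2) by blast
      moreover have "hinner H p ?r = 0" using p(2)[OF r] er by simp
      ultimately have "hinner H ?r ?r = hinner H (hdiff H x u) ?r"
        using x uc p(1) by (simp add: inner_diff_left)
      then have "(hnorm H ?r)\<^sup>2 \<le> hdist H x u * hnorm H ?r"
        using cauchy_schwarz[of "hdiff H x u" ?r] x uc r complex_Re_le_cmod[of "hinner H (hdiff H x u) ?r"]
        by (simp add: norm_sq hdist_hdiff)
      then have "hnorm H ?r \<le> hdist H x u"
        using norm_nonneg[OF r] dist_nonneg[OF x uc]
        by (cases "hnorm H ?r = 0") (auto simp: power2_eq_square)
      then have le: "hnorm H ?r \<le> d" using u(2) by simp
      have "(\<Sum>e\<in>F. hinner H x e * hinner H e y) - hinner H x y = - hinner H ?r y"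
        using p y x by (simp add: inner_simps)
      then have "cmod ((\<Sum>e\<in>F. hinner H x e * hinner H e y) - hinner H x y) \<le> hnorm H ?r * hnorm H y"
        using cauchy_schwarz[OF r y] by simp
      also have "... \<le> d * hnorm H y" by (rule mult_right_mono[OF le]) (use y in simp)
      finally show ?thesis .
    qed
    then show ?thesis using F0 by blast
  qed
  show ?thesis
    unfolding has_sum_def
  proof (rule tendstoI)
    fix r :: real assume "r > 0"
    \<comment> \<open>The summand 1 keeps the denominator positive for y = 0; the half makes the
      final inequality strict.\<close>
    define d where "d = (r / 2) / (hnorm H y + 1)"
    have y1: "hnorm H y + 1 > 0" using norm_nonneg[OF y] by linarith
    have d: "d > 0" using \<open>r > 0\<close> y1 by (simp add: d_def)
    have "d * hnorm H y \<le> d * (hnorm H y + 1)" using d by simp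
    also have "... = r / 2"
      by (subst nonzero_eq_divide_eq[symmetric]) (use y1 d_def in auto)
    also have "... < r" using \<open>r > 0\<close> by simp
    finally have dr: "d * hnorm H y < r" .
    obtain F0 where "finite F0" "F0 \<subseteq> E" "\<forall>F. finite F \<and> F0 \<subseteq> F \<and> F \<subseteq> E \<longrightarrow>
      cmod ((\<Sum>e\<in>F. hinner H x e * hinner H e y) - hinner H x y) \<le> d * hnorm H y"
      using key[OF d] by blast
    then show "\<forall>\<^sub>F F in finite_subsets_at_top E. dist (\<Sum>e\<in>F. hinner H x e * hinner H e y) (hinner H x y) < r"
      unfolding eventually_finite_subsets_at_top dist_norm
      using dr by (intro exI[of _ F0]) (auto intro: le_less_trans)
  qed
qed

text \<open>The sum in the form in which inner products over \<open>count_space E\<close> are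
  computed. Unconditional summability of complex families is absolute, hence integrability.\<close>

lemma parseval_integral:
  assumes E: "orthonormal_basis H E" and x: "x \<in> hcar H" and y: "y \<in> hcar H"
  shows "integrable (count_space E) (\<lambda>e. hinner H x e * hinner H e y)"
    "(\<integral>e. hinner H x e * hinner H e y \<partial>count_space E) = hinner H x y"
proof -
  note P = parseval[OF assms]
  have abs: "Infinite_Sum.abs_summable_on (\<lambda>e. hinner H x e * hinner H e y) E"
    by (rule summable_on_iff_abs_summable_on_complex[THEN iffD1, OF has_sum_imp_summable[OF P]])
  then have "Infinite_Set_Sum.abs_summable_on (\<lambda>e. hinner H x e * hinner H e y) E"
    by (rule abs_summable_equivalent[THEN iffD1])
  then show "integrable (count_space E) (\<lambda>e. hinner H x e * hinner H e y)"
    by (simp add: Infinite_Set_Sum.abs_summable_on_def)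
  have "(\<integral>e. hinner H x e * hinner H e y \<partial>count_space E) = infsetsum (\<lambda>e. hinner H x e * hinner H e y) E"
    by (simp add: infsetsum_def)
  also have "... = infsum (\<lambda>e. hinner H x e * hinner H e y) E"
    by (rule infsetsum_infsum[OF abs_summable_equivalent[THEN iffD1, OF abs]])
  also have "... = hinner H x y" using P by (rule infsumI)
  finally show "(\<integral>e. hinner H x e * hinner H e y \<partial>count_space E) = hinner H x y" .
qed

lemma inner_mult_self:
  assumes "x \<in> hcar H" "e \<in> hcar H"
  shows "hinner H x e * hinner H e x = complex_of_real ((cmod (hinner H x e))\<^sup>2)"
  by (simp only: complex_norm_square inner_cnj[OF assms])

lemma parseval_nn:
  assumes E: "orthonormal_basis H E" and x: "x \<in> hcar H"
  shows "(\<integral>\<^sup>+e. ennreal ((cmod (hinner H x e))\<^sup>2) \<partial>count_space E) = ennreal ((hnorm H x)\<^sup>2)"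
proof -
  have Ec: "E \<subseteq> hcar H" using E by (auto simp: orthonormal_basis_def)
  have eq: "hinner H x e * hinner H e x = complex_of_real ((cmod (hinner H x e))\<^sup>2)" if "e \<in> E" for e
    using inner_mult_self x Ec that by blast
  note P = parseval_integral[OF E x x]
  have int: "integrable (count_space E) (\<lambda>e. (cmod (hinner H x e))\<^sup>2)"
    using integrable_Re[OF P(1)] by (rule Bochner_Integration.integrable_cong[THEN iffD1, rotated -1])
      (simp_all add: eq)
  have "(\<integral>e. (cmod (hinner H x e))\<^sup>2 \<partial>count_space E) = Re (\<integral>e. hinner H x e * hinner H e x \<partial>count_space E)"
    unfolding integral_Re[OF P(1), symmetric] by (intro Bochner_Integration.integral_cong) (simp_all add: eq)
  also have "... = (hnorm H x)\<^sup>2" using P(2) x by (simp add: norm_sq)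
  finally show ?thesis
    using nn_integral_eq_integral[OF int] by simp
qed

text \<open>Each vector of D has nonzero coefficients at countably many basis vectors only, and
  totality of D leaves no basis vector without a nonzero coefficient. Countability makes sums over
  the basis accessible to Fubini.\<close>

lemma orthonormal_basis_countable:
  assumes E: "orthonormal_basis H E" and D: "htotal H D" "countable D"
  shows "countable E"
proof -
  have Ec: "E \<subseteq> hcar H" and on: "\<And>e. e \<in> E ==> hinner H e e = 1"
    using E by (auto simp: orthonormal_basis_def)
  have Dc: "D \<subseteq> hcar H" using D by (auto simp: htotal_def)
  have "countable {e \<in> E. hinner H d e * hinner H e d \<noteq> 0}" if "d \<in> D" for d
    using parseval[OF E, of d d] that Dc
    by (intro summable_countable_complex) (auto simp: summable_on_def)
  then have "countable (\<Union>d\<in>D. {e \<in> E. hinner H d e * hinner H e d \<noteq> 0})"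
    using D(2) by auto
  moreover have "E \<subseteq> (\<Union>d\<in>D. {e \<in> E. hinner H d e * hinner H e d \<noteq> 0})"
  proof
    fix e assume e: "e \<in> E"
    then have ec: "e \<in> hcar H" using Ec by auto
    have "\<exists>d\<in>D. hinner H e d \<noteq> 0"
      using D(1) ec on[OF e] unfolding htotal_def by (metis inner_zero_left zero_neq_one)
    then obtain d where d: "d \<in> D" "hinner H e d \<noteq> 0" by blast
    then have "hinner H d e \<noteq> 0" using inner_cnj[OF ec, of d] Dc by auto
    then show "e \<in> (\<Union>d\<in>D. {e \<in> E. hinner H d e * hinner H e d \<noteq> 0})" using d e by auto
  qed
  ultimately show ?thesis by (rule countable_subset[rotated])
qed

text \<open>A basis enumerated as a sequence, padded with the zero vector outside the indices in use
  so that finite bases need no separate treatment.\<close>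

lemma inner_series:
  assumes D: "htotal H D" "countable D"
  obtains e :: "nat => 'a" where "\<And>n. e n \<in> hcar H"
    "\<And>x y. x \<in> hcar H ==> y \<in> hcar H ==> (\<lambda>n. \<Sum>k<n. hinner H x (e k) * hinner H (e k) y) \<longlonglongrightarrow> hinner H x y"
proof -
  obtain E where E: "orthonormal_basis H E" using orthonormal_basis_ex by blast
  have Ec: "E \<subseteq> hcar H" using E by (auto simp: orthonormal_basis_def)
  have cE: "countable E" by (rule orthonormal_basis_countable[OF E D])
  define N where "N = to_nat_on E ` E"
  define e where "e n = (if n \<in> N then from_nat_into E n else hzero H)" for n
  have bij: "bij_betw (to_nat_on E) E N"
    unfolding N_def using cE by (simp add: inj_on_imp_bij_betw inj_on_to_nat_on)
  have e_to: "e (to_nat_on E f) = f" if "f \<in> E" for f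
    using that cE by (simp add: e_def N_def)
  have car: "e n \<in> hcar H" for n
    using Ec cE by (auto simp: e_def N_def)
  have "(\<lambda>n. \<Sum>k<n. hinner H x (e k) * hinner H (e k) y) \<longlonglongrightarrow> hinner H x y"
    if xy: "x \<in> hcar H" "y \<in> hcar H" for x y
  proof -
    have "((\<lambda>f. hinner H x (e (to_nat_on E f)) * hinner H (e (to_nat_on E f)) y) has_sum hinner H x y) E"
      using parseval[OF E xy] by (subst has_sum_cong[where g = "\<lambda>f. hinner H x f * hinner H f y"]) (auto simp: e_to)
    then have "((\<lambda>k. hinner H x (e k) * hinner H (e k) y) has_sum hinner H x y) N"
      using has_sum_reindex_bij_betw[OF bij, of "\<lambda>k. hinner H x (e k) * hinner H (e k) y"] by simp
    then have "((\<lambda>k. hinner H x (e k) * hinner H (e k) y) has_sum hinner H x y) UNIV"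
      by (rule has_sum_cong_neutral[THEN iffD1, rotated -1]) (use xy in \<open>auto simp: e_def\<close>)
    then show ?thesis using has_sum_imp_sums sums_def by blast
  qed
  then show ?thesis using that car by blast
qed

end

subsection \<open>Tensor products\<close>

text \<open>Schur product theorem by induction on the index set. A Gram-Schmidt step splits the
  first Gram matrix into one whose row and column at n vanish and a rank one part a i * cnj (a j).
  The induction hypothesis handles the former, and the latter contributes <v,v>, where v has the
  inner products of the sum of the a i y i.\<close>

lemma gram_product_nonneg:
  assumes "semi_inner_space H" "semi_inner_space K" "finite F"
    "\<And>i. i \<in> F ==> x i \<in> hcar H" "\<And>i. i \<in> F ==> y i \<in> hcar K"
  shows "0 \<le> Re (\<Sum>i\<in>F. \<Sum>j\<in>F. hinner H (x i) (x j) * hinner K (y i) (y j))"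
  using assms(3-5)
proof (induction F arbitrary: x rule: finite_induct)
  case (insert n F)
  interpret H: semi_inner_space H by fact
  interpret K: semi_inner_space K by fact
  have y: "\<And>i. i \<in> insert n F ==> y i \<in> hcar K" and x: "\<And>i. i \<in> insert n F ==> x i \<in> hcar H"
    using insert.prems by auto
  have "\<exists>x' a. (\<forall>i\<in>insert n F. x' i \<in> hcar H) \<and> hnorm H (x' n) = 0 \<and>
      (\<forall>i\<in>insert n F. \<forall>j\<in>insert n F. hinner H (x i) (x j) = hinner H (x' i) (x' j) + a i * cnj (a j))"
  proof (cases "hnorm H (x n) = 0")
    case True
    then show ?thesis using x by (intro exI[of _ x] exI[of _ "\<lambda>_. 0"]) auto
  next
    case False
    let ?u = "hscale H (1 / complex_of_real (hnorm H (x n))) (x n)"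
    have xn: "x n \<in> hcar H" and u: "?u \<in> hcar H" using x by auto
    have uu: "hinner H ?u ?u = 1"
      using xn False by (simp add: H.inner_scale_left H.inner_scale_right H.inner_self[OF xn] power2_eq_square)
    define a where "a i = hinner H (x i) ?u" for i
    define x' where "x' i = hdiff H (x i) (hscale H (a i) ?u)" for i
    have ua: "hinner H ?u (x i) = cnj (a i)" if "i \<in> insert n F" for i
      unfolding a_def by (rule H.inner_cnj[OF x[OF that] u, symmetric])
    have car: "x' i \<in> hcar H" if "i \<in> insert n F" for i
      unfolding x'_def using x[OF that] u by simp
    have eq: "hinner H (x' i) (x' j) = hinner H (x i) (x j) - a i * cnj (a j)"
      if ij: "i \<in> insert n F" "j \<in> insert n F" for i j
    proof -
      have "hinner H (x' i) (x' j) = hinner H (x i) (x j) - cnj (a j) * hinner H (x i) ?u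
          - a i * (hinner H ?u (x j) - cnj (a j) * hinner H ?u ?u)"
        unfolding x'_def
        by (simp only: H.inner_diff_left H.inner_diff_right H.inner_scale_left[OF u] H.inner_scale_right[OF _ u]
            x[OF ij(1)] x[OF ij(2)] u H.scale_car[OF u] H.diff_car)
          (simp add: algebra_simps)
      then show ?thesis by (simp add: uu ua[OF ij(2)] a_def[symmetric])
    qed
    have "a n = complex_of_real (hnorm H (x n))"
      using xn False by (simp add: a_def H.inner_scale_right H.inner_self[OF xn] power2_eq_square)
    then have "hinner H (x' n) (x' n) = 0"
      by (simp add: eq H.inner_self[OF xn] power2_eq_square)
    then have "hnorm H (x' n) = 0" by (simp add: hnorm_def)
    then show ?thesis
      using car eq by (intro exI[of _ x'] exI[of _ a]) simp
  qed
  then obtain x' a where ex: "(\<forall>i\<in>insert n F. x' i \<in> hcar H) \<and> hnorm H (x' n) = 0 \<and>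
      (\<forall>i\<in>insert n F. \<forall>j\<in>insert n F. hinner H (x i) (x j) = hinner H (x' i) (x' j) + a i * cnj (a j))"
    by (elim exE)
  have x': "\<And>i. i \<in> insert n F ==> x' i \<in> hcar H" "hnorm H (x' n) = 0"
    using ex by blast+
  have split: "\<And>i j. i \<in> insert n F ==> j \<in> insert n F ==>
      hinner H (x i) (x j) = hinner H (x' i) (x' j) + a i * cnj (a j)"
    using ex by blast
  have x'n: "hinner H (x' n) (x' j) = 0" "hinner H (x' j) (x' n) = 0" if "j \<in> insert n F" for j
    using H.cauchy_schwarz[OF x'(1) x'(1), of n j] H.cauchy_schwarz[OF x'(1) x'(1), of j n] x'(2) that
    by auto
  obtain v where v: "v \<in> hcar K" "\<And>z. z \<in> hcar K ==> hinner K v z = (\<Sum>i\<in>insert n F. a i * hinner K (y i) z)"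
    using K.lincomb_ex[of "insert n F" y a] insert.hyps(1) y by blast
  have "hinner K v v = (\<Sum>i\<in>insert n F. \<Sum>j\<in>insert n F. a i * cnj (a j) * hinner K (y i) (y j))"
  proof -
    have "hinner K v v = (\<Sum>i\<in>insert n F. a i * hinner K (y i) v)" by (rule v(2)[OF v(1)])
    also have "... = (\<Sum>i\<in>insert n F. a i * cnj (hinner K v (y i)))"
      using K.inner_cnj[OF v(1) y] by (intro sum.cong refl) simp
    also have "... = (\<Sum>i\<in>insert n F. a i * cnj (\<Sum>j\<in>insert n F. a j * hinner K (y j) (y i)))"
      using v(2)[OF y] by (intro sum.cong refl) simp
    also have "... = (\<Sum>i\<in>insert n F. \<Sum>j\<in>insert n F. a i * (cnj (a j) * hinner K (y i) (y j)))"
      unfolding cnj_sum complex_cnj_mult sum_distrib_left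
      using K.inner_cnj[OF y y] by (intro sum.cong refl) simp
    finally show ?thesis by (simp only: mult.assoc)
  qed
  then have "(\<Sum>i\<in>insert n F. \<Sum>j\<in>insert n F. hinner H (x i) (x j) * hinner K (y i) (y j))
      = (\<Sum>i\<in>insert n F. \<Sum>j\<in>insert n F. hinner H (x' i) (x' j) * hinner K (y i) (y j)) + hinner K v v"
    by (simp only: sum.distrib[symmetric])
      (intro sum.cong refl, simp add: split algebra_simps)
  also have "(\<Sum>i\<in>insert n F. \<Sum>j\<in>insert n F. hinner H (x' i) (x' j) * hinner K (y i) (y j))
      = (\<Sum>i\<in>F. \<Sum>j\<in>F. hinner H (x' i) (x' j) * hinner K (y i) (y j))"
    using insert.hyps by (simp add: x'n)
  finally show ?case
    using insert.IH[of x'] x'(1) y K.inner_pos[OF v(1)] by simp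
qed simp

section \<open>The tensor product form and elementary tensors\<close>

context
  fixes H :: "'a hspace" and K :: "'b hspace"
  assumes H: "semi_inner_space H" and K: "semi_inner_space K"
begin

interpretation H: semi_inner_space H by (rule H)
interpretation K: semi_inner_space K by (rule K)

text \<open>Summation over any finite superset of the supports. This is needed because supports may
  shrink when formal tensors are added.\<close>

lemma formal_inner:
  assumes "finite A" "{p. c p \<noteq> 0} \<subseteq> A" "finite B" "{p. d p \<noteq> 0} \<subseteq> B"
  shows "hinner (formal_tensors H K) c d =
    (\<Sum>p\<in>A. \<Sum>q\<in>B. c p * cnj (d q) * (hinner H (fst p) (fst q) * hinner K (snd p) (snd q)))"
proof -
  have "(\<Sum>p\<in>A. \<Sum>q\<in>B. c p * cnj (d q) * (hinner H (fst p) (fst q) * hinner K (snd p) (snd q))) =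
     (\<Sum>p | c p \<noteq> 0. \<Sum>q\<in>B. c p * cnj (d q) * (hinner H (fst p) (fst q) * hinner K (snd p) (snd q)))"
    using assms by (intro sum.mono_neutral_right) auto
  also have "... = (\<Sum>p | c p \<noteq> 0. \<Sum>q | d q \<noteq> 0. c p * cnj (d q) * (hinner H (fst p) (fst q) * hinner K (snd p) (snd q)))"
    using assms by (intro sum.cong refl sum.mono_neutral_right) auto
  finally show ?thesis by (simp add: formal_tensors_def)
qed

lemma formal_simps:
  "hzero (formal_tensors H K) = (\<lambda>_. 0)"
  "hadd (formal_tensors H K) c d = (\<lambda>p. c p + d p)"
  "hscale (formal_tensors H K) a c = (\<lambda>p. a * c p)"
  "c \<in> hcar (formal_tensors H K) \<longleftrightarrow> finite {p. c p \<noteq> 0} \<and> {p. c p \<noteq> 0} \<subseteq> hcar H \<times> hcar K"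
  by (simp_all add: formal_tensors_def)

lemma semi_inner_space_formal: "semi_inner_space (formal_tensors H K)"
proof
  let ?T = "formal_tensors H K"
  let ?g = "\<lambda>p q. hinner H (fst p) (fst q) * hinner K (snd p) (snd q)"
  show "hzero ?T \<in> hcar ?T" by (simp add: formal_simps)
  show "hadd ?T c d \<in> hcar ?T" if "c \<in> hcar ?T" "d \<in> hcar ?T" for c d
  proof -
    have "{p. c p + d p \<noteq> 0} \<subseteq> {p. c p \<noteq> 0} \<union> {p. d p \<noteq> 0}" by auto
    then show ?thesis using that finite_subset unfolding formal_simps
      by (metis (no_types, lifting) finite_UnI le_sup_iff order_trans)
  qed
  show "hscale ?T a c \<in> hcar ?T" if "c \<in> hcar ?T" for a c
  proof -
    have "{p. a * c p \<noteq> 0} \<subseteq> {p. c p \<noteq> 0}" by auto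
    then show ?thesis using that finite_subset unfolding formal_simps by (metis (no_types, lifting) order_trans)
  qed
  show "hinner ?T (hzero ?T) c = 0" if "c \<in> hcar ?T" for c
    using formal_inner[of "{}" "\<lambda>_. 0" "{p. c p \<noteq> 0}" c] that by (simp add: formal_simps)
  show "hinner ?T (hadd ?T c c') d = hinner ?T c d + hinner ?T c' d"
    if "c \<in> hcar ?T" "c' \<in> hcar ?T" "d \<in> hcar ?T" for c c' d
  proof -
    let ?A = "{p. c p \<noteq> 0} \<union> {p. c' p \<noteq> 0}" and ?B = "{p. d p \<noteq> 0}"
    have fin: "finite ?A" "finite ?B" using that by (auto simp: formal_simps)
    have sub: "{p. c p + c' p \<noteq> 0} \<subseteq> ?A" by auto
    show ?thesis
      unfolding formal_simps formal_inner[OF fin(1) sub fin(2) order_refl]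
        formal_inner[OF fin(1) Un_upper1 fin(2) order_refl] formal_inner[OF fin(1) Un_upper2 fin(2) order_refl]
      by (simp only: sum.distrib[symmetric] distrib_right)
  qed
  show "hinner ?T (hscale ?T a c) d = a * hinner ?T c d" if "c \<in> hcar ?T" "d \<in> hcar ?T" for a c d
  proof -
    let ?A = "{p. c p \<noteq> 0}" and ?B = "{p. d p \<noteq> 0}"
    have fin: "finite ?A" "finite ?B" using that by (auto simp: formal_simps)
    have sub: "{p. a * c p \<noteq> 0} \<subseteq> ?A" by auto
    show ?thesis
      unfolding formal_simps formal_inner[OF fin(1) sub fin(2) order_refl]
        formal_inner[OF fin(1) order_refl fin(2) order_refl]
      by (simp only: sum_distrib_left mult.assoc)
  qed
  show "cnj (hinner ?T c d) = hinner ?T d c" if cd: "c \<in> hcar ?T" "d \<in> hcar ?T" for c d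
  proof -
    let ?A = "{p. c p \<noteq> 0}" and ?B = "{p. d p \<noteq> 0}"
    have fin: "finite ?A" "finite ?B" and sub: "?A \<subseteq> hcar H \<times> hcar K" "?B \<subseteq> hcar H \<times> hcar K"
      using cd by (auto simp: formal_simps)
    have "cnj (c p * cnj (d q) * ?g p q) = d q * cnj (c p) * ?g q p" if "p \<in> ?A" "q \<in> ?B" for p q
    proof -
      have "fst p \<in> hcar H" "snd p \<in> hcar K" "fst q \<in> hcar H" "snd q \<in> hcar K"
        using that sub by (auto simp: mem_Times_iff)
      then show ?thesis by (simp add: H.inner_cnj K.inner_cnj)
    qed
    then have "cnj (hinner ?T c d) = (\<Sum>p\<in>?A. \<Sum>q\<in>?B. d q * cnj (c p) * ?g q p)"
      unfolding formal_inner[OF fin(1) order_refl fin(2) order_refl] cnj_sum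
      by (intro sum.cong refl) blast
    also have "... = hinner ?T d c"
      unfolding formal_inner[OF fin(2) order_refl fin(1) order_refl] by (rule sum.swap)
    finally show ?thesis .
  qed
  show "0 \<le> Re (hinner ?T c c)" if "c \<in> hcar ?T" for c
  proof -
    let ?A = "{p. c p \<noteq> 0}"
    have fin: "finite ?A" and sub: "\<And>p. p \<in> ?A ==> fst p \<in> hcar H" "\<And>p. p \<in> ?A ==> snd p \<in> hcar K"
      using that by (auto simp: formal_simps)
    have "hinner ?T c c = (\<Sum>p\<in>?A. \<Sum>q\<in>?A. hinner H (hscale H (c p) (fst p)) (hscale H (c q) (fst q)) * hinner K (snd p) (snd q))"
      unfolding formal_inner[OF fin order_refl fin order_refl]
      by (intro sum.cong refl) (simp only: H.inner_scale_left H.inner_scale_right H.scale_car sub mult_ac)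
    then show ?thesis
      using gram_product_nonneg[OF H K fin, of "\<lambda>p. hscale H (c p) (fst p)" snd] sub by simp
  qed
qed

interpretation T: semi_inner_space "formal_tensors H K" by (rule semi_inner_space_formal)

lemma hilbert_htensor: "hilbert (htensor H K)"
  unfolding htensor_def by (rule T.hilbert_completion)

interpretation HT: hilbert "htensor H K" by (rule hilbert_htensor)

abbreviation delta :: "'a => 'b => 'a \<times> 'b => complex" where
  "delta x y \<equiv> (\<lambda>p. if p = (x, y) then 1 else 0)"

lemma delta_car: "x \<in> hcar H ==> y \<in> hcar K ==> delta x y \<in> hcar (formal_tensors H K)"
  by (auto simp: formal_simps)

lemma elem_tensor_car: "x \<in> hcar H ==> y \<in> hcar K ==> elem_tensor H K x y \<in> hcar (htensor H K)"
  unfolding elem_tensor_def htensor_def by (rule T.hembed_car[OF delta_car])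

lemma elem_tensor_inner:
  assumes "x \<in> hcar H" "y \<in> hcar K" "x' \<in> hcar H" "y' \<in> hcar K"
  shows "hinner (htensor H K) (elem_tensor H K x y) (elem_tensor H K x' y') = hinner H x x' * hinner K y y'"
  unfolding elem_tensor_def htensor_def T.hembed_inner[OF delta_car[OF assms(1,2)] delta_car[OF assms(3,4)]]
  by (subst formal_inner[of "{(x, y)}" _ "{(x', y')}"]) auto

text \<open>As formal tensors the two sides differ in general; their difference is a null vector,
  which the completion identifies with zero.\<close>

lemma elem_tensor_add_left:
  assumes "x \<in> hcar H" "x' \<in> hcar H" "y \<in> hcar K"
  shows "elem_tensor H K (hadd H x x') y = hadd (htensor H K) (elem_tensor H K x y) (elem_tensor H K x' y)"
proof (rule HT.dist_eq_0)
  have "hinner (htensor H K) (hdiff (htensor H K) (elem_tensor H K (hadd H x x') y) (hadd (htensor H K) (elem_tensor H K x y) (elem_tensor H K x' y)))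
     (hdiff (htensor H K) (elem_tensor H K (hadd H x x') y) (hadd (htensor H K) (elem_tensor H K x y) (elem_tensor H K x' y))) = 0"
    using assms by (simp add: HT.inner_simps elem_tensor_car elem_tensor_inner H.inner_simps algebra_simps)
  then show "hdist (htensor H K) (elem_tensor H K (hadd H x x') y) (hadd (htensor H K) (elem_tensor H K x y) (elem_tensor H K x' y)) = 0"
    by (simp add: hdist_hdiff hnorm_def)
qed (use assms elem_tensor_car in auto)

lemma elem_tensor_add_right:
  assumes "x \<in> hcar H" "y \<in> hcar K" "y' \<in> hcar K"
  shows "elem_tensor H K x (hadd K y y') = hadd (htensor H K) (elem_tensor H K x y) (elem_tensor H K x y')"
proof (rule HT.dist_eq_0)
  have "hinner (htensor H K) (hdiff (htensor H K) (elem_tensor H K x (hadd K y y')) (hadd (htensor H K) (elem_tensor H K x y) (elem_tensor H K x y')))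
     (hdiff (htensor H K) (elem_tensor H K x (hadd K y y')) (hadd (htensor H K) (elem_tensor H K x y) (elem_tensor H K x y'))) = 0"
    using assms by (simp add: HT.inner_simps elem_tensor_car elem_tensor_inner K.inner_simps algebra_simps)
  then show "hdist (htensor H K) (elem_tensor H K x (hadd K y y')) (hadd (htensor H K) (elem_tensor H K x y) (elem_tensor H K x y')) = 0"
    by (simp add: hdist_hdiff hnorm_def)
qed (use assms elem_tensor_car in auto)

lemma elem_tensor_scale_left:
  assumes "x \<in> hcar H" "y \<in> hcar K"
  shows "elem_tensor H K (hscale H c x) y = hscale (htensor H K) c (elem_tensor H K x y)"
proof (rule HT.dist_eq_0)
  have "hinner (htensor H K) (hdiff (htensor H K) (elem_tensor H K (hscale H c x) y) (hscale (htensor H K) c (elem_tensor H K x y)))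
     (hdiff (htensor H K) (elem_tensor H K (hscale H c x) y) (hscale (htensor H K) c (elem_tensor H K x y))) = 0"
    using assms by (simp add: HT.inner_simps elem_tensor_car elem_tensor_inner H.inner_simps algebra_simps)
  then show "hdist (htensor H K) (elem_tensor H K (hscale H c x) y) (hscale (htensor H K) c (elem_tensor H K x y)) = 0"
    by (simp add: hdist_hdiff hnorm_def)
qed (use assms elem_tensor_car in auto)

lemma elem_tensor_scale_right:
  assumes "x \<in> hcar H" "y \<in> hcar K"
  shows "elem_tensor H K x (hscale K c y) = hscale (htensor H K) c (elem_tensor H K x y)"
proof (rule HT.dist_eq_0)
  have "hinner (htensor H K) (hdiff (htensor H K) (elem_tensor H K x (hscale K c y)) (hscale (htensor H K) c (elem_tensor H K x y)))
     (hdiff (htensor H K) (elem_tensor H K x (hscale K c y)) (hscale (htensor H K) c (elem_tensor H K x y))) = 0"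
    using assms by (simp add: HT.inner_simps elem_tensor_car elem_tensor_inner K.inner_simps algebra_simps)
  then show "hdist (htensor H K) (elem_tensor H K x (hscale K c y)) (hscale (htensor H K) c (elem_tensor H K x y)) = 0"
    by (simp add: hdist_hdiff hnorm_def)
qed (use assms elem_tensor_car in auto)

lemma elem_tensor_norm:
  assumes "x \<in> hcar H" "y \<in> hcar K"
  shows "hnorm (htensor H K) (elem_tensor H K x y) = hnorm H x * hnorm K y"
proof -
  have "(hnorm (htensor H K) (elem_tensor H K x y))\<^sup>2 = Re (hinner H x x * hinner K y y)"
    by (simp only: HT.norm_sq[OF elem_tensor_car[OF assms]] elem_tensor_inner[OF assms assms])
  also have "... = (hnorm H x * hnorm K y)\<^sup>2"
    unfolding H.inner_self[OF assms(1)] K.inner_self[OF assms(2)] of_real_mult[symmetric] Re_complex_of_real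
    by (simp only: power_mult_distrib)
  finally show ?thesis
    using assms elem_tensor_car[OF assms] by (subst (asm) power2_eq_iff_nonneg) auto
qed

lemma elem_tensor_dist_left:
  assumes "x \<in> hcar H" "x' \<in> hcar H" "y \<in> hcar K"
  shows "hdist (htensor H K) (elem_tensor H K x y) (elem_tensor H K x' y) = hdist H x x' * hnorm K y"
  using assms
  by (simp add: hdist_def elem_tensor_scale_left[symmetric] elem_tensor_add_left[symmetric] elem_tensor_norm)

lemma elem_tensor_dist_right:
  assumes "x \<in> hcar H" "y \<in> hcar K" "y' \<in> hcar K"
  shows "hdist (htensor H K) (elem_tensor H K x y) (elem_tensor H K x y') = hnorm H x * hdist K y y'"
  using assms
  by (simp add: hdist_def elem_tensor_scale_right[symmetric] elem_tensor_add_right[symmetric] elem_tensor_norm)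

lemma hembed_formal_span:
  assumes "c \<in> hcar (formal_tensors H K)"
  shows "hembed (formal_tensors H K) c \<in>
    hspan (htensor H K) ((\<lambda>(x, y). elem_tensor H K x y) ` (hcar H \<times> hcar K))"
proof -
  let ?T = "formal_tensors H K"
  let ?E = "(\<lambda>(x, y). elem_tensor H K x y) ` (hcar H \<times> hcar K)"
  have "hembed ?T c \<in> hspan (htensor H K) ?E" if "finite A" "{p. c p \<noteq> 0} \<subseteq> A" "A \<subseteq> hcar H \<times> hcar K" for A c
    using that
  proof (induction A arbitrary: c rule: finite_induct)
    case empty
    then have "c = hzero ?T" by (auto simp: formal_simps)
    then show ?case using hspan.zero T.hembed_zero by (simp add: htensor_def)
  next
    case (insert p A)
    define c' where "c' = c(p := 0)"
    have c': "{q. c' q \<noteq> 0} \<subseteq> A" using insert.prems(1) by (auto simp: c'_def)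
    have c'_car: "c' \<in> hcar ?T"
      using c' insert.hyps(1) insert.prems(2) finite_subset by (fastforce simp: formal_simps)
    have p: "fst p \<in> hcar H" "snd p \<in> hcar K" using insert.prems(2) by auto
    have d: "delta (fst p) (snd p) \<in> hcar ?T" by (rule delta_car[OF p])
    have "c = hadd ?T c' (hscale ?T (c p) (delta (fst p) (snd p)))"
      by (auto simp: formal_simps c'_def)
    then have "hembed ?T c = hembed ?T (hadd ?T c' (hscale ?T (c p) (delta (fst p) (snd p))))" by simp
    also have "... = hadd (htensor H K) (hembed ?T c') (hscale (htensor H K) (c p) (elem_tensor H K (fst p) (snd p)))"
      unfolding T.hembed_add[OF c'_car T.scale_car[OF d]] T.hembed_scale[OF d] elem_tensor_def htensor_def ..
    also have "... \<in> hspan (htensor H K) ?E"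
    proof (rule hspan.add)
      show "hembed ?T c' \<in> hspan (htensor H K) ?E" using insert.IH[OF c'] insert.prems(2) by simp
      have "elem_tensor H K (fst p) (snd p) \<in> ?E"
        by (rule image_eqI[of _ _ p]) (use p in \<open>auto simp: split_def mem_Times_iff\<close>)
      then show "hscale (htensor H K) (c p) (elem_tensor H K (fst p) (snd p)) \<in> hspan (htensor H K) ?E"
        by (intro hspan.scale hspan.base)
    qed
    finally show ?case .
  qed
  then show ?thesis using assms by (auto simp: formal_simps)
qed

lemma elem_tensor_total: "htotal (htensor H K) ((\<lambda>(x, y). elem_tensor H K x y) ` (hcar H \<times> hcar K))"
  unfolding htotal_def
proof (intro conjI ballI impI)
  let ?E = "(\<lambda>(x, y). elem_tensor H K x y) ` (hcar H \<times> hcar K)"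
  show E: "?E \<subseteq> hcar (htensor H K)" using elem_tensor_car by auto
  fix z assume z: "z \<in> hcar (htensor H K)" "\<forall>s\<in>?E. hinner (htensor H K) z s = 0"
  have z': "hinner (htensor H K) s z = 0" if "s \<in> ?E" for s
    using HT.inner_cnj[OF z(1), of s] z(2) that E by auto
  have "hinner (htensor H K) z (hembed (formal_tensors H K) c) = 0" if "c \<in> hcar (formal_tensors H K)" for c
  proof -
    have "hinner (htensor H K) (hembed (formal_tensors H K) c) z = 0"
      by (rule hspan_inner_zero[OF HT.semi_inner_space_axioms E z(1) z' hembed_formal_span[OF that]])
    then show ?thesis
      using HT.inner_cnj[OF _ z(1), of "hembed (formal_tensors H K) c"] T.hembed_car[OF that]
      by (simp add: htensor_def)
  qed
  then show "z = hzero (htensor H K)"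
    using T.hembed_total z(1) unfolding htotal_def htensor_def by blast
qed

end

text \<open>Orthogonality to z extends in one factor at a time: with the other factor fixed, <x
  \<otimes> y, z> is a bounded functional that vanishes on a total set.\<close>

lemma elem_tensor_total_of_total:
  assumes "hilbert H" "hilbert K" "htotal H A" "htotal K B"
  shows "htotal (htensor H K) ((\<lambda>(x, y). elem_tensor H K x y) ` (A \<times> B))"
proof -
  interpret H: hilbert H by fact
  interpret K: hilbert K by fact
  have s: "semi_inner_space H" "semi_inner_space K" by unfold_locales
  interpret HT: hilbert "htensor H K" by (rule hilbert_htensor[OF s])
  note car = elem_tensor_car[OF s]
  have A: "A \<subseteq> hcar H" and B: "B \<subseteq> hcar K" using assms by (auto simp: htotal_def)
  show ?thesis
    unfolding htotal_def
  proof (intro conjI ballI impI)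
    show "(\<lambda>(x, y). elem_tensor H K x y) ` (A \<times> B) \<subseteq> hcar (htensor H K)" using car A B by auto
    fix z assume z: "z \<in> hcar (htensor H K)"
      "\<forall>s\<in>(\<lambda>(x, y). elem_tensor H K x y) ` (A \<times> B). hinner (htensor H K) z s = 0"
    have z0: "hinner (htensor H K) (elem_tensor H K a b) z = 0" if ab: "a \<in> A" "b \<in> B" for a b
    proof -
      have "hinner (htensor H K) z (elem_tensor H K a b) = 0" using z(2) ab by auto
      moreover have "elem_tensor H K a b \<in> hcar (htensor H K)" using car A B ab by blast
      ultimately show ?thesis using HT.inner_cnj[OF z(1), of "elem_tensor H K a b"] by simp
    qed
    have z1: "hinner (htensor H K) (elem_tensor H K x b) z = 0" if x: "x \<in> hcar H" and b: "b \<in> B" for x b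
    proof (rule H.functional_eq_zero[of "\<lambda>x. hinner (htensor H K) (elem_tensor H K x b) z", OF _ _ _ assms(3) _ x])
      have bK: "b \<in> hcar K" using b B by auto
      fix x assume x: "x \<in> hcar H"
      show "cmod (hinner (htensor H K) (elem_tensor H K x b) z) \<le> (hnorm K b * hnorm (htensor H K) z) * hnorm H x"
        using HT.cauchy_schwarz[OF car[OF x bK] z(1)] by (simp add: elem_tensor_norm[OF s x bK] mult_ac)
    qed (use b B z(1) z0 in \<open>auto simp: elem_tensor_add_left[OF s] elem_tensor_scale_left[OF s] HT.inner_simps car\<close>)
    have z2: "hinner (htensor H K) (elem_tensor H K x y) z = 0" if x: "x \<in> hcar H" and y: "y \<in> hcar K" for x y
    proof (rule K.functional_eq_zero[of "\<lambda>y. hinner (htensor H K) (elem_tensor H K x y) z", OF _ _ _ assms(4) _ y])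
      fix y assume y: "y \<in> hcar K"
      show "cmod (hinner (htensor H K) (elem_tensor H K x y) z) \<le> (hnorm H x * hnorm (htensor H K) z) * hnorm K y"
        using HT.cauchy_schwarz[OF car[OF x y] z(1)] by (simp add: elem_tensor_norm[OF s x y] mult_ac)
    qed (use x z(1) z1 in \<open>auto simp: elem_tensor_add_right[OF s] elem_tensor_scale_right[OF s] HT.inner_simps car\<close>)
    have "hinner (htensor H K) z (elem_tensor H K x y) = 0" if "x \<in> hcar H" "y \<in> hcar K" for x y
      using HT.inner_cnj[OF car[OF that] z(1)] z2[OF that] by simp
    then show "z = hzero (htensor H K)"
      using elem_tensor_total[OF s] z(1) unfolding htotal_def by auto
  qed
qed

section \<open>Square-integrable functions\<close>

lemma hdist_complex [simp]: "hdist \<C> x y = cmod (x - y)"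
  and hnorm_complex [simp]: "hnorm \<C> x = cmod x"
  and hinner_complex [simp]: "hinner \<C> x y = x * cnj y"
  and hcar_complex [simp]: "hcar \<C> = UNIV"
  and hzero_complex [simp]: "hzero \<C> = 0"
  and hadd_complex [simp]: "hadd \<C> x y = x + y"
  and hscale_complex [simp]: "hscale \<C> c x = c * x"
proof -
  have *: "hnorm \<C> x = cmod x" for x
    by (simp add: hnorm_def complex_hspace_def complex_mult_cnj cmod_def)
  show "hnorm \<C> x = cmod x" by (rule *)
  show "hdist \<C> x y = cmod (x - y)"
    unfolding hdist_def * by (simp add: complex_hspace_def)
qed (simp_all add: complex_hspace_def)

lemma hdiff_complex [simp]: "hdiff \<C> x y = x - y"
  by (simp add: hdiff_def)

lemma hilbert_complex: "hilbert \<C>"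
proof
  fix X :: "nat => complex" assume "hcauchy \<C> X"
  then have "Cauchy X" by (simp add: hcauchy_def Cauchy_def dist_norm)
  then obtain x where "X \<longlonglongrightarrow> x" using Cauchy_convergent convergent_def by blast
  then have "(\<lambda>n. cmod (X n - x)) \<longlonglongrightarrow> 0"
    by (intro tendsto_norm_zero LIM_zero)
  then have "htends \<C> X x" by (simp add: htends_def)
  then show "\<exists>x\<in>hcar \<C>. htends \<C> X x"
    by (intro bexI[where x = x]) simp_all
qed (auto simp: algebra_simps simp flip: power2_eq_square)

locale separable_hilbert = hilbert +
  assumes separable: "\<exists>D. htotal H D \<and> countable D"

lemma separable_hilbert_complex: "separable_hilbert \<C>"
proof -
  interpret hilbert \<C> by (rule hilbert_complex)
  have "htotal \<C> {1}" by (auto simp: htotal_def)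
  then show ?thesis by unfold_locales (intro exI[of _ "{1}"], simp)
qed

lemma (in hilbert) hcauchy_geometric:
  assumes X: "\<And>n. X n \<in> hcar H" and le: "\<And>k. hdist H (X (Suc k)) (X k) \<le> B * (1 / 2) ^ k"
  shows "hcauchy H X"
proof -
  have B: "B \<ge> 0" using le[of 0] dist_nonneg[OF X X, of "Suc 0" 0] by simp
  \<comment> \<open>The remaining tail is subtracted on the right so that the induction on j
    closes.\<close>
  have step: "hdist H (X (k + j)) (X k) \<le> 2 * B * (1 / 2) ^ k - 2 * B * (1 / 2) ^ (k + j)" for k j
  proof (induction j)
    case (Suc j)
    have "hdist H (X (k + Suc j)) (X k) \<le> hdist H (X (k + Suc j)) (X (k + j)) + hdist H (X (k + j)) (X k)"
      by (rule dist_triangle[OF X X X])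
    also have "hdist H (X (k + Suc j)) (X (k + j)) \<le> B * (1 / 2) ^ (k + j)"
      using le[of "k + j"] by simp
    finally show ?case using Suc by simp
  qed (simp add: X)
  have half: "hdist H (X m) (X n) \<le> 2 * B * (1 / 2) ^ n" if "n \<le> m" for m n
    using step[of n "m - n"] that B by (smt (verit) le_add_diff_inverse mult_nonneg_nonneg zero_le_divide_1_iff zero_le_power)
  have pos: "0 \<le> 2 * B * (1 / 2) ^ n" for n using B by simp
  have le': "hdist H (X m) (X n) \<le> 2 * B * (1 / 2) ^ m + 2 * B * (1 / 2) ^ n" for m n
  proof (cases "n \<le> m")
    case True then show ?thesis using half[OF True] pos[of m] by linarith
  next
    case False
    then show ?thesis using half[of m n] pos[of n] dist_commute[OF X X, of m n] by linarith
  qed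
  have "(\<lambda>n. 2 * B * (1 / 2) ^ n) \<longlonglongrightarrow> 2 * B * 0"
    by (intro tendsto_mult tendsto_const LIMSEQ_realpow_zero) auto
  then show ?thesis by (intro hcauchy_if_dist_le[OF le']) simp
qed

lemma (in semi_inner_space) norm_add_sq_le:
  assumes "x \<in> hcar H" "y \<in> hcar H"
  shows "(hnorm H (hadd H x y))\<^sup>2 \<le> 2 * (hnorm H x)\<^sup>2 + 2 * (hnorm H y)\<^sup>2"
proof -
  have "(hnorm H (hadd H x y))\<^sup>2 \<le> (hnorm H x + hnorm H y)\<^sup>2"
    using norm_triangle[OF assms] assms by (intro power_mono) auto
  also have "... \<le> 2 * (hnorm H x)\<^sup>2 + 2 * (hnorm H y)\<^sup>2"
    using sum_squares_bound[of "hnorm H x" "hnorm H y"] by (simp add: power2_sum)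
  finally show ?thesis .
qed

locale L2_space = K: separable_hilbert K
  for K :: "'h hspace" and M :: "'x measure"
begin

definition wmeas :: "('x => 'h) => bool" where
  "wmeas f \<longleftrightarrow> (\<forall>x\<in>space M. f x \<in> hcar K) \<and>
     (\<forall>h\<in>hcar K. (\<lambda>x. hinner K (f x) h) \<in> borel_measurable M)"

lemma wmeas_car: "wmeas f ==> x \<in> space M ==> f x \<in> hcar K"
  by (simp add: wmeas_def)

lemma hcar_sqint:
  "sqint M K = {f. wmeas f \<and> (\<integral>\<^sup>+x. ennreal ((hnorm K (f x))\<^sup>2) \<partial>M) < \<infinity>}"
  by (auto simp: sqint_space_def wmeas_def)

lemma sqint_simps:
  "hzero (sqint_space M K) = (\<lambda>_. hzero K)"
  "hadd (sqint_space M K) f g = (\<lambda>x. hadd K (f x) (g x))"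
  "hscale (sqint_space M K) c f = (\<lambda>x. hscale K c (f x))"
  "hinner (sqint_space M K) f g = (\<integral>x. hinner K (f x) (g x) \<partial>M)"
  "hdiff (sqint_space M K) f g = (\<lambda>x. hdiff K (f x) (g x))"
  by (simp_all add: sqint_space_def hdiff_def)

text \<open>Weak measurability controls inner products with fixed vectors. Separability expresses
  the inner product of two such functions as a pointwise limit of sums of products of these.\<close>

lemma inner_measurable:
  assumes f: "wmeas f" and g: "wmeas g"
  shows "(\<lambda>x. hinner K (f x) (g x)) \<in> borel_measurable M"
proof -
  obtain D where D: "htotal K D" "countable D" using K.separable by blast
  obtain e :: "nat => 'h" where e: "\<And>n. e n \<in> hcar K"
    and lim: "\<And>x y. x \<in> hcar K ==> y \<in> hcar K ==>
      (\<lambda>n. \<Sum>k<n. hinner K x (e k) * hinner K (e k) y) \<longlonglongrightarrow> hinner K x y"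
    using K.inner_series[OF D] by blast
  show ?thesis
  proof (rule borel_measurable_LIMSEQ_metric)
    show "(\<lambda>n. \<Sum>k<n. hinner K (f x) (e k) * cnj (hinner K (g x) (e k))) \<longlonglongrightarrow> hinner K (f x) (g x)"
      if x: "x \<in> space M" for x
      using lim[OF wmeas_car[OF f x] wmeas_car[OF g x]] K.inner_cnj[OF wmeas_car[OF g x] e] by simp
    show "(\<lambda>x. \<Sum>k<n. hinner K (f x) (e k) * cnj (hinner K (g x) (e k))) \<in> borel_measurable M" for n
    proof -
      have m: "(\<lambda>x. hinner K (f x) (e k)) \<in> borel_measurable M" "(\<lambda>x. hinner K (g x) (e k)) \<in> borel_measurable M" for k
        using f g e by (auto simp: wmeas_def)
      have "continuous_on UNIV cnj" by (intro continuous_intros)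
      then have c: "(\<lambda>x. cnj (hinner K (g x) (e k))) \<in> borel_measurable M" for k
        by (rule borel_measurable_continuous_on[OF _ m(2)])
      show ?thesis by (intro borel_measurable_sum borel_measurable_times m c)
    qed
  qed
qed

lemma norm_measurable:
  assumes f: "wmeas f" shows "(\<lambda>x. hnorm K (f x)) \<in> borel_measurable M"
  unfolding hnorm_def using inner_measurable[OF f f] by measurable

lemma wmeas_zero: "wmeas (\<lambda>_. hzero K)"
  by (simp add: wmeas_def)

lemma wmeas_add: "wmeas f ==> wmeas g ==> wmeas (\<lambda>x. hadd K (f x) (g x))"
  by (auto simp: wmeas_def K.inner_add_left intro!: borel_measurable_add cong: measurable_cong)

lemma wmeas_scale: "wmeas f ==> wmeas (\<lambda>x. hscale K c (f x))"
  by (auto simp: wmeas_def K.inner_scale_left cong: measurable_cong)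

lemma wmeas_diff: "wmeas f ==> wmeas g ==> wmeas (\<lambda>x. hdiff K (f x) (g x))"
  unfolding hdiff_def by (intro wmeas_add wmeas_scale)

lemma sqint_add:
  assumes f: "f \<in> sqint M K" and g: "g \<in> sqint M K"
  shows "(\<lambda>x. hadd K (f x) (g x)) \<in> sqint M K"
proof -
  have f': "wmeas f" and g': "wmeas g"
    and fin: "(\<integral>\<^sup>+x. ennreal ((hnorm K (f x))\<^sup>2) \<partial>M) < \<infinity>" "(\<integral>\<^sup>+x. ennreal ((hnorm K (g x))\<^sup>2) \<partial>M) < \<infinity>"
    using f g by (auto simp: hcar_sqint)
  note [measurable] = norm_measurable[OF f'] norm_measurable[OF g']
  have "(\<integral>\<^sup>+x. ennreal ((hnorm K (hadd K (f x) (g x)))\<^sup>2) \<partial>M)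
      \<le> (\<integral>\<^sup>+x. 2 * ennreal ((hnorm K (f x))\<^sup>2) + 2 * ennreal ((hnorm K (g x))\<^sup>2) \<partial>M)"
  proof (rule nn_integral_mono)
    fix x assume x: "x \<in> space M"
    have "ennreal ((hnorm K (hadd K (f x) (g x)))\<^sup>2) \<le> ennreal (2 * (hnorm K (f x))\<^sup>2 + 2 * (hnorm K (g x))\<^sup>2)"
      by (intro ennreal_leI K.norm_add_sq_le wmeas_car f' g' x)
    also have "... = 2 * ennreal ((hnorm K (f x))\<^sup>2) + 2 * ennreal ((hnorm K (g x))\<^sup>2)"
      by (simp add: ennreal_plus ennreal_mult)
    finally show "ennreal ((hnorm K (hadd K (f x) (g x)))\<^sup>2) \<le> 2 * ennreal ((hnorm K (f x))\<^sup>2) + 2 * ennreal ((hnorm K (g x))\<^sup>2)" .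
  qed
  also have "... = 2 * (\<integral>\<^sup>+x. ennreal ((hnorm K (f x))\<^sup>2) \<partial>M) + 2 * (\<integral>\<^sup>+x. ennreal ((hnorm K (g x))\<^sup>2) \<partial>M)"
    by (simp add: nn_integral_add nn_integral_cmult)
  also have "... < \<infinity>" using fin by (simp add: ennreal_mult_less_top)
  finally show ?thesis using wmeas_add[OF f' g'] by (simp add: hcar_sqint)
qed

lemma sqint_scale:
  assumes f: "f \<in> sqint M K"
  shows "(\<lambda>x. hscale K c (f x)) \<in> sqint M K"
proof -
  have f': "wmeas f" and fin: "(\<integral>\<^sup>+x. ennreal ((hnorm K (f x))\<^sup>2) \<partial>M) < \<infinity>"
    using f by (auto simp: hcar_sqint)
  note [measurable] = norm_measurable[OF f']
  have "(\<integral>\<^sup>+x. ennreal ((hnorm K (hscale K c (f x)))\<^sup>2) \<partial>M)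
      = (\<integral>\<^sup>+x. ennreal ((cmod c)\<^sup>2) * ennreal ((hnorm K (f x))\<^sup>2) \<partial>M)"
    by (intro nn_integral_cong)
      (simp add: K.norm_scale wmeas_car[OF f'] power_mult_distrib ennreal_mult)
  also have "... = ennreal ((cmod c)\<^sup>2) * (\<integral>\<^sup>+x. ennreal ((hnorm K (f x))\<^sup>2) \<partial>M)"
    by (simp add: nn_integral_cmult)
  also have "... < \<infinity>" using fin by (simp add: ennreal_mult_less_top)
  finally show ?thesis using wmeas_scale[OF f'] by (simp add: hcar_sqint)
qed

lemma sqint_diff:
  "f \<in> sqint M K ==> g \<in> sqint M K ==>
    (\<lambda>x. hdiff K (f x) (g x)) \<in> sqint M K"
  unfolding hdiff_def by (intro sqint_add sqint_scale)

lemma sqint_inner_integrable: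
  assumes f: "f \<in> sqint M K" and g: "g \<in> sqint M K"
  shows "integrable M (\<lambda>x. hinner K (f x) (g x))"
proof (rule integrableI_bounded)
  have f': "wmeas f" and g': "wmeas g"
    and fin: "(\<integral>\<^sup>+x. ennreal ((hnorm K (f x))\<^sup>2) \<partial>M) < \<infinity>" "(\<integral>\<^sup>+x. ennreal ((hnorm K (g x))\<^sup>2) \<partial>M) < \<infinity>"
    using f g by (auto simp: hcar_sqint)
  note [measurable] = norm_measurable[OF f'] norm_measurable[OF g']
  show "(\<lambda>x. hinner K (f x) (g x)) \<in> borel_measurable M" by (rule inner_measurable[OF f' g'])
  have "(\<integral>\<^sup>+x. ennreal (cmod (hinner K (f x) (g x))) \<partial>M)
      \<le> (\<integral>\<^sup>+x. ennreal ((hnorm K (f x))\<^sup>2) + ennreal ((hnorm K (g x))\<^sup>2) \<partial>M)"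
  proof (rule nn_integral_mono)
    fix x assume x: "x \<in> space M"
    let ?a = "hnorm K (f x)" and ?b = "hnorm K (g x)"
    have "cmod (hinner K (f x) (g x)) \<le> ?a * ?b"
      by (intro K.cauchy_schwarz wmeas_car f' g' x)
    also have "... \<le> ?a\<^sup>2 + ?b\<^sup>2"
      using sum_squares_bound[of ?a ?b] K.norm_nonneg[OF wmeas_car[OF f' x]] K.norm_nonneg[OF wmeas_car[OF g' x]]
        mult_nonneg_nonneg[of ?a ?b] by linarith
    finally show "ennreal (cmod (hinner K (f x) (g x))) \<le> ennreal (?a\<^sup>2) + ennreal (?b\<^sup>2)"
      by (simp add: ennreal_leI flip: ennreal_plus)
  qed
  also have "... = (\<integral>\<^sup>+x. ennreal ((hnorm K (f x))\<^sup>2) \<partial>M) + (\<integral>\<^sup>+x. ennreal ((hnorm K (g x))\<^sup>2) \<partial>M)"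
    by (simp add: nn_integral_add)
  also have "... < \<infinity>" using fin by simp
  finally show "(\<integral>\<^sup>+x. ennreal (norm (hinner K (f x) (g x))) \<partial>M) < \<infinity>" .
qed

sublocale S: semi_inner_space "sqint_space M K"
proof
  let ?S = "sqint_space M K"
  show "hzero ?S \<in> hcar ?S" by (simp add: hcar_sqint sqint_simps wmeas_zero)
  show "hadd ?S f g \<in> hcar ?S" if "f \<in> hcar ?S" "g \<in> hcar ?S" for f g
    using sqint_add[OF that] by (simp add: sqint_simps)
  show "hscale ?S c f \<in> hcar ?S" if "f \<in> hcar ?S" for c f
    using sqint_scale[OF that] by (simp add: sqint_simps)
  have car: "f x \<in> hcar K" if "f \<in> hcar ?S" "x \<in> space M" for f x
    using that by (auto simp: hcar_sqint wmeas_def)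
  show "hinner ?S (hzero ?S) g = 0" if g: "g \<in> hcar ?S" for g
  proof -
    have "(\<integral>x. hinner K (hzero K) (g x) \<partial>M) = (\<integral>x. 0 \<partial>M)"
      by (intro int_cong) (simp add: car[OF g])
    then show ?thesis by (simp add: sqint_simps)
  qed
  show "hinner ?S (hadd ?S f g) h = hinner ?S f h + hinner ?S g h"
    if f: "f \<in> hcar ?S" and g: "g \<in> hcar ?S" and h: "h \<in> hcar ?S" for f g h
  proof -
    have "(\<integral>x. hinner K (hadd K (f x) (g x)) (h x) \<partial>M) = (\<integral>x. hinner K (f x) (h x) + hinner K (g x) (h x) \<partial>M)"
      by (intro int_cong) (simp add: K.inner_add_left car f g h)
    then show ?thesis
      using sqint_inner_integrable[OF f h] sqint_inner_integrable[OF g h] by (simp add: sqint_simps)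
  qed
  show "hinner ?S (hscale ?S c f) h = c * hinner ?S f h" if f: "f \<in> hcar ?S" and h: "h \<in> hcar ?S" for c f h
  proof -
    have "(\<integral>x. hinner K (hscale K c (f x)) (h x) \<partial>M) = (\<integral>x. c * hinner K (f x) (h x) \<partial>M)"
      by (intro int_cong) (simp add: K.inner_scale_left car f h)
    then show ?thesis by (simp add: sqint_simps)
  qed
  show "cnj (hinner ?S f g) = hinner ?S g f" if f: "f \<in> hcar ?S" and g: "g \<in> hcar ?S" for f g
  proof -
    have "(\<integral>x. hinner K (g x) (f x) \<partial>M) = (\<integral>x. cnj (hinner K (f x) (g x)) \<partial>M)"
      by (intro int_cong) (simp add: K.inner_cnj car f g)
    then show ?thesis by (simp add: sqint_simps)
  qed
  show "0 \<le> Re (hinner ?S f f)" if f: "f \<in> hcar ?S" for f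
    unfolding sqint_simps integral_Re[OF sqint_inner_integrable[OF f f], symmetric]
    by (intro Bochner_Integration.integral_nonneg_AE AE_I2 K.inner_pos car f)
qed

lemma sqint_norm_nn:
  assumes f: "f \<in> sqint M K"
  shows "(\<integral>\<^sup>+x. ennreal ((hnorm K (f x))\<^sup>2) \<partial>M) = ennreal ((hnorm (sqint_space M K) f)\<^sup>2)"
proof -
  have f': "wmeas f" using f by (simp add: hcar_sqint)
  have eq: "Re (hinner K (f x) (f x)) = (hnorm K (f x))\<^sup>2" if "x \<in> space M" for x
    using K.norm_sq[OF wmeas_car[OF f' that]] by simp
  have int: "integrable M (\<lambda>x. (hnorm K (f x))\<^sup>2)"
    using integrable_Re[OF sqint_inner_integrable[OF f f]]
    by (rule Bochner_Integration.integrable_cong[THEN iffD1, rotated -1]) (simp_all add: eq)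
  have "(hnorm (sqint_space M K) f)\<^sup>2 = (\<integral>x. Re (hinner K (f x) (f x)) \<partial>M)"
    unfolding S.norm_sq[OF f] sqint_simps integral_Re[OF sqint_inner_integrable[OF f f]] ..
  also have "... = (\<integral>x. (hnorm K (f x))\<^sup>2 \<partial>M)"
    by (intro int_cong eq)
  finally show ?thesis using nn_integral_eq_integral[OF int] by simp
qed

lemma sqint_dist_nn:
  assumes f: "f \<in> sqint M K" and g: "g \<in> sqint M K"
  shows "(\<integral>\<^sup>+x. ennreal ((hdist K (f x) (g x))\<^sup>2) \<partial>M) = ennreal ((hdist (sqint_space M K) f g)\<^sup>2)"
  using sqint_norm_nn[OF sqint_diff[OF f g]] by (simp add: hdist_hdiff sqint_simps)

lemma dist_measurable:
  assumes "wmeas f" "wmeas g" shows "(\<lambda>x. hdist K (f x) (g x)) \<in> borel_measurable M"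
  unfolding hdist_hdiff by (intro norm_measurable wmeas_diff assms)

lemma sqint_dist_zero_iff:
  assumes f: "f \<in> sqint M K" and g: "g \<in> sqint M K"
  shows "hdist (sqint_space M K) f g = 0 \<longleftrightarrow> (AE x in M. f x = g x)"
proof -
  have f': "wmeas f" and g': "wmeas g" using f g by (auto simp: hcar_sqint)
  have [measurable]: "(\<lambda>x. hdist K (f x) (g x)) \<in> borel_measurable M"
    by (rule dist_measurable[OF f' g'])
  have "hdist (sqint_space M K) f g = 0 \<longleftrightarrow> (\<integral>\<^sup>+x. ennreal ((hdist K (f x) (g x))\<^sup>2) \<partial>M) = 0"
    unfolding sqint_dist_nn[OF f g] by (simp add: ennreal_eq_0_iff)
  also have "... \<longleftrightarrow> (AE x in M. ennreal ((hdist K (f x) (g x))\<^sup>2) = 0)"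
    by (subst nn_integral_0_iff_AE) auto
  also have "... \<longleftrightarrow> (AE x in M. f x = g x)"
  proof (rule AE_cong)
    fix x assume x: "x \<in> space M"
    have c: "f x \<in> hcar K" "g x \<in> hcar K" using wmeas_car f' g' x by auto
    show "ennreal ((hdist K (f x) (g x))\<^sup>2) = 0 \<longleftrightarrow> f x = g x"
      using K.dist_eq_0[OF c] K.dist_self[OF c(1)] by (auto simp: ennreal_eq_0_iff)
  qed
  finally show ?thesis .
qed

lemma ae_rel_null: "ae_rel M K = null_rel (sqint_space M K)"
  by (auto simp: ae_rel_def null_rel_def sqint_dist_zero_iff)

text \<open>
  Along a subsequence with distances at most \<open>8\<^sup>-\<^sup>k\<close> the function \<open>\<Sum>\<^sub>k 4\<^sup>k dist\<^sup>2\<close> is integrable, which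
  gives pointwise geometric convergence almost everywhere.
\<close>

lemma fast_cauchy_limit:
  assumes X: "\<And>n. X n \<in> sqint M K"
    and fast: "\<And>k n. n \<ge> k ==> hdist (sqint_space M K) (X n) (X k) \<le> (1 / 8) ^ k"
  shows "\<exists>F. F \<in> sqint M K \<and> (\<forall>k. hdist (sqint_space M K) (X k) F \<le> (1 / 8) ^ k)
    \<and> (AE x in M. htends K (\<lambda>n. X n x) (F x))"
proof -
  let ?S = "sqint_space M K"
  have Xw: "wmeas (X n)" for n using X by (auto simp: hcar_sqint)
  have car: "X n x \<in> hcar K" if "x \<in> space M" for n x by (rule wmeas_car[OF Xw that])
  have [measurable]: "(\<lambda>x. hdist K (X m x) (X n x)) \<in> borel_measurable M" for m n
    by (rule dist_measurable[OF Xw Xw])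
  define C where "C x = (\<Sum>k. ennreal (4 ^ k * (hdist K (X (Suc k) x) (X k x))\<^sup>2))" for x
  have C_meas [measurable]: "C \<in> borel_measurable M" unfolding C_def by measurable
  have "(\<integral>\<^sup>+x. C x \<partial>M) = (\<Sum>k. \<integral>\<^sup>+x. ennreal (4 ^ k * (hdist K (X (Suc k) x) (X k x))\<^sup>2) \<partial>M)"
    unfolding C_def by (rule nn_integral_suminf) measurable
  also have "... \<le> (\<Sum>k. ennreal ((1 / 2) ^ k))"
  proof (intro suminf_le allI)
    fix k
    have "(\<integral>\<^sup>+x. ennreal (4 ^ k * (hdist K (X (Suc k) x) (X k x))\<^sup>2) \<partial>M)
        = ennreal (4 ^ k) * (\<integral>\<^sup>+x. ennreal ((hdist K (X (Suc k) x) (X k x))\<^sup>2) \<partial>M)"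
      by (simp add: ennreal_mult nn_integral_cmult)
    also have "... = ennreal (4 ^ k * (hdist ?S (X (Suc k)) (X k))\<^sup>2)"
      unfolding sqint_dist_nn[OF X X] by (simp add: ennreal_mult)
    also have "... \<le> ennreal ((1 / 2) ^ k)"
    proof (rule ennreal_leI)
      have "(hdist ?S (X (Suc k)) (X k))\<^sup>2 \<le> ((1 / 8) ^ k)\<^sup>2"
        by (rule power_mono[OF fast]) (simp_all add: X)
      then have "4 ^ k * (hdist ?S (X (Suc k)) (X k))\<^sup>2 \<le> 4 ^ k * ((1 / 8) ^ k)\<^sup>2"
        by (rule mult_left_mono) simp
      also have "... = (1 / 16) ^ k"
        by (simp add: power2_eq_square flip: power_mult_distrib)
      also have "... \<le> (1 / 2) ^ k" by (rule power_mono) auto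
      finally show "4 ^ k * (hdist ?S (X (Suc k)) (X k))\<^sup>2 \<le> (1 / 2) ^ k" .
    qed
    finally show "(\<integral>\<^sup>+x. ennreal (4 ^ k * (hdist K (X (Suc k) x) (X k x))\<^sup>2) \<partial>M) \<le> ennreal ((1 / 2) ^ k)" .
  qed auto
  also have "(\<Sum>k. ennreal ((1 / 2) ^ k)) = ennreal (\<Sum>k. (1 / 2) ^ k)"
    by (rule suminf_ennreal2) (auto intro!: summable_geometric)
  also have "... < \<infinity>" by simp
  finally have C_fin: "(\<integral>\<^sup>+x. C x \<partial>M) \<noteq> \<infinity>" by simp
  have AE_C: "AE x in M. C x \<noteq> \<infinity>"
    by (rule nn_integral_PInf_AE[OF C_meas C_fin])
  have lim_ex: "\<exists>y\<in>hcar K. htends K (\<lambda>n. X n x) y" if x: "x \<in> space M" "C x \<noteq> \<infinity>" for x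
  proof -
    have carx: "X n x \<in> hcar K" for n by (rule car[OF x(1)])
    have le: "hdist K (X (Suc k) x) (X k x) \<le> sqrt (enn2real (C x)) * (1 / 2) ^ k" for k
    proof -
      let ?d = "hdist K (X (Suc k) x) (X k x)"
      have "(\<Sum>j\<in>{k}. ennreal (4 ^ j * (hdist K (X (Suc j) x) (X j x))\<^sup>2)) \<le> C x"
        unfolding C_def by (rule sum_le_suminf) (rule summableI, simp_all)
      then have "ennreal (4 ^ k * ?d\<^sup>2) \<le> C x"
        by (simp only: sum.insert sum.empty finite.emptyI empty_iff not_False_eq_True add_0_right)
      then have "enn2real (ennreal (4 ^ k * ?d\<^sup>2)) \<le> enn2real (C x)"
        by (rule enn2real_mono) (use x(2) in \<open>simp add: less_top\<close>)
      then have "4 ^ k * ?d\<^sup>2 \<le> enn2real (C x)"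
        by (subst (asm) enn2real_ennreal) simp_all
      moreover have "((2::real) ^ k)\<^sup>2 = 4 ^ k"
        by (simp add: power2_eq_square flip: power_mult_distrib)
      then have "(2 ^ k * ?d)\<^sup>2 = 4 ^ k * ?d\<^sup>2"
        by (simp only: power_mult_distrib)
      ultimately have "2 ^ k * ?d \<le> sqrt (enn2real (C x))"
        by (intro real_le_rsqrt) simp
      then have "?d \<le> sqrt (enn2real (C x)) / 2 ^ k"
        by (subst pos_le_divide_eq) (simp_all add: mult.commute)
      then show ?thesis by (simp only: power_one_over times_divide_eq_right mult_1_right)
    qed
    have "hcauchy K (\<lambda>n. X n x)"
      by (rule K.hcauchy_geometric[of "\<lambda>n. X n x", OF carx le])
    from K.complete[of "\<lambda>n. X n x", OF carx this] show ?thesis .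
  qed
  \<comment> \<open>The zero vector is the default on the null set where the sum C is infinite; with
    it F is weakly measurable on the whole space.\<close>
  define F where "F x = (if C x \<noteq> \<infinity> then SOME y. y \<in> hcar K \<and> htends K (\<lambda>n. X n x) y else hzero K)" for x
  have F_lim: "F x \<in> hcar K \<and> htends K (\<lambda>n. X n x) (F x)" if x: "x \<in> space M" "C x \<noteq> \<infinity>" for x
  proof -
    have "\<exists>y. y \<in> hcar K \<and> htends K (\<lambda>n. X n x) y" using lim_ex[OF x] by (elim bexE) (intro exI conjI)
    from someI_ex[OF this] show ?thesis by (simp only: F_def x(2) not_False_eq_True if_True)
  qed
  have F: "F x \<in> hcar K" if x: "x \<in> space M" for x
  proof (cases "C x = \<infinity>")
    case True then show ?thesis by (simp add: F_def)
  next
    case False then show ?thesis by (rule conjunct1[OF F_lim[OF x]])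
  qed
  have F2: "htends K (\<lambda>n. X n x) (F x)" if "x \<in> space M" "C x \<noteq> \<infinity>" for x
    by (rule conjunct2[OF F_lim[OF that]])
  have Fw: "wmeas F"
    unfolding wmeas_def
  proof (intro conjI ballI)
    show "F x \<in> hcar K" if "x \<in> space M" for x by (rule F[OF that])
    fix h assume h: "h \<in> hcar K"
    show "(\<lambda>x. hinner K (F x) h) \<in> borel_measurable M"
    proof (rule borel_measurable_LIMSEQ_metric)
      show "(\<lambda>x. if C x \<noteq> \<infinity> then hinner K (X n x) h else 0) \<in> borel_measurable M" for n
      proof -
        have [measurable]: "(\<lambda>x. hinner K (X n x) h) \<in> borel_measurable M"
          using Xw h by (auto simp: wmeas_def)
        show ?thesis by measurable
      qed
      fix x assume x: "x \<in> space M"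
      show "(\<lambda>n. if C x \<noteq> \<infinity> then hinner K (X n x) h else 0) \<longlonglongrightarrow> hinner K (F x) h"
      proof (cases "C x = \<infinity>")
        case True then show ?thesis using h by (simp add: F_def)
      next
        case False
        then show ?thesis
          using K.inner_tendsto[OF car[OF x] h F[OF x] h F2[OF x False] K.htends_const[OF h]] by simp
      qed
    qed
  qed
  have dist_le: "(\<integral>\<^sup>+x. ennreal ((hdist K (X k x) (F x))\<^sup>2) \<partial>M) \<le> ennreal (((1 / 8) ^ k)\<^sup>2)" for k
  proof -
    have pt: "ennreal ((hdist K (X k x) (F x))\<^sup>2) = liminf (\<lambda>n. ennreal ((hdist K (X k x) (X n x))\<^sup>2))"
      if x: "x \<in> space M" and fin: "C x \<noteq> \<infinity>" for x
    proof -
      have d: "htends K (\<lambda>n. hdiff K (X k x) (X n x)) (hdiff K (X k x) (F x))"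
        by (intro K.htends_diff) (use car[OF x] F[OF x] F2[OF x fin] in auto)
      have "(\<lambda>n. hdist K (X k x) (X n x)) \<longlonglongrightarrow> hdist K (X k x) (F x)"
        unfolding hdist_hdiff
        by (rule K.norm_tendsto[OF _ _ d]) (use car[OF x] F[OF x] in auto)
      then have "(\<lambda>n. ennreal ((hdist K (X k x) (X n x))\<^sup>2)) \<longlonglongrightarrow> ennreal ((hdist K (X k x) (F x))\<^sup>2)"
        by (intro tendsto_ennrealI tendsto_power)
      then show "ennreal ((hdist K (X k x) (F x))\<^sup>2) = liminf (\<lambda>n. ennreal ((hdist K (X k x) (X n x))\<^sup>2))"
        by (rule lim_imp_Liminf[OF trivial_limit_sequentially, symmetric])
    qed
    have "(\<integral>\<^sup>+x. ennreal ((hdist K (X k x) (F x))\<^sup>2) \<partial>M)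
        = (\<integral>\<^sup>+x. liminf (\<lambda>n. ennreal ((hdist K (X k x) (X n x))\<^sup>2)) \<partial>M)"
    proof (rule nn_integral_cong_AE)
      show "AE x in M. ennreal ((hdist K (X k x) (F x))\<^sup>2) = liminf (\<lambda>n. ennreal ((hdist K (X k x) (X n x))\<^sup>2))"
        using AE_C AE_space by eventually_elim (rule pt)
    qed
    also have "... \<le> liminf (\<lambda>n. \<integral>\<^sup>+x. ennreal ((hdist K (X k x) (X n x))\<^sup>2) \<partial>M)"
      by (rule nn_integral_liminf) measurable
    also have "... \<le> ennreal (((1 / 8) ^ k)\<^sup>2)"
    proof -
      have "(\<integral>\<^sup>+x. ennreal ((hdist K (X k x) (X n x))\<^sup>2) \<partial>M) \<le> ennreal (((1 / 8) ^ k)\<^sup>2)" if "n \<ge> k" for n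
      proof -
        have "hdist ?S (X k) (X n) \<le> (1 / 8) ^ k"
          using fast[OF that] S.dist_commute[OF X X, of k n] by simp
        then show ?thesis
          unfolding sqint_dist_nn[OF X X] by (intro ennreal_leI power_mono) (simp_all add: X)
      qed
      then have "liminf (\<lambda>n. \<integral>\<^sup>+x. ennreal ((hdist K (X k x) (X n x))\<^sup>2) \<partial>M) \<le> liminf (\<lambda>_::nat. ennreal (((1 / 8) ^ k)\<^sup>2))"
        by (intro Liminf_mono eventually_sequentiallyI[of k])
      then show ?thesis by (simp only: Liminf_const[OF trivial_limit_sequentially])
    qed
    finally show ?thesis .
  qed
  have FX: "(\<lambda>x. hdiff K (X 0 x) (F x)) \<in> hcar ?S"
    using wmeas_diff[OF Xw Fw, of 0] order_le_less_trans[OF dist_le[of 0]] by (simp add: hcar_sqint hdist_hdiff)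
  \<comment> \<open>Fatou's lemma has shown that X 0 - F is square-integrable; F itself is recovered
    as X 0 - (X 0 - F).\<close>
  have "(\<lambda>x. hdiff K (X 0 x) (hdiff K (X 0 x) (F x))) \<in> hcar ?S"
    by (rule sqint_diff[OF X FX])
  moreover have "hdiff K (X 0 x) (hdiff K (X 0 x) (F x)) = F x" if "x \<in> space M" for x
    by (rule K.eqI) (use car[OF that] F[OF that] in \<open>auto simp: K.inner_simps\<close>)
  ultimately have "(\<integral>\<^sup>+x. ennreal ((hnorm K (F x))\<^sup>2) \<partial>M) < \<infinity>"
    by (simp add: hcar_sqint cong: nn_integral_cong)
  then have FS: "F \<in> hcar ?S" using Fw by (simp add: hcar_sqint)
  have "hdist ?S (X k) F \<le> (1 / 8) ^ k" for k
  proof -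
    have "ennreal ((hdist ?S (X k) F)\<^sup>2) \<le> ennreal (((1 / 8) ^ k)\<^sup>2)"
      using dist_le[of k] sqint_dist_nn[OF X FS] by simp
    then have "(hdist ?S (X k) F)\<^sup>2 \<le> ((1 / 8) ^ k)\<^sup>2" by (simp add: ennreal_le_iff)
    then show ?thesis by (rule power2_le_imp_le) simp
  qed
  moreover have "AE x in M. htends K (\<lambda>n. X n x) (F x)"
    using AE_C by (rule AE_mp) (auto intro!: AE_I2 F2)
  ultimately show ?thesis using FS by (intro exI[of _ F]) simp
qed

text \<open>The almost everywhere convergent subsequence is recorded besides completeness. It is
  what later identifies an abstract L2 limit with a given pointwise limit.\<close>

lemma cauchy_subsequence:
  assumes X: "\<And>n. X n \<in> sqint M K" and cau: "hcauchy (sqint_space M K) X"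
  shows "\<exists>F r. strict_mono r \<and> F \<in> sqint M K \<and> htends (sqint_space M K) X F
    \<and> (AE x in M. htends K (\<lambda>n. X (r n) x) (F x))"
proof -
  let ?S = "sqint_space M K"
  have "\<exists>N. \<forall>m\<ge>N. \<forall>n\<ge>N. hdist ?S (X m) (X n) < (1 / 8) ^ k" for k
    using cau unfolding hcauchy_def by simp
  then obtain N where N: "\<And>k m n. m \<ge> N k ==> n \<ge> N k ==> hdist ?S (X m) (X n) < (1 / 8) ^ k"
    by metis
  \<comment> \<open>The maximum places r k beyond N k, and the added k makes r strictly
    increasing.\<close>
  define r where "r k = k + Max (N ` {..k})" for k
  have rN: "r k \<ge> N k" for k
    unfolding r_def by (rule trans_le_add2, rule Max_ge) auto
  have mono: "strict_mono r"
  proof (rule strict_monoI_Suc)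
    fix k
    have "Max (N ` {..k}) \<le> Max (N ` {..Suc k})" by (rule Max_mono) auto
    then show "r k < r (Suc k)" unfolding r_def by linarith
  qed
  have "hdist ?S (X (r n)) (X (r k)) \<le> (1 / 8) ^ k" if "n \<ge> k" for n k
    using N[of k "r n" "r k"] rN[of k] strict_mono_leD[OF mono that] by simp
  from fast_cauchy_limit[of "\<lambda>n. X (r n)", OF X this]
  obtain F where F: "F \<in> hcar ?S" "\<And>k. hdist ?S (X (r k)) F \<le> (1 / 8) ^ k"
    "AE x in M. htends K (\<lambda>n. X (r n) x) (F x)" by blast
  have "htends ?S X F"
    unfolding htends_def
  proof (rule LIMSEQ_I)
    fix e :: real assume "e > 0"
    then obtain k where k: "(1 / 8 :: real) ^ k < e / 2"
      using real_arch_pow_inv[of "e / 2" "1 / 8"] by auto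
    have "norm (hdist ?S (X n) F - 0) < e" if "n \<ge> N k" for n
    proof -
      have "hdist ?S (X n) F \<le> hdist ?S (X n) (X (r k)) + hdist ?S (X (r k)) F"
        by (rule S.dist_triangle[OF X X F(1)])
      also have "... < e" using N[OF that rN] F(2)[of k] k by (smt (verit) field_sum_of_halves)
      finally show ?thesis using S.dist_nonneg[OF X F(1), of n] by simp
    qed
    then show "\<exists>n0. \<forall>n\<ge>n0. norm (hdist ?S (X n) F - 0) < e" by blast
  qed
  then show ?thesis using mono F by blast
qed

lemma hilbert_L2: "hilbert (L2 M K)"
  unfolding L2_def ae_rel_null
  by (rule S.hilbert_quot) (use cauchy_subsequence in blast)

sublocale L2: hilbert "L2 M K" by (rule hilbert_L2)

lemma L2_class_car: "f \<in> sqint M K ==> L2_class M K f \<in> hcar (L2 M K)"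
  unfolding L2_class_def L2_def ae_rel_null S.hcar_quot by blast

lemma L2_class_ex: "X \<in> hcar (L2 M K) ==> \<exists>f\<in>sqint M K. X = L2_class M K f"
  unfolding L2_class_def L2_def ae_rel_null S.hcar_quot by blast

lemma L2_class_eq_iff:
  "f \<in> sqint M K ==> g \<in> sqint M K ==>
    L2_class M K f = L2_class M K g \<longleftrightarrow> (AE x in M. f x = g x)"
  unfolding L2_class_def ae_rel_null by (simp only: S.cls_eq_iff sqint_dist_zero_iff)

lemma L2_class_inner:
  "f \<in> sqint M K ==> g \<in> sqint M K ==>
    hinner (L2 M K) (L2_class M K f) (L2_class M K g) = (\<integral>x. hinner K (f x) (g x) \<partial>M)"
  unfolding L2_class_def L2_def ae_rel_null by (simp only: S.quot_inner sqint_simps)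

lemma L2_class_add:
  "f \<in> sqint M K ==> g \<in> sqint M K ==>
    hadd (L2 M K) (L2_class M K f) (L2_class M K g) = L2_class M K (\<lambda>x. hadd K (f x) (g x))"
  unfolding L2_class_def L2_def ae_rel_null by (simp only: S.quot_add sqint_simps)

lemma L2_class_scale:
  "f \<in> sqint M K ==>
    hscale (L2 M K) c (L2_class M K f) = L2_class M K (\<lambda>x. hscale K c (f x))"
  unfolding L2_class_def L2_def ae_rel_null by (simp only: S.quot_scale sqint_simps)

lemma L2_class_dist:
  "f \<in> sqint M K ==> g \<in> sqint M K ==>
    hdist (L2 M K) (L2_class M K f) (L2_class M K g) = hdist (sqint_space M K) f g"
  unfolding L2_class_def L2_def ae_rel_null by (simp only: S.quot_dist)

lemma L2_class_norm:
  "f \<in> sqint M K ==>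
    (\<integral>\<^sup>+x. ennreal ((hnorm K (f x))\<^sup>2) \<partial>M) = ennreal ((hnorm (L2 M K) (L2_class M K f))\<^sup>2)"
  unfolding L2_class_def L2_def ae_rel_null by (simp only: S.quot_norm sqint_norm_nn)

lemma L2_rep:
  assumes "X \<in> hcar (L2 M K)"
  shows "(SOME f. f \<in> X) \<in> sqint M K" "L2_class M K (SOME f. f \<in> X) = X"
proof -
  obtain f where f: "f \<in> sqint M K" "X = null_rel (sqint_space M K) `` {f}"
    using L2_class_ex[OF assms] by (auto simp: L2_class_def ae_rel_null)
  show "(SOME f. f \<in> X) \<in> sqint M K"
    unfolding f(2) by (rule S.cls_rep(1)[OF f(1)])
  show "L2_class M K (SOME f. f \<in> X) = X"
    unfolding L2_class_def ae_rel_null f(2)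
    by (rule S.cls_eq_iff[OF f(1) S.cls_rep(1)[OF f(1)], THEN iffD2, symmetric, OF S.cls_rep(2)[OF f(1)]])
qed

lemma L2_class_rep:
  assumes "f \<in> sqint M K"
  shows "AE x in M. (SOME g. g \<in> L2_class M K f) x = f x"
  using L2_rep[OF L2_class_car[OF assms]] L2_class_eq_iff assms by blast

end

global_interpretation CL2: L2_space \<C> M for M
  by (simp add: L2_space_def separable_hilbert_complex)

lemma sqint_complex_iff:
  "f \<in> sqint M \<C> \<longleftrightarrow>
    f \<in> borel_measurable M \<and> (\<integral>\<^sup>+x. ennreal ((cmod (f x))\<^sup>2) \<partial>M) < \<infinity>"
proof -
  have "(\<forall>h. (\<lambda>x. f x * cnj h) \<in> borel_measurable M) \<longleftrightarrow> f \<in> borel_measurable M"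
  proof
    assume "\<forall>h. (\<lambda>x. f x * cnj h) \<in> borel_measurable M"
    then have "(\<lambda>x. f x * cnj 1) \<in> borel_measurable M" by (rule spec)
    then show "f \<in> borel_measurable M" by simp
  qed auto
  then show ?thesis by (auto simp: CL2.hcar_sqint CL2.wmeas_def)
qed

section \<open>Haar measures\<close>

definition invariant_measure :: "'g::topological_group_add measure => bool" where
  "invariant_measure \<mu> \<longleftrightarrow> sets \<mu> = sets borel \<and> sigma_finite_measure \<mu> \<and> emeasure \<mu> UNIV \<noteq> 0 \<and>
     (\<forall>g. \<forall>f\<in>borel_measurable borel. (\<integral>\<^sup>+x. f (g + x) \<partial>\<mu>) = (\<integral>\<^sup>+x. f x \<partial>\<mu>))"

lemma borel_measurable_uminus_group [measurable]:
  fixes f :: "'a => 'g::topological_group_add"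
  assumes [measurable]: "f \<in> borel_measurable M"
  shows "(\<lambda>x. - f x) \<in> borel_measurable M"
proof -
  have "(uminus :: 'g => 'g) \<in> borel_measurable borel"
    by (intro borel_measurable_continuous_onI continuous_intros)
  then show ?thesis using assms measurable_compose by blast
qed

text \<open>By local compactness the basic open sets contained in some compact set still form a
  basis. Finite intersections are added to obtain a pi-system of sets of finite measure;
  countability then also yields sigma-finiteness.\<close>

lemma compact_base:
  fixes \<mu> :: "'g::{second_countable_topology, t2_space} measure"
  assumes lc: "locally compact (UNIV :: 'g set)" and fin: "\<And>K. compact K ==> emeasure \<mu> K < \<infinity>"
    and sets: "sets \<mu> = sets borel"
  obtains \<U> :: "'g set set" where "countable \<U>" "Int_stable \<U>" "\<Union>\<U> = UNIV"
    "\<And>U. U \<in> \<U> ==> open U \<and> emeasure \<mu> U < \<infinity>" "sets borel = sigma_sets UNIV \<U>"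
proof -
  obtain B :: "'g set set" where B: "countable B" "topological_basis B"
    using ex_countable_basis by blast
  define B0 where "B0 = {U \<in> B. \<exists>K. compact K \<and> U \<subseteq> K}"
  define \<U> where "\<U> = Inter ` {F. F \<subseteq> B0 \<and> finite F \<and> F \<noteq> {}}"
  have cB0: "countable B0" using B(1) by (auto simp: B0_def)
  have "countable {F. finite F \<and> F \<subseteq> B0}" by (rule countable_Collect_finite_subset[OF cB0])
  then have c: "countable \<U>"
    unfolding \<U>_def by (intro countable_image) (rule countable_subset[rotated], auto)
  have sub: "B0 \<subseteq> \<U>"
  proof
    fix U assume "U \<in> B0"
    then show "U \<in> \<U>" unfolding \<U>_def by (intro image_eqI[of _ _ "{U}"]) auto
  qed
  have opn: "open U" if U: "U \<in> \<U>" for U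
  proof -
    obtain F where F: "U = \<Inter>F" "F \<subseteq> B0" "finite F" using U by (auto simp: \<U>_def)
    have "open (\<Inter>F)"
      by (rule open_Inter[OF F(3)]) (use F(2) topological_basis_open[OF B(2)] in \<open>auto simp: B0_def\<close>)
    then show ?thesis using F(1) by simp
  qed
  have cpt: "\<exists>K. compact K \<and> U \<subseteq> K" if U: "U \<in> \<U>" for U
  proof -
    obtain F where F: "U = \<Inter>F" "F \<subseteq> B0" "F \<noteq> {}" using U by (auto simp: \<U>_def)
    then obtain W where "W \<in> F" by blast
    moreover from this obtain K where "compact K" "W \<subseteq> K" using F(2) by (auto simp: B0_def)
    ultimately show ?thesis using F(1) by blast
  qed
  have basis: "topological_basis \<U>"
  proof (rule topological_basisI)
    fix O' :: "'g set" and x assume O': "open O'" "x \<in> O'"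
    obtain u v where uv: "open u" "compact v" "x \<in> u" "u \<subseteq> v" "v \<subseteq> O'"
      using lc O' unfolding locally_def by (metis open_openin subtopology_UNIV topspace_euclidean)
    obtain W where W: "W \<in> B" "x \<in> W" "W \<subseteq> u" using topological_basisE[OF B(2) uv(1,3)] by blast
    then have "W \<in> B0" using uv by (auto simp: B0_def)
    then show "\<exists>B'\<in>\<U>. x \<in> B' \<and> B' \<subseteq> O'" using W uv sub by blast
  qed (rule opn)
  have gen: "sets borel = sigma_sets UNIV \<U>"
    using borel_eq_countable_basis[OF c basis] by (metis Pow_UNIV sets_measure_of subset_UNIV)
  have ist: "Int_stable \<U>"
  proof (rule Int_stableI)
    fix a b assume "a \<in> \<U>" "b \<in> \<U>"
    then obtain F G where "a = \<Inter>F" "F \<subseteq> B0" "finite F" "F \<noteq> {}" "b = \<Inter>G" "G \<subseteq> B0" "finite G"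
      by (auto simp: \<U>_def)
    then show "a \<inter> b \<in> \<U>"
      unfolding \<U>_def by (intro image_eqI[of _ _ "F \<union> G"]) auto
  qed
  have cov: "\<Union>\<U> = UNIV"
    using topological_basisE[OF basis open_UNIV] by blast
  have "open U \<and> emeasure \<mu> U < \<infinity>" if U: "U \<in> \<U>" for U
  proof
    show "open U" by (rule opn[OF U])
    obtain K where K: "compact K" "U \<subseteq> K" using cpt[OF U] by blast
    have "emeasure \<mu> U \<le> emeasure \<mu> K"
      using K compact_imp_closed[OF K(1)] by (intro emeasure_mono) (auto simp: sets)
    then show "emeasure \<mu> U < \<infinity>" using fin[OF K(1)] by (rule le_less_trans)
  qed
  then show ?thesis by (rule that[OF c ist cov _ gen])
qed

lemma left_haar_invariant:
  fixes \<mu> :: "'g::{topological_group_add, second_countable_topology, t2_space} measure"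
  assumes lc: "locally compact (UNIV :: 'g set)" and haar: "left_haar \<mu>"
  shows "invariant_measure \<mu>"
proof -
  have sets [measurable_cong]: "sets \<mu> = sets borel" and ne: "emeasure \<mu> UNIV \<noteq> 0"
    and fin: "\<And>K. compact K ==> emeasure \<mu> K < \<infinity>"
    and inv: "\<And>g A. A \<in> sets borel ==> emeasure \<mu> ((\<lambda>x. g + x) ` A) = emeasure \<mu> A"
    using haar by (auto simp: left_haar_def)
  have space: "space \<mu> = UNIV" using sets_eq_imp_space_eq[OF sets] by simp
  obtain \<U> where \<U>: "countable \<U>" "\<Union>\<U> = UNIV" "\<And>U. U \<in> \<U> ==> open U \<and> emeasure \<mu> U < \<infinity>"
    using compact_base[OF lc fin sets] by metis
  have "sigma_finite_measure \<mu>"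
    by (rule sigma_finite_measure.intro, rule exI[of _ \<U>]) (use \<U> in \<open>auto simp: space sets less_top[symmetric]\<close>)
  moreover have "(\<integral>\<^sup>+x. f (g + x) \<partial>\<mu>) = (\<integral>\<^sup>+x. f x \<partial>\<mu>)" if [measurable]: "f \<in> borel_measurable borel" for f :: "'g => ennreal" and g
  proof -
    have "distr \<mu> borel (\<lambda>x. g + x) = \<mu>"
    proof (rule measure_eqI)
      fix A assume "A \<in> sets (distr \<mu> borel (\<lambda>x. g + x))"
      then have A: "A \<in> sets borel" by simp
      \<comment> \<open>Invariance in \<open>left_haar\<close> concerns images of sets, whereas a
        push-forward needs preimages; one is the other for the inverse translation.\<close>
      have "(\<lambda>x. g + x) -` A = (\<lambda>x. - g + x) ` A"
        by (auto simp: image_iff add.assoc[symmetric] intro!: bexI[of _ "g + _"])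
      then show "emeasure (distr \<mu> borel (\<lambda>x. g + x)) A = emeasure \<mu> A"
        using inv[OF A, of "- g"] A by (subst emeasure_distr) (auto simp: space)
    qed (simp add: sets)
    then have "(\<integral>\<^sup>+x. f x \<partial>\<mu>) = (\<integral>\<^sup>+x. f x \<partial>(distr \<mu> borel (\<lambda>x. g + x)))" by simp
    also have "... = (\<integral>\<^sup>+x. f (g + x) \<partial>\<mu>)" by (rule nn_integral_distr) measurable
    finally show ?thesis by simp
  qed
  ultimately show ?thesis using sets ne by (auto simp: invariant_measure_def)
qed

text \<open>Sigma-finiteness takes the place of finiteness on compact sets. It is preserved under
  the measurable push-forwards of \<open>modulus_THE\<close>, and it suffices for
  uniqueness.\<close>

locale invariant = sigma_finite_measure \<mu>
  for \<mu> :: "'g::{topological_group_add, second_countable_topology, t2_space} measure" +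
  assumes sets_inv [measurable_cong, simp]: "sets \<mu> = sets borel"
    and nonzero: "emeasure \<mu> UNIV \<noteq> 0"
    and nn_translate: "f \<in> borel_measurable borel ==> (\<integral>\<^sup>+x. f (g + x) \<partial>\<mu>) = (\<integral>\<^sup>+x. f x \<partial>\<mu>)"
begin

lemma space_inv [simp]: "space \<mu> = UNIV"
  using sets_eq_imp_space_eq[OF sets_inv] by simp

lemma AE_ex: "AE x in \<mu>. P x ==> \<exists>x. P x"
proof (rule ccontr)
  assume "AE x in \<mu>. P x" "\<not> (\<exists>x. P x)"
  then have "AE x in \<mu>. False" by simp
  then show False using nonzero by (simp add: AE_iff_measurable[where N = UNIV])
qed

lemma finite_positive_set:
  obtains A where "A \<in> sets borel" "0 < emeasure \<mu> A" "emeasure \<mu> A < \<infinity>"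
proof -
  obtain A :: "nat => 'g set" where A: "range A \<subseteq> sets \<mu>" "(\<Union>i. A i) = space \<mu>" "\<And>i. emeasure \<mu> (A i) \<noteq> \<infinity>"
    using sigma_finite by blast
  have "\<exists>i. emeasure \<mu> (A i) \<noteq> 0"
  proof (rule ccontr)
    assume "\<not> ?thesis"
    then have "\<And>i. A i \<in> null_sets \<mu>" using A(1) by (auto simp: null_sets_def)
    then have "(\<Union>i. A i) \<in> null_sets \<mu>" by (rule null_sets_UN)
    then show False using A(2) nonzero by (simp add: null_sets_def)
  qed
  then obtain i where "emeasure \<mu> (A i) \<noteq> 0" by blast
  then show ?thesis using that[of "A i"] A(1,3) by (auto simp: less_top zero_less_iff_neq_zero)
qed

text \<open>Integrate the indicator of N at -x + y over x and y. Left invariance in y makes the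
  double integral zero, so for some y the x-integral vanishes, and translating x by this y leaves
  the indicator at -x. Taking a second measure for x gives absolute continuity of one invariant
  measure with respect to another.\<close>

lemma null_inverse:
  assumes \<nu>: "invariant \<nu>" and N: "N \<in> sets borel" "emeasure \<mu> N = 0"
  shows "emeasure \<nu> (uminus -` N) = 0"
proof -
  interpret \<nu>: invariant \<nu> by (rule \<nu>)
  interpret P: pair_sigma_finite \<nu> \<mu> ..
  note [measurable] = N(1)
  have m: "(\<lambda>p. indicator N (- fst p + snd p) :: ennreal) \<in> borel_measurable (\<nu> \<Otimes>\<^sub>M \<mu>)" by measurable
  have "(\<integral>\<^sup>+y. \<integral>\<^sup>+x. indicator N (- x + y) \<partial>\<nu> \<partial>\<mu>) = (\<integral>\<^sup>+x. \<integral>\<^sup>+y. indicator N (- x + y) \<partial>\<mu> \<partial>\<nu>)"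
    using P.Fubini[OF m] by simp
  also have "... = (\<integral>\<^sup>+x. (\<integral>\<^sup>+y. indicator N y \<partial>\<mu>) \<partial>\<nu>)"
    by (intro nn_integral_cong nn_translate) measurable
  also have "... = 0" using N by simp
  finally have "(\<integral>\<^sup>+y. \<integral>\<^sup>+x. indicator N (- x + y) \<partial>\<nu> \<partial>\<mu>) = 0" .
  moreover have "(\<lambda>y. \<integral>\<^sup>+x. indicator N (- x + y) \<partial>\<nu>) \<in> borel_measurable \<mu>" by measurable
  ultimately have "AE y in \<mu>. (\<integral>\<^sup>+x. indicator N (- x + y) \<partial>\<nu>) = 0"
    by (simp add: nn_integral_0_iff_AE)
  then obtain y where y: "(\<integral>\<^sup>+x. indicator N (- x + y) \<partial>\<nu>) = 0" using AE_ex by blast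
  have "(\<integral>\<^sup>+x. indicator N (- (y + x) + y) \<partial>\<nu>) = (\<integral>\<^sup>+x. indicator N (- x + y) \<partial>\<nu>)"
    by (rule \<nu>.nn_translate[where f = "\<lambda>x. indicator N (- x + y)"]) measurable
  then have "(\<integral>\<^sup>+x. indicator N (- x) \<partial>\<nu>) = 0"
    using y by (simp add: minus_add add.assoc)
  moreover have "(\<integral>\<^sup>+x. indicator N (- x) \<partial>\<nu>) = (\<integral>\<^sup>+x. indicator (uminus -` N) x \<partial>\<nu>)"
    by (intro nn_integral_cong) (auto simp: indicator_def)
  moreover have "uminus -` N \<in> sets \<nu>"
    using measurable_sets[of uminus borel borel N] N(1) by simp
  ultimately show ?thesis by simp
qed

text \<open>The density h of one measure with respect to the other is invariant under every left
  translation up to a null set. Fubini yields a point x0 with h (g + x0) = h x0 for almost all g. A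
  right translation need not preserve the measure, but inversion preserves null sets: inverting,
  translating on the left by x0 and inverting again shows that h is constant almost
  everywhere.\<close>

theorem unique:
  assumes \<nu>: "invariant \<nu>"
  obtains c :: real where "c > 0" "\<And>f. f \<in> borel_measurable borel ==> (\<integral>\<^sup>+x. f x \<partial>\<nu>) = ennreal c * (\<integral>\<^sup>+x. f x \<partial>\<mu>)"
proof -
  interpret \<nu>: invariant \<nu> by (rule \<nu>)
  interpret P: pair_sigma_finite \<mu> \<mu> ..
  have inv: "invariant \<mu>" by (rule invariant_axioms)
  have inv_set: "uminus -` N \<in> sets borel" if "N \<in> sets borel" for N :: "'g set"
    using measurable_sets[of uminus borel borel N] that by simp
  have "absolutely_continuous \<mu> \<nu>"
    unfolding absolutely_continuous_def
  proof
    fix N assume "N \<in> null_sets \<mu>"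
    then have N: "N \<in> sets borel" "emeasure \<mu> N = 0" by (auto simp: null_sets_def)
    have "emeasure \<nu> (uminus -` (uminus -` N)) = 0"
      by (rule null_inverse[OF \<nu> inv_set[OF N(1)] null_inverse[OF inv N]])
    then show "N \<in> null_sets \<nu>" using N(1) by (simp add: null_sets_def vimage_def)
  qed
  then obtain h where h [measurable]: "h \<in> borel_measurable \<mu>" and h_eq: "density \<mu> h = \<nu>"
    using Radon_Nikodym by (metis \<nu>.sets_inv sets_inv)
  have nn_h: "(\<integral>\<^sup>+x. f x \<partial>\<nu>) = (\<integral>\<^sup>+x. h x * f x \<partial>\<mu>)" if [measurable]: "f \<in> borel_measurable borel" for f
    unfolding h_eq[symmetric] by (rule nn_integral_density) measurable
  have "AE x in \<mu>. h (g + x) = h x" for g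
  proof -
    have "density \<mu> (\<lambda>x. h (g + x)) = density \<mu> h"
    proof (rule measure_eqI)
      fix A assume "A \<in> sets (density \<mu> (\<lambda>x. h (g + x)))"
      then have [measurable]: "A \<in> sets borel" by simp
      have "emeasure (density \<mu> (\<lambda>x. h (g + x))) A = (\<integral>\<^sup>+x. h (g + x) * indicator A x \<partial>\<mu>)"
        by (rule emeasure_density) measurable
      also have "... = (\<integral>\<^sup>+x. h (g + x) * indicator A (- g + (g + x)) \<partial>\<mu>)"
        by (simp add: add.assoc[symmetric])
      also have "... = (\<integral>\<^sup>+x. h x * indicator A (- g + x) \<partial>\<mu>)"
        by (rule nn_translate[where f = "\<lambda>x. h x * indicator A (- g + x)"]) measurable
      also have "... = (\<integral>\<^sup>+x. indicator A (- g + x) \<partial>\<nu>)" by (rule nn_h[symmetric]) measurable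
      also have "... = (\<integral>\<^sup>+x. indicator A x \<partial>\<nu>)" by (rule \<nu>.nn_translate) measurable
      finally show "emeasure (density \<mu> (\<lambda>x. h (g + x))) A = emeasure (density \<mu> h) A"
        by (simp add: h_eq)
    qed simp
    moreover have "sigma_finite_measure (density \<mu> h)" unfolding h_eq by (rule \<nu>.sigma_finite_measure_axioms)
    moreover have "(\<lambda>x. h (g + x)) \<in> borel_measurable \<mu>" by measurable
    ultimately show ?thesis
      using density_unique_iff[of "\<lambda>x. h (g + x)" h] h by simp
  qed
  then have "AE g in \<mu>. AE x in \<mu>. h (g + x) = h x" by simp
  then have "AE x in \<mu>. AE g in \<mu>. h (g + x) = h x"
    by (subst (asm) P.AE_commute) measurable
  then obtain x0 where x0: "AE g in \<mu>. h (g + x0) = h x0" using AE_ex by blast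
  define N where "N = {x. h x \<noteq> h x0}"
  have N [measurable]: "N \<in> sets borel" unfolding N_def by measurable
  have "{g. g + x0 \<in> N} \<in> sets borel" by measurable
  then have "emeasure \<mu> {g. g + x0 \<in> N} = 0"
    using x0 by (subst (asm) AE_iff_measurable[where N = "{g. g + x0 \<in> N}"]) (auto simp: N_def)
  from null_inverse[OF inv \<open>{g. g + x0 \<in> N} \<in> sets borel\<close> this]
  have "emeasure \<mu> (uminus -` {g. g + x0 \<in> N}) = 0" .
  moreover have "uminus -` {g. g + x0 \<in> N} \<in> sets \<mu>" using inv_set[of "{g. g + x0 \<in> N}"] by simp
  ultimately have "(\<integral>\<^sup>+x. indicator N (- x + x0) \<partial>\<mu>) = 0"
    by (subst nn_integral_cong[where v = "indicator (uminus -` {g. g + x0 \<in> N})"])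
      (auto simp: indicator_def)
  moreover have "(\<integral>\<^sup>+x. indicator N (- (x0 + x) + x0) \<partial>\<mu>) = (\<integral>\<^sup>+x. indicator N (- x + x0) \<partial>\<mu>)"
    by (rule nn_translate[where f = "\<lambda>x. indicator N (- x + x0)"]) measurable
  ultimately have "(\<integral>\<^sup>+x. indicator N (- x) \<partial>\<mu>) = 0"
    by (simp add: minus_add add.assoc)
  then have "emeasure \<mu> (uminus -` N) = 0"
    using inv_set[OF N]
    by (subst (asm) nn_integral_cong[where v = "indicator (uminus -` N)"]) (auto simp: indicator_def)
  then have "emeasure \<mu> (uminus -` (uminus -` N)) = 0"
    by (rule null_inverse[OF inv inv_set[OF N]])
  then have "emeasure \<mu> N = 0" by (simp add: vimage_def)
  then have AE_h: "AE x in \<mu>. h x = h x0"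
    using N by (subst AE_iff_measurable[where N = N]) (auto simp: N_def)
  have nn: "(\<integral>\<^sup>+x. f x \<partial>\<nu>) = h x0 * (\<integral>\<^sup>+x. f x \<partial>\<mu>)" if [measurable]: "f \<in> borel_measurable borel" for f
  proof -
    have "(\<integral>\<^sup>+x. f x \<partial>\<nu>) = (\<integral>\<^sup>+x. h x0 * f x \<partial>\<mu>)"
      unfolding nn_h[OF that] by (rule nn_integral_cong_AE) (use AE_h in auto)
    then show ?thesis by (simp add: nn_integral_cmult)
  qed
  have ne0: "h x0 \<noteq> 0"
    using nn[of "\<lambda>_. 1"] \<nu>.nonzero by auto
  obtain A where A: "A \<in> sets borel" "0 < emeasure \<nu> A" "emeasure \<nu> A < \<infinity>"
    by (rule \<nu>.finite_positive_set)
  have "emeasure \<nu> A = h x0 * emeasure \<mu> A"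
    using nn[of "indicator A"] A(1) by simp
  then have "h x0 \<noteq> \<infinity>" using A(2,3) by (auto simp: ennreal_top_mult split: if_splits)
  then have "h x0 = ennreal (enn2real (h x0))" "enn2real (h x0) > 0"
    using ne0 by (auto simp: less_top enn2real_positive_iff zero_less_iff_neq_zero)
  then show ?thesis using that[of "enn2real (h x0)"] nn by metis
qed

text \<open>Serves \<open>modular_fun\<close> and \<open>act_modulus\<close> alike. The push-forward
  along T is again invariant, hence a multiple a of \<mu>, and the described constant is the inverse
  of a.\<close>

lemma modulus_THE:
  fixes T T' :: "'g => 'g"
  assumes T [measurable]: "T \<in> borel_measurable borel" and T' [measurable]: "T' \<in> borel_measurable borel"
    and inverse: "\<And>x. T' (T x) = x"
    and equivariant: "\<And>g f. f \<in> borel_measurable borel ==> (\<integral>\<^sup>+x. f (g + T x) \<partial>\<mu>) = (\<integral>\<^sup>+x. f (T x) \<partial>\<mu>)"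
  defines "c \<equiv> THE c. 0 < c \<and> (\<forall>f\<in>borel_measurable borel.
     (\<integral>\<^sup>+x. f (T x) \<partial>\<mu>) = ennreal (inverse c) * (\<integral>\<^sup>+x. f x \<partial>\<mu>))"
  shows "0 < c" "f \<in> borel_measurable borel ==> (\<integral>\<^sup>+x. f (T x) \<partial>\<mu>) = ennreal (inverse c) * (\<integral>\<^sup>+x. f x \<partial>\<mu>)"
proof -
  let ?\<nu> = "distr \<mu> borel T"
  have nn: "(\<integral>\<^sup>+x. f x \<partial>?\<nu>) = (\<integral>\<^sup>+x. f (T x) \<partial>\<mu>)" if [measurable]: "f \<in> borel_measurable borel" for f
    by (rule nn_integral_distr) measurable
  have "sigma_finite_measure ?\<nu>"
  proof -
    obtain A :: "nat => 'g set" where A: "range A \<subseteq> sets \<mu>" "(\<Union>i. A i) = space \<mu>" "\<And>i. emeasure \<mu> (A i) \<noteq> \<infinity>"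
      using sigma_finite by blast
    have m: "T' -` A i \<in> sets borel" for i
      using measurable_sets[OF T', of "A i"] A(1) by auto
    show ?thesis
    proof (rule sigma_finite_measure.intro, rule exI[of _ "range (\<lambda>i. T' -` A i)"], intro conjI ballI)
      show "\<Union> (range (\<lambda>i. T' -` A i)) = space ?\<nu>" using A(2) by (simp add: vimage_Union[symmetric] vimage_UN[symmetric])
      fix a assume "a \<in> range (\<lambda>i. T' -` A i)"
      then obtain i where i: "a = T' -` A i" by blast
      have "emeasure ?\<nu> a = emeasure \<mu> (T -` a \<inter> space \<mu>)"
        unfolding i by (rule emeasure_distr) (use m in auto)
      also have "T -` a \<inter> space \<mu> = A i" by (auto simp: i inverse)
      finally show "emeasure ?\<nu> a \<noteq> \<infinity>" using A(3) by simp
    qed (use m in auto)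
  qed
  then have "invariant ?\<nu>"
  proof (rule invariant.intro, unfold_locales)
    show "emeasure ?\<nu> UNIV \<noteq> 0" using nonzero by (simp add: emeasure_distr)
    fix f :: "'g => ennreal" and g assume [measurable]: "f \<in> borel_measurable borel"
    show "(\<integral>\<^sup>+x. f (g + x) \<partial>?\<nu>) = (\<integral>\<^sup>+x. f x \<partial>?\<nu>)"
      by (simp add: nn equivariant)
  qed simp
  then obtain a :: real where a: "a > 0" "\<And>f. f \<in> borel_measurable borel ==> (\<integral>\<^sup>+x. f x \<partial>?\<nu>) = ennreal a * (\<integral>\<^sup>+x. f x \<partial>\<mu>)"
    using unique by metis
  have ex: "0 < inverse a \<and> (\<forall>f\<in>borel_measurable borel. (\<integral>\<^sup>+x. f (T x) \<partial>\<mu>) = ennreal (inverse (inverse a)) * (\<integral>\<^sup>+x. f x \<partial>\<mu>))"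
    using a nn by simp
  have "c = inverse a"
    unfolding c_def
  proof (rule the_equality)
    show "0 < inverse a \<and> (\<forall>f\<in>borel_measurable borel. (\<integral>\<^sup>+x. f (T x) \<partial>\<mu>) = ennreal (inverse (inverse a)) * (\<integral>\<^sup>+x. f x \<partial>\<mu>))"
      by (rule ex)
    fix c' assume c': "0 < c' \<and> (\<forall>f\<in>borel_measurable borel. (\<integral>\<^sup>+x. f (T x) \<partial>\<mu>) = ennreal (inverse c') * (\<integral>\<^sup>+x. f x \<partial>\<mu>))"
    obtain A where A: "A \<in> sets borel" "0 < emeasure \<mu> A" "emeasure \<mu> A < \<infinity>" by (rule finite_positive_set)
    have "ennreal (inverse c') * emeasure \<mu> A = ennreal (inverse (inverse a)) * emeasure \<mu> A"
      using c' ex A(1) borel_measurable_indicator[OF A(1), where 'b = ennreal]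
      by (metis (no_types, lifting) nn_integral_indicator sets_inv)
    then have "ennreal (inverse c') = ennreal (inverse (inverse a))"
      using A(2,3) by (auto simp: mult.commute[of _ "emeasure \<mu> A"] ennreal_mult_cancel_left)
    then have "inverse c' = a" using c' a(1) by (simp add: ennreal_inj)
    then show "c' = inverse a" by (metis inverse_inverse_eq)
  qed
  then show "0 < c" "f \<in> borel_measurable borel ==> (\<integral>\<^sup>+x. f (T x) \<partial>\<mu>) = ennreal (inverse c) * (\<integral>\<^sup>+x. f x \<partial>\<mu>)"
    using ex by auto
qed

lemma modulus_unique:
  assumes "\<And>f. f \<in> borel_measurable borel ==> ennreal a * (\<integral>\<^sup>+x. f x \<partial>\<mu>) = ennreal b * (\<integral>\<^sup>+x. f x \<partial>\<mu>)"
    "a \<ge> 0" "b \<ge> 0"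
  shows "a = b"
proof -
  obtain A where A: "A \<in> sets borel" "0 < emeasure \<mu> A" "emeasure \<mu> A < \<infinity>" by (rule finite_positive_set)
  have "ennreal a * emeasure \<mu> A = ennreal b * emeasure \<mu> A"
    using assms(1)[of "indicator A"] A(1) by simp
  then have "ennreal a = ennreal b" using A(2,3) by (auto simp: mult.commute[of _ "emeasure \<mu> A"] ennreal_mult_cancel_left)
  then show ?thesis using assms(2,3) by (simp add: ennreal_inj)
qed

section \<open>The modular function and integration under inversion\<close>

lemma modular_fun:
  shows modular_pos: "0 < modular_fun \<mu> p"
    and nn_right_translate:
      "f \<in> borel_measurable borel ==> (\<integral>\<^sup>+x. f (x + p) \<partial>\<mu>) = ennreal (inverse (modular_fun \<mu> p)) * (\<integral>\<^sup>+x. f x \<partial>\<mu>)"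
proof -
  have m: "(\<lambda>x. x + p) \<in> borel_measurable borel" "(\<lambda>x. x + - p) \<in> borel_measurable borel" by measurable
  have inv: "x + p + - p = x" for x by (simp add: add.assoc)
  have eqv: "(\<integral>\<^sup>+x. f (g + (x + p)) \<partial>\<mu>) = (\<integral>\<^sup>+x. f (x + p) \<partial>\<mu>)" if [measurable]: "f \<in> borel_measurable borel" for f :: "'g => ennreal" and g
    using nn_translate[of "\<lambda>x. f (x + p)" g] by (simp add: add.assoc)
  show "0 < modular_fun \<mu> p"
    unfolding modular_fun_def by (rule modulus_THE(1)[OF m inv eqv])
  show "f \<in> borel_measurable borel ==> (\<integral>\<^sup>+x. f (x + p) \<partial>\<mu>) = ennreal (inverse (modular_fun \<mu> p)) * (\<integral>\<^sup>+x. f x \<partial>\<mu>)"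
    unfolding modular_fun_def by (rule modulus_THE(2)[OF m inv eqv])
qed

lemma modular_add: "modular_fun \<mu> (p + q) = modular_fun \<mu> p * modular_fun \<mu> q"
proof -
  have "inverse (modular_fun \<mu> (p + q)) = inverse (modular_fun \<mu> p) * inverse (modular_fun \<mu> q)"
  proof (rule modulus_unique)
    fix f :: "'g => ennreal" assume [measurable]: "f \<in> borel_measurable borel"
    have "(\<integral>\<^sup>+x. f (x + (p + q)) \<partial>\<mu>) = (\<integral>\<^sup>+x. (\<lambda>x. f (x + q)) (x + p) \<partial>\<mu>)" by (simp add: add.assoc)
    also have "... = ennreal (inverse (modular_fun \<mu> p)) * (\<integral>\<^sup>+x. f (x + q) \<partial>\<mu>)"
      by (rule nn_right_translate) measurable
    also have "... = ennreal (inverse (modular_fun \<mu> p)) * (ennreal (inverse (modular_fun \<mu> q)) * (\<integral>\<^sup>+x. f x \<partial>\<mu>))"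
      by (subst nn_right_translate) simp_all
    finally show "ennreal (inverse (modular_fun \<mu> (p + q))) * (\<integral>\<^sup>+x. f x \<partial>\<mu>)
        = ennreal (inverse (modular_fun \<mu> p) * inverse (modular_fun \<mu> q)) * (\<integral>\<^sup>+x. f x \<partial>\<mu>)"
      using nn_right_translate[of f "p + q"] modular_pos[of p] modular_pos[of q]
      by (simp add: ennreal_mult mult.assoc less_imp_le)
  qed (use modular_pos[of p] modular_pos[of q] modular_pos[of "p + q"] in \<open>auto intro: less_imp_le\<close>)
  then show ?thesis by (metis inverse_inverse_eq inverse_mult_distrib)
qed

lemma modular_uminus: "modular_fun \<mu> (- p) = inverse (modular_fun \<mu> p)"
proof -
  have "modular_fun \<mu> 0 * modular_fun \<mu> 0 = modular_fun \<mu> 0"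
    using modular_add[of 0 0] by simp
  then have one: "modular_fun \<mu> 0 = 1" using modular_pos[of 0] by simp
  have "modular_fun \<mu> p * modular_fun \<mu> (- p) = 1"
    using modular_add[of p "- p"] one by simp
  then show ?thesis using modular_pos[of p] by (simp add: field_simps)
qed

text \<open>Evaluating the defining relation on one set of finite positive measure writes the
  function as a parameter integral, which depends measurably on the parameter.\<close>

lemma modular_measurable [measurable]: "modular_fun \<mu> \<in> borel_measurable borel"
proof -
  obtain A where A: "A \<in> sets borel" "0 < emeasure \<mu> A" "emeasure \<mu> A < \<infinity>" by (rule finite_positive_set)
  note [measurable] = A(1)
  have eq: "modular_fun \<mu> p = inverse (enn2real (\<integral>\<^sup>+x. indicator A (x + p) \<partial>\<mu>) / enn2real (emeasure \<mu> A))" for p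
  proof -
    have "(\<integral>\<^sup>+x. indicator A (x + p) \<partial>\<mu>) = ennreal (inverse (modular_fun \<mu> p)) * emeasure \<mu> A"
      using nn_right_translate[of "indicator A" p] A(1) by simp
    then have "enn2real (\<integral>\<^sup>+x. indicator A (x + p) \<partial>\<mu>) = inverse (modular_fun \<mu> p) * enn2real (emeasure \<mu> A)"
      using modular_pos[of p] by (simp add: enn2real_mult)
    moreover have "enn2real (emeasure \<mu> A) > 0" using A by (simp add: enn2real_positive_iff)
    ultimately show ?thesis by simp
  qed
  have "(\<lambda>p. inverse (enn2real (\<integral>\<^sup>+x. indicator A (x + p) \<partial>\<mu>) / enn2real (emeasure \<mu> A))) \<in> borel_measurable borel"
    by measurable
  then show ?thesis by (subst measurable_cong[OF eq])
qed

text \<open>Multiply by the measure of an auxiliary set A and write this measure as the modular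
  function at x times the integral of the indicator of A at y + x. Two exchanges of integration and
  two left translations separate the variables, and the measure of A cancels again.\<close>

lemma nn_inverse:
  assumes [measurable]: "f \<in> borel_measurable borel"
  shows "(\<integral>\<^sup>+x. f (- x) \<partial>\<mu>) = (\<integral>\<^sup>+x. f x * ennreal (inverse (modular_fun \<mu> x)) \<partial>\<mu>)"
proof -
  interpret P: pair_sigma_finite \<mu> \<mu> ..
  obtain A where A: "A \<in> sets borel" "0 < emeasure \<mu> A" "emeasure \<mu> A < \<infinity>" by (rule finite_positive_set)
  note [measurable] = A(1)
  let ?D = "\<lambda>x. ennreal (modular_fun \<mu> x)"
  have cancel: "?D x * ennreal (inverse (modular_fun \<mu> x)) = 1" for x
    using modular_pos[of x] by (simp flip: ennreal_mult)
  have "(\<integral>\<^sup>+x. f (- x) \<partial>\<mu>) * emeasure \<mu> A = (\<integral>\<^sup>+x. f (- x) * emeasure \<mu> A \<partial>\<mu>)"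
    by (simp add: nn_integral_multc)
  also have "... = (\<integral>\<^sup>+x. \<integral>\<^sup>+y. f (- x) * ?D x * indicator A (y + x) \<partial>\<mu> \<partial>\<mu>)"
  proof (rule nn_integral_cong)
    fix x
    have "(\<integral>\<^sup>+y. f (- x) * ?D x * indicator A (y + x) \<partial>\<mu>) = f (- x) * ?D x * (\<integral>\<^sup>+y. indicator A (y + x) \<partial>\<mu>)"
      by (rule nn_integral_cmult) measurable
    also have "(\<integral>\<^sup>+y. indicator A (y + x) \<partial>\<mu>) = ennreal (inverse (modular_fun \<mu> x)) * emeasure \<mu> A"
      using nn_right_translate[of "indicator A" x] A(1) by simp
    finally show "f (- x) * emeasure \<mu> A = (\<integral>\<^sup>+y. f (- x) * ?D x * indicator A (y + x) \<partial>\<mu>)"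
      using cancel[of x] by (metis (no_types, lifting) mult.assoc mult.right_neutral)
  qed
  also have "... = (\<integral>\<^sup>+y. \<integral>\<^sup>+x. f (- x) * ?D x * indicator A (y + x) \<partial>\<mu> \<partial>\<mu>)"
    by (rule P.Fubini'[symmetric]) measurable
  also have "... = (\<integral>\<^sup>+y. \<integral>\<^sup>+x. f (- x + y) * ?D (- y + x) * indicator A x \<partial>\<mu> \<partial>\<mu>)"
  proof (rule nn_integral_cong)
    fix y
    have "(\<integral>\<^sup>+x. f (- (y + x) + y) * ?D (- y + (y + x)) * indicator A (y + x) \<partial>\<mu>)
        = (\<integral>\<^sup>+x. f (- x + y) * ?D (- y + x) * indicator A x \<partial>\<mu>)"
      by (rule nn_translate[where f = "\<lambda>x. f (- x + y) * ?D (- y + x) * indicator A x"]) measurable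
    moreover have "- (y + x) + y = - x" "- y + (y + x) = x" for x
      by (simp_all add: minus_add add.assoc flip: add.assoc[of "- y" y] add.assoc[of "- x" x])
    ultimately show "(\<integral>\<^sup>+x. f (- x) * ?D x * indicator A (y + x) \<partial>\<mu>)
        = (\<integral>\<^sup>+x. f (- x + y) * ?D (- y + x) * indicator A x \<partial>\<mu>)" by simp
  qed
  also have "... = (\<integral>\<^sup>+x. \<integral>\<^sup>+y. f (- x + y) * ?D (- y + x) * indicator A x \<partial>\<mu> \<partial>\<mu>)"
    by (rule P.Fubini') measurable
  also have "... = (\<integral>\<^sup>+x. \<integral>\<^sup>+y. f y * ?D (- y) * indicator A x \<partial>\<mu> \<partial>\<mu>)"
  proof (rule nn_integral_cong)
    fix x
    have "(\<integral>\<^sup>+y. f (- x + (x + y)) * ?D (- (x + y) + x) * indicator A x \<partial>\<mu>)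
        = (\<integral>\<^sup>+y. f (- x + y) * ?D (- y + x) * indicator A x \<partial>\<mu>)"
      by (rule nn_translate[where f = "\<lambda>y. f (- x + y) * ?D (- y + x) * indicator A x"]) measurable
    moreover have "- x + (x + y) = y" "- (x + y) + x = - y" for y
      by (simp_all add: minus_add add.assoc flip: add.assoc[of "- y" y] add.assoc[of "- x" x])
    ultimately show "(\<integral>\<^sup>+y. f (- x + y) * ?D (- y + x) * indicator A x \<partial>\<mu>)
        = (\<integral>\<^sup>+y. f y * ?D (- y) * indicator A x \<partial>\<mu>)" by simp
  qed
  also have "... = (\<integral>\<^sup>+y. f y * ?D (- y) \<partial>\<mu>) * emeasure \<mu> A"
    by (simp add: nn_integral_multc nn_integral_cmult)
  finally have "(\<integral>\<^sup>+x. f (- x) \<partial>\<mu>) = (\<integral>\<^sup>+y. f y * ?D (- y) \<partial>\<mu>)"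
    using A(2,3) by (auto simp: mult.commute[of _ "emeasure \<mu> A"] ennreal_mult_cancel_left)
  then show ?thesis by (simp add: modular_uminus)
qed

end

lemma invariant_left_haar:
  fixes \<mu> :: "'g::{topological_group_add, second_countable_topology, t2_space} measure"
  assumes "locally compact (UNIV :: 'g set)" "left_haar \<mu>"
  shows "invariant \<mu>"
  using left_haar_invariant[OF assms]
  by (intro invariant.intro invariant_axioms.intro) (auto simp: invariant_measure_def)

subsection \<open>Actions by automorphisms\<close>

locale haar_action = Q: invariant \<mu> + V: invariant \<nu>
  for \<mu> :: "'q::{topological_group_add, second_countable_topology, t2_space} measure"
    and \<nu> :: "'v::{topological_ab_group_add, second_countable_topology, t2_space} measure" +
  fixes act :: "'q => 'v => 'v"
  assumes action: "continuous_group_action act"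
begin

abbreviation "iV q \<equiv> ennreal (inverse (act_modulus \<nu> act q))"
abbreviation "modV \<equiv> act_modulus \<nu> act"
abbreviation "modQ \<equiv> modular_fun \<mu>"

lemma act_zero: "act 0 v = v"
  and act_add_left: "act (p + q) v = act p (act q v)"
  and act_add_right: "act q (v + w) = act q v + act q w"
proof -
  note a = action[unfolded continuous_group_action_def]
  show "act 0 v = v" by (rule conjunct1[OF a, THEN spec])
  show "act (p + q) v = act p (act q v)" by (rule a[THEN conjunct2, THEN conjunct1, THEN spec, THEN spec, THEN spec])
  show "act q (v + w) = act q v + act q w"
    by (rule a[THEN conjunct2, THEN conjunct2, THEN conjunct1, THEN spec, THEN spec, THEN spec])
qed

lemmas act_simps = act_zero act_add_left act_add_right

lemma act_minus: "act (- q) (act q v) = v" "act q (act (- q) v) = v"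
  by (simp_all add: act_zero act_add_left[symmetric])

lemma act_measurable [measurable]:
  assumes [measurable]: "f \<in> borel_measurable M" "g \<in> borel_measurable M"
  shows "(\<lambda>x. act (f x) (g x)) \<in> borel_measurable M"
  by (rule borel_measurable_continuous_Pair[OF assms])
    (use action in \<open>simp add: continuous_group_action_def split_def\<close>)

text \<open>Translation by g after \<open>act q\<close> equals \<open>act q\<close> after
  translation by \<open>act (- q) g\<close>, which is the equivariance that
  \<open>modulus_THE\<close> asks for.\<close>

lemma act_modulus:
  shows modV_pos: "0 < modV q"
    and nn_act: "f \<in> borel_measurable borel ==> (\<integral>\<^sup>+v. f (act q v) \<partial>\<nu>) = iV q * (\<integral>\<^sup>+v. f v \<partial>\<nu>)"
proof -
  have m: "act q \<in> borel_measurable borel" "act (- q) \<in> borel_measurable borel" by measurable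
  have eqv: "(\<integral>\<^sup>+v. f (g + act q v) \<partial>\<nu>) = (\<integral>\<^sup>+v. f (act q v) \<partial>\<nu>)" if [measurable]: "f \<in> borel_measurable borel" for f :: "'v => ennreal" and g
  proof -
    have "(\<integral>\<^sup>+v. f (act q (act (- q) g + v)) \<partial>\<nu>) = (\<integral>\<^sup>+v. f (act q v) \<partial>\<nu>)"
      by (rule V.nn_translate) measurable
    then show ?thesis by (simp add: act_add_right act_minus)
  qed
  show "0 < modV q"
    unfolding act_modulus_def by (rule V.modulus_THE(1)[OF m act_minus(1) eqv])
  show "f \<in> borel_measurable borel ==> (\<integral>\<^sup>+v. f (act q v) \<partial>\<nu>) = iV q * (\<integral>\<^sup>+v. f v \<partial>\<nu>)"
    unfolding act_modulus_def by (rule V.modulus_THE(2)[OF m act_minus(1) eqv])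
qed

lemma modV_add: "modV (p + q) = modV p * modV q"
proof -
  have "inverse (modV (p + q)) = inverse (modV p) * inverse (modV q)"
  proof (rule V.modulus_unique)
    fix f :: "'v => ennreal" assume [measurable]: "f \<in> borel_measurable borel"
    have "(\<integral>\<^sup>+v. f (act (p + q) v) \<partial>\<nu>) = (\<integral>\<^sup>+v. (\<lambda>v. f (act p v)) (act q v) \<partial>\<nu>)" by (simp add: act_simps)
    also have "... = iV q * (\<integral>\<^sup>+v. f (act p v) \<partial>\<nu>)"
      by (rule nn_act) measurable
    also have "... = iV q * (iV p * (\<integral>\<^sup>+v. f v \<partial>\<nu>))"
      by (subst nn_act) simp_all
    finally show "ennreal (inverse (modV (p + q))) * (\<integral>\<^sup>+v. f v \<partial>\<nu>)
        = ennreal (inverse (modV p) * inverse (modV q)) * (\<integral>\<^sup>+v. f v \<partial>\<nu>)"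
      using nn_act[of f "p + q"] modV_pos[of p] modV_pos[of q]
      by (simp add: ennreal_mult mult_ac less_imp_le)
  qed (use modV_pos[of p] modV_pos[of q] modV_pos[of "p + q"] in \<open>auto intro: less_imp_le\<close>)
  then show ?thesis by (metis inverse_inverse_eq inverse_mult_distrib)
qed

lemma modV_uminus: "modV (- p) = inverse (modV p)"
proof -
  have "modV 0 * modV 0 = modV 0"
    using modV_add[of 0 0] by simp
  then have one: "modV 0 = 1" using modV_pos[of 0] by simp
  have "modV p * modV (- p) = 1"
    using modV_add[of p "- p"] one by simp
  then show ?thesis using modV_pos[of p] by (simp add: field_simps)
qed

lemma modV_measurable [measurable]: "modV \<in> borel_measurable borel"
proof -
  obtain A where A: "A \<in> sets borel" "0 < emeasure \<nu> A" "emeasure \<nu> A < \<infinity>" by (rule V.finite_positive_set)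
  note [measurable] = A(1)
  have eq: "modV p = inverse (enn2real (\<integral>\<^sup>+v. indicator A (act p v) \<partial>\<nu>) / enn2real (emeasure \<nu> A))" for p
  proof -
    have "(\<integral>\<^sup>+v. indicator A (act p v) \<partial>\<nu>) = iV p * emeasure \<nu> A"
      using nn_act[of "indicator A" p] A(1) by simp
    then have "enn2real (\<integral>\<^sup>+v. indicator A (act p v) \<partial>\<nu>) = inverse (modV p) * enn2real (emeasure \<nu> A)"
      using modV_pos[of p] by (simp add: enn2real_mult)
    moreover have "enn2real (emeasure \<nu> A) > 0" using A by (simp add: enn2real_positive_iff)
    ultimately show ?thesis by simp
  qed
  have "(\<lambda>p. inverse (enn2real (\<integral>\<^sup>+v. indicator A (act p v) \<partial>\<nu>) / enn2real (emeasure \<nu> A))) \<in> borel_measurable borel"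
    by measurable
  then show ?thesis by (subst measurable_cong[OF eq])
qed

lemma duflo_moore:
  shows "0 < duflo_moore_density act \<mu> \<nu> q"
    and "duflo_moore_density act \<mu> \<nu> \<in> borel_measurable borel"
  using modV_pos[of q] Q.modular_pos[of q]
  by (auto simp: duflo_moore_density_def[abs_def])

end

section \<open>Functions with vanishing integrals\<close>

text \<open>Real and imaginary parts are separately densities with the same integrals as
  zero.\<close>

lemma AE_zero_of_set_integrals:
  fixes f :: "'a => complex"
  assumes f: "integrable M f" and zero: "\<And>B. B \<in> sets M ==> (LINT x:B|M. f x) = 0"
  shows "AE x in M. f x = 0"
proof -
  have int: "integrable M (\<lambda>x. indicator B x *\<^sub>R f x)" if "B \<in> sets M" for B
    using integrable_mult_indicator[OF that f] .
  have "(LINT x:B|M. Re (f x)) = (LINT x:B|M. 0)" if B: "B \<in> sets M" for B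
  proof -
    have "(LINT x:B|M. Re (f x)) = Re (LINT x:B|M. f x)"
      unfolding set_lebesgue_integral_def integral_Re[OF int[OF B], symmetric] by simp
    then show ?thesis using zero[OF B] by (simp add: set_lebesgue_integral_def)
  qed
  then have re: "AE x in M. Re (f x) = 0"
    using density_unique_real[of M "\<lambda>x. Re (f x)" "\<lambda>_. 0"] f by simp
  have "(LINT x:B|M. Im (f x)) = (LINT x:B|M. 0)" if B: "B \<in> sets M" for B
  proof -
    have "(LINT x:B|M. Im (f x)) = Im (LINT x:B|M. f x)"
      unfolding set_lebesgue_integral_def integral_Im[OF int[OF B], symmetric] by simp
    then show ?thesis using zero[OF B] by (simp add: set_lebesgue_integral_def)
  qed
  then have im: "AE x in M. Im (f x) = 0"
    using density_unique_real[of M "\<lambda>x. Im (f x)" "\<lambda>_. 0"] f by simp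
  show ?thesis using re im by eventually_elim (simp add: complex_eq_iff)
qed

text \<open>Integrability is required on each member of G only, since the functions to be tested are
  not globally integrable. For fixed A in G, the sets B on which the integral of g over A and B
  vanishes are handled by Dynkin induction, with B \<inter> A in G as the starting case. The
  countable cover glues the results.\<close>

lemma AE_zero_of_pi_system:
  fixes g :: "'a => complex"
  assumes gen: "sets M = sigma_sets (space M) G" and G: "Int_stable G"
    and cover: "countable C" "C \<subseteq> G" "\<Union>C = space M"
    and int: "\<And>A. A \<in> G ==> set_integrable M A g"
    and zero: "\<And>A. A \<in> G ==> (LINT x:A|M. g x) = 0"
  shows "AE x in M. g x = 0"
proof -
  have GM: "G \<subseteq> sets M" unfolding gen by (rule sigma_sets.Basic[THEN subsetI])
  then have GP: "G \<subseteq> Pow (space M)" using sets.sets_into_space by blast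
  have "AE x in M. indicator A x *\<^sub>R g x = 0" if A: "A \<in> G" for A
  proof (rule AE_zero_of_set_integrals)
    define f where "f x = indicator A x *\<^sub>R g x" for x
    show f: "integrable M (\<lambda>x. indicator A x *\<^sub>R g x)"
      using int[OF A] by (simp add: set_integrable_def)
    then have f': "integrable M f" by (simp add: f_def[abs_def])
    have fB: "integrable M (\<lambda>x. indicator B x *\<^sub>R f x)" if "B \<in> sets M" for B
      using integrable_mult_indicator[OF that f'] .
    fix B assume "B \<in> sets M"
    then have "B \<in> sigma_sets (space M) G" by (simp add: gen)
    from G GP this have "(LINT x:B|M. f x) = 0"
    proof (induction rule: sigma_sets_induct_disjoint)
      case (basic B)
      have "(LINT x:B|M. f x) = (LINT x:B \<inter> A|M. g x)"
        unfolding set_lebesgue_integral_def f_def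
        by (intro int_cong) (auto simp: indicator_def)
      then show ?case using zero[OF Int_stableD[OF G basic A]] by simp
    next
      case empty show ?case by (simp add: set_lebesgue_integral_def)
    next
      case (compl B)
      then have B: "B \<in> sets M" by (simp add: gen)
      have "(LINT x:space M - B|M. f x) = (\<integral>x. f x - indicator B x *\<^sub>R f x \<partial>M)"
        unfolding set_lebesgue_integral_def
        by (intro int_cong) (auto simp: indicator_def)
      also have "... = (\<integral>x. f x \<partial>M) - (\<integral>x. indicator B x *\<^sub>R f x \<partial>M)"
        by (rule Bochner_Integration.integral_diff[OF f' fB[OF B]])
      also have "(\<integral>x. f x \<partial>M) = 0" using zero[OF A] by (simp add: set_lebesgue_integral_def f_def)
      finally show ?case using compl by (simp add: set_lebesgue_integral_def)
    next
      case (union B)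
      have B: "B i \<in> sets M" for i using union(2) by (auto simp: gen)
      have "(LINT x:(\<Union>i. B i)|M. f x) = (\<Sum>i. (LINT x:(B i)|M. f x))"
      proof (rule lebesgue_integral_countable_add)
        show "B i \<inter> B j = {}" if "i \<noteq> j" for i j
          using union(1) that by (auto simp: disjoint_family_on_def)
        show "set_integrable M (\<Union>i. B i) f"
          unfolding set_integrable_def by (rule fB) (use B in auto)
      qed (rule B)
      then show ?case using union(3) by simp
    qed
    then show "(LINT x:B|M. indicator A x *\<^sub>R g x) = 0" by (simp add: f_def)
  qed
  then have "AE x in M. \<forall>A\<in>C. indicator A x *\<^sub>R g x = 0"
    using cover(1,2) by (subst AE_ball_countable) auto
  then show ?thesis
  proof (rule AE_mp, intro AE_I2 impI)
    fix x assume x: "x \<in> space M" and z: "\<forall>A\<in>C. indicator A x *\<^sub>R g x = 0"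
    obtain A where "A \<in> C" "x \<in> A" using x cover(3) by blast
    then show "g x = 0" using bspec[OF z, of A] by simp
  qed
qed

text \<open>Sets of finite measure form a generating pi-system, because every measurable set is the
  countable union of its intersections with an exhausting sequence.\<close>

lemma AE_zero_sigma_finite:
  fixes g :: "'a => complex"
  assumes "sigma_finite_measure M"
    and int: "\<And>A. A \<in> sets M ==> emeasure M A < \<infinity> ==> set_integrable M A g"
    and zero: "\<And>A. A \<in> sets M ==> emeasure M A < \<infinity> ==> (LINT x:A|M. g x) = 0"
  shows "AE x in M. g x = 0"
proof -
  interpret sigma_finite_measure M by fact
  let ?G = "{A \<in> sets M. emeasure M A < \<infinity>}"
  obtain A :: "nat => 'a set" where A: "range A \<subseteq> sets M" "(\<Union>i. A i) = space M" "\<And>i. emeasure M (A i) \<noteq> \<infinity>"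
    using sigma_finite by blast
  show ?thesis
  proof (rule AE_zero_of_pi_system[where G = ?G and C = "range A"])
    show "sets M = sigma_sets (space M) ?G"
    proof
      show "sigma_sets (space M) ?G \<subseteq> sets M" by (rule sets.sigma_sets_subset) auto
      show "sets M \<subseteq> sigma_sets (space M) ?G"
      proof
        fix B assume B: "B \<in> sets M"
        have "B \<inter> A i \<in> ?G" for i
        proof -
          have "emeasure M (B \<inter> A i) \<le> emeasure M (A i)" using A(1) by (intro emeasure_mono) auto
          also have "... < \<infinity>" using A(3) by (simp add: less_top)
          finally show ?thesis using B A(1) by auto
        qed
        then have "(\<Union>i. B \<inter> A i) \<in> sigma_sets (space M) ?G"
          by (intro sigma_sets.Union sigma_sets.Basic)
        moreover have "(\<Union>i. B \<inter> A i) = B" using A(2) sets.sets_into_space[OF B] by auto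
        ultimately show "B \<in> sigma_sets (space M) ?G" by simp
      qed
    qed
    show "Int_stable ?G"
    proof (rule Int_stableI, intro CollectI conjI)
      fix a b assume ab: "a \<in> ?G" "b \<in> ?G"
      then show "a \<inter> b \<in> sets M" by auto
      have "emeasure M (a \<inter> b) \<le> emeasure M a" using ab by (intro emeasure_mono) auto
      then show "emeasure M (a \<inter> b) < \<infinity>" using ab le_less_trans by blast
    qed
    show "range A \<subseteq> ?G" using A(1,3) by (auto simp: less_top)
  qed (use A int zero in auto)
qed

text \<open>Cut the sets of \<open>compact_base\<close> by the levels w \<le> n. Intersections of
  cuts are cuts at the smaller level, and each original set is the union of its cuts, so the
  generated sigma-algebra does not change.\<close>

lemma weighted_base:
  fixes \<mu> :: "'g::{topological_group_add, second_countable_topology, t2_space} measure"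
  assumes lc: "locally compact (UNIV :: 'g set)" and haar: "left_haar \<mu>"
    and w: "w \<in> borel_measurable borel"
  obtains G :: "'g set set" where "countable G" "Int_stable G" "\<Union>G = UNIV"
    "\<And>A. A \<in> G ==> A \<in> sets borel" "\<And>A. A \<in> G ==> emeasure \<mu> A < \<infinity>"
    "\<And>A. A \<in> G ==> \<exists>n::nat. \<forall>x\<in>A. w x \<le> real n" "sets borel = sigma_sets UNIV G"
proof -
  have sets: "sets \<mu> = sets borel" and fin: "\<And>K. compact K ==> emeasure \<mu> K < \<infinity>"
    using haar by (auto simp: left_haar_def)
  have "\<exists>\<U> :: 'g set set. countable \<U> \<and> Int_stable \<U> \<and> \<Union>\<U> = UNIV \<and>
    (\<forall>U\<in>\<U>. open U \<and> emeasure \<mu> U < \<infinity>) \<and> sets borel = sigma_sets UNIV \<U>"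
  proof (rule compact_base[OF lc fin sets])
    fix \<U> :: "'g set set"
    assume "countable \<U>" "Int_stable \<U>" "\<Union>\<U> = UNIV"
      "\<And>U. U \<in> \<U> ==> open U \<and> emeasure \<mu> U < \<infinity>" "sets borel = sigma_sets UNIV \<U>"
    then show ?thesis by (intro exI[of _ \<U>] conjI ballI) simp_all
  qed
  then obtain \<U> :: "'g set set" where ex: "countable \<U> \<and> Int_stable \<U> \<and> \<Union>\<U> = UNIV \<and>
    (\<forall>U\<in>\<U>. open U \<and> emeasure \<mu> U < \<infinity>) \<and> sets borel = sigma_sets UNIV \<U>"
    by (elim exE)
  have \<U>: "countable \<U>" "Int_stable \<U>" "\<Union>\<U> = UNIV"
    "\<And>U. U \<in> \<U> ==> open U \<and> emeasure \<mu> U < \<infinity>" "sets borel = sigma_sets UNIV \<U>"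
    using ex by simp_all
  define g where "g = (\<lambda>(U, n::nat). U \<inter> {x. w x \<le> real n})"
  define G where "G = g ` (\<U> \<times> UNIV)"
  have wn: "{x. w x \<le> real n} \<in> sets borel" for n using w by measurable
  have G_ex: "\<exists>U n. U \<in> \<U> \<and> A = U \<inter> {x. w x \<le> real n}" if "A \<in> G" for A
    using that by (auto simp: G_def g_def)
  have c: "countable G" unfolding G_def using \<U>(1) by auto
  have GB: "A \<in> sets borel" if A: "A \<in> G" for A
  proof -
    obtain U n where "U \<in> \<U>" "A = U \<inter> {x. w x \<le> real n}" using G_ex[OF A] by (elim exE conjE)
    then show ?thesis using wn \<U>(4) borel_open by blast
  qed
  have Gfin: "emeasure \<mu> A < \<infinity>" if A: "A \<in> G" for A
  proof -
    obtain U n where U: "U \<in> \<U>" "A = U \<inter> {x. w x \<le> real n}" using G_ex[OF A] by (elim exE conjE)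
    have "emeasure \<mu> A \<le> emeasure \<mu> U" using U \<U>(4)[OF U(1)] by (intro emeasure_mono) (auto simp: sets)
    then show ?thesis using \<U>(4)[OF U(1)] le_less_trans by blast
  qed
  have Gw: "\<exists>n::nat. \<forall>x\<in>A. w x \<le> real n" if A: "A \<in> G" for A
  proof -
    obtain U n where "A = U \<inter> {x. w x \<le> real n}" using G_ex[OF A] by (elim exE conjE)
    then show ?thesis by (intro exI[of _ n]) simp
  qed
  have ist: "Int_stable G"
  proof (rule Int_stableI)
    fix A B assume "A \<in> G" "B \<in> G"
    from G_ex[OF this(1)] G_ex[OF this(2)] obtain U m V n
      where UV: "U \<in> \<U>" "A = U \<inter> {x. w x \<le> real m}" "V \<in> \<U>" "B = V \<inter> {x. w x \<le> real n}"
      by (elim exE conjE)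
    have "A \<inter> B = g (U \<inter> V, min m n)" using UV by (auto simp: g_def)
    then show "A \<inter> B \<in> G" unfolding G_def using Int_stableD[OF \<U>(2) UV(1,3)] by blast
  qed
  have Usub: "U = (\<Union>n. g (U, n))" for U
  proof
    show "U \<subseteq> (\<Union>n. g (U, n))"
    proof
      fix x assume "x \<in> U"
      obtain n where "w x \<le> real n" using real_arch_simple[of "w x"] by (elim exE)
      then have "x \<in> g (U, n)" using \<open>x \<in> U\<close> by (simp add: g_def)
      then show "x \<in> (\<Union>n. g (U, n))" by (rule UN_I[OF UNIV_I])
    qed
  qed (auto simp: g_def)
  have cov: "\<Union>G = UNIV"
  proof -
    have "x \<in> \<Union>G" for x
    proof -
      obtain U where U: "U \<in> \<U>" "x \<in> U" using \<U>(3) by (metis UNIV_I UnionE)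
      have "x \<in> (\<Union>n. g (U, n))" using U(2) Usub[of U] by simp
      then obtain n where "x \<in> g (U, n)" by (rule UN_E)
      moreover have "g (U, n) \<in> G" unfolding G_def using U(1) by simp
      ultimately show ?thesis by (rule UnionI[rotated])
    qed
    then show ?thesis by blast
  qed
  have gen: "sets borel = sigma_sets UNIV G"
  proof
    show "sigma_sets UNIV G \<subseteq> sets borel"
      using sets.sigma_sets_subset[of G borel] GB by auto
    have "\<U> \<subseteq> sigma_sets UNIV G"
    proof
      fix U assume "U \<in> \<U>"
      then have "g (U, n) \<in> sigma_sets UNIV G" for n by (intro sigma_sets.Basic) (auto simp: G_def)
      then have "(\<Union>n. g (U, n)) \<in> sigma_sets UNIV G" by (rule sigma_sets.Union)
      then show "U \<in> sigma_sets UNIV G" using Usub[of U] by simp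
    qed
    then show "sets borel \<subseteq> sigma_sets UNIV G" unfolding \<U>(5) by (rule sigma_sets_mono)
  qed
  show ?thesis by (rule that[OF c ist cov GB Gfin Gw gen])
qed

section \<open>The Fourier transform along the cocycle\<close>

text \<open>Uses the compact-open topology at a compact neighbourhood K of the second argument:
  mapping K into W is an open condition on the character. Joint continuity is what makes the pairing
  jointly measurable.\<close>

lemma continuous_pairing:
  fixes \<eta> :: "'q::topological_space => 'v::topological_ab_group_add pdual"
  assumes lc: "locally compact (UNIV :: 'v set)" and \<eta>: "continuous_on UNIV \<eta>"
  shows "continuous_on UNIV (\<lambda>p. pairing (\<eta> (fst p)) (snd p))"
  unfolding continuous_on_open_vimage[OF open_UNIV]
proof (intro allI impI)
  fix W :: "complex set" assume W: "open W"
  have "open ((\<lambda>p. pairing (\<eta> (fst p)) (snd p)) -` W)"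
  proof (rule open_prod_intro)
    fix p assume p: "p \<in> (\<lambda>p. pairing (\<eta> (fst p)) (snd p)) -` W"
    have "continuous_on UNIV (pairing (\<eta> (fst p)))"
      using is_character_pairing by (auto simp: is_character_def)
    then have op: "open (pairing (\<eta> (fst p)) -` W)"
      using W by (simp add: continuous_on_open_vimage)
    moreover have "snd p \<in> pairing (\<eta> (fst p)) -` W" using p by simp
    ultimately obtain u K where uK: "open u" "compact K" "snd p \<in> u" "u \<subseteq> K" "K \<subseteq> pairing (\<eta> (fst p)) -` W"
      using lc unfolding locally_def by (metis open_openin subtopology_UNIV topspace_euclidean)
    let ?N = "{\<xi>. pairing \<xi> ` K \<subseteq> W}"
    have "open ?N"
      unfolding open_pdual_def using uK(2) W by (intro generate_topology.Basis) blast
    then have "open (\<eta> -` ?N)" by (rule open_vimage[OF _ \<eta>])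
    moreover have "p \<in> (\<eta> -` ?N) \<times> u" using uK by (auto simp: mem_Times_iff)
    moreover have "(\<eta> -` ?N) \<times> u \<subseteq> (\<lambda>p. pairing (\<eta> (fst p)) (snd p)) -` W"
      using uK(4) by (auto simp: image_subset_iff)
    ultimately show "\<exists>A B. open A \<and> open B \<and> p \<in> A \<times> B \<and> A \<times> B \<subseteq> (\<lambda>p. pairing (\<eta> (fst p)) (snd p)) -` W"
      using uK(1) by blast
  qed
  then show "open ((\<lambda>p. pairing (\<eta> (fst p)) (snd p)) -` W \<inter> UNIV)" by simp
qed

lemma norm_pairing [simp]: "cmod (pairing \<xi> v) = 1"
  using is_character_pairing[of \<xi>] by (simp add: is_character_def)

locale fourier_setup = haar_action \<mu> \<nu> act
  for \<mu> :: "'q::{topological_group_add, second_countable_topology, t2_space} measure"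
    and \<nu> :: "'v::{topological_ab_group_add, second_countable_topology, t2_space} measure"
    and act :: "'q => 'v => 'v" +
  fixes \<sigma> :: "'v pdual measure" and \<eta> :: "'q => 'v pdual"
  assumes lcQ: "locally compact (UNIV :: 'q set)" and lcV: "locally compact (UNIV :: 'v set)"
    and eta: "\<eta> \<in> Z1c act"
    and haarQ: "left_haar \<mu>" and sets_sigma [measurable_cong, simp]: "sets \<sigma> = sets borel"
    and iso: "measure_class_iso \<mu> \<sigma> \<eta>"
    and normalized: "haar_normalized act \<eta> \<mu> \<nu> \<sigma>" and fourier: "fourier_unitary \<nu> \<sigma>"
begin

lemma space_sigma [simp]: "space \<sigma> = UNIV"
  using sets_eq_imp_space_eq[OF sets_sigma] by simp

lemma eta_continuous: "continuous_on UNIV \<eta>"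
  using eta by (simp add: Z1c_def)

lemma eta_measurable [measurable]: "\<eta> \<in> borel_measurable borel"
  by (rule borel_measurable_continuous_onI[OF eta_continuous])

lemma pairing_measurable [measurable]:
  assumes "f \<in> borel_measurable M" "g \<in> borel_measurable M"
  shows "(\<lambda>x. pairing (\<eta> (f x)) (g x)) \<in> borel_measurable M"
  by (rule borel_measurable_continuous_Pair[OF assms, where H = "\<lambda>z. pairing (\<eta> z)"])
    (rule continuous_pairing[OF lcV eta_continuous])

lemma cnj_measurable [measurable]:
  assumes "f \<in> borel_measurable M" shows "(\<lambda>x. cnj (f x)) \<in> borel_measurable M"
proof -
  have "continuous_on UNIV cnj" by (intro continuous_intros)
  then show ?thesis by (rule borel_measurable_continuous_on[OF _ assms])
qed

lemma nn_sigma: "f \<in> borel_measurable borel ==>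
    (\<integral>\<^sup>+\<xi>. f \<xi> \<partial>\<sigma>) = (\<integral>\<^sup>+q. f (\<eta> q) * iV q \<partial>\<mu>)"
  using normalized by (simp add: haar_normalized_def)

text \<open>The normalization is an equality of integrals of nonnegative functions. As an equality
  of measures it also applies to complex integrals.\<close>

lemma sigma_eq: "\<sigma> = distr (density \<mu> (\<lambda>q. iV q)) borel \<eta>"
proof (rule measure_eqI)
  fix A assume "A \<in> sets \<sigma>"
  then have [measurable]: "A \<in> sets borel" by simp
  have [measurable]: "\<eta> -` A \<in> sets borel" using measurable_sets[OF eta_measurable, of A] by simp
  have "emeasure \<sigma> A = (\<integral>\<^sup>+q. indicator A (\<eta> q) * iV q \<partial>\<mu>)"
    using nn_sigma[of "indicator A"] by simp
  also have "... = (\<integral>\<^sup>+q. iV q * indicator (\<eta> -` A) q \<partial>\<mu>)"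
    by (intro nn_integral_cong) (auto simp: indicator_def)
  also have "... = emeasure (distr (density \<mu> (\<lambda>q. iV q)) borel \<eta>) A"
    by (simp add: emeasure_distr emeasure_density)
  finally show "emeasure \<sigma> A = emeasure (distr (density \<mu> (\<lambda>q. iV q)) borel \<eta>) A" .
qed simp

lemma integral_sigma:
  fixes f :: "'v pdual => complex"
  assumes [measurable]: "f \<in> borel_measurable borel"
  shows "(\<integral>\<xi>. f \<xi> \<partial>\<sigma>) = (\<integral>q. inverse (modV q) *\<^sub>R f (\<eta> q) \<partial>\<mu>)"
proof -
  have "(\<integral>\<xi>. f \<xi> \<partial>\<sigma>) = (\<integral>q. f (\<eta> q) \<partial>(density \<mu> (\<lambda>q. iV q)))"
    by (subst sigma_eq, rule integral_distr) measurable
  also have "... = (\<integral>q. inverse (modV q) *\<^sub>R f (\<eta> q) \<partial>\<mu>)"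
    by (rule integral_density) (use modV_pos in \<open>auto intro: less_imp_le\<close>)
  finally show ?thesis .
qed

text \<open>Transport of h to the dual through the inverse of \<open>\<eta>\<close>, with value 0 on
  the exceptional null set. The factor \<open>modV\<close> cancels the density in the normalization,
  so that pairing with l over \<sigma> is pairing with h over \<mu>.\<close>

lemma lift_ex:
  fixes h :: "'q => complex"
  assumes [measurable]: "h \<in> borel_measurable borel"
  shows "\<exists>l. l \<in> borel_measurable borel \<and> (AE z in \<mu>. l (\<eta> z) = modV z *\<^sub>R h z)"
proof -
  obtain A B where A: "A \<in> null_sets \<mu>" and B: "B \<in> null_sets \<sigma>"
    and bij: "bij_betw \<eta> (space \<mu> - A) (space \<sigma> - B)"
    and inv: "the_inv_into (space \<mu> - A) \<eta>
       \<in> measurable (restrict_space \<sigma> (space \<sigma> - B)) (restrict_space \<mu> (space \<mu> - A))"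
    using iso unfolding measure_class_iso_def by blast
  let ?\<theta> = "the_inv_into (space \<mu> - A) \<eta>"
  let ?k = "\<lambda>z. modV z *\<^sub>R h z"
  have "?\<theta> \<in> measurable (restrict_space \<sigma> (space \<sigma> - B)) \<mu>"
    using inv measurable_restrict_space2_iff by blast
  then have "(\<lambda>\<xi>. ?k (?\<theta> \<xi>)) \<in> borel_measurable (restrict_space \<sigma> (space \<sigma> - B))"
    by (rule measurable_compose) measurable
  moreover have "(space \<sigma> - B) \<inter> space \<sigma> \<in> sets \<sigma>" using B by (auto simp: null_sets_def)
  ultimately have m: "(\<lambda>\<xi>. if \<xi> \<in> space \<sigma> - B then ?k (?\<theta> \<xi>) else 0) \<in> borel_measurable \<sigma>"
    by (subst (asm) measurable_restrict_space_iff) auto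
  have "AE z in \<mu>. z \<notin> A" by (rule AE_not_in[OF A])
  then have "AE z in \<mu>. (\<lambda>\<xi>. if \<xi> \<in> space \<sigma> - B then ?k (?\<theta> \<xi>) else 0) (\<eta> z) = ?k z"
  proof eventually_elim
    case (elim z)
    then have z: "z \<in> space \<mu> - A" by simp
    have "\<eta> z \<in> space \<sigma> - B" using bij z by (auto simp: bij_betw_def)
    moreover have "?\<theta> (\<eta> z) = z" using bij z by (intro the_inv_into_f_f) (auto simp: bij_betw_def)
    ultimately show ?case by simp
  qed
  then show ?thesis using m by (intro exI conjI) simp_all
qed

section \<open>Plancherel's theorem read along the cocycle\<close>

definition FU :: "('v => complex) set => ('v pdual => complex) set" where
  "FU = (SOME U. hunitary (L2 \<nu> \<C>) (L2 \<sigma> \<C>) U \<and>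
       (\<forall>f\<in>sqint \<nu> \<C>. integrable \<nu> f \<longrightarrow>
          fourier \<nu> f \<in> sqint \<sigma> \<C> \<and>
          U (L2_class \<nu> \<C> f) = L2_class \<sigma> \<C> (fourier \<nu> f)))"

lemma FU:
  shows FU_unitary: "hunitary (L2 \<nu> \<C>) (L2 \<sigma> \<C>) FU"
    and FU_fourier: "f \<in> sqint \<nu> \<C> ==> integrable \<nu> f ==>
      fourier \<nu> f \<in> sqint \<sigma> \<C> \<and>
      FU (L2_class \<nu> \<C> f) = L2_class \<sigma> \<C> (fourier \<nu> f)"
proof -
  have "hunitary (L2 \<nu> \<C>) (L2 \<sigma> \<C>) FU \<and>
       (\<forall>f\<in>sqint \<nu> \<C>. integrable \<nu> f \<longrightarrow>
          fourier \<nu> f \<in> sqint \<sigma> \<C> \<and>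
          FU (L2_class \<nu> \<C> f) = L2_class \<sigma> \<C> (fourier \<nu> f))"
    unfolding FU_def by (rule someI_ex[OF fourier[unfolded fourier_unitary_def]])
  then show "hunitary (L2 \<nu> \<C>) (L2 \<sigma> \<C>) FU"
    "f \<in> sqint \<nu> \<C> ==> integrable \<nu> f ==>
      fourier \<nu> f \<in> sqint \<sigma> \<C> \<and>
      FU (L2_class \<nu> \<C> f) = L2_class \<sigma> \<C> (fourier \<nu> f)"
    by blast+
qed

text \<open>The inverse Fourier transform of the function on the dual that corresponds to
  \<open>modV\<close> times h; the density in the normalization removes the factor again.\<close>

definition invF :: "('q => complex) => 'v => complex" where
  "invF h v = (\<integral>z. pairing (\<eta> z) v * h z \<partial>\<mu>)"

lemma invF_measurable:
  assumes [measurable]: "h \<in> borel_measurable borel" shows "invF h \<in> borel_measurable borel"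
  unfolding invF_def by measurable

lemma invF_bound:
  assumes h: "integrable \<mu> h" shows "cmod (invF h v) \<le> (\<integral>z. cmod (h z) \<partial>\<mu>)"
proof -
  have "cmod (invF h v) \<le> (\<integral>z. cmod (pairing (\<eta> z) v * h z) \<partial>\<mu>)"
    unfolding invF_def by (rule integral_norm_bound)
  then show ?thesis by (simp add: norm_mult)
qed

lemma indicator_sqint:
  assumes "A \<in> sets M" "emeasure M A < \<infinity>"
  shows "(\<lambda>x. indicator A x :: complex) \<in> sqint M \<C>"
proof -
  have "(\<integral>\<^sup>+x. ennreal ((cmod (indicator A x))\<^sup>2) \<partial>M) = (\<integral>\<^sup>+x. indicator A x \<partial>M)"
    by (intro nn_integral_cong) (simp add: indicator_def)
  then show ?thesis using assms by (simp add: sqint_complex_iff)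
qed

text \<open>Formal adjointness of \<open>fourier\<close> and \<open>invF\<close>. Both functions are
  integrable and the pairing is bounded, so Fubini applies directly.\<close>

lemma fubini_test:
  assumes h: "integrable \<mu> h" and f: "integrable \<nu> f"
  shows "(\<integral>z. fourier \<nu> f (\<eta> z) * cnj (h z) \<partial>\<mu>) = (\<integral>v. f v * cnj (invF h v) \<partial>\<nu>)"
proof -
  interpret P: pair_sigma_finite \<mu> \<nu> ..
  have [measurable]: "h \<in> borel_measurable borel" "f \<in> borel_measurable borel"
    using borel_measurable_integrable[OF h] borel_measurable_integrable[OF f] by simp_all
  let ?F = "\<lambda>z v. cnj (pairing (\<eta> z) v) * f v * cnj (h z)"
  have int: "integrable (\<mu> \<Otimes>\<^sub>M \<nu>) (case_prod ?F)"
  proof (rule P.Fubini_integrable)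
    show "case_prod ?F \<in> borel_measurable (\<mu> \<Otimes>\<^sub>M \<nu>)" by measurable
    have "(\<integral>v. norm (case_prod ?F (z, v)) \<partial>\<nu>) = (\<integral>v. cmod (f v) \<partial>\<nu>) * cmod (h z)" for z
      by (simp add: norm_mult)
    then show "integrable \<mu> (\<lambda>z. \<integral>v. norm (case_prod ?F (z, v)) \<partial>\<nu>)"
      using h by simp
    have "integrable \<nu> (\<lambda>v. case_prod ?F (z, v))" for z
    proof (rule Bochner_Integration.integrable_bound)
      show "integrable \<nu> (\<lambda>v. f v * cnj (h z))" using f by simp
    qed (simp_all add: norm_mult)
    then show "AE z in \<mu>. integrable \<nu> (\<lambda>v. case_prod ?F (z, v))" by simp
  qed
  have "(\<integral>z. fourier \<nu> f (\<eta> z) * cnj (h z) \<partial>\<mu>) = (\<integral>z. \<integral>v. ?F z v \<partial>\<nu> \<partial>\<mu>)"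
    by (simp add: fourier_def)
  also have "... = (\<integral>v. \<integral>z. ?F z v \<partial>\<mu> \<partial>\<nu>)" by (rule P.Fubini_integral[OF int, symmetric])
  also have "... = (\<integral>v. f v * cnj (invF h v) \<partial>\<nu>)"
  proof (rule Bochner_Integration.integral_cong[OF refl])
    fix v
    have "(\<integral>z. ?F z v \<partial>\<mu>) = (\<integral>z. f v * cnj (pairing (\<eta> z) v * h z) \<partial>\<mu>)"
      by (intro int_cong) simp
    also have "... = f v * (\<integral>z. cnj (pairing (\<eta> z) v * h z) \<partial>\<mu>)" by simp
    also have "(\<integral>z. cnj (pairing (\<eta> z) v * h z) \<partial>\<mu>) = cnj (invF h v)"
      unfolding invF_def by (rule Bochner_Integration.integral_cnj)
    finally show "(\<integral>z. ?F z v \<partial>\<mu>) = f v * cnj (invF h v)" .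
  qed
  finally show ?thesis .
qed

text \<open>Surjectivity of the Fourier transform provides f0 whose transform is the lift of h.
  Indicators of sets of finite measure are integrable, so the integral formula and
  \<open>fubini_test\<close> apply to them and show f0 = \<open>invF h\<close> almost everywhere.
  Norms and inner products are then those of the unitary, and the weight \<open>modV\<close> is
  |modV h|^2 against the density of \<sigma>.\<close>

lemma fourier_fibre:
  assumes h: "integrable \<mu> h" and fin: "(\<integral>\<^sup>+z. ennreal ((cmod (h z))\<^sup>2) * ennreal (modV z) \<partial>\<mu>) < \<infinity>"
  shows invF_sqint: "invF h \<in> sqint \<nu> \<C>"
    and invF_norm: "(\<integral>\<^sup>+v. ennreal ((cmod (invF h v))\<^sup>2) \<partial>\<nu>) = (\<integral>\<^sup>+z. ennreal ((cmod (h z))\<^sup>2) * ennreal (modV z) \<partial>\<mu>)"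
    and invF_inner: "\<And>F F'. F \<in> sqint \<nu> \<C> ==> F' \<in> sqint \<sigma> \<C> ==>
      FU (L2_class \<nu> \<C> F) = L2_class \<sigma> \<C> F' ==>
      (\<integral>v. F v * cnj (invF h v) \<partial>\<nu>) = (\<integral>z. F' (\<eta> z) * cnj (h z) \<partial>\<mu>)"
proof -
  have hm [measurable]: "h \<in> borel_measurable borel"
    using borel_measurable_integrable[OF h] by simp
  obtain l where l [measurable]: "l \<in> borel_measurable borel" and l_eq: "AE z in \<mu>. l (\<eta> z) = modV z *\<^sub>R h z"
    using lift_ex[OF hm] by blast
  have cancel: "inverse (modV z) * modV z = 1" for z using modV_pos[of z] by simp
  have l_norm: "(\<integral>\<^sup>+\<xi>. ennreal ((cmod (l \<xi>))\<^sup>2) \<partial>\<sigma>) = (\<integral>\<^sup>+z. ennreal ((cmod (h z))\<^sup>2) * ennreal (modV z) \<partial>\<mu>)"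
  proof -
    have "(\<integral>\<^sup>+\<xi>. ennreal ((cmod (l \<xi>))\<^sup>2) \<partial>\<sigma>) = (\<integral>\<^sup>+z. ennreal ((cmod (l (\<eta> z)))\<^sup>2) * iV z \<partial>\<mu>)"
      by (rule nn_sigma) measurable
    also have "... = (\<integral>\<^sup>+z. ennreal ((cmod (h z))\<^sup>2) * ennreal (modV z) \<partial>\<mu>)"
    proof (rule nn_integral_cong_AE, use l_eq in eventually_elim)
      fix z assume "l (\<eta> z) = modV z *\<^sub>R h z"
      then have "(cmod (l (\<eta> z)))\<^sup>2 * inverse (modV z) = (cmod (h z))\<^sup>2 * modV z * (inverse (modV z) * modV z)"
        by (simp add: norm_mult power2_eq_square)
      then show "ennreal ((cmod (l (\<eta> z)))\<^sup>2) * iV z = ennreal ((cmod (h z))\<^sup>2) * ennreal (modV z)"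
        using modV_pos[of z] by (simp add: cancel less_imp_le flip: ennreal_mult)
    qed
    finally show ?thesis .
  qed
  have lS: "l \<in> sqint \<sigma> \<C>"
    using fin l_norm by (simp add: sqint_complex_iff)
  have inner_l: "(\<integral>\<xi>. F' \<xi> * cnj (l \<xi>) \<partial>\<sigma>) = (\<integral>z. F' (\<eta> z) * cnj (h z) \<partial>\<mu>)"
    if [measurable]: "F' \<in> borel_measurable borel" for F'
  proof -
    have "(\<integral>\<xi>. F' \<xi> * cnj (l \<xi>) \<partial>\<sigma>) = (\<integral>z. inverse (modV z) *\<^sub>R (F' (\<eta> z) * cnj (l (\<eta> z))) \<partial>\<mu>)"
      by (rule integral_sigma) measurable
    also have "... = (\<integral>z. F' (\<eta> z) * cnj (h z) \<partial>\<mu>)"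
    proof (rule integral_cong_AE)
      show "AE z in \<mu>. inverse (modV z) *\<^sub>R (F' (\<eta> z) * cnj (l (\<eta> z))) = F' (\<eta> z) * cnj (h z)"
        using l_eq
      proof eventually_elim
        case (elim z)
        have "inverse (modV z) *\<^sub>R (F' (\<eta> z) * cnj (l (\<eta> z))) = (inverse (modV z) * modV z) *\<^sub>R (F' (\<eta> z) * cnj (h z))"
          unfolding elim by simp
        then show ?case by (simp only: cancel scaleR_one)
      qed
    qed measurable
    finally show ?thesis .
  qed
  obtain f0 where f0: "f0 \<in> sqint \<nu> \<C>"
    and FUf0: "FU (L2_class \<nu> \<C> f0) = L2_class \<sigma> \<C> l"
  proof -
    have "L2_class \<sigma> \<C> l \<in> FU ` hcar (L2 \<nu> \<C>)"
      using FU_unitary CL2.L2_class_car[OF lS] by (simp add: hunitary_def)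
    then obtain X where "X \<in> hcar (L2 \<nu> \<C>)" "FU X = L2_class \<sigma> \<C> l" by auto
    moreover from this obtain f where "f \<in> sqint \<nu> \<C>" "X = L2_class \<nu> \<C> f"
      using CL2.L2_class_ex by blast
    ultimately show ?thesis using that by blast
  qed
  have f0m [measurable]: "f0 \<in> borel_measurable borel" using f0 by (simp add: sqint_complex_iff measurable_cong_sets[OF V.sets_inv refl])
  have isoU: "hinner (L2 \<sigma> \<C>) (FU X) (FU Y) = hinner (L2 \<nu> \<C>) X Y"
    if "X \<in> hcar (L2 \<nu> \<C>)" "Y \<in> hcar (L2 \<nu> \<C>)" for X Y
    using FU_unitary that by (auto simp: hunitary_def)
  have inner_f0: "(\<integral>v. F v * cnj (f0 v) \<partial>\<nu>) = (\<integral>z. F' (\<eta> z) * cnj (h z) \<partial>\<mu>)"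
    if F: "F \<in> sqint \<nu> \<C>" and F': "F' \<in> sqint \<sigma> \<C>"
      and eq: "FU (L2_class \<nu> \<C> F) = L2_class \<sigma> \<C> F'" for F F'
  proof -
    have [measurable]: "F' \<in> borel_measurable borel" using F' by (simp add: sqint_complex_iff measurable_cong_sets[OF sets_sigma refl])
    have "(\<integral>v. F v * cnj (f0 v) \<partial>\<nu>) = hinner (L2 \<nu> \<C>) (L2_class \<nu> \<C> F) (L2_class \<nu> \<C> f0)"
      using CL2.L2_class_inner[OF F f0] by simp
    also have "... = hinner (L2 \<sigma> \<C>) (L2_class \<sigma> \<C> F') (L2_class \<sigma> \<C> l)"
      using isoU[OF CL2.L2_class_car[OF F] CL2.L2_class_car[OF f0]] by (simp add: eq FUf0)
    also have "... = (\<integral>\<xi>. F' \<xi> * cnj (l \<xi>) \<partial>\<sigma>)"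
      using CL2.L2_class_inner[OF F' lS] by simp
    finally show ?thesis by (simp add: inner_l)
  qed
  have "AE v in \<nu>. cnj (f0 v) - cnj (invF h v) = 0"
  proof (rule AE_zero_sigma_finite[OF V.sigma_finite_measure_axioms])
    fix A assume "A \<in> sets \<nu>" "emeasure \<nu> A < \<infinity>"
    then have A: "A \<in> sets \<nu>" "emeasure \<nu> A < \<infinity>" and [measurable]: "A \<in> sets borel" by simp_all
    let ?f = "\<lambda>v. indicator A v :: complex"
    have fS: "?f \<in> sqint \<nu> \<C>" by (rule indicator_sqint[OF A])
    have fi: "integrable \<nu> ?f"
    proof -
      have "integrable \<nu> (\<lambda>v. indicator A v *\<^sub>R (1 :: complex))"
        using A by (intro integrable_scaleR_left integrable_real_indicator)
      moreover have "indicator A v *\<^sub>R (1 :: complex) = indicator A v" for v :: 'v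
        by (simp add: indicator_def)
      ultimately show ?thesis by simp
    qed
    have i1: "integrable \<nu> (\<lambda>v. ?f v * cnj (f0 v))"
      using CL2.sqint_inner_integrable[OF fS f0] by simp
    \<comment> \<open>\<open>invF h\<close> is bounded because h is integrable. This gives
      integrability on A before square-integrability is known.\<close>
    have i2: "integrable \<nu> (\<lambda>v. ?f v * cnj (invF h v))"
    proof (rule Bochner_Integration.integrable_bound)
      show "integrable \<nu> (\<lambda>v. (\<integral>z. cmod (h z) \<partial>\<mu>) *\<^sub>R ?f v)" using fi by simp
      show "(\<lambda>v. ?f v * cnj (invF h v)) \<in> borel_measurable \<nu>"
        using invF_measurable[OF hm] by measurable
      show "AE v in \<nu>. cmod (?f v * cnj (invF h v)) \<le> cmod ((\<integral>z. cmod (h z) \<partial>\<mu>) *\<^sub>R ?f v)"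
        using invF_bound[OF h] by (intro AE_I2) (auto simp: indicator_def norm_mult intro: order_trans)
    qed
    have eq: "(\<integral>v. ?f v * cnj (f0 v) \<partial>\<nu>) = (\<integral>v. ?f v * cnj (invF h v) \<partial>\<nu>)"
      using FU_fourier[OF fS fi] inner_f0[OF fS, of "fourier \<nu> ?f"] fubini_test[OF h fi] by simp
    have ind: "indicator A v *\<^sub>R (cnj (f0 v) - cnj (invF h v)) = ?f v * cnj (f0 v) - ?f v * cnj (invF h v)" for v
      by (simp add: indicator_def)
    show "set_integrable \<nu> A (\<lambda>v. cnj (f0 v) - cnj (invF h v))"
      unfolding set_integrable_def ind using i1 i2 by (rule Bochner_Integration.integrable_diff)
    show "(LINT v:A|\<nu>. cnj (f0 v) - cnj (invF h v)) = 0"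
      unfolding set_lebesgue_integral_def ind using eq
      by (simp only: Bochner_Integration.integral_diff[OF i1 i2]) simp
  qed
  then have AE: "AE v in \<nu>. f0 v = invF h v"
    by eventually_elim (simp flip: complex_cnj_diff)
  have "(\<integral>\<^sup>+v. ennreal ((cmod (invF h v))\<^sup>2) \<partial>\<nu>) = (\<integral>\<^sup>+v. ennreal ((cmod (f0 v))\<^sup>2) \<partial>\<nu>)"
    by (rule nn_integral_cong_AE) (use AE in eventually_elim, simp)
  also have "... = ennreal ((hnorm (L2 \<nu> \<C>) (L2_class \<nu> \<C> f0))\<^sup>2)"
    using CL2.L2_class_norm[OF f0] by simp
  also have "... = ennreal ((hnorm (L2 \<sigma> \<C>) (L2_class \<sigma> \<C> l))\<^sup>2)"
    using isoU[OF CL2.L2_class_car[OF f0] CL2.L2_class_car[OF f0]] by (simp add: FUf0 hnorm_def)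
  also have "... = (\<integral>\<^sup>+\<xi>. ennreal ((cmod (l \<xi>))\<^sup>2) \<partial>\<sigma>)"
    using CL2.L2_class_norm[OF lS] by simp
  finally show nrm: "(\<integral>\<^sup>+v. ennreal ((cmod (invF h v))\<^sup>2) \<partial>\<nu>) = (\<integral>\<^sup>+z. ennreal ((cmod (h z))\<^sup>2) * ennreal (modV z) \<partial>\<mu>)"
    by (simp add: l_norm)
  show "invF h \<in> sqint \<nu> \<C>"
    using invF_measurable[OF hm] fin by (simp add: sqint_complex_iff nrm)
  fix F F' assume F: "F \<in> sqint \<nu> \<C>" and F': "F' \<in> sqint \<sigma> \<C>"
      and eq: "FU (L2_class \<nu> \<C> F) = L2_class \<sigma> \<C> F'"
  have [measurable]: "F \<in> borel_measurable borel" using F by (simp add: sqint_complex_iff measurable_cong_sets[OF V.sets_inv refl])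
  have "(\<integral>v. F v * cnj (invF h v) \<partial>\<nu>) = (\<integral>v. F v * cnj (f0 v) \<partial>\<nu>)"
    using AE invF_measurable[OF hm] by (intro integral_cong_AE) auto
  then show "(\<integral>v. F v * cnj (invF h v) \<partial>\<nu>) = (\<integral>z. F' (\<eta> z) * cnj (h z) \<partial>\<mu>)"
    using inner_f0[OF F F' eq] by simp
qed

end

section \<open>Matrix coefficients\<close>

locale cocycle_setup = fourier_setup \<mu> \<nu> act \<sigma> \<eta>
  for \<mu> :: "'q::{topological_group_add, second_countable_topology, t2_space} measure"
    and \<nu> :: "'v::{topological_ab_group_add, second_countable_topology, t2_space} measure"
    and act :: "'q => 'v => 'v" and \<sigma> :: "'v pdual measure" and \<eta> :: "'q => 'v pdual" +
  fixes b :: "'q => 'q => complex"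
  assumes b: "circle_cochain2 b"
begin

definition haarG :: "('q \<times> 'v) measure" where "haarG = ext_haar act \<mu> \<nu>"

text \<open>The weight in z comes from Plancherel on each fibre, the weight in q from the Haar
  measure of the extension.\<close>

definition kerM :: "('q \<times> 'q) measure" where
  "kerM = density (\<mu> \<Otimes>\<^sub>M \<mu>) (\<lambda>(q, z). ennreal (modV z) * iV q)"

abbreviation "dens \<equiv> duflo_moore_density act \<mu> \<nu>"

lemma dens_pos: "0 < dens q" by (rule duflo_moore(1))

lemma dens_measurable [measurable]: "dens \<in> borel_measurable borel" by (rule duflo_moore(2))

lemma b_measurable [measurable]:
  assumes "f \<in> borel_measurable M" "g \<in> borel_measurable M"
  shows "(\<lambda>x. b (f x) (g x)) \<in> borel_measurable M"
proof -
  have "(\<lambda>(p, q). b p q) \<in> borel_measurable borel2"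
    using b by (simp add: circle_cochain2_def)
  from measurable_compose[OF measurable_Pair[OF assms] this] show ?thesis by simp
qed

lemma norm_b [simp]: "cmod (b p q) = 1" using b by (simp add: circle_cochain2_def)

lemma sets_haarG [measurable_cong]: "sets haarG = sets borel2"
  by (simp add: haarG_def ext_haar_def cong: sets_pair_measure_cong)

lemma sets_kerM [measurable_cong]: "sets kerM = sets borel2"
  by (simp add: kerM_def cong: sets_pair_measure_cong)

lemma meas_haarG_iff: "f \<in> borel_measurable haarG \<longleftrightarrow> f \<in> borel_measurable borel2"
  by (rule arg_cong[of _ _ "\<lambda>S. f \<in> S"], rule measurable_cong_sets[OF sets_haarG refl])

lemma meas_kerM_iff: "f \<in> borel_measurable kerM \<longleftrightarrow> f \<in> borel_measurable borel2"
  by (rule arg_cong[of _ _ "\<lambda>S. f \<in> S"], rule measurable_cong_sets[OF sets_kerM refl])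

lemma sets_QV [measurable_cong]: "sets (\<mu> \<Otimes>\<^sub>M \<nu>) = sets borel2"
  and sets_QQ [measurable_cong]: "sets (\<mu> \<Otimes>\<^sub>M \<mu>) = sets borel2"
  by (simp_all cong: sets_pair_measure_cong)

section \<open>Kernels and their fibrewise transforms\<close>

lemma nn_haarG:
  assumes [measurable]: "f \<in> borel_measurable borel2"
  shows "(\<integral>\<^sup>+x. f x \<partial>haarG) = (\<integral>\<^sup>+q. (\<integral>\<^sup>+v. f (q, v) \<partial>\<nu>) * iV q \<partial>\<mu>)"
proof -
  have "(\<integral>\<^sup>+x. f x \<partial>haarG) = (\<integral>\<^sup>+x. (case x of (q, v) => iV q) * f x \<partial>(\<mu> \<Otimes>\<^sub>M \<nu>))"
    unfolding haarG_def ext_haar_def by (rule nn_integral_density) measurable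
  also have "... = (\<integral>\<^sup>+q. \<integral>\<^sup>+v. iV q * f (q, v) \<partial>\<nu> \<partial>\<mu>)"
    by (subst V.nn_integral_fst[symmetric]) simp_all
  also have "... = (\<integral>\<^sup>+q. (\<integral>\<^sup>+v. f (q, v) \<partial>\<nu>) * iV q \<partial>\<mu>)"
    by (intro nn_integral_cong) (simp add: nn_integral_multc mult.commute)
  finally show ?thesis .
qed

lemma nn_kerM:
  assumes [measurable]: "f \<in> borel_measurable borel2"
  shows "(\<integral>\<^sup>+x. f x \<partial>kerM) = (\<integral>\<^sup>+q. (\<integral>\<^sup>+z. f (q, z) * ennreal (modV z) \<partial>\<mu>) * iV q \<partial>\<mu>)"
proof -
  have "(\<integral>\<^sup>+x. f x \<partial>kerM) = (\<integral>\<^sup>+x. (case x of (q, z) => ennreal (modV z) * iV q) * f x \<partial>(\<mu> \<Otimes>\<^sub>M \<mu>))"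
    unfolding kerM_def by (rule nn_integral_density) measurable
  also have "... = (\<integral>\<^sup>+q. \<integral>\<^sup>+z. ennreal (modV z) * iV q * f (q, z) \<partial>\<mu> \<partial>\<mu>)"
    by (subst Q.nn_integral_fst[symmetric]) simp_all
  also have "... = (\<integral>\<^sup>+q. \<integral>\<^sup>+z. iV q * (f (q, z) * ennreal (modV z)) \<partial>\<mu> \<partial>\<mu>)"
    by (simp add: mult_ac)
  also have "... = (\<integral>\<^sup>+q. (\<integral>\<^sup>+z. f (q, z) * ennreal (modV z) \<partial>\<mu>) * iV q \<partial>\<mu>)"
    by (intro nn_integral_cong) (subst nn_integral_cmult, simp_all add: mult.commute)
  finally show ?thesis .
qed

lemma AE_haarG:
  assumes [measurable]: "Measurable.pred borel2 P"
    and ae: "AE q in \<mu>. AE v in \<nu>. P (q, v)"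
  shows "AE x in haarG. P x"
proof -
  interpret P: pair_sigma_finite \<mu> \<nu> ..
  have "{x \<in> space (\<mu> \<Otimes>\<^sub>M \<nu>). P x} \<in> sets (\<mu> \<Otimes>\<^sub>M \<nu>)" by measurable
  then have "AE x in \<mu> \<Otimes>\<^sub>M \<nu>. P x"
    using ae by (intro P.AE_pair_measure) (simp_all add: space_pair_measure)
  then show ?thesis
    unfolding haarG_def ext_haar_def by (subst AE_density) auto
qed

text \<open>Integrability of the section is demanded at every q, so that the transform is a genuine
  integral at every point of the group. Square-integrability makes Plancherel available at almost
  every q.\<close>

definition Kern :: "('q \<times> 'q => complex) set" where
  "Kern = {k. k \<in> borel_measurable borel2 \<and> (\<forall>q. integrable \<mu> (\<lambda>z. k (q, z))) \<and>
     (\<integral>\<^sup>+x. ennreal ((cmod (k x))\<^sup>2) \<partial>kerM) < \<infinity>}"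

definition theta :: "('q \<times> 'q => complex) => 'q \<times> 'v => complex" where
  "theta k = (\<lambda>(q, v). invF (\<lambda>z. k (q, z)) v)"

lemma theta_measurable:
  assumes [measurable]: "k \<in> borel_measurable borel2"
  shows "theta k \<in> borel_measurable borel2"
  unfolding theta_def invF_def by measurable

lemma Kern_section_finite:
  assumes k: "k \<in> Kern"
  shows "AE q in \<mu>. (\<integral>\<^sup>+z. ennreal ((cmod (k (q, z)))\<^sup>2) * ennreal (modV z) \<partial>\<mu>) < \<infinity>"
proof -
  have [measurable]: "k \<in> borel_measurable borel2" using k by (simp add: Kern_def)
  have "(\<integral>\<^sup>+q. (\<integral>\<^sup>+z. ennreal ((cmod (k (q, z)))\<^sup>2) * ennreal (modV z) \<partial>\<mu>) * iV q \<partial>\<mu>) < \<infinity>"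
    using k nn_kerM[of "\<lambda>x. ennreal ((cmod (k x))\<^sup>2)"] by (simp add: Kern_def)
  then have "AE q in \<mu>. (\<integral>\<^sup>+z. ennreal ((cmod (k (q, z)))\<^sup>2) * ennreal (modV z) \<partial>\<mu>) * iV q \<noteq> \<infinity>"
    by (intro nn_integral_PInf_AE) simp_all
  then show ?thesis
  proof eventually_elim
    case (elim q)
    have "iV q \<noteq> 0" using modV_pos[of q] by simp
    then show ?case using elim by (auto simp: ennreal_mult_eq_top_iff less_top)
  qed
qed

lemma theta_norm:
  assumes k: "k \<in> Kern"
  shows "(\<integral>\<^sup>+x. ennreal ((cmod (theta k x))\<^sup>2) \<partial>haarG) = (\<integral>\<^sup>+x. ennreal ((cmod (k x))\<^sup>2) \<partial>kerM)"
proof -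
  have km [measurable]: "k \<in> borel_measurable borel2" using k by (simp add: Kern_def)
  have [measurable]: "theta k \<in> borel_measurable borel2" by (rule theta_measurable[OF km])
  have "(\<integral>\<^sup>+x. ennreal ((cmod (theta k x))\<^sup>2) \<partial>haarG)
      = (\<integral>\<^sup>+q. (\<integral>\<^sup>+v. ennreal ((cmod (theta k (q, v)))\<^sup>2) \<partial>\<nu>) * iV q \<partial>\<mu>)"
    by (rule nn_haarG) measurable
  also have "... = (\<integral>\<^sup>+q. (\<integral>\<^sup>+z. ennreal ((cmod (k (q, z)))\<^sup>2) * ennreal (modV z) \<partial>\<mu>) * iV q \<partial>\<mu>)"
  proof (rule nn_integral_cong_AE, use Kern_section_finite[OF k] in eventually_elim)
    fix q assume fin: "(\<integral>\<^sup>+z. ennreal ((cmod (k (q, z)))\<^sup>2) * ennreal (modV z) \<partial>\<mu>) < \<infinity>"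
    have int: "integrable \<mu> (\<lambda>z. k (q, z))" using k by (simp add: Kern_def)
    show "(\<integral>\<^sup>+v. ennreal ((cmod (theta k (q, v)))\<^sup>2) \<partial>\<nu>) * iV q
       = (\<integral>\<^sup>+z. ennreal ((cmod (k (q, z)))\<^sup>2) * ennreal (modV z) \<partial>\<mu>) * iV q"
      using invF_norm[OF int fin] by (simp add: theta_def)
  qed
  also have "... = (\<integral>\<^sup>+x. ennreal ((cmod (k x))\<^sup>2) \<partial>kerM)"
    by (rule nn_kerM[symmetric]) measurable
  finally show ?thesis .
qed

lemma Kern_sqint: "k \<in> Kern ==> k \<in> sqint kerM \<C>"
  by (simp add: Kern_def sqint_complex_iff meas_kerM_iff)

lemma theta_sqint: "k \<in> Kern ==> theta k \<in> sqint haarG \<C>"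
  using theta_norm[of k] theta_measurable[of k] by (simp add: Kern_def sqint_complex_iff meas_haarG_iff)

text \<open>Pointwise linearity of the transform; polarization in \<open>theta_inner\<close> uses it
  to pass from norms to inner products.\<close>

lemma Kern_lin:
  assumes k: "k \<in> Kern" and l: "l \<in> Kern"
  shows "(\<lambda>x. k x + c * l x) \<in> Kern" "theta (\<lambda>x. k x + c * l x) = (\<lambda>x. theta k x + c * theta l x)"
proof -
  have "(\<lambda>x. k x + c * l x) \<in> sqint kerM \<C>"
    using CL2.sqint_add[OF Kern_sqint[OF k] CL2.sqint_scale[OF Kern_sqint[OF l], of c]] by simp
  then show "(\<lambda>x. k x + c * l x) \<in> Kern"
    using k l by (simp add: Kern_def sqint_complex_iff meas_kerM_iff)
  have int: "integrable \<mu> (\<lambda>z. pairing (\<eta> z) v * k (q, z))" if "k \<in> Kern" for k q v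
  proof (rule Bochner_Integration.integrable_bound)
    show i: "integrable \<mu> (\<lambda>z. k (q, z))" using that by (simp add: Kern_def)
    have [measurable]: "(\<lambda>z. k (q, z)) \<in> borel_measurable borel" using borel_measurable_integrable[OF i] by simp
    show "(\<lambda>z. pairing (\<eta> z) v * k (q, z)) \<in> borel_measurable \<mu>" by measurable
  qed (simp add: norm_mult)
  have "invF (\<lambda>z. k (q, z) + c * l (q, z)) v = invF (\<lambda>z. k (q, z)) v + c * invF (\<lambda>z. l (q, z)) v" for q v
  proof -
    have "(\<integral>z. pairing (\<eta> z) v * (k (q, z) + c * l (q, z)) \<partial>\<mu>)
        = (\<integral>z. pairing (\<eta> z) v * k (q, z) + c * (pairing (\<eta> z) v * l (q, z)) \<partial>\<mu>)"
      by (intro int_cong) (simp add: algebra_simps)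
    also have "... = (\<integral>z. pairing (\<eta> z) v * k (q, z) \<partial>\<mu>) + c * (\<integral>z. pairing (\<eta> z) v * l (q, z) \<partial>\<mu>)"
      using int[OF k] int[OF l] by simp
    finally show ?thesis by (simp add: invF_def)
  qed
  then show "theta (\<lambda>x. k x + c * l x) = (\<lambda>x. theta k x + c * theta l x)"
    by (auto simp: theta_def)
qed

lemma theta_inner:
  assumes k: "k \<in> Kern" and l: "l \<in> Kern"
  shows "(\<integral>x. theta k x * cnj (theta l x) \<partial>haarG) = (\<integral>x. k x * cnj (l x) \<partial>kerM)"
proof -
  let ?S = "sqint_space haarG \<C>" and ?T = "sqint_space kerM \<C>"
  have norms: "hnorm ?S (theta k) = hnorm ?T k" if k: "k \<in> Kern" for k
  proof -
    have "ennreal ((hnorm ?S (theta k))\<^sup>2) = ennreal ((hnorm ?T k)\<^sup>2)"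
      using CL2.sqint_norm_nn[OF theta_sqint[OF k]] CL2.sqint_norm_nn[OF Kern_sqint[OF k]] theta_norm[OF k]
      by simp
    then have "(hnorm ?S (theta k))\<^sup>2 = (hnorm ?T k)\<^sup>2" by (simp add: ennreal_inj)
    then show ?thesis
      using CL2.S.norm_nonneg[OF theta_sqint[OF k]] CL2.S.norm_nonneg[OF Kern_sqint[OF k]]
      by (simp add: power2_eq_iff_nonneg)
  qed
  have "hinner ?S (theta k) (theta l) = hinner ?T k l"
    unfolding CL2.S.polarization[OF theta_sqint[OF k] theta_sqint[OF l]]
      CL2.S.polarization[OF Kern_sqint[OF k] Kern_sqint[OF l]]
    using norms[OF Kern_lin(1)[OF k l]] Kern_lin(2)[OF k l] by (simp add: CL2.sqint_simps)
  then show ?thesis by (simp add: CL2.sqint_simps)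
qed

definition kerTensor :: "('q => complex) => ('q => complex) => 'q \<times> 'q => complex" where
  "kerTensor c e = (\<lambda>(q, z). c z * cnj (b (- z) q) * cnj (e (- q + z)))"

section \<open>Change of variables on kernels\<close>

abbreviation "QQ \<equiv> \<mu> \<Otimes>\<^sub>M density \<mu> (\<lambda>q. ennreal (dens q))"

lemma sigma_finite_dens: "sigma_finite_measure (density \<mu> (\<lambda>q. ennreal (dens q)))"
  by (subst Q.sigma_finite_iff_density_finite) auto

lemma sets_wQQ [measurable_cong]: "sets QQ = sets borel2"
  by (simp cong: sets_pair_measure_cong)

text \<open>Origin of the Duflo-Moore density. For fixed z, the left translation of q by z turns the
  weight into \<open>modV (- q)\<close>, and the inversion q \<mapsto> -q turns this into
  \<open>modV q\<close> divided by the modular function of Q.\<close>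

lemma nn_change:
  assumes [measurable]: "f \<in> borel_measurable borel2"
  shows "(\<integral>\<^sup>+x. f (snd x, - fst x + snd x) \<partial>kerM) = (\<integral>\<^sup>+x. f x \<partial>QQ)"
proof -
  interpret D: sigma_finite_measure "density \<mu> (\<lambda>q. ennreal (dens q))" by (rule sigma_finite_dens)
  interpret P: pair_sigma_finite \<mu> \<mu> ..
  let ?w = "\<lambda>q z. ennreal (modV z) * iV q"
  have "(\<integral>\<^sup>+x. f (snd x, - fst x + snd x) \<partial>kerM)
      = (\<integral>\<^sup>+q. (\<integral>\<^sup>+z. f (z, - q + z) * ennreal (modV z) \<partial>\<mu>) * iV q \<partial>\<mu>)"
    by (subst nn_kerM) simp_all
  also have "... = (\<integral>\<^sup>+q. \<integral>\<^sup>+z. f (z, - q + z) * ?w q z \<partial>\<mu> \<partial>\<mu>)"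
    by (intro nn_integral_cong) (simp add: nn_integral_multc[symmetric] mult.assoc)
  also have "... = (\<integral>\<^sup>+z. \<integral>\<^sup>+q. f (z, - q + z) * ?w q z \<partial>\<mu> \<partial>\<mu>)"
    by (rule P.Fubini'[symmetric]) measurable
  also have "... = (\<integral>\<^sup>+z. \<integral>\<^sup>+w. ennreal (dens w) * f (z, w) \<partial>\<mu> \<partial>\<mu>)"
  proof (rule nn_integral_cong)
    fix z
    have "(\<integral>\<^sup>+q. f (z, - q + z) * ?w q z \<partial>\<mu>) = (\<integral>\<^sup>+q. f (z, - (z + q) + z) * ?w (z + q) z \<partial>\<mu>)"
      by (rule Q.nn_translate[where f = "\<lambda>q. f (z, - q + z) * ?w q z", symmetric]) measurable
    also have "... = (\<integral>\<^sup>+q. f (z, - q) * ennreal (modV (- q)) \<partial>\<mu>)"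
    proof (rule nn_integral_cong)
      fix q
      have "?w (z + q) z = ennreal (modV z * inverse (modV z * modV q))"
        using modV_pos[of z] modV_pos[of q] by (simp add: modV_add ennreal_mult less_imp_le)
      also have "modV z * inverse (modV z * modV q) = modV (- q)"
        using modV_pos[of z] by (simp add: modV_uminus)
      finally show "f (z, - (z + q) + z) * ?w (z + q) z = f (z, - q) * ennreal (modV (- q))"
        by (simp add: minus_add add.assoc)
    qed
    also have "... = (\<integral>\<^sup>+q. f (z, q) * ennreal (modV q) * ennreal (inverse (modQ q)) \<partial>\<mu>)"
      by (rule Q.nn_inverse[where f = "\<lambda>q. f (z, q) * ennreal (modV q)"]) measurable
    also have "... = (\<integral>\<^sup>+w. ennreal (dens w) * f (z, w) \<partial>\<mu>)"
    proof (rule nn_integral_cong)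
      fix q
      have "ennreal (dens q) = ennreal (modV q) * ennreal (inverse (modQ q))"
        using modV_pos[of q] Q.modular_pos[of q]
        by (simp add: duflo_moore_density_def divide_inverse ennreal_mult less_imp_le)
      then show "f (z, q) * ennreal (modV q) * ennreal (inverse (modQ q)) = ennreal (dens q) * f (z, q)"
        by (simp add: mult_ac)
    qed
    finally show "(\<integral>\<^sup>+q. f (z, - q + z) * ?w q z \<partial>\<mu>) = (\<integral>\<^sup>+w. ennreal (dens w) * f (z, w) \<partial>\<mu>)" .
  qed
  also have "... = (\<integral>\<^sup>+z. \<integral>\<^sup>+w. f (z, w) \<partial>(density \<mu> (\<lambda>q. ennreal (dens q))) \<partial>\<mu>)"
    by (intro nn_integral_cong nn_integral_density[symmetric]) measurable
  also have "... = (\<integral>\<^sup>+x. f x \<partial>QQ)"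
    by (rule D.nn_integral_fst) measurable
  finally show ?thesis .
qed

definition shear :: "'q \<times> 'q => 'q \<times> 'q" where "shear x = (snd x, - fst x + snd x)"

lemma shear_measurable: "shear \<in> measurable kerM borel2"
  unfolding shear_def[abs_def] by measurable

lemma distr_shear: "distr kerM QQ shear = QQ"
proof (rule measure_eqI)
  fix A assume "A \<in> sets (distr kerM QQ shear)"
  then have A: "A \<in> sets borel2" by (simp add: sets_wQQ)
  have m: "shear \<in> measurable kerM QQ"
    using shear_measurable by (simp add: measurable_cong_sets[OF refl sets_wQQ])
  have "emeasure (distr kerM QQ shear) A = (\<integral>\<^sup>+x. indicator A x \<partial>(distr kerM QQ shear))"
    using A by (simp add: sets_wQQ)
  also have "... = (\<integral>\<^sup>+x. indicator A (shear x) \<partial>kerM)"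
    by (rule nn_integral_distr[OF m]) (use A in \<open>simp add: sets_wQQ measurable_cong_sets[OF sets_wQQ refl]\<close>)
  also have "... = (\<integral>\<^sup>+x. indicator A x \<partial>QQ)"
    unfolding shear_def by (rule nn_change) (use A in measurable)
  finally show "emeasure (distr kerM QQ shear) A = emeasure QQ A"
    using A by (simp add: sets_wQQ)
qed simp

lemma shear_QQ: "shear \<in> measurable kerM QQ"
  using shear_measurable by (simp add: measurable_cong_sets[OF refl sets_wQQ])

lemma integral_shear:
  fixes f :: "'q \<times> 'q => complex"
  assumes "f \<in> borel_measurable borel2"
  shows "(\<integral>x. f (shear x) \<partial>kerM) = (\<integral>x. f x \<partial>QQ)"
    and "integrable kerM (\<lambda>x. f (shear x)) \<longleftrightarrow> integrable QQ f"
proof -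
  have f: "f \<in> borel_measurable QQ" using assms by (simp add: measurable_cong_sets[OF sets_wQQ refl])
  show "(\<integral>x. f (shear x) \<partial>kerM) = (\<integral>x. f x \<partial>QQ)"
    using integral_distr[OF shear_QQ f] by (simp add: distr_shear)
  show "integrable kerM (\<lambda>x. f (shear x)) \<longleftrightarrow> integrable QQ f"
    using integrable_distr_eq[OF shear_QQ f] by (simp add: distr_shear)
qed

text \<open>Functions that represent the domain of D^(1/2). Functions are used instead of classes
  because kernels and their sections are evaluated pointwise.\<close>

definition Dom :: "('q => complex) set" where
  "Dom = {e. e \<in> borel_measurable borel \<and> (\<integral>\<^sup>+q. ennreal ((cmod (e q))\<^sup>2) \<partial>\<mu>) < \<infinity> \<and>
     (\<integral>\<^sup>+q. ennreal (dens q) * ennreal ((cmod (e q))\<^sup>2) \<partial>\<mu>) < \<infinity>}"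

definition Sq :: "('q => complex) set" where
  "Sq = {e. e \<in> borel_measurable borel \<and> (\<integral>\<^sup>+q. ennreal ((cmod (e q))\<^sup>2) \<partial>\<mu>) < \<infinity>}"

lemma Sq_sqint: "e \<in> Sq \<longleftrightarrow> e \<in> sqint \<mu> \<C>"
  by (simp add: Sq_def sqint_complex_iff measurable_cong_sets[OF Q.sets_inv refl])

lemma Dom_Sq: "e \<in> Dom ==> e \<in> Sq" by (simp add: Dom_def Sq_def)

lemma Dom_sqint: "e \<in> Dom ==> e \<in> hcar (sqint_space (density \<mu> (\<lambda>q. ennreal (dens q))) \<C>)"
proof -
  assume e: "e \<in> Dom"
  then have [measurable]: "e \<in> borel_measurable borel" by (simp add: Dom_def)
  have "(\<integral>\<^sup>+q. ennreal ((cmod (e q))\<^sup>2) \<partial>(density \<mu> (\<lambda>q. ennreal (dens q))))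
      = (\<integral>\<^sup>+q. ennreal (dens q) * ennreal ((cmod (e q))\<^sup>2) \<partial>\<mu>)"
    by (rule nn_integral_density) measurable
  then show ?thesis using e by (simp add: Dom_def sqint_complex_iff)
qed

lemma Sq_translate:
  assumes "e \<in> Sq" shows "(\<lambda>z. e (q + z)) \<in> Sq"
proof -
  have [measurable]: "e \<in> borel_measurable borel" using assms by (simp add: Sq_def)
  have "(\<integral>\<^sup>+z. ennreal ((cmod (e (q + z)))\<^sup>2) \<partial>\<mu>) = (\<integral>\<^sup>+z. ennreal ((cmod (e z))\<^sup>2) \<partial>\<mu>)"
    by (rule Q.nn_translate) measurable
  then show ?thesis using assms by (simp add: Sq_def)
qed

text \<open>Holds at every q, as \<open>Kern\<close> demands: c and each left translate of e are
  square-integrable, and \<open>b\<close> has modulus one.\<close>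

lemma kerTensor_integrable:
  assumes c: "c \<in> Sq" and e: "e \<in> Sq"
  shows "integrable \<mu> (\<lambda>z. kerTensor c e (q, z))"
proof -
  have [measurable]: "c \<in> borel_measurable borel" "e \<in> borel_measurable borel" using c e by (auto simp: Sq_def)
  have "integrable \<mu> (\<lambda>z. c z * cnj (e (- q + z)))"
    using CL2.sqint_inner_integrable[of c \<mu> "\<lambda>z. e (- q + z)"] c Sq_translate[OF e, of "- q"]
    by (simp add: Sq_sqint)
  then show ?thesis
    by (rule Bochner_Integration.integrable_bound) (simp_all add: kerTensor_def norm_mult)
qed

lemma kerTensor_measurable [measurable]:
  assumes [measurable]: "c \<in> borel_measurable borel" "e \<in> borel_measurable borel"
  shows "kerTensor c e \<in> borel_measurable borel2"
  unfolding kerTensor_def by measurable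

lemma kerTensor_Kern:
  assumes c: "c \<in> Sq" and e: "e \<in> Dom"
  shows "kerTensor c e \<in> Kern"
proof -
  interpret D: sigma_finite_measure "density \<mu> (\<lambda>q. ennreal (dens q))" by (rule sigma_finite_dens)
  have [measurable]: "c \<in> borel_measurable borel" "e \<in> borel_measurable borel" using c e by (auto simp: Sq_def Dom_def)
  have "(\<integral>\<^sup>+x. ennreal ((cmod (kerTensor c e x))\<^sup>2) \<partial>kerM)
      = (\<integral>\<^sup>+x. ennreal ((cmod (c (snd x)))\<^sup>2) * ennreal ((cmod (e (- fst x + snd x)))\<^sup>2) \<partial>kerM)"
    by (intro nn_integral_cong)
      (simp add: kerTensor_def split_def norm_mult power_mult_distrib ennreal_mult)
  also have "... = (\<integral>\<^sup>+x. ennreal ((cmod (c (fst x)))\<^sup>2) * ennreal ((cmod (e (snd x)))\<^sup>2) \<partial>QQ)"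
    using nn_change[of "\<lambda>x. ennreal ((cmod (c (fst x)))\<^sup>2) * ennreal ((cmod (e (snd x)))\<^sup>2)"] by simp
  also have "... = (\<integral>\<^sup>+z. \<integral>\<^sup>+w. ennreal ((cmod (c z))\<^sup>2) * ennreal ((cmod (e w))\<^sup>2) \<partial>(density \<mu> (\<lambda>q. ennreal (dens q))) \<partial>\<mu>)"
    by (subst D.nn_integral_fst[symmetric]) simp_all
  also have "... = (\<integral>\<^sup>+z. ennreal ((cmod (c z))\<^sup>2) \<partial>\<mu>) * (\<integral>\<^sup>+w. ennreal ((cmod (e w))\<^sup>2) \<partial>(density \<mu> (\<lambda>q. ennreal (dens q))))"
    by (simp add: nn_integral_cmult nn_integral_multc)
  also have "... < \<infinity>"
    using c e by (simp add: Sq_def Dom_def nn_integral_density ennreal_mult_less_top)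
  finally show ?thesis
    using kerTensor_integrable[OF c Dom_Sq[OF e]] by (simp add: Kern_def)
qed

lemma integral_product:
  assumes c: "c \<in> Sq" "c' \<in> Sq" and e: "e \<in> Dom" "e' \<in> Dom"
  shows "integrable QQ (\<lambda>x. (c (fst x) * cnj (c' (fst x))) * (e' (snd x) * cnj (e (snd x))))"
    "(\<integral>x. (c (fst x) * cnj (c' (fst x))) * (e' (snd x) * cnj (e (snd x))) \<partial>QQ)
     = (\<integral>z. c z * cnj (c' z) \<partial>\<mu>) * (\<integral>w. e' w * cnj (e w) \<partial>(density \<mu> (\<lambda>q. ennreal (dens q))))"
proof -
  let ?D = "density \<mu> (\<lambda>q. ennreal (dens q))"
  interpret D: sigma_finite_measure ?D by (rule sigma_finite_dens)
  interpret P: pair_sigma_finite \<mu> ?D ..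
  have [measurable]: "c \<in> borel_measurable borel" "c' \<in> borel_measurable borel"
     "e \<in> borel_measurable borel" "e' \<in> borel_measurable borel"
    using c e by (auto simp: Sq_def Dom_def)
  have i1: "integrable \<mu> (\<lambda>z. c z * cnj (c' z))"
    using CL2.sqint_inner_integrable[of c \<mu> c'] c by (simp add: Sq_sqint)
  have i2: "integrable ?D (\<lambda>w. e' w * cnj (e w))"
    using CL2.sqint_inner_integrable[of e' ?D e] e Dom_sqint by simp
  let ?F = "\<lambda>x. (c (fst x) * cnj (c' (fst x))) * (e' (snd x) * cnj (e (snd x)))"
  show int: "integrable QQ ?F"
  proof (rule P.Fubini_integrable)
    show "?F \<in> borel_measurable QQ" by measurable
    have "(\<integral>w. norm (?F (z, w)) \<partial>?D) = cmod (c z * cnj (c' z)) * (\<integral>w. cmod (e' w * cnj (e w)) \<partial>?D)" for z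
      by (simp add: norm_mult)
    then show "integrable \<mu> (\<lambda>z. \<integral>w. norm (?F (z, w)) \<partial>?D)"
      using integrable_norm[OF i1] by simp
    show "AE z in \<mu>. integrable ?D (\<lambda>w. ?F (z, w))" using i2 by simp
  qed
  show "(\<integral>x. ?F x \<partial>QQ) = (\<integral>z. c z * cnj (c' z) \<partial>\<mu>) * (\<integral>w. e' w * cnj (e w) \<partial>?D)"
    using P.integral_fst'[OF int] by simp
qed

lemma theta_kerTensor_inner:
  assumes c: "c \<in> Sq" "c' \<in> Sq" and e: "e \<in> Dom" "e' \<in> Dom"
  shows "(\<integral>x. theta (kerTensor c e) x * cnj (theta (kerTensor c' e') x) \<partial>haarG)
    = (\<integral>z. c z * cnj (c' z) \<partial>\<mu>) * (\<integral>w. e' w * cnj (e w) \<partial>(density \<mu> (\<lambda>q. ennreal (dens q))))"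
proof -
  have [measurable]: "c \<in> borel_measurable borel" "c' \<in> borel_measurable borel"
     "e \<in> borel_measurable borel" "e' \<in> borel_measurable borel"
    using c e by (auto simp: Sq_def Dom_def)
  let ?F = "\<lambda>x. (c (fst x) * cnj (c' (fst x))) * (e' (snd x) * cnj (e (snd x)))"
  have bb: "b p q * cnj (b p q) = 1" for p q
    using complex_norm_square[of "b p q"] by simp
  \<comment> \<open>The phases \<open>b\<close> cancel, and the sheared function is a product. The
    roles of e and e' are exchanged because \<open>kerTensor\<close> is conjugate-linear in its
    second argument.\<close>
  have "kerTensor c e x * cnj (kerTensor c' e' x) = ?F (shear x)" for x
  proof -
    have "kerTensor c e x * cnj (kerTensor c' e' x) =
      (b (- snd x) (fst x) * cnj (b (- snd x) (fst x))) * ?F (shear x)"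
      by (simp add: kerTensor_def split_def shear_def mult_ac)
    then show ?thesis by (simp add: bb)
  qed
  then have "(\<integral>x. kerTensor c e x * cnj (kerTensor c' e' x) \<partial>kerM) = (\<integral>x. ?F x \<partial>QQ)"
    using integral_shear(1)[of ?F] by simp
  then show ?thesis
    using theta_inner[OF kerTensor_Kern[OF c(1) e(1)] kerTensor_Kern[OF c(2) e(2)]] integral_product(2)[OF c e]
    by simp
qed

end

lemma (in hilbert_pair) unitary_extension:
  assumes H: "htotal H (fst ` S)" and K: "htotal K (snd ` S)"
  shows "\<exists>U. hunitary H K U \<and> (\<forall>p\<in>S. U (fst p) = snd p)"
proof (rule isometry_extension[OF H])
  fix U
  assume "hlinear H K U" "\<And>u v. u \<in> hcar H ==> v \<in> hcar H ==> hinner K (U u) (U v) = hinner H u v"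
    "\<And>p. p \<in> S ==> U (fst p) = snd p" "htotal K (snd ` S) ==> U ` hcar H = hcar K"
  then show ?thesis using K unfolding hunitary_def by (intro exI[of _ U]) simp
qed

context cocycle_setup
begin

section \<open>Test sets with bounded weights\<close>

lemma base_ex:
  "\<exists>G :: 'q set set. countable G \<and> Int_stable G \<and> \<Union>G = UNIV \<and>
    (\<forall>A\<in>G. A \<in> sets borel \<and> emeasure \<mu> A < \<infinity> \<and>
       (\<exists>n::nat. \<forall>x\<in>A. modV x + inverse (modV x) + dens x \<le> real n)) \<and> sets borel = sigma_sets UNIV G"
proof (rule weighted_base[OF lcQ haarQ])
  show "(\<lambda>x. modV x + inverse (modV x) + dens x) \<in> borel_measurable borel" by measurable
  fix G :: "'q set set"
  assume "countable G" "Int_stable G" "\<Union>G = UNIV"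
    "\<And>A. A \<in> G ==> A \<in> sets borel" "\<And>A. A \<in> G ==> emeasure \<mu> A < \<infinity>"
    "\<And>A. A \<in> G ==> \<exists>n::nat. \<forall>x\<in>A. modV x + inverse (modV x) + dens x \<le> real n" "sets borel = sigma_sets UNIV G"
  then show ?thesis by (intro exI[of _ G] conjI ballI) simp_all
qed

text \<open>
  A countable basis of sets on which all the weights are bounded, so that their indicator functions
  lie in every domain that occurs.
\<close>

definition base :: "'q set set" where
  "base = (SOME G. countable G \<and> Int_stable G \<and> \<Union>G = UNIV \<and>
    (\<forall>A\<in>G. A \<in> sets borel \<and> emeasure \<mu> A < \<infinity> \<and>
       (\<exists>n::nat. \<forall>x\<in>A. modV x + inverse (modV x) + dens x \<le> real n)) \<and> sets borel = sigma_sets UNIV G)"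

lemma base:
  shows base_countable: "countable base" and base_Int: "Int_stable base" and base_cover: "\<Union>base = UNIV"
    and base_sets: "A \<in> base ==> A \<in> sets borel" and base_finite: "A \<in> base ==> emeasure \<mu> A < \<infinity>"
    and base_bound: "A \<in> base ==> \<exists>n::nat. \<forall>x\<in>A. modV x + inverse (modV x) + dens x \<le> real n"
    and base_sigma: "sets borel = sigma_sets UNIV base"
proof -
  have "countable base \<and> Int_stable base \<and> \<Union>base = UNIV \<and>
    (\<forall>A\<in>base. A \<in> sets borel \<and> emeasure \<mu> A < \<infinity> \<and>
       (\<exists>n::nat. \<forall>x\<in>A. modV x + inverse (modV x) + dens x \<le> real n)) \<and> sets borel = sigma_sets UNIV base"
    unfolding base_def by (rule someI_ex[OF base_ex])
  then show "countable base" "Int_stable base" "\<Union>base = UNIV"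
    "A \<in> base ==> A \<in> sets borel" "A \<in> base ==> emeasure \<mu> A < \<infinity>"
    "A \<in> base ==> \<exists>n::nat. \<forall>x\<in>A. modV x + inverse (modV x) + dens x \<le> real n"
    "sets borel = sigma_sets UNIV base"
    by simp_all
qed

lemma base_weight:
  assumes A: "A \<in> base" and u: "\<And>x. u x \<le> modV x + inverse (modV x) + dens x"
  shows "(\<integral>\<^sup>+x. ennreal (u x) * indicator A x \<partial>\<mu>) < \<infinity>"
proof -
  obtain n :: nat where n: "\<forall>x\<in>A. modV x + inverse (modV x) + dens x \<le> real n"
    using base_bound[OF A] by (elim exE)
  have "(\<integral>\<^sup>+x. ennreal (u x) * indicator A x \<partial>\<mu>) \<le> (\<integral>\<^sup>+x. ennreal (real n) * indicator A x \<partial>\<mu>)"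
  proof (rule nn_integral_mono)
    fix x
    show "ennreal (u x) * indicator A x \<le> ennreal (real n) * indicator A x"
    proof (cases "x \<in> A")
      case True
      then have "u x \<le> real n" using n u[of x] order_trans by blast
      then show ?thesis using True by (simp add: ennreal_leI)
    qed simp
  qed
  also have "... = ennreal (real n) * emeasure \<mu> A"
    using base_sets[OF A] by (simp add: nn_integral_cmult)
  also have "... < \<infinity>" using base_finite[OF A] by (simp add: ennreal_mult_less_top)
  finally show ?thesis .
qed

lemma base_modV: "A \<in> base ==> (\<integral>\<^sup>+x. ennreal (modV x) * indicator A x \<partial>\<mu>) < \<infinity>"
  and base_inv_modV: "A \<in> base ==> (\<integral>\<^sup>+x. iV x * indicator A x \<partial>\<mu>) < \<infinity>"
  and base_dens: "A \<in> base ==> (\<integral>\<^sup>+x. ennreal (dens x) * indicator A x \<partial>\<mu>) < \<infinity>"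
proof -
  have p: "0 \<le> modV x" "0 \<le> inverse (modV x)" "0 \<le> dens x" for x
    using modV_pos[of x] dens_pos[of x] by simp_all
  show "A \<in> base ==> (\<integral>\<^sup>+x. ennreal (modV x) * indicator A x \<partial>\<mu>) < \<infinity>"
    by (rule base_weight[where u = modV]) (use p in \<open>simp_all add: add_nonneg_nonneg\<close>)
  show "A \<in> base ==> (\<integral>\<^sup>+x. iV x * indicator A x \<partial>\<mu>) < \<infinity>"
    by (rule base_weight[where u = "\<lambda>x. inverse (modV x)"]) (use p in \<open>simp_all add: add_nonneg_nonneg\<close>)
  show "A \<in> base ==> (\<integral>\<^sup>+x. ennreal (dens x) * indicator A x \<partial>\<mu>) < \<infinity>"
    by (rule base_weight[where u = dens]) (use p in \<open>simp_all add: add_nonneg_nonneg\<close>)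
qed

section \<open>Totality of the matrix coefficients\<close>

lemma norm_indicator_sq: "ennreal ((cmod (indicator A x))\<^sup>2) = indicator A x"
  by (simp add: indicator_def)

lemma base_Dom: "A \<in> base ==> (\<lambda>x. indicator A x) \<in> Dom"
  using base_dens[of A] base_finite[of A] base_sets[of A] by (simp add: Dom_def norm_indicator_sq)

lemma base_integrable:
  assumes A: "A \<in> base" shows "integrable \<mu> (\<lambda>x. indicator A x :: complex)"
proof -
  have "integrable \<mu> (\<lambda>v. indicator A v *\<^sub>R (1 :: complex))"
    using base_sets[OF A] base_finite[OF A] by (intro integrable_scaleR_left integrable_real_indicator) simp_all
  moreover have "indicator A v *\<^sub>R (1 :: complex) = indicator A v" for v :: 'q
    by (simp add: indicator_def)
  ultimately show ?thesis by simp
qed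

text \<open>Rectangles are the test kernels whose transform splits into a function of q and a
  function of v, so that the two variables can be tested one after the other.\<close>

lemma base_rect_Kern:
  assumes A: "A \<in> base" and B: "B \<in> base"
  shows "(\<lambda>x. indicator A (fst x) * indicator B (snd x)) \<in> Kern"
    and "theta (\<lambda>x. indicator A (fst x) * indicator B (snd x)) x = indicator A (fst x) * invF (indicator B) (snd x)"
proof -
  note [measurable] = base_sets[OF A] base_sets[OF B]
  have "(\<integral>\<^sup>+x. ennreal ((cmod (indicator A (fst x) * indicator B (snd x)))\<^sup>2) \<partial>kerM)
     = (\<integral>\<^sup>+q. (\<integral>\<^sup>+z. indicator A q * indicator B z * ennreal (modV z) \<partial>\<mu>) * iV q \<partial>\<mu>)"
    by (subst nn_kerM) (simp_all add: norm_mult power_mult_distrib ennreal_mult norm_indicator_sq)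
  also have "... = (\<integral>\<^sup>+q. (\<integral>\<^sup>+z. ennreal (modV z) * indicator B z \<partial>\<mu>) * (iV q * indicator A q) \<partial>\<mu>)"
  proof (rule nn_integral_cong)
    fix q
    have "(\<integral>\<^sup>+z. indicator A q * indicator B z * ennreal (modV z) \<partial>\<mu>)
        = (\<integral>\<^sup>+z. indicator A q * (ennreal (modV z) * indicator B z) \<partial>\<mu>)" by (simp add: mult_ac)
    also have "... = indicator A q * (\<integral>\<^sup>+z. ennreal (modV z) * indicator B z \<partial>\<mu>)"
      by (rule nn_integral_cmult) measurable
    finally show "(\<integral>\<^sup>+z. indicator A q * indicator B z * ennreal (modV z) \<partial>\<mu>) * iV q
       = (\<integral>\<^sup>+z. ennreal (modV z) * indicator B z \<partial>\<mu>) * (iV q * indicator A q)"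
      by (simp add: mult_ac)
  qed
  also have "... = (\<integral>\<^sup>+z. ennreal (modV z) * indicator B z \<partial>\<mu>) * (\<integral>\<^sup>+q. iV q * indicator A q \<partial>\<mu>)"
    by (rule nn_integral_cmult) measurable
  also have "... < \<infinity>" using base_modV[OF B] base_inv_modV[OF A] by (simp add: ennreal_mult_less_top)
  finally show "(\<lambda>x. indicator A (fst x) * indicator B (snd x)) \<in> Kern"
    using base_integrable[OF B] by (simp add: Kern_def)
  have "invF (\<lambda>z. indicator A q * indicator B z) v = indicator A q * invF (indicator B) v" for q v
    by (simp add: invF_def indicator_def)
  then show "theta (\<lambda>x. indicator A (fst x) * indicator B (snd x)) x = indicator A (fst x) * invF (indicator B) (snd x)"
    by (simp add: theta_def split_def)
qed

text \<open>By \<open>invF_inner\<close> the hypothesis says that the transform of F, pulled back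
  along \<open>\<eta>\<close>, has zero integral over every base set. It therefore vanishes almost
  everywhere, and unitarity of the Fourier transform gives the claim for F.\<close>

lemma fibre_zero:
  assumes F: "F \<in> sqint \<nu> \<C>"
    and zero: "\<And>B. B \<in> base ==> (\<integral>v. F v * cnj (invF (indicator B) v) \<partial>\<nu>) = 0"
  shows "AE v in \<nu>. F v = 0"
proof -
  have Fm [measurable]: "F \<in> borel_measurable borel"
    using F by (simp add: sqint_complex_iff measurable_cong_sets[OF V.sets_inv refl])
  let ?X = "L2_class \<nu> \<C> F"
  have X: "?X \<in> hcar (L2 \<nu> \<C>)" by (rule CL2.L2_class_car[OF F])
  then have "FU ?X \<in> hcar (L2 \<sigma> \<C>)"
    using FU_unitary unfolding hunitary_def hlinear_def by blast
  then obtain F' where F': "F' \<in> sqint \<sigma> \<C>" "FU ?X = L2_class \<sigma> \<C> F'"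
    using CL2.L2_class_ex by blast
  have [measurable]: "F' \<in> borel_measurable borel"
    using F'(1) by (simp add: sqint_complex_iff measurable_cong_sets[OF sets_sigma refl])
  have fin: "(\<integral>\<^sup>+z. ennreal ((cmod (F' (\<eta> z)))\<^sup>2) * iV z \<partial>\<mu>) < \<infinity>"
    using F'(1) nn_sigma[of "\<lambda>\<xi>. ennreal ((cmod (F' \<xi>))\<^sup>2)"] by (simp add: sqint_complex_iff)
  have "AE z in \<mu>. F' (\<eta> z) = 0"
  proof (rule AE_zero_of_pi_system[where G = base and C = base])
    show "sets \<mu> = sigma_sets (space \<mu>) base" using base_sigma by simp
    show "\<Union>base = space \<mu>" using base_cover by simp
    fix B assume B: "B \<in> base"
    note [measurable] = base_sets[OF B]
    obtain n :: nat where n: "\<forall>x\<in>B. modV x + inverse (modV x) + dens x \<le> real n"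
      using base_bound[OF B] by (elim exE)
    \<comment> \<open>With a = |F' (\<eta> z)|, use a \<le> 1 + a^2 and the bound n for
      \<open>modV\<close> on B: the integrand is at most the indicator of B plus n times the
      integrand that \<open>fin\<close> controls.\<close>
    show si: "set_integrable \<mu> B (\<lambda>z. F' (\<eta> z))"
      unfolding set_integrable_def
    proof (rule integrableI_bounded)
      have "(\<integral>\<^sup>+z. ennreal (norm (indicator B z *\<^sub>R F' (\<eta> z))) \<partial>\<mu>)
         \<le> (\<integral>\<^sup>+z. indicator B z + ennreal (real n) * (ennreal ((cmod (F' (\<eta> z)))\<^sup>2) * iV z) \<partial>\<mu>)"
      proof (rule nn_integral_mono)
        fix z
        let ?a = "cmod (F' (\<eta> z))"
        show "ennreal (norm (indicator B z *\<^sub>R F' (\<eta> z)))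
          \<le> indicator B z + ennreal (real n) * (ennreal (?a\<^sup>2) * iV z)"
        proof (cases "z \<in> B")
          case True
          have "modV z \<le> real n"
            using n True modV_pos[of z] dens_pos[of z] by (smt (verit) positive_imp_inverse_positive)
          then have "1 \<le> real n * inverse (modV z)" using modV_pos[of z] by (simp add: field_simps)
          then have "?a\<^sup>2 * 1 \<le> ?a\<^sup>2 * (real n * inverse (modV z))" by (intro mult_left_mono) auto
          moreover have "?a \<le> 1 + ?a\<^sup>2"
          proof -
            have "2 * ?a \<le> 1 + ?a\<^sup>2" using sum_squares_bound[of 1 ?a] by simp
            moreover have "0 \<le> ?a" by simp
            ultimately show ?thesis by linarith
          qed
          ultimately have "?a \<le> 1 + real n * (?a\<^sup>2 * inverse (modV z))" by (simp add: mult_ac)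
          then have "ennreal ?a \<le> ennreal (1 + real n * (?a\<^sup>2 * inverse (modV z)))" by (rule ennreal_leI)
          also have "... = 1 + ennreal (real n) * (ennreal (?a\<^sup>2) * iV z)"
            using modV_pos[of z] by (simp add: ennreal_plus ennreal_mult less_imp_le)
          finally show ?thesis using True by simp
        qed simp
      qed
      also have "... = emeasure \<mu> B + ennreal (real n) * (\<integral>\<^sup>+z. ennreal ((cmod (F' (\<eta> z)))\<^sup>2) * iV z \<partial>\<mu>)"
        by (simp add: nn_integral_add nn_integral_cmult)
      also have "... < \<infinity>" using fin base_finite[OF B] by (simp add: ennreal_mult_less_top)
      finally show "(\<integral>\<^sup>+z. ennreal (norm (indicator B z *\<^sub>R F' (\<eta> z))) \<partial>\<mu>) < \<infinity>" .
    qed measurable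
    have finB: "(\<integral>\<^sup>+z. ennreal ((cmod (indicator B z :: complex))\<^sup>2) * ennreal (modV z) \<partial>\<mu>) < \<infinity>"
      using base_modV[OF B] by (simp add: norm_indicator_sq mult.commute)
    have "(\<integral>z. F' (\<eta> z) * cnj (indicator B z) \<partial>\<mu>) = 0"
      using invF_inner[OF base_integrable[OF B] finB F F'] zero[OF B] by simp
    moreover have "(\<integral>z. F' (\<eta> z) * cnj (indicator B z) \<partial>\<mu>) = (\<integral>z. indicator B z *\<^sub>R F' (\<eta> z) \<partial>\<mu>)"
      by (intro int_cong) (simp add: indicator_def)
    ultimately show "(LINT z:B|\<mu>. F' (\<eta> z)) = 0" by (simp add: set_lebesgue_integral_def)
  qed (use base_countable base_Int in auto)
  then have "(\<integral>\<^sup>+z. ennreal ((cmod (F' (\<eta> z)))\<^sup>2) * iV z \<partial>\<mu>) = 0"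
    by (subst nn_integral_0_iff_AE) auto
  then have z: "(\<integral>\<^sup>+\<xi>. ennreal ((cmod (F' \<xi>))\<^sup>2) \<partial>\<sigma>) = 0"
    using nn_sigma[of "\<lambda>\<xi>. ennreal ((cmod (F' \<xi>))\<^sup>2)"] by simp
  have "(\<integral>\<^sup>+v. ennreal ((cmod (F v))\<^sup>2) \<partial>\<nu>) = ennreal ((hnorm (L2 \<nu> \<C>) ?X)\<^sup>2)"
    using CL2.L2_class_norm[OF F] by simp
  also have "hnorm (L2 \<nu> \<C>) ?X = hnorm (L2 \<sigma> \<C>) (FU ?X)"
    using FU_unitary X by (simp add: hunitary_def hnorm_def)
  also have "ennreal ((hnorm (L2 \<sigma> \<C>) (FU ?X))\<^sup>2) = 0"
    using CL2.L2_class_norm[OF F'(1)] z by (simp add: F'(2))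
  finally have "AE v in \<nu>. ennreal ((cmod (F v))\<^sup>2) = 0"
    by (subst (asm) nn_integral_0_iff_AE) auto
  then show ?thesis by eventually_elim (simp add: ennreal_eq_0_iff)
qed

text \<open>Testing with rectangles, first in q for fixed B: the fibre integral against
  \<open>invF (indicator B)\<close> vanishes for almost all q. As the base is countable, one null
  set of q serves all B, and outside it \<open>fibre_zero\<close> applies to the fibre.\<close>

lemma theta_separating:
  assumes f: "f \<in> sqint haarG \<C>"
    and zero: "\<And>k. k \<in> Kern ==> (\<integral>x. f x * cnj (theta k x) \<partial>haarG) = 0"
  shows "AE x in haarG. f x = 0"
proof -
  interpret P: pair_sigma_finite \<mu> \<nu> ..
  have fm [measurable]: "f \<in> borel_measurable borel2"
    using f by (simp add: sqint_complex_iff meas_haarG_iff)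
  define \<phi> where "\<phi> B q = (\<integral>v. f (q, v) * cnj (invF (indicator B) v) \<partial>\<nu>)" for B q
  have phi_zero: "AE q in \<mu>. inverse (modV q) *\<^sub>R \<phi> B q = 0" if B: "B \<in> base" for B
  proof (rule AE_zero_of_pi_system[where G = base and C = base])
    show "sets \<mu> = sigma_sets (space \<mu>) base" using base_sigma by simp
    show "\<Union>base = space \<mu>" using base_cover by simp
    have [measurable]: "invF (indicator B) \<in> borel_measurable borel"
      by (rule invF_measurable) (use base_sets[OF B] in measurable)
    fix A assume A: "A \<in> base"
    note [measurable] = base_sets[OF A]
    let ?k = "\<lambda>x. indicator A (fst x) * indicator B (snd x) :: complex"
    note k = base_rect_Kern[OF A B]
    let ?F = "\<lambda>x. inverse (modV (fst x)) *\<^sub>R (f x * cnj (theta ?k x))"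
    have i0: "integrable haarG (\<lambda>x. f x * cnj (theta ?k x))"
      using CL2.sqint_inner_integrable[OF f theta_sqint[OF k(1)]] by simp
    have tm: "theta ?k \<in> borel_measurable borel2"
      by (rule theta_measurable) (use k(1) in \<open>simp add: Kern_def\<close>)
    note [measurable] = tm
    have d: "haarG = density (\<mu> \<Otimes>\<^sub>M \<nu>) (\<lambda>x. ennreal (inverse (modV (fst x))))"
      by (simp add: haarG_def ext_haar_def split_def)
    have nn: "AE x in \<mu> \<Otimes>\<^sub>M \<nu>. 0 \<le> inverse (modV (fst x))"
      using modV_pos by (simp add: less_imp_le)
    have i1: "integrable (\<mu> \<Otimes>\<^sub>M \<nu>) ?F"
      using i0 unfolding d by (subst (asm) integrable_density[OF _ _ nn]) simp_all
    have e1: "(\<integral>x. f x * cnj (theta ?k x) \<partial>haarG) = (\<integral>x. ?F x \<partial>(\<mu> \<Otimes>\<^sub>M \<nu>))"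
      unfolding d by (rule integral_density[OF _ _ nn]) measurable
    have sec: "(\<integral>v. ?F (q, v) \<partial>\<nu>) = indicator A q *\<^sub>R (inverse (modV q) *\<^sub>R \<phi> B q)" for q
    proof -
      have "(\<integral>v. ?F (q, v) \<partial>\<nu>) = (\<integral>v. (indicator A q *\<^sub>R inverse (modV q)) *\<^sub>R (f (q, v) * cnj (invF (indicator B) v)) \<partial>\<nu>)"
        by (intro int_cong)
          (simp only: k(2) fst_conv snd_conv, simp add: indicator_def)
      then show ?thesis by (simp add: \<phi>_def)
    qed
    show "set_integrable \<mu> A (\<lambda>q. inverse (modV q) *\<^sub>R \<phi> B q)"
      using P.integrable_fst'[OF i1] unfolding sec set_integrable_def .
    have "(\<integral>q. indicator A q *\<^sub>R (inverse (modV q) *\<^sub>R \<phi> B q) \<partial>\<mu>) = (\<integral>x. ?F x \<partial>(\<mu> \<Otimes>\<^sub>M \<nu>))"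
      using P.integral_fst'[OF i1] unfolding sec .
    then show "(LINT q:A|\<mu>. inverse (modV q) *\<^sub>R \<phi> B q) = 0"
      using zero[OF k(1)] e1 by (simp add: set_lebesgue_integral_def)
  qed (use base_countable base_Int in auto)
  have "AE q in \<mu>. \<forall>B\<in>base. inverse (modV q) *\<^sub>R \<phi> B q = 0"
    using phi_zero base_countable by (subst AE_ball_countable) auto
  moreover have "AE q in \<mu>. (\<integral>\<^sup>+v. ennreal ((cmod (f (q, v)))\<^sup>2) \<partial>\<nu>) < \<infinity>"
  proof -
    have "(\<integral>\<^sup>+q. (\<integral>\<^sup>+v. ennreal ((cmod (f (q, v)))\<^sup>2) \<partial>\<nu>) * iV q \<partial>\<mu>) < \<infinity>"
      using f nn_haarG[of "\<lambda>x. ennreal ((cmod (f x))\<^sup>2)"] by (simp add: sqint_complex_iff)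
    then have "AE q in \<mu>. (\<integral>\<^sup>+v. ennreal ((cmod (f (q, v)))\<^sup>2) \<partial>\<nu>) * iV q \<noteq> \<infinity>"
      by (intro nn_integral_PInf_AE) simp_all
    then show ?thesis
    proof eventually_elim
      case (elim q)
      have "iV q \<noteq> 0" using modV_pos[of q] by simp
      then show ?case using elim by (auto simp: ennreal_mult_eq_top_iff less_top)
    qed
  qed
  ultimately have "AE q in \<mu>. AE v in \<nu>. f (q, v) = 0"
  proof eventually_elim
    case (elim q)
    show ?case
    proof (rule fibre_zero)
      show "(\<lambda>v. f (q, v)) \<in> sqint \<nu> \<C>"
        using elim(2) by (simp add: sqint_complex_iff)
      show "(\<integral>v. f (q, v) * cnj (invF (indicator B) v) \<partial>\<nu>) = 0" if "B \<in> base" for B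
        using bspec[OF elim(1) that] modV_pos[of q] by (simp add: \<phi>_def)
    qed
  qed
  then show ?thesis by (intro AE_haarG) simp_all
qed

text \<open>In the sheared coordinates, pairing with kernels made from indicators of base sets is
  integration over rectangles, and these form a pi-system generating the product
  sigma-algebra.\<close>

lemma kerTensor_separating:
  assumes g: "g \<in> sqint kerM \<C>"
    and zero: "\<And>c e. c \<in> Sq ==> e \<in> Dom ==> (\<integral>x. g x * cnj (kerTensor c e x) \<partial>kerM) = 0"
  shows "AE x in kerM. g x = 0"
proof -
  have gm [measurable]: "g \<in> borel_measurable borel2"
    using g by (simp add: sqint_complex_iff meas_kerM_iff)
  \<comment> \<open>g in the coordinates (z, w) with w = - q + z, that is q = z + - w. The phase is
    absorbed here: the conjugate of \<open>kerTensor\<close> carries \<open>b\<close>, which never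
    vanishes.\<close>
  define g' where "g' = (\<lambda>(z, w). g (z + - w, z) * b (- z) (z + - w))"
  have g'm [measurable]: "g' \<in> borel_measurable borel2" unfolding g'_def by measurable
  have shear: "g' (shear x) = g x * b (- snd x) (fst x)" for x
  proof -
    have "snd x + - (- fst x + snd x) = fst x"
      by (simp only: minus_add minus_minus) (simp flip: add.assoc)
    then show ?thesis by (simp add: g'_def shear_def)
  qed
  let ?G = "(\<lambda>(A, B). A \<times> B) ` (base \<times> base)"
  have "AE x in QQ. g' x = 0"
  proof (rule AE_zero_of_pi_system[where G = ?G and C = ?G])
    show "countable ?G" using base_countable by auto
    have cov: "\<exists>A\<in>base. x \<in> A" for x using base_cover by (metis UNIV_I UnionE)
    have "(x, y) \<in> \<Union>?G" for x y
    proof -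
      obtain A B where "A \<in> base" "x \<in> A" "B \<in> base" "y \<in> B" using cov[of x] cov[of y] by (elim bexE)
      then show ?thesis by (intro UnionI[of "A \<times> B"]) auto
    qed
    then show "\<Union>?G = space QQ" by (auto simp: space_pair_measure)
    show "Int_stable ?G"
    proof (rule Int_stableI)
      fix X Y assume "X \<in> ?G" "Y \<in> ?G"
      then obtain A B C D where *: "A \<in> base" "B \<in> base" "X = A \<times> B" "C \<in> base" "D \<in> base" "Y = C \<times> D" by auto
      have "X \<inter> Y = (A \<inter> C) \<times> (B \<inter> D)" using * by auto
      moreover have "A \<inter> C \<in> base" "B \<inter> D \<in> base" using Int_stableD[OF base_Int] * by auto
      ultimately show "X \<inter> Y \<in> ?G" by auto
    qed
    show "sets QQ = sigma_sets (space QQ) ?G"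
    proof -
      have s: "sets (borel :: 'q measure) = sets (sigma UNIV base)" using base_sigma by simp
      have "sets QQ = sets (sigma UNIV base \<Otimes>\<^sub>M sigma UNIV base)"
        unfolding sets_wQQ by (rule sets_pair_measure_cong[OF s s])
      also have "sigma UNIV base \<Otimes>\<^sub>M sigma UNIV base = sigma (UNIV \<times> UNIV) {a \<times> b | a b. a \<in> base \<and> b \<in> base}"
        by (rule sigma_prod) (use base_cover base_countable in \<open>auto intro!: exI[of _ base]\<close>)
      also have "{a \<times> b | a b. a \<in> base \<and> b \<in> base} = ?G" by auto
      also have "sets (sigma (UNIV \<times> UNIV) ?G) = sigma_sets (space QQ) ?G"
        by (simp add: space_pair_measure)
      finally show ?thesis .
    qed
    fix X assume "X \<in> ?G"
    then obtain A B where A: "A \<in> base" and B: "B \<in> base" and X: "X = A \<times> B" by auto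
    note [measurable] = base_sets[OF A] base_sets[OF B]
    let ?c = "\<lambda>x. indicator A x :: complex" and ?e = "\<lambda>x. indicator B x :: complex"
    have c: "?c \<in> Sq" and e: "?e \<in> Dom" using base_Dom[OF A] base_Dom[OF B] Dom_Sq by auto
    let ?H = "\<lambda>x. indicator X x *\<^sub>R g' x"
    have Hm: "?H \<in> borel_measurable borel2" unfolding X by measurable
    have eq: "g x * cnj (kerTensor ?c ?e x) = ?H (shear x)" for x
      unfolding shear X by (simp add: kerTensor_def split_def shear_def indicator_def)
    have "integrable kerM (\<lambda>x. g x * cnj (kerTensor ?c ?e x))"
      using CL2.sqint_inner_integrable[OF g Kern_sqint[OF kerTensor_Kern[OF c e]]] by simp
    then show "set_integrable QQ X g'"
      unfolding set_integrable_def eq integral_shear(2)[OF Hm] .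
    show "(LINT x:X|QQ. g' x) = 0"
      using zero[OF c e] unfolding set_lebesgue_integral_def eq integral_shear(1)[OF Hm] .
  qed auto
  then have "AE x in distr kerM QQ shear. g' x = 0" by (simp only: distr_shear)
  then have "AE x in kerM. g' (shear x) = 0" by (rule AE_distrD[OF shear_QQ])
  then show ?thesis
  proof eventually_elim
    case (elim x)
    have "b (- snd x) (fst x) \<noteq> 0" using norm_b[of "- snd x" "fst x"] by force
    then show ?case using elim by (simp add: shear)
  qed
qed

lemma L2_total_of_separating:
  assumes S: "S \<subseteq> sqint M \<C>"
    and sep: "\<And>f. f \<in> sqint M \<C> ==>
      (\<And>k. k \<in> S ==> (\<integral>x. f x * cnj (k x) \<partial>M) = 0) ==> AE x in M. f x = 0"
  shows "htotal (L2 M \<C>) (L2_class M \<C> ` S)"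
  unfolding htotal_def
proof (intro conjI ballI impI)
  show "L2_class M \<C> ` S \<subseteq> hcar (L2 M \<C>)"
    using S CL2.L2_class_car by blast
  fix X assume X: "X \<in> hcar (L2 M \<C>)"
    "\<forall>s\<in>L2_class M \<C> ` S. hinner (L2 M \<C>) X s = 0"
  obtain f where f: "f \<in> sqint M \<C>" "X = L2_class M \<C> f"
    using CL2.L2_class_ex[OF X(1)] by blast
  have "(\<integral>x. f x * cnj (k x) \<partial>M) = 0" if "k \<in> S" for k
    using X(2) that CL2.L2_class_inner[OF f(1), of k] S f(2) by auto
  from sep[OF f(1) this] have "AE x in M. f x = 0" by blast
  then have "hinner (L2 M \<C>) X X = 0"
    unfolding f(2) CL2.L2_class_inner[OF f(1) f(1)]
    by (intro integral_eq_zero_AE) auto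
  then show "X = hzero (L2 M \<C>)" by (rule CL2.L2.eq_zeroI[OF X(1)])
qed

text \<open>The transform is isometric on kernels, and both its domain and its image are total, so
  it extends to a unitary. A unitary carries the total family of product kernels to a total
  family.\<close>

theorem coefficients_total:
  "htotal (L2 haarG \<C>)
    ((\<lambda>(c, e). L2_class haarG \<C> (theta (kerTensor c e))) ` (Sq \<times> Dom))"
proof -
  let ?H = "L2 kerM \<C>" and ?K = "L2 haarG \<C>"
  let ?S = "(\<lambda>k. (L2_class kerM \<C> k, L2_class haarG \<C> (theta k))) ` Kern"
  interpret hilbert_pair ?H ?K ?S
  proof
    show "?S \<subseteq> hcar ?H \<times> hcar ?K"
    proof (rule image_subsetI)
      fix k assume "k \<in> Kern"
      then show "(L2_class kerM \<C> k, L2_class haarG \<C> (theta k)) \<in> hcar ?H \<times> hcar ?K"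
        by (intro SigmaI CL2.L2_class_car Kern_sqint theta_sqint)
    qed
    fix p q assume "p \<in> ?S" "q \<in> ?S"
    then obtain k l where kl: "k \<in> Kern" "l \<in> Kern"
      and p: "p = (L2_class kerM \<C> k, L2_class haarG \<C> (theta k))"
      and q: "q = (L2_class kerM \<C> l, L2_class haarG \<C> (theta l))" by (elim imageE)
    show "hinner ?H (fst p) (fst q) = hinner ?K (snd p) (snd q)"
      unfolding p q fst_conv snd_conv CL2.L2_class_inner[OF Kern_sqint[OF kl(1)] Kern_sqint[OF kl(2)]]
        CL2.L2_class_inner[OF theta_sqint[OF kl(1)] theta_sqint[OF kl(2)]]
      using theta_inner[OF kl] by simp
  qed
  let ?T = "(\<lambda>(c, e). kerTensor c e) ` (Sq \<times> Dom)"
  have TK: "?T \<subseteq> Kern" using kerTensor_Kern by auto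
  have tot: "htotal ?H (L2_class kerM \<C> ` ?T)"
  proof (rule L2_total_of_separating)
    show "?T \<subseteq> sqint kerM \<C>" using TK Kern_sqint by blast
    fix f assume "f \<in> sqint kerM \<C>" "\<And>k. k \<in> ?T ==> (\<integral>x. f x * cnj (k x) \<partial>kerM) = 0"
    then show "AE x in kerM. f x = 0" by (intro kerTensor_separating) auto
  qed
  have fst_S: "fst ` ?S = L2_class kerM \<C> ` Kern" by (simp add: image_image)
  have snd_S: "snd ` ?S = L2_class haarG \<C> ` theta ` Kern" by (simp add: image_image)
  have tot_H: "htotal ?H (fst ` ?S)"
    unfolding fst_S htotal_def
  proof (intro conjI ballI impI)
    show "L2_class kerM \<C> ` Kern \<subseteq> hcar ?H"
      by (intro image_subsetI CL2.L2_class_car Kern_sqint)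
    fix x assume "x \<in> hcar ?H" "\<forall>s\<in>L2_class kerM \<C> ` Kern. hinner ?H x s = 0"
    moreover have "L2_class kerM \<C> ` ?T \<subseteq> L2_class kerM \<C> ` Kern"
      by (rule image_mono[OF TK])
    ultimately show "x = hzero ?H"
      using tot unfolding htotal_def by (meson subsetD)
  qed
  have tot_K: "htotal ?K (snd ` ?S)"
    unfolding snd_S
  proof (rule L2_total_of_separating)
    show "theta ` Kern \<subseteq> sqint haarG \<C>" using theta_sqint by blast
    fix f assume "f \<in> sqint haarG \<C>" "\<And>k. k \<in> theta ` Kern ==> (\<integral>x. f x * cnj (k x) \<partial>haarG) = 0"
    then show "AE x in haarG. f x = 0" by (intro theta_separating) auto
  qed
  obtain U where U: "hunitary ?H ?K U" and U_S: "\<forall>p\<in>?S. U (fst p) = snd p"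
    using unitary_extension[OF tot_H tot_K] by (elim exE conjE)
    from U have "hunitary ?H ?K U" .
  then have "htotal ?K (U ` L2_class kerM \<C> ` ?T)"
    by (rule unitary_image_total[OF CL2.hilbert_L2 CL2.hilbert_L2 _ tot])
  moreover have "U (L2_class kerM \<C> k) = L2_class haarG \<C> (theta k)" if "k \<in> Kern" for k
    using bspec[OF U_S imageI[OF that]] by simp
  then have "U ` L2_class kerM \<C> ` ?T = (\<lambda>(c, e). L2_class haarG \<C> (theta (kerTensor c e))) ` (Sq \<times> Dom)"
  proof -
    assume *: "\<And>k. k \<in> Kern ==> U (L2_class kerM \<C> k) = L2_class haarG \<C> (theta k)"
    have "U (L2_class kerM \<C> (kerTensor c e)) = L2_class haarG \<C> (theta (kerTensor c e))"
      if "c \<in> Sq" "e \<in> Dom" for c e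
      by (rule *[OF kerTensor_Kern[OF that]])
    then show ?thesis unfolding image_image by (intro image_cong refl) (simp add: split_def mem_Times_iff)
  qed
  ultimately show ?thesis by simp
qed

end

section \<open>The weight and its GNS space\<close>

lemma (in hilbert) trace_adjoint:
  assumes E: "orthonormal_basis H E" and cE: "countable E" and A: "A \<in> bounded_ops H"
  shows "(\<integral>\<^sup>+e. ennreal ((hnorm H (A e))\<^sup>2) \<partial>count_space E) = (\<integral>\<^sup>+e. ennreal ((hnorm H (op_adj H A e))\<^sup>2) \<partial>count_space E)"
proof -
  have Ec: "\<And>e. e \<in> E ==> e \<in> hcar H" using E by (auto simp: orthonormal_basis_def)
  note Ac = bounded_opsD(2)[OF A] and Bc = bounded_opsD(2)[OF op_adj_bounded[OF A]]
  interpret C: sigma_finite_measure "count_space E" by (rule sigma_finite_measure_count_space_countable[OF cE])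
  interpret P: pair_sigma_finite "count_space E" "count_space E" ..
  have m: "case_prod f \<in> borel_measurable (count_space E \<Otimes>\<^sub>M count_space E)" for f :: "_ => _ => ennreal"
    by (simp add: pair_measure_countable[OF cE cE])
  have "(\<integral>\<^sup>+e. ennreal ((hnorm H (A e))\<^sup>2) \<partial>count_space E)
      = (\<integral>\<^sup>+e. \<integral>\<^sup>+f. ennreal ((cmod (hinner H (A e) f))\<^sup>2) \<partial>count_space E \<partial>count_space E)"
    by (intro nn_integral_cong) (simp add: parseval_nn[OF E Ac[OF Ec]])
  also have "... = (\<integral>\<^sup>+f. \<integral>\<^sup>+e. ennreal ((cmod (hinner H (A e) f))\<^sup>2) \<partial>count_space E \<partial>count_space E)"
    by (rule P.Fubini'[OF m, symmetric])
  also have "... = (\<integral>\<^sup>+f. \<integral>\<^sup>+e. ennreal ((cmod (hinner H (op_adj H A f) e))\<^sup>2) \<partial>count_space E \<partial>count_space E)"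
  proof (intro nn_integral_cong)
    fix e f assume "f \<in> space (count_space E)" "e \<in> space (count_space E)"
    then have ef: "e \<in> hcar H" "f \<in> hcar H" using Ec by auto
    have "cmod (hinner H (A e) f) = cmod (cnj (hinner H (op_adj H A f) e))"
      using op_adj_inner[OF A ef] inner_cnj[OF Bc[OF ef(2)] ef(1)] by simp
    then show "ennreal ((cmod (hinner H (A e) f))\<^sup>2) = ennreal ((cmod (hinner H (op_adj H A f) e))\<^sup>2)" by simp
  qed
  also have "... = (\<integral>\<^sup>+e. ennreal ((hnorm H (op_adj H A e))\<^sup>2) \<partial>count_space E)"
    by (intro nn_integral_cong) (simp add: parseval_nn[OF E Bc[OF Ec]])
  finally show ?thesis .
qed

text \<open>The rank one operator usually written |a><e|.\<close>

definition rk :: "'a hspace => 'a => 'a => 'a => 'a" where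
  "rk H a e = (\<lambda>x\<in>hcar H. hscale H (hinner H x e) a)"

context hilbert
begin

lemma rk_bounded:
  assumes "a \<in> hcar H" "e \<in> hcar H" shows "rk H a e \<in> bounded_ops H"
proof (rule bounded_opsI[where C = "hnorm H e * hnorm H a"])
  fix x assume x: "x \<in> hcar H"
  have "cmod (hinner H x e) * hnorm H a \<le> (hnorm H x * hnorm H e) * hnorm H a"
    by (rule mult_right_mono[OF cauchy_schwarz[OF x assms(2)] norm_nonneg[OF assms(1)]])
  then show "hnorm H (rk H a e x) \<le> hnorm H e * hnorm H a * hnorm H x"
    using x assms by (simp add: rk_def norm_scale mult_ac)
next
  fix x y assume xy: "x \<in> hcar H" "y \<in> hcar H"
  show "rk H a e (hadd H x y) = hadd H (rk H a e x) (rk H a e y)"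
    by (rule eqI) (use xy assms in \<open>auto simp: rk_def inner_simps algebra_simps\<close>)
next
  fix c x assume x: "x \<in> hcar H"
  show "rk H a e (hscale H c x) = hscale H c (rk H a e x)"
    by (rule eqI) (use x assms in \<open>auto simp: rk_def inner_simps algebra_simps\<close>)
qed (use assms in \<open>auto simp: rk_def\<close>)

lemma rk_adj:
  assumes a: "a \<in> hcar H" and e: "e \<in> hcar H" shows "op_adj H (rk H a e) = rk H e a"
proof (rule op_adjI[OF rk_bounded[OF a e] rk_bounded[OF e a]])
  fix x y assume xy: "x \<in> hcar H" "y \<in> hcar H"
  show "hinner H (rk H a e x) y = hinner H x (rk H e a y)"
    using xy a e inner_cnj[OF xy(2) a] by (simp add: rk_def inner_simps)
qed

end

text \<open>One countable family is asked to be total both in the plain and in the weighted space.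
  This gives separability of both and enough vectors in the domain of D^(1/2) at once.\<close>

locale weight_setup =
  fixes M :: "'x measure" and d :: "'x => real"
  assumes d_meas [measurable]: "d \<in> borel_measurable M" and d_pos: "0 < d x"
    and separating: "\<exists>F. countable F \<and> F \<subseteq> sqint M \<C> \<and>
      F \<subseteq> hcar (sqint_space (density M (\<lambda>x. ennreal (d x))) \<C>) \<and>
      htotal (L2 M \<C>) (L2_class M \<C> ` F) \<and>
      htotal (L2 (density M (\<lambda>x. ennreal (d x))) \<C>)
        (L2_class (density M (\<lambda>x. ennreal (d x))) \<C> ` F)"
begin

abbreviation "H \<equiv> L2 M \<C>"
abbreviation "D \<equiv> density M (\<lambda>x. ennreal (d x))"
abbreviation "HD \<equiv> L2 D \<C>"
abbreviation "rp X \<equiv> (SOME f. f \<in> X)"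
abbreviation "\<phi> \<equiv> trace_weight M d"

section \<open>The cut-off operators and the weight as a sum\<close>

definition E where "E = (SOME E. orthonormal_basis H E)"

lemma E: "orthonormal_basis H E"
  unfolding E_def by (rule CL2.L2.orthonormal_basis_some)

lemma E_car: "e \<in> E ==> e \<in> hcar H"
  using E by (auto simp: orthonormal_basis_def)

lemma E_countable: "countable E"
proof -
  have "\<exists>F. countable F \<and> htotal H (L2_class M \<C> ` F)"
    using separating by (elim exE conjE) (rule exI conjI | assumption)+
  then obtain F where F: "countable F" and tot: "htotal H (L2_class M \<C> ` F)"
    by (elim exE conjE)
  show ?thesis by (rule CL2.L2.orthonormal_basis_countable[OF E tot countable_image[OF F]])
qed

lemma rp: "X \<in> hcar H ==> rp X \<in> sqint M \<C>" "X \<in> hcar H ==> L2_class M \<C> (rp X) = X"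
  by (simp_all only: CL2.L2_rep)

lemma rp_meas: "X \<in> hcar H ==> rp X \<in> borel_measurable M"
  using rp(1) by (simp add: sqint_complex_iff)

lemma rp_class: "f \<in> sqint M \<C> ==> AE x in M. rp (L2_class M \<C> f) x = f x"
  by (rule CL2.L2_class_rep)

definition r :: "real => 'x => real" where "r \<epsilon> x = sqrt (d x / (1 + \<epsilon> * d x))"

definition R :: "real => ('x => complex) set => ('x => complex) set" where
  "R \<epsilon> = L2_op M (\<lambda>f x. complex_of_real (sqrt (d x / (1 + \<epsilon> * d x))) * f x)"

lemma r_meas [measurable]: "r \<epsilon> \<in> borel_measurable M" unfolding r_def by measurable

lemma r_sq: "\<epsilon> > 0 ==> (r \<epsilon> x)\<^sup>2 = d x / (1 + \<epsilon> * d x)"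
  using d_pos[of x] by (simp add: r_def)

text \<open>The first bound makes the cut-off operator bounded, the second compares it with the
  uncut density.\<close>

lemma r_sq_le:
  assumes "\<epsilon> > 0" shows "(r \<epsilon> x)\<^sup>2 \<le> 1 / \<epsilon>" "(r \<epsilon> x)\<^sup>2 \<le> d x"
proof -
  have p: "0 < 1 + \<epsilon> * d x" using d_pos[of x] assms by (simp add: add_pos_pos)
  have "d x * \<epsilon> \<le> 1 * (1 + \<epsilon> * d x)" by (simp add: mult.commute)
  then show "(r \<epsilon> x)\<^sup>2 \<le> 1 / \<epsilon>" unfolding r_sq[OF assms] using p assms by (simp add: frac_le_eq divide_le_eq le_divide_eq pos_divide_le_eq mult.commute)
  have "d x * 1 \<le> d x * (1 + \<epsilon> * d x)"
    using d_pos[of x] assms by (intro mult_left_mono) (simp_all add: less_imp_le)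
  then show "(r \<epsilon> x)\<^sup>2 \<le> d x" unfolding r_sq[OF assms] using p by (simp add: divide_le_eq)
qed

lemma r_mult_norm:
  assumes "\<epsilon> > 0" and f [measurable]: "f \<in> borel_measurable M"
  shows "(\<integral>\<^sup>+x. ennreal ((cmod (complex_of_real (r \<epsilon> x) * f x))\<^sup>2) \<partial>M)
    = (\<integral>\<^sup>+x. ennreal (d x / (1 + \<epsilon> * d x)) * ennreal ((cmod (f x))\<^sup>2) \<partial>M)"
proof (rule nn_integral_cong)
  fix x
  have nn: "0 \<le> d x / (1 + \<epsilon> * d x)" using r_sq[OF assms(1), of x] zero_le_power2[of "r \<epsilon> x"] by simp
  have eq: "(cmod (complex_of_real (r \<epsilon> x) * f x))\<^sup>2 = d x / (1 + \<epsilon> * d x) * (cmod (f x))\<^sup>2"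
    by (simp add: norm_mult power_mult_distrib r_sq[OF assms(1)])
  show "ennreal ((cmod (complex_of_real (r \<epsilon> x) * f x))\<^sup>2) = ennreal (d x / (1 + \<epsilon> * d x)) * ennreal ((cmod (f x))\<^sup>2)"
    unfolding eq by (rule ennreal_mult[OF nn]) simp
qed

lemma r_mult_sqint:
  assumes e: "\<epsilon> > 0" and f: "f \<in> sqint M \<C>"
  shows "(\<lambda>x. complex_of_real (r \<epsilon> x) * f x) \<in> sqint M \<C>"
proof -
  have [measurable]: "f \<in> borel_measurable M" using f by (simp add: sqint_complex_iff)
  have "(\<integral>\<^sup>+x. ennreal ((cmod (complex_of_real (r \<epsilon> x) * f x))\<^sup>2) \<partial>M)
     \<le> (\<integral>\<^sup>+x. ennreal (1 / \<epsilon>) * ennreal ((cmod (f x))\<^sup>2) \<partial>M)"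
  proof (rule nn_integral_mono)
    fix x
    have "(cmod (complex_of_real (r \<epsilon> x) * f x))\<^sup>2 = (r \<epsilon> x)\<^sup>2 * (cmod (f x))\<^sup>2"
      by (simp add: norm_mult power_mult_distrib)
    also have "... \<le> (1 / \<epsilon>) * (cmod (f x))\<^sup>2" by (intro mult_right_mono r_sq_le[OF e]) simp
    finally show "ennreal ((cmod (complex_of_real (r \<epsilon> x) * f x))\<^sup>2) \<le> ennreal (1 / \<epsilon>) * ennreal ((cmod (f x))\<^sup>2)"
      using e by (simp add: ennreal_leI flip: ennreal_mult)
  qed
  also have "... = ennreal (1 / \<epsilon>) * (\<integral>\<^sup>+x. ennreal ((cmod (f x))\<^sup>2) \<partial>M)" by (simp add: nn_integral_cmult)
  also have "... < \<infinity>" using f by (simp add: sqint_complex_iff ennreal_mult_less_top)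
  finally show ?thesis using f by (simp add: sqint_complex_iff)
qed

lemma R_apply: "X \<in> hcar H ==> R \<epsilon> X = L2_class M \<C> (\<lambda>x. complex_of_real (r \<epsilon> x) * rp X x)"
  by (simp add: R_def L2_op_def r_def)

lemma R_car: "\<epsilon> > 0 ==> X \<in> hcar H ==> R \<epsilon> X \<in> hcar H"
  using CL2.L2_class_car[OF r_mult_sqint[OF _ rp(1)]] by (simp add: R_apply)

lemma R_inner:
  assumes e: "\<epsilon> > 0" and X: "X \<in> hcar H" and Y: "Y \<in> hcar H"
  shows "hinner H (R \<epsilon> X) Y = hinner H X (R \<epsilon> Y)"
proof -
  have "hinner H (R \<epsilon> X) (L2_class M \<C> (rp Y)) = hinner H (L2_class M \<C> (rp X)) (R \<epsilon> Y)"
    unfolding R_apply[OF X] R_apply[OF Y]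
      CL2.L2_class_inner[OF r_mult_sqint[OF e rp(1)[OF X]] rp(1)[OF Y]]
      CL2.L2_class_inner[OF rp(1)[OF X] r_mult_sqint[OF e rp(1)[OF Y]]]
    by (intro int_cong) simp
  then show ?thesis by (simp add: rp(2) X Y)
qed

lemma R_norm:
  assumes e: "\<epsilon> > 0" and X: "X \<in> hcar H"
  shows "ennreal ((hnorm H (R \<epsilon> X))\<^sup>2) = (\<integral>\<^sup>+x. ennreal (d x / (1 + \<epsilon> * d x)) * ennreal ((cmod (rp X x))\<^sup>2) \<partial>M)"
  using CL2.L2_class_norm[OF r_mult_sqint[OF e rp(1)[OF X]]] r_mult_norm[OF e rp_meas[OF X]]
  by (simp add: R_apply[OF X])

lemma R_bounded:
  assumes e: "\<epsilon> > 0" shows "R \<epsilon> \<in> bounded_ops H"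
proof (rule bounded_opsI[where C = "sqrt (1 / \<epsilon>)"])
  show "R \<epsilon> \<in> extensional (hcar H)" by (simp add: R_def L2_op_def)
  show "R \<epsilon> X \<in> hcar H" if "X \<in> hcar H" for X by (rule R_car[OF e that])
  show "R \<epsilon> (hadd H X Y) = hadd H (R \<epsilon> X) (R \<epsilon> Y)" if "X \<in> hcar H" "Y \<in> hcar H" for X Y
    by (rule CL2.L2.eqI[where M = M]) (use that in \<open>auto simp: R_car[OF e] R_inner[OF e] CL2.L2.inner_simps\<close>)
  show "R \<epsilon> (hscale H c X) = hscale H c (R \<epsilon> X)" if "X \<in> hcar H" for c X
    by (rule CL2.L2.eqI[where M = M]) (use that in \<open>auto simp: R_car[OF e] R_inner[OF e] CL2.L2.inner_simps\<close>)
  fix X assume X: "X \<in> hcar H"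
  have "ennreal ((hnorm H (R \<epsilon> X))\<^sup>2) \<le> (\<integral>\<^sup>+x. ennreal (1 / \<epsilon>) * ennreal ((cmod (rp X x))\<^sup>2) \<partial>M)"
    unfolding R_norm[OF e X]
    by (intro nn_integral_mono mult_right_mono ennreal_leI) (use r_sq_le(1)[OF e] r_sq[OF e] in simp_all)
  also have "... = ennreal (1 / \<epsilon>) * ennreal ((hnorm H X)\<^sup>2)"
    using CL2.L2_class_norm[OF rp(1)[OF X]] rp_meas[OF X] by (simp add: nn_integral_cmult rp(2)[OF X])
  finally have "(hnorm H (R \<epsilon> X))\<^sup>2 \<le> (1 / \<epsilon>) * (hnorm H X)\<^sup>2"
    using e by (simp add: ennreal_le_iff flip: ennreal_mult)
  then have "(hnorm H (R \<epsilon> X))\<^sup>2 \<le> (sqrt (1 / \<epsilon>) * hnorm H X)\<^sup>2"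
    using e by (simp add: power_mult_distrib)
  then show "hnorm H (R \<epsilon> X) \<le> sqrt (1 / \<epsilon>) * hnorm H X"
    by (rule power2_le_imp_le) (use e X in simp)
qed

lemma R_adj: "\<epsilon> > 0 ==> op_adj H (R \<epsilon>) = R \<epsilon>"
  by (rule CL2.L2.op_adjI) (auto simp: R_bounded R_inner)

text \<open>The squared norm of D^(1/2) X as an extended number; finiteness singles out the
  domain.\<close>

definition wn :: "('x => complex) set => ennreal" where
  "wn X = (\<integral>\<^sup>+x. ennreal (d x) * ennreal ((cmod (rp X x))\<^sup>2) \<partial>M)"

lemma R_norm_le_wn: "\<epsilon> > 0 ==> X \<in> hcar H ==> ennreal ((hnorm H (R \<epsilon> X))\<^sup>2) \<le> wn X"
  unfolding R_norm wn_def
  by (intro nn_integral_mono mult_right_mono ennreal_leI) (use r_sq_le(2) r_sq in auto)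

lemma wn_lim:
  assumes X: "X \<in> hcar H"
  shows "(\<lambda>n. ennreal ((hnorm H (R (1 / real (Suc n)) X))\<^sup>2)) \<longlonglongrightarrow> wn X"
    and "incseq (\<lambda>n. ennreal ((hnorm H (R (1 / real (Suc n)) X))\<^sup>2))"
proof -
  note [measurable] = rp_meas[OF X]
  let ?f = "\<lambda>n x. ennreal (d x / (1 + 1 / real (Suc n) * d x)) * ennreal ((cmod (rp X x))\<^sup>2)"
  have eq: "ennreal ((hnorm H (R (1 / real (Suc n)) X))\<^sup>2) = (\<integral>\<^sup>+x. ?f n x \<partial>M)" for n
    by (rule R_norm) (use X in simp_all)
  have inc: "?f m x \<le> ?f n x" if "m \<le> n" for m n x
  proof (intro mult_right_mono ennreal_leI divide_left_mono)
    have "1 / real (Suc n) \<le> 1 / real (Suc m)" using that by (simp add: frac_le)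
    then show "1 + 1 / real (Suc n) * d x \<le> 1 + 1 / real (Suc m) * d x"
      using d_pos[of x] by (intro add_left_mono mult_right_mono) simp_all
    show "0 < (1 + 1 / real (Suc m) * d x) * (1 + 1 / real (Suc n) * d x)"
      using d_pos[of x] by (intro mult_pos_pos add_pos_pos) simp_all
  qed (use d_pos[of x] in simp_all)
  have inc': "incseq ?f" using inc by (auto simp: incseq_def le_fun_def)
  have lim: "(\<lambda>n. ?f n x) \<longlonglongrightarrow> ennreal (d x) * ennreal ((cmod (rp X x))\<^sup>2)" for x
  proof -
    have "(\<lambda>n. d x / (1 + 1 / real (Suc n) * d x)) \<longlonglongrightarrow> d x / (1 + 0 * d x)"
      by (intro tendsto_divide tendsto_add tendsto_mult tendsto_const lim_const_over_n[THEN LIMSEQ_Suc]) simp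
    then have "(\<lambda>n. (d x / (1 + 1 / real (Suc n) * d x)) * (cmod (rp X x))\<^sup>2) \<longlonglongrightarrow> d x * (cmod (rp X x))\<^sup>2"
      by (intro tendsto_mult_right) simp
    then have "(\<lambda>n. ennreal ((d x / (1 + 1 / real (Suc n) * d x)) * (cmod (rp X x))\<^sup>2)) \<longlonglongrightarrow> ennreal (d x * (cmod (rp X x))\<^sup>2)"
      by (rule tendsto_ennrealI)
    moreover have "0 \<le> d x / (1 + 1 / real (Suc n) * d x)" for n
      using r_sq[of "1 / real (Suc n)" x] zero_le_power2[of "r (1 / real (Suc n)) x"] by simp
    moreover have "0 \<le> d x" using d_pos[of x] by simp
    ultimately show ?thesis by (simp only: ennreal_mult zero_le_power2)
  qed
  show "(\<lambda>n. ennreal ((hnorm H (R (1 / real (Suc n)) X))\<^sup>2)) \<longlonglongrightarrow> wn X"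
    unfolding eq wn_def by (rule nn_integral_LIMSEQ[OF inc']) (use lim in measurable)
  show "incseq (\<lambda>n. ennreal ((hnorm H (R (1 / real (Suc n)) X))\<^sup>2))"
    unfolding eq incseq_def using inc by (auto intro!: nn_integral_mono)
qed

definition Phi :: "(('x => complex) set => ('x => complex) set) => ennreal" where
  "Phi T = \<phi> (op_comp H (op_adj H T) T)"

text \<open>The cut-offs are selfadjoint, so the trace for one \<epsilon> is the squared
  Hilbert-Schmidt norm of T times the cut-off.\<close>

lemma Phi_SUP:
  assumes T: "T \<in> bounded_ops H"
  shows "Phi T = (SUP \<epsilon>\<in>{0<..}. \<integral>\<^sup>+e. ennreal ((hnorm H (T (R \<epsilon> e)))\<^sup>2) \<partial>count_space E)"
  unfolding Phi_def trace_weight_def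
proof (rule SUP_cong[OF refl])
  fix \<epsilon> :: real assume "\<epsilon> \<in> {0<..}"
  then have e: "\<epsilon> > 0" by simp
  have Rd: "L2_op M (\<lambda>f x. complex_of_real (sqrt (d x / (1 + \<epsilon> * d x))) * f x) = R \<epsilon>" by (simp add: R_def)
  have eq: "Re (hinner H (op_comp H (R \<epsilon>) (op_comp H (op_comp H (op_adj H T) T) (R \<epsilon>)) f) f) = (hnorm H (T (R \<epsilon> f)))\<^sup>2"
    if f: "f \<in> E" for f
  proof -
    have fc: "f \<in> hcar H" and Rf: "R \<epsilon> f \<in> hcar H" using E_car[OF f] R_car[OF e] by auto
    have TR: "T (R \<epsilon> f) \<in> hcar H" by (rule bounded_opsD(2)[OF T Rf])
    have TTR: "op_adj H T (T (R \<epsilon> f)) \<in> hcar H" by (rule bounded_opsD(2)[OF CL2.L2.op_adj_bounded[OF T] TR])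
    have "hinner H (op_comp H (R \<epsilon>) (op_comp H (op_comp H (op_adj H T) T) (R \<epsilon>)) f) f
       = hinner H (R \<epsilon> (op_adj H T (T (R \<epsilon> f)))) f"
      using fc Rf by (simp add: op_comp_def)
    also have "... = hinner H (T (R \<epsilon> f)) (T (R \<epsilon> f))"
      by (simp add: R_inner[OF e TTR fc] CL2.L2.op_adj_inner'[OF T TR Rf])
    finally show ?thesis by (simp add: CL2.L2.norm_sq[OF TR])
  qed
  show "(let K = H; R = L2_op M (\<lambda>f x. complex_of_real (sqrt (d x / (1 + \<epsilon> * d x))) * f x)
     in pos_trace K (op_comp K R (op_comp K (op_comp H (op_adj H T) T) R)))
    = (\<integral>\<^sup>+e. ennreal ((hnorm H (T (R \<epsilon> e)))\<^sup>2) \<partial>count_space E)"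
    unfolding Let_def Rd pos_trace_def E_def[symmetric]
    by (intro nn_integral_cong) (simp add: eq)
qed

end

lemma tail_sum_tendsto_0:
  fixes w :: "'a => ennreal" and F :: "nat => 'a set"
  assumes fin: "(\<integral>\<^sup>+e. w e \<partial>count_space E) < \<infinity>" and F: "\<And>e. e \<in> E ==> \<exists>N. \<forall>n\<ge>N. e \<in> F n"
  shows "(\<lambda>n. \<integral>\<^sup>+e. w e * indicator (- F n) e \<partial>count_space E) \<longlonglongrightarrow> 0"
proof -
  have "(\<lambda>n. \<integral>\<^sup>+e. w e * indicator (- F n) e \<partial>count_space E) \<longlonglongrightarrow> (\<integral>\<^sup>+e. 0 \<partial>count_space E)"
  proof (rule nn_integral_dominated_convergence[where w = w])
    show "AE e in count_space E. (\<lambda>n. w e * indicator (- F n) e) \<longlonglongrightarrow> 0"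
    proof (rule AE_I2)
      fix e assume "e \<in> space (count_space E)"
      then obtain N where "\<forall>n\<ge>N. e \<in> F n" using F by auto
      then have "\<forall>n\<ge>N. w e * indicator (- F n) e = 0" by simp
      then show "(\<lambda>n. w e * indicator (- F n) e) \<longlonglongrightarrow> 0"
        by (intro tendsto_eventually eventually_sequentiallyI[of N]) simp
    qed
    show "AE e in count_space E. w e * indicator (- F n) e \<le> w e" for n
      by (intro AE_I2) (simp add: indicator_def)
  qed (use fin in auto)
  then show ?thesis by simp
qed

context weight_setup
begin

text \<open>By \<open>trace_adjoint\<close> the cut-off can be applied last, to the adjoint images
  of basis vectors. Each term then increases to \<open>wn\<close> as \<epsilon> decreases, and
  monotone convergence exchanges supremum and sum.\<close>

lemma Phi_eq:
  assumes T: "T \<in> bounded_ops H"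
  shows "Phi T = (\<integral>\<^sup>+e. wn (op_adj H T e) \<partial>count_space E)"
proof -
  let ?a = "\<lambda>\<epsilon>. \<integral>\<^sup>+e. ennreal ((hnorm H (R \<epsilon> (op_adj H T e)))\<^sup>2) \<partial>count_space E"
  have Tc: "op_adj H T e \<in> hcar H" if "e \<in> E" for e
    by (rule bounded_opsD(2)[OF CL2.L2.op_adj_bounded[OF T] E_car[OF that]])
  have a: "(\<integral>\<^sup>+e. ennreal ((hnorm H (T (R \<epsilon> e)))\<^sup>2) \<partial>count_space E) = ?a \<epsilon>" if e: "\<epsilon> > 0" for \<epsilon>
  proof -
    have "(\<integral>\<^sup>+e. ennreal ((hnorm H (T (R \<epsilon> e)))\<^sup>2) \<partial>count_space E)
        = (\<integral>\<^sup>+e. ennreal ((hnorm H (op_comp H T (R \<epsilon>) e))\<^sup>2) \<partial>count_space E)"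
      by (intro nn_integral_cong) (simp add: op_comp_def E_car)
    also have "... = (\<integral>\<^sup>+e. ennreal ((hnorm H (op_adj H (op_comp H T (R \<epsilon>)) e))\<^sup>2) \<partial>count_space E)"
      by (rule CL2.L2.trace_adjoint[OF E E_countable CL2.L2.op_comp_bounded[OF T R_bounded[OF e]]])
    also have "... = ?a \<epsilon>"
      unfolding CL2.L2.op_adj_comp[OF T R_bounded[OF e]] R_adj[OF e]
      by (intro nn_integral_cong) (simp add: op_comp_def E_car)
    finally show ?thesis .
  qed
  have Phi: "Phi T = (SUP \<epsilon>\<in>{0<..}. ?a \<epsilon>)"
    unfolding Phi_SUP[OF T] by (rule SUP_cong[OF refl]) (simp add: a)
  show ?thesis
  proof (rule antisym)
    show "Phi T \<le> (\<integral>\<^sup>+e. wn (op_adj H T e) \<partial>count_space E)"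
      unfolding Phi
    proof (rule SUP_least)
      fix \<epsilon> :: real assume "\<epsilon> \<in> {0<..}"
      then show "?a \<epsilon> \<le> (\<integral>\<^sup>+e. wn (op_adj H T e) \<partial>count_space E)"
        by (intro nn_integral_mono R_norm_le_wn) (simp_all add: Tc)
    qed
    \<comment> \<open>Extended by zero off E, since monotone convergence asks for monotonicity and
      limits at every point of the type.\<close>
    let ?f = "\<lambda>n e. if e \<in> E then ennreal ((hnorm H (R (1 / real (Suc n)) (op_adj H T e)))\<^sup>2) else 0"
    let ?u = "\<lambda>e. if e \<in> E then wn (op_adj H T e) else 0"
    have "(\<lambda>n. \<integral>\<^sup>+e. ?f n e \<partial>count_space E) \<longlonglongrightarrow> (\<integral>\<^sup>+e. ?u e \<partial>count_space E)"
    proof (rule nn_integral_LIMSEQ)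
      show "incseq ?f"
        unfolding incseq_def le_fun_def
      proof (intro allI impI)
        fix m n :: nat and e assume "m \<le> n"
        then show "?f m e \<le> ?f n e"
          using wn_lim(2)[OF Tc, of e] by (auto simp: incseq_def)
      qed
      show "(\<lambda>n. ?f n e) \<longlonglongrightarrow> ?u e" for e using wn_lim(1)[OF Tc, of e] by (cases "e \<in> E") simp_all
    qed simp
    moreover have "(\<integral>\<^sup>+e. ?f n e \<partial>count_space E) = ?a (1 / real (Suc n))" for n
      by (intro nn_integral_cong) simp
    moreover have "(\<integral>\<^sup>+e. ?u e \<partial>count_space E) = (\<integral>\<^sup>+e. wn (op_adj H T e) \<partial>count_space E)"
      by (intro nn_integral_cong) simp
    ultimately have lim: "(\<lambda>n. ?a (1 / real (Suc n))) \<longlonglongrightarrow> (\<integral>\<^sup>+e. wn (op_adj H T e) \<partial>count_space E)" by simp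
    have "?a (1 / real (Suc n)) \<le> Phi T" for n
      unfolding Phi by (rule SUP_upper) simp
    then show "(\<integral>\<^sup>+e. wn (op_adj H T e) \<partial>count_space E) \<le> Phi T"
      by (intro LIMSEQ_le_const2[OF lim]) blast
  qed
qed

text \<open>In the form \<open>Phi_SUP\<close> the cut-off acts before T, so a factor A on the left
  is estimated term by term. The domain of the weight is a left ideal for this reason.\<close>

lemma Phi_ideal:
  assumes A: "A \<in> bounded_ops H" and T: "T \<in> bounded_ops H" and C: "C \<ge> 0"
    and le: "\<And>x. x \<in> hcar H ==> hnorm H (A x) \<le> C * hnorm H x"
  shows "Phi (op_comp H A T) \<le> ennreal (C\<^sup>2) * Phi T"
  unfolding Phi_SUP[OF CL2.L2.op_comp_bounded[OF A T]]
proof (rule SUP_least)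
  fix \<epsilon> :: real assume "\<epsilon> \<in> {0<..}"
  then have e: "\<epsilon> > 0" by simp
  have "(\<integral>\<^sup>+e. ennreal ((hnorm H (op_comp H A T (R \<epsilon> e)))\<^sup>2) \<partial>count_space E)
      \<le> (\<integral>\<^sup>+e. ennreal (C\<^sup>2) * ennreal ((hnorm H (T (R \<epsilon> e)))\<^sup>2) \<partial>count_space E)"
  proof (rule nn_integral_mono)
    fix f assume "f \<in> space (count_space E)"
    then have Rf: "R \<epsilon> f \<in> hcar H" using R_car[OF e E_car] by simp
    then have TR: "T (R \<epsilon> f) \<in> hcar H" by (rule bounded_opsD(2)[OF T])
    have "(hnorm H (A (T (R \<epsilon> f))))\<^sup>2 \<le> (C * hnorm H (T (R \<epsilon> f)))\<^sup>2"
      by (rule power_mono[OF le[OF TR] CL2.L2.norm_nonneg[OF bounded_opsD(2)[OF A TR]]])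
    then show "ennreal ((hnorm H (op_comp H A T (R \<epsilon> f)))\<^sup>2) \<le> ennreal (C\<^sup>2) * ennreal ((hnorm H (T (R \<epsilon> f)))\<^sup>2)"
      using Rf by (simp add: op_comp_def power_mult_distrib ennreal_leI flip: ennreal_mult)
  qed
  also have "... = ennreal (C\<^sup>2) * (\<integral>\<^sup>+e. ennreal ((hnorm H (T (R \<epsilon> e)))\<^sup>2) \<partial>count_space E)"
    by (simp add: nn_integral_cmult)
  also have "... \<le> ennreal (C\<^sup>2) * Phi T"
    unfolding Phi_SUP[OF T] by (intro mult_left_mono SUP_upper) (simp_all add: e)
  finally show "(\<integral>\<^sup>+e. ennreal ((hnorm H (op_comp H A T (R \<epsilon> e)))\<^sup>2) \<partial>count_space E) \<le> ennreal (C\<^sup>2) * Phi T" .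
qed

text \<open>
  The domain of \<open>D\<^sup>1\<^sup>/\<^sup>2\<close>. Instead of applying \<open>D\<^sup>1\<^sup>/\<^sup>2\<close>, the map \<open>jd\<close> reads a vector in the \<open>L\<^sup>2\<close> space of the
  measure with density \<open>d\<close>.
\<close>

definition DomH :: "('x => complex) set set" where
  "DomH = {X \<in> hcar H. wn X < \<infinity>}"

definition jd :: "('x => complex) set => ('x => complex) set" where
  "jd X = L2_class D \<C> (rp X)"

lemma DomH_car: "X \<in> DomH ==> X \<in> hcar H" by (simp add: DomH_def)

lemma AE_D: "AE x in M. P x ==> AE x in D. P x"
  by (subst AE_density) auto

lemma rp_sqintD: "X \<in> DomH ==> rp X \<in> sqint D \<C>"
proof -
  assume X: "X \<in> DomH"
  note m [measurable] = rp_meas[OF DomH_car[OF X]]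
  have "(\<integral>\<^sup>+x. ennreal ((cmod (rp X x))\<^sup>2) \<partial>D) = wn X"
    unfolding wn_def by (rule nn_integral_density) measurable
  then show ?thesis using X m by (simp add: sqint_complex_iff DomH_def)
qed

lemma jd_car: "X \<in> DomH ==> jd X \<in> hcar HD"
  unfolding jd_def by (rule CL2.L2_class_car[OF rp_sqintD])

lemma jd_norm: "X \<in> DomH ==> ennreal ((hnorm HD (jd X))\<^sup>2) = wn X"
proof -
  assume X: "X \<in> DomH"
  note m [measurable] = rp_meas[OF DomH_car[OF X]]
  have "(\<integral>\<^sup>+x. ennreal ((cmod (rp X x))\<^sup>2) \<partial>D) = wn X"
    unfolding wn_def by (rule nn_integral_density) measurable
  then show ?thesis using CL2.L2_class_norm[OF rp_sqintD[OF X]] by (simp add: jd_def)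
qed

lemma jd_class:
  assumes f: "f \<in> sqint M \<C>" "f \<in> sqint D \<C>"
  shows "L2_class M \<C> f \<in> DomH" "jd (L2_class M \<C> f) = L2_class D \<C> f"
proof -
  let ?X = "L2_class M \<C> f"
  have X: "?X \<in> hcar H" by (rule CL2.L2_class_car[OF f(1)])
  have fm [measurable]: "f \<in> borel_measurable M" using f(1) by (simp add: sqint_complex_iff)
  have ae: "AE x in M. rp ?X x = f x" by (rule rp_class[OF f(1)])
  have "wn ?X = (\<integral>\<^sup>+x. ennreal (d x) * ennreal ((cmod (f x))\<^sup>2) \<partial>M)"
    unfolding wn_def by (rule nn_integral_cong_AE) (use ae in eventually_elim, simp)
  also have "... = (\<integral>\<^sup>+x. ennreal ((cmod (f x))\<^sup>2) \<partial>D)" by (rule nn_integral_density[symmetric]) measurable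
  also have "... < \<infinity>" using f(2) by (simp add: sqint_complex_iff)
  finally show WD: "?X \<in> DomH" using X by (simp add: DomH_def)
  show "jd ?X = L2_class D \<C> f"
    unfolding jd_def by (rule CL2.L2_class_eq_iff[THEN iffD2, OF rp_sqintD[OF WD] f(2) AE_D[OF ae]])
qed

lemma jd_add:
  assumes X: "X \<in> DomH" and Y: "Y \<in> DomH"
  shows "hadd H X Y \<in> DomH" "jd (hadd H X Y) = hadd HD (jd X) (jd Y)"
proof -
  let ?f = "\<lambda>x. rp X x + rp Y x"
  have f: "?f \<in> sqint M \<C>" "?f \<in> sqint D \<C>"
    using CL2.sqint_add[OF rp(1)[OF DomH_car[OF X]] rp(1)[OF DomH_car[OF Y]]] CL2.sqint_add[OF rp_sqintD[OF X] rp_sqintD[OF Y]]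
    by simp_all
  have eq: "hadd H X Y = L2_class M \<C> ?f"
    using CL2.L2_class_add[OF rp(1)[OF DomH_car[OF X]] rp(1)[OF DomH_car[OF Y]]]
    by (simp add: rp(2)[OF DomH_car[OF X]] rp(2)[OF DomH_car[OF Y]])
  show "hadd H X Y \<in> DomH" unfolding eq by (rule jd_class(1)[OF f])
  show "jd (hadd H X Y) = hadd HD (jd X) (jd Y)"
    unfolding eq jd_class(2)[OF f] using CL2.L2_class_add[OF rp_sqintD[OF X] rp_sqintD[OF Y]] by (simp add: jd_def)
qed

lemma jd_scale:
  assumes X: "X \<in> DomH"
  shows "hscale H c X \<in> DomH" "jd (hscale H c X) = hscale HD c (jd X)"
proof -
  let ?f = "\<lambda>x. c * rp X x"
  have f: "?f \<in> sqint M \<C>" "?f \<in> sqint D \<C>"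
    using CL2.sqint_scale[OF rp(1)[OF DomH_car[OF X]], of c] CL2.sqint_scale[OF rp_sqintD[OF X], of c]
    by simp_all
  have eq: "hscale H c X = L2_class M \<C> ?f"
    using CL2.L2_class_scale[OF rp(1)[OF DomH_car[OF X]], of c] by (simp add: rp(2)[OF DomH_car[OF X]])
  show "hscale H c X \<in> DomH" unfolding eq by (rule jd_class(1)[OF f])
  show "jd (hscale H c X) = hscale HD c (jd X)"
    unfolding eq jd_class(2)[OF f] using CL2.L2_class_scale[OF rp_sqintD[OF X], of c] by (simp add: jd_def)
qed

lemma jd_inner:
  assumes X: "X \<in> DomH" and Y: "Y \<in> DomH"
  shows "hinner HD (jd X) (jd Y) = (\<integral>x. rp X x * cnj (rp Y x) \<partial>D)"
  using CL2.L2_class_inner[OF rp_sqintD[OF X] rp_sqintD[OF Y]] by (simp add: jd_def)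

lemma jd_zero: "hzero H \<in> DomH" "jd (hzero H) = hzero HD"
proof -
  have Z: "hzero H = L2_class M \<C> (\<lambda>_. 0)"
    using CL2.S.quot_zero[of M] by (simp add: L2_def L2_class_def CL2.ae_rel_null CL2.sqint_simps)
  have ZD: "hzero HD = L2_class D \<C> (\<lambda>_. 0)"
    using CL2.S.quot_zero[of D] by (simp add: L2_def L2_class_def CL2.ae_rel_null CL2.sqint_simps)
  have f: "(\<lambda>_. 0) \<in> sqint M \<C>" "(\<lambda>_. 0) \<in> sqint D \<C>"
    by (simp_all add: sqint_complex_iff)
  show "hzero H \<in> DomH" "jd (hzero H) = hzero HD"
    unfolding Z ZD using jd_class[OF f] by simp_all
qed

lemma separable_HD: "separable_hilbert HD"
proof -
  interpret HD: hilbert HD by (rule CL2.hilbert_L2)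
  obtain F where "countable F" "htotal HD (L2_class D \<C> ` F)"
    using separating by (elim exE conjE)
  then have "htotal HD (L2_class D \<C> ` F) \<and> countable (L2_class D \<C> ` F)"
    by (intro conjI countable_image)
  then show ?thesis
    by (intro separable_hilbert.intro separable_hilbert_axioms.intro CL2.hilbert_L2 exI)
qed

sublocale KE: L2_space HD "count_space E"
  by (rule L2_space.intro[OF separable_HD])

abbreviation "KK \<equiv> sqint_space (count_space E) HD"

text \<open>
  The weight of \<open>T\<^sup>* T\<close> is the sum of the \<open>\<parallel>D\<^sup>1\<^sup>/\<^sup>2 T\<^sup>* e\<parallel>\<^sup>2\<close>, so \<open>T \<mapsto> (D\<^sup>1\<^sup>/\<^sup>2 T\<^sup>* e)\<close> is a conjugate-linear
  isometry from the weight space into the square-summable families.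
\<close>

definition \<kappa> :: "(('x => complex) set => ('x => complex) set) => ('x => complex) set => ('x => complex) set" where
  "\<kappa> T e = jd (op_adj H T e)"

section \<open>The weight space as an inner product space\<close>

abbreviation "WD \<equiv> weight_domain H \<phi>"

lemma dom_iff: "T \<in> WD \<longleftrightarrow> T \<in> bounded_ops H \<and> Phi T < \<infinity>"
  by (simp add: weight_domain_def Phi_def)

lemma dom_bounded: "T \<in> WD ==> T \<in> bounded_ops H" by (simp add: dom_iff)

lemma adj_car: "T \<in> bounded_ops H ==> e \<in> E ==> op_adj H T e \<in> hcar H"
  by (rule bounded_opsD(2)[OF CL2.L2.op_adj_bounded E_car])

text \<open>A finite sum has finite terms; counting measure leaves no exceptional basis
  vector.\<close>

lemma dom_adj: assumes T: "T \<in> WD" and e: "e \<in> E" shows "op_adj H T e \<in> DomH"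
proof -
  have "(\<integral>\<^sup>+e. wn (op_adj H T e) \<partial>count_space E) < \<infinity>"
    using T Phi_eq[of T] by (simp add: dom_iff)
  then have "AE e in count_space E. wn (op_adj H T e) \<noteq> \<infinity>"
    by (intro nn_integral_PInf_AE) simp_all
  then have "wn (op_adj H T e) \<noteq> \<infinity>" using e by (simp add: AE_count_space)
  then show ?thesis using adj_car[OF dom_bounded[OF T] e] by (simp add: DomH_def less_top)
qed

lemma domI:
  assumes T: "T \<in> bounded_ops H" and e: "\<And>e. e \<in> E ==> op_adj H T e \<in> DomH"
    and g: "g \<in> hcar KK" "\<And>e. e \<in> E ==> \<kappa> T e = g e"
  shows "T \<in> WD" "Phi T = ennreal ((hnorm KK g)\<^sup>2)"
proof -
  have "Phi T = (\<integral>\<^sup>+e. ennreal ((hnorm HD (g e))\<^sup>2) \<partial>count_space E)"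
    unfolding Phi_eq[OF T]
    by (intro nn_integral_cong) (simp add: jd_norm[OF e, symmetric] g(2)[symmetric] \<kappa>_def)
  then show "Phi T = ennreal ((hnorm KK g)\<^sup>2)" by (simp add: KE.sqint_norm_nn[OF g(1)])
  then show "T \<in> WD" using T by (simp add: dom_iff)
qed

lemma \<kappa>_car: assumes T: "T \<in> WD" shows "\<kappa> T \<in> hcar KK"
proof -
  have "(\<integral>\<^sup>+e. ennreal ((hnorm HD (\<kappa> T e))\<^sup>2) \<partial>count_space E) = Phi T"
    unfolding Phi_eq[OF dom_bounded[OF T]]
    by (intro nn_integral_cong) (simp add: jd_norm[OF dom_adj[OF T]] \<kappa>_def)
  then show ?thesis
    using T jd_car[OF dom_adj[OF T]] by (simp add: KE.hcar_sqint KE.wmeas_def dom_iff \<kappa>_def)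
qed

lemma Phi_\<kappa>: "T \<in> WD ==> Phi T = ennreal ((hnorm KK (\<kappa> T))\<^sup>2)"
  by (rule domI(2)[OF dom_bounded dom_adj \<kappa>_car refl])

lemma \<kappa>_add:
  assumes S: "S \<in> WD" and T: "T \<in> WD"
  shows "op_add H S T \<in> WD" "e \<in> E ==> \<kappa> (op_add H S T) e = hadd HD (\<kappa> S e) (\<kappa> T e)"
    "Phi (op_add H S T) = ennreal ((hnorm KK (hadd KK (\<kappa> S) (\<kappa> T)))\<^sup>2)"
proof -
  have b: "op_add H S T \<in> bounded_ops H" by (rule CL2.L2.op_add_bounded[OF dom_bounded[OF S] dom_bounded[OF T]])
  have adj: "op_adj H (op_add H S T) e = hadd H (op_adj H S e) (op_adj H T e)" if "e \<in> E" for e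
    using CL2.L2.op_adj_add[OF dom_bounded[OF S] dom_bounded[OF T]] E_car[OF that] by (simp add: op_add_def)
  have dd: "op_adj H (op_add H S T) e \<in> DomH" if "e \<in> E" for e
    unfolding adj[OF that] by (rule jd_add(1)[OF dom_adj[OF S that] dom_adj[OF T that]])
  show eq: "\<kappa> (op_add H S T) e = hadd HD (\<kappa> S e) (\<kappa> T e)" if "e \<in> E" for e
    unfolding \<kappa>_def adj[OF that] by (rule jd_add(2)[OF dom_adj[OF S that] dom_adj[OF T that]])
  have g: "hadd KK (\<kappa> S) (\<kappa> T) \<in> hcar KK" by (rule KE.S.add_car[OF \<kappa>_car[OF S] \<kappa>_car[OF T]])
  have eq': "\<kappa> (op_add H S T) e = hadd KK (\<kappa> S) (\<kappa> T) e" if "e \<in> E" for e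
    using eq[OF that] by (simp add: KE.sqint_simps)
  show "op_add H S T \<in> WD" "Phi (op_add H S T) = ennreal ((hnorm KK (hadd KK (\<kappa> S) (\<kappa> T)))\<^sup>2)"
    by (rule domI[OF b dd g eq'], assumption+)+
qed

lemma \<kappa>_scale:
  assumes S: "S \<in> WD"
  shows "op_scale H c S \<in> WD" "e \<in> E ==> \<kappa> (op_scale H c S) e = hscale HD (cnj c) (\<kappa> S e)"
proof -
  have b: "op_scale H c S \<in> bounded_ops H" by (rule CL2.L2.op_scale_bounded[OF dom_bounded[OF S]])
  have adj: "op_adj H (op_scale H c S) e = hscale H (cnj c) (op_adj H S e)" if "e \<in> E" for e
    using CL2.L2.op_adj_scale[OF dom_bounded[OF S]] E_car[OF that] by (simp add: op_scale_def)
  have dd: "op_adj H (op_scale H c S) e \<in> DomH" if "e \<in> E" for e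
    unfolding adj[OF that] by (rule jd_scale(1)[OF dom_adj[OF S that]])
  show eq: "\<kappa> (op_scale H c S) e = hscale HD (cnj c) (\<kappa> S e)" if "e \<in> E" for e
    unfolding \<kappa>_def adj[OF that] by (rule jd_scale(2)[OF dom_adj[OF S that]])
  have g: "hscale KK (cnj c) (\<kappa> S) \<in> hcar KK" by (rule KE.S.scale_car[OF \<kappa>_car[OF S]])
  have eq': "\<kappa> (op_scale H c S) e = hscale KK (cnj c) (\<kappa> S) e" if "e \<in> E" for e
    using eq[OF that] by (simp add: KE.sqint_simps)
  show "op_scale H c S \<in> WD"
    by (rule domI(1)[OF b dd g eq'])
qed

text \<open>Identities for \<open>\<kappa>\<close> are available on E only, so equality off E cannot
  be expected.\<close>

lemma kin_cong:
  assumes "\<And>e. e \<in> E ==> f e = f' e" "\<And>e. e \<in> E ==> g e = g' e"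
  shows "hinner KK f g = hinner KK f' g'"
  unfolding KE.sqint_simps by (intro int_cong) (simp add: assms)

text \<open>The arguments trade places because \<open>\<kappa>\<close> is conjugate-linear. In the
  polarization sum, a scalar of modulus one moves from the second family to the first without
  changing the norm.\<close>

lemma weight_form_eq:
  assumes S: "S \<in> WD" and T: "T \<in> WD"
  shows "weight_form H \<phi> S T = hinner KK (\<kappa> T) (\<kappa> S)"
proof -
  note c = \<kappa>_car[OF S] \<kappa>_car[OF T]
  have nrm: "enn2real (Phi (op_add H S (op_scale H c T))) = (hnorm KK (hadd KK (\<kappa> T) (hscale KK c (\<kappa> S))))\<^sup>2"
    if one: "cmod c = 1" for c
  proof -
    note T' = \<kappa>_scale(1)[OF T, of c]
    have "hnorm KK (hadd KK (\<kappa> S) (\<kappa> (op_scale H c T))) = hnorm KK (hadd KK (\<kappa> S) (hscale KK (cnj c) (\<kappa> T)))"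
      unfolding hnorm_def using \<kappa>_scale(2)[OF T, of _ c]
      by (intro arg_cong[of _ _ sqrt] arg_cong[of _ _ Re] kin_cong) (simp_all add: KE.sqint_simps)
    moreover have "(hnorm KK (hadd KK (\<kappa> S) (hscale KK (cnj c) (\<kappa> T))))\<^sup>2 = (hnorm KK (hadd KK (\<kappa> T) (hscale KK c (\<kappa> S))))\<^sup>2"
    proof -
      have "Re (hinner KK (\<kappa> S) (hscale KK (cnj c) (\<kappa> T))) = Re (hinner KK (\<kappa> T) (hscale KK c (\<kappa> S)))"
        using KE.S.inner_cnj[OF c(1) c(2), symmetric] c by (simp add: KE.S.inner_scale_right)
      then show ?thesis
        using c one by (simp add: KE.S.norm_sq_add KE.S.norm_scale)
    qed
    ultimately show ?thesis by (simp add: \<kappa>_add(3)[OF S T'])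
  qed
  have "weight_form H \<phi> S T = (1 / 4) * (\<Sum>k<4. \<i> ^ k * complex_of_real (enn2real (Phi (op_add H S (op_scale H (\<i> ^ k) T)))))"
    by (simp add: weight_form_def Let_def Phi_def)
  also have "... = (1 / 4) * (\<Sum>k<4. \<i> ^ k * complex_of_real ((hnorm KK (hadd KK (\<kappa> T) (hscale KK (\<i> ^ k) (\<kappa> S))))\<^sup>2))"
    by (simp only: nrm norm_power norm_ii power_one)
  also have "... = hinner KK (\<kappa> T) (\<kappa> S)" by (rule KE.S.polarization[OF c(2,1), symmetric])
  finally show ?thesis .
qed

abbreviation "W \<equiv> weight_space H \<phi>"

lemma W_simps:
  "hcar W = WD" "hzero W = (\<lambda>x\<in>hcar H. hzero H)" "hadd W = op_add H" "hscale W = op_scale H"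
  "hinner W = weight_form H \<phi>" "hdiff W S T = op_add H S (op_scale H (- 1) T)"
  by (simp_all add: weight_space_def hdiff_def)

lemma zero_dom: "(\<lambda>x\<in>hcar H. hzero H) \<in> WD" and \<kappa>_zero: "e \<in> E ==> \<kappa> (\<lambda>x\<in>hcar H. hzero H) e = hzero HD"
proof -
  let ?Z = "\<lambda>x\<in>hcar H. hzero H"
  have b: "?Z \<in> bounded_ops H" by (rule CL2.L2.op_zero_bounded)
  have adj: "op_adj H ?Z = ?Z" by (rule CL2.L2.op_adjI[OF b b]) simp
  have dd: "op_adj H ?Z e \<in> DomH" if "e \<in> E" for e using jd_zero(1) E_car[OF that] by (simp add: adj)
  show k: "\<kappa> ?Z e = hzero HD" if "e \<in> E" for e using E_car[OF that] by (simp add: \<kappa>_def adj jd_zero)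
  have k': "\<kappa> ?Z e = hzero KK e" if "e \<in> E" for e using k[OF that] by (simp add: KE.sqint_simps)
  show "?Z \<in> WD" by (rule domI(1)[OF b dd KE.S.zero_car k'])
qed

sublocale W: semi_inner_space "weight_space (L2 M \<C>) (trace_weight M d)"
proof
  show "hzero W \<in> hcar W" using zero_dom by (simp add: W_simps)
  show "hadd W S T \<in> hcar W" if "S \<in> hcar W" "T \<in> hcar W" for S T
    using \<kappa>_add(1) that by (simp add: W_simps)
  show "hscale W c S \<in> hcar W" if "S \<in> hcar W" for c S
    using \<kappa>_scale(1) that by (simp add: W_simps)
  show "hinner W (hzero W) T = 0" if "T \<in> hcar W" for T
  proof -
    have T: "T \<in> WD" using that by (simp add: W_simps)
    have "hinner KK (\<kappa> T) (\<kappa> (hzero W)) = hinner KK (\<kappa> T) (hzero KK)"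
      by (rule kin_cong) (simp_all add: W_simps \<kappa>_zero KE.sqint_simps)
    then show ?thesis using weight_form_eq[OF zero_dom T] \<kappa>_car[OF T] by (simp add: W_simps)
  qed
  show "hinner W (hadd W S S') T = hinner W S T + hinner W S' T"
    if "S \<in> hcar W" "S' \<in> hcar W" "T \<in> hcar W" for S S' T
  proof -
    have d: "S \<in> WD" "S' \<in> WD" "T \<in> WD" using that by (simp_all add: W_simps)
    have "hinner KK (\<kappa> T) (\<kappa> (op_add H S S')) = hinner KK (\<kappa> T) (hadd KK (\<kappa> S) (\<kappa> S'))"
      by (rule kin_cong) (simp_all add: \<kappa>_add(2)[OF d(1,2)] KE.sqint_simps)
    then show ?thesis
      using d by (simp add: W_simps weight_form_eq \<kappa>_add(1) KE.S.inner_add_right \<kappa>_car)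
  qed
  show "hinner W (hscale W c S) T = c * hinner W S T" if "S \<in> hcar W" "T \<in> hcar W" for c S T
  proof -
    have d: "S \<in> WD" "T \<in> WD" using that by (simp_all add: W_simps)
    have "hinner KK (\<kappa> T) (\<kappa> (op_scale H c S)) = hinner KK (\<kappa> T) (hscale KK (cnj c) (\<kappa> S))"
      by (rule kin_cong) (simp_all add: \<kappa>_scale(2)[OF d(1)] KE.sqint_simps)
    then show ?thesis
      using d by (simp add: W_simps weight_form_eq \<kappa>_scale(1) KE.S.inner_scale_right \<kappa>_car)
  qed
  show "cnj (hinner W S T) = hinner W T S" if "S \<in> hcar W" "T \<in> hcar W" for S T
    using that by (simp add: W_simps weight_form_eq KE.S.inner_cnj \<kappa>_car)
  show "0 \<le> Re (hinner W S S)" if "S \<in> hcar W" for S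
    using that by (simp add: W_simps weight_form_eq KE.S.inner_pos \<kappa>_car)
qed

lemma W_norm: "T \<in> WD ==> ennreal ((hnorm W T)\<^sup>2) = Phi T"
proof -
  assume T: "T \<in> WD"
  have "(hnorm W T)\<^sup>2 = (hnorm KK (\<kappa> T))\<^sup>2"
    using T by (simp add: W.norm_sq W_simps weight_form_eq KE.S.norm_sq \<kappa>_car)
  then show ?thesis using Phi_\<kappa>[OF T] by simp
qed

lemma W_ideal:
  assumes A: "A \<in> bounded_ops H" and T: "T \<in> WD" and C: "C \<ge> 0"
    and le: "\<And>x. x \<in> hcar H ==> hnorm H (A x) \<le> C * hnorm H x"
  shows "op_comp H A T \<in> WD" "hnorm W (op_comp H A T) \<le> C * hnorm W T"
proof -
  have P: "Phi (op_comp H A T) \<le> ennreal (C\<^sup>2) * Phi T"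
    by (rule Phi_ideal[OF A dom_bounded[OF T] C]) (rule le)
  have "Phi (op_comp H A T) < \<infinity>"
    by (rule le_less_trans[OF P]) (use T in \<open>simp add: dom_iff ennreal_mult_less_top\<close>)
  then show AT: "op_comp H A T \<in> WD"
    using CL2.L2.op_comp_bounded[OF A dom_bounded[OF T]] by (simp add: dom_iff)
  have "ennreal ((hnorm W (op_comp H A T))\<^sup>2) \<le> ennreal (C\<^sup>2 * (hnorm W T)\<^sup>2)"
    using P by (simp add: W_norm[OF AT] W_norm[OF T] ennreal_mult)
  then have "(hnorm W (op_comp H A T))\<^sup>2 \<le> (C * hnorm W T)\<^sup>2"
    by (simp add: ennreal_le_iff power_mult_distrib)
  then show "hnorm W (op_comp H A T) \<le> C * hnorm W T"
    by (rule power2_le_imp_le) (use C T W.norm_nonneg[of T] in \<open>simp add: W_simps\<close>)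
qed

end

lemma (in hilbert) rk_linear:
  assumes "a \<in> hcar H" "a' \<in> hcar H" "e \<in> hcar H"
  shows "rk H (hadd H a a') e = op_add H (rk H a e) (rk H a' e)"
    "rk H (hscale H c a) e = op_scale H c (rk H a e)"
    "rk H e (hadd H a a') = op_add H (rk H e a) (rk H e a')"
    "rk H e (hscale H c a) = op_scale H (cnj c) (rk H e a)"
  using assms
  by (auto simp: rk_def op_add_def op_scale_def inner_simps algebra_simps intro!: restrict_ext eqI)

lemma sq_tendsto_0:
  assumes "\<And>n. 0 \<le> a n" "(\<lambda>n. ennreal ((a n)\<^sup>2)) \<longlonglongrightarrow> 0" shows "a \<longlonglongrightarrow> 0"
proof -
  have "(\<lambda>n. enn2real (ennreal ((a n)\<^sup>2))) \<longlonglongrightarrow> enn2real 0"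
    using assms(2) by (intro tendsto_enn2real) simp_all
  then have "(\<lambda>n. sqrt ((a n)\<^sup>2)) \<longlonglongrightarrow> sqrt 0" by (intro tendsto_real_sqrt) simp
  then show ?thesis by (simp add: assms(1))
qed

context weight_setup
begin

section \<open>Rank one operators in the GNS space\<close>

abbreviation "LL \<equiv> hcompletion W"
abbreviation "\<Lambda> \<equiv> hembed W"

lemma jd_diff:
  assumes "X \<in> DomH" "Y \<in> DomH"
  shows "hdiff H X Y \<in> DomH" "jd (hdiff H X Y) = hdiff HD (jd X) (jd Y)"
  by (simp_all add: hdiff_def jd_add jd_scale assms)

lemma rk_op_adj:
  "a \<in> hcar H ==> e \<in> hcar H ==> f \<in> hcar H ==> op_adj H (rk H a e) f = hscale H (hinner H f a) e"
  by (simp only: CL2.L2.rk_adj) (simp add: rk_def)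

lemma \<kappa>_rk: "a \<in> hcar H ==> e \<in> DomH ==> f \<in> E ==> \<kappa> (rk H a e) f = hscale HD (hinner H f a) (jd e)"
  by (simp add: \<kappa>_def rk_op_adj DomH_car E_car jd_scale)

lemma rk_dom:
  assumes a: "a \<in> hcar H" and e: "e \<in> DomH" shows "rk H a e \<in> WD"
proof (rule domI(1)[OF CL2.L2.rk_bounded[OF a DomH_car[OF e]] _ _ \<kappa>_rk[OF a e]])
  show "op_adj H (rk H a e) f \<in> DomH" if "f \<in> E" for f
    by (simp add: rk_op_adj a DomH_car[OF e] E_car[OF that] jd_scale(1)[OF e])
  let ?g = "\<lambda>f. hscale HD (hinner H f a) (jd e)"
  have "(\<integral>\<^sup>+f. ennreal ((hnorm HD (?g f))\<^sup>2) \<partial>count_space E)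
      = (\<integral>\<^sup>+f. ennreal ((cmod (hinner H a f))\<^sup>2) * ennreal ((hnorm HD (jd e))\<^sup>2) \<partial>count_space E)"
  proof (rule nn_integral_cong)
    fix f assume "f \<in> space (count_space E)"
    then have "cmod (hinner H f a) = cmod (hinner H a f)"
      using CL2.L2.inner_cnj[OF a E_car, of f] by (metis complex_mod_cnj space_count_space)
    then show "ennreal ((hnorm HD (?g f))\<^sup>2) = ennreal ((cmod (hinner H a f))\<^sup>2) * ennreal ((hnorm HD (jd e))\<^sup>2)"
      by (simp add: CL2.L2.norm_scale[OF jd_car[OF e]] power_mult_distrib flip: ennreal_mult)
  qed
  also have "... = ennreal ((hnorm H a)\<^sup>2) * ennreal ((hnorm HD (jd e))\<^sup>2)"
    by (simp add: nn_integral_multc CL2.L2.parseval_nn[OF E a])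
  also have "... < \<infinity>" by (simp add: ennreal_mult_less_top)
  finally show "?g \<in> hcar KK"
    by (simp add: KE.hcar_sqint KE.wmeas_def jd_car[OF e])
qed

text \<open>Parseval in the first leg. On rank one operators the GNS inner product is that of L2
  tensored with the conjugate of the weighted L2, hence the reversed order of e and e'.\<close>

lemma rk_inner:
  assumes a: "a \<in> hcar H" "a' \<in> hcar H" and e: "e \<in> DomH" "e' \<in> DomH"
  shows "hinner W (rk H a e) (rk H a' e') = hinner H a a' * hinner HD (jd e') (jd e)"
proof -
  have "hinner W (rk H a e) (rk H a' e') = (\<integral>f. hinner HD (\<kappa> (rk H a' e') f) (\<kappa> (rk H a e) f) \<partial>count_space E)"
    by (simp add: W_simps weight_form_eq rk_dom a e KE.sqint_simps)
  also have "... = (\<integral>f. (hinner H a f * hinner H f a') * hinner HD (jd e') (jd e) \<partial>count_space E)"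
  proof (intro int_cong)
    fix f assume "f \<in> space (count_space E)"
    then have f: "f \<in> E" by simp
    show "hinner HD (\<kappa> (rk H a' e') f) (\<kappa> (rk H a e) f) = (hinner H a f * hinner H f a') * hinner HD (jd e') (jd e)"
      using CL2.L2.inner_cnj[OF E_car[OF f] a(1)]
      by (simp add: \<kappa>_rk a e f CL2.L2.inner_scale_left CL2.L2.inner_scale_right jd_car)
  qed
  also have "... = hinner H a a' * hinner HD (jd e') (jd e)"
    by (simp only: Bochner_Integration.integral_mult_left_zero CL2.L2.parseval_integral(2)[OF E a])
  finally show ?thesis .
qed

lemma rk_norm: "a \<in> hcar H ==> e \<in> DomH ==> hnorm W (rk H a e) = hnorm H a * hnorm HD (jd e)"
proof -
  assume a: "a \<in> hcar H" and e: "e \<in> DomH"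
  have "hinner W (rk H a e) (rk H a e) = complex_of_real ((hnorm H a)\<^sup>2) * complex_of_real ((hnorm HD (jd e))\<^sup>2)"
    unfolding rk_inner[OF a a e e] CL2.L2.inner_self[OF a] CL2.L2.inner_self[OF jd_car[OF e]] ..
  then have "(hnorm W (rk H a e))\<^sup>2 = (hnorm H a * hnorm HD (jd e))\<^sup>2"
    by (subst W.norm_sq) (simp_all add: W_simps rk_dom a e power_mult_distrib)
  then show ?thesis
    using a e by (subst (asm) power2_eq_iff_nonneg) (simp_all add: W.norm_nonneg W_simps rk_dom jd_car)
qed

definition "RK = (\<lambda>(a, e). rk H a e) ` (hcar H \<times> DomH)"

lemma RK_dom: "RK \<subseteq> hcar W" by (auto simp: RK_def W_simps rk_dom)

lemma span_dom: "S \<in> hspan W RK ==> S \<in> WD"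
  using W.hspan_car[OF _ RK_dom] by (simp add: W_simps)

text \<open>S is the sum over f in F of the operators |f><adj T f|, that is, T followed by the
  projection to the span of F. It is described by its adjoint on the basis, since this is what
  \<open>\<kappa>\<close> evaluates.\<close>

lemma finite_rank:
  assumes T: "T \<in> WD" and F: "finite F" "F \<subseteq> E"
  shows "\<exists>S\<in>hspan W RK. \<forall>f\<in>E. op_adj H S f = (if f \<in> F then op_adj H T f else hzero H)"
  using F
proof (induction F rule: finite_induct)
  case empty
  have b: "(\<lambda>x\<in>hcar H. hzero H) \<in> bounded_ops H" by (rule CL2.L2.op_zero_bounded)
  have adj: "op_adj H (\<lambda>x\<in>hcar H. hzero H) = (\<lambda>x\<in>hcar H. hzero H)" by (rule CL2.L2.op_adjI[OF b b]) simp
  show ?case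
  proof (intro bexI[of _ "hzero W"] ballI)
    show "hzero W \<in> hspan W RK" by (rule hspan.zero)
    show "op_adj H (hzero W) f = (if f \<in> {} then op_adj H T f else hzero H)" if "f \<in> E" for f
      unfolding W_simps(2) adj using E_car[OF that] by simp
  qed
next
  case (insert g F)
  then have g: "g \<in> E" and "F \<subseteq> E" by auto
  then obtain S where S: "S \<in> hspan W RK"
    and adj: "\<And>f. f \<in> E ==> op_adj H S f = (if f \<in> F then op_adj H T f else hzero H)"
    using insert.IH by blast
  let ?r = "rk H g (op_adj H T g)"
  note Tg = dom_adj[OF T g]
  have r: "?r \<in> RK" unfolding RK_def using E_car[OF g] Tg by (intro image_eqI[of _ _ "(g, op_adj H T g)"]) auto
  show ?case
  proof (intro bexI[of _ "hadd W S ?r"] ballI)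
    show "hadd W S ?r \<in> hspan W RK" by (intro hspan.add hspan.base S r)
    fix f assume f: "f \<in> E"
    have "op_adj H (hadd W S ?r) f = hadd H (op_adj H S f) (op_adj H ?r f)"
      using CL2.L2.op_adj_add[OF dom_bounded[OF span_dom[OF S]] CL2.L2.rk_bounded[OF E_car[OF g] DomH_car[OF Tg]]] E_car[OF f]
      by (simp add: W_simps op_add_def)
    also have "... = hadd H (if f \<in> F then op_adj H T f else hzero H) (hscale H (if f = g then 1 else 0) (op_adj H T g))"
      using E f g by (simp add: adj rk_op_adj E_car DomH_car[OF Tg] orthonormal_basis_def)
    also have "... = (if f \<in> insert g F then op_adj H T f else hzero H)"
      by (rule CL2.L2.eqI[where M = M])
        (use insert.hyps(2) in \<open>auto simp: DomH_car[OF Tg] DomH_car[OF dom_adj[OF T f]] CL2.L2.inner_simps\<close>)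
    finally show "op_adj H (hadd W S ?r) f = (if f \<in> insert g F then op_adj H T f else hzero H)" .
  qed
qed

text \<open>The same sequence converges in the GNS norm and strongly: the errors are tails of the
  sums of |\<open>\<kappa> T e\<close>|^2 and of |<T x, e>|^2. Both modes are used for the Galois
  map.\<close>

lemma finite_rank_approx:
  assumes T: "T \<in> WD"
  shows "\<exists>S. (\<forall>n. S n \<in> hspan W RK) \<and> htends W S T \<and> (\<forall>x\<in>hcar H. htends H (\<lambda>n. S n x) (T x))"
proof -
  define F where "F n = {e \<in> E. to_nat_on E e < n}" for n
  have finF: "finite (F n)" for n
    unfolding F_def by (rule finite_imageD[of "to_nat_on E"])
      (auto intro: finite_subset[of _ "{..<n}"] inj_on_subset[OF inj_on_to_nat_on[OF E_countable]])
  have evF: "\<exists>N. \<forall>n\<ge>N. e \<in> F n" if "e \<in> E" for e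
    using that by (intro exI[of _ "Suc (to_nat_on E e)"]) (auto simp: F_def)
  have "\<forall>n. \<exists>S. S \<in> hspan W RK \<and> (\<forall>f\<in>E. op_adj H S f = (if f \<in> F n then op_adj H T f else hzero H))"
  proof
    fix n
    have "F n \<subseteq> E" by (auto simp: F_def)
    from finite_rank[OF T finF this] show "\<exists>S. S \<in> hspan W RK \<and> (\<forall>f\<in>E. op_adj H S f = (if f \<in> F n then op_adj H T f else hzero H))"
      by (elim bexE) (intro exI conjI)
  qed
  from choice[OF this] obtain S where S: "\<And>n. S n \<in> hspan W RK"
    and adj: "\<And>n f. f \<in> E ==> op_adj H (S n) f = (if f \<in> F n then op_adj H T f else hzero H)"
    by blast
  note SW = span_dom[OF S]
  have "htends W S T"
    unfolding htends_def
  proof (rule sq_tendsto_0)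
    show "0 \<le> hdist W (S n) T" for n using SW T by (simp add: W_simps)
    have "ennreal ((hdist W (S n) T)\<^sup>2) = (\<integral>\<^sup>+e. ennreal ((hnorm HD (\<kappa> T e))\<^sup>2) * indicator (- F n) e \<partial>count_space E)" for n
    proof -
      have R: "hdiff W (S n) T \<in> WD" using W.diff_car[of "S n" T] SW T by (simp add: W_simps)
      have "ennreal ((hdist W (S n) T)\<^sup>2) = (\<integral>\<^sup>+e. ennreal ((hnorm HD (\<kappa> (hdiff W (S n) T) e))\<^sup>2) \<partial>count_space E)"
        by (simp add: hdist_hdiff W_norm[OF R] Phi_\<kappa>[OF R] KE.sqint_norm_nn[OF \<kappa>_car[OF R]])
      also have "... = (\<integral>\<^sup>+e. ennreal ((hnorm HD (\<kappa> T e))\<^sup>2) * indicator (- F n) e \<partial>count_space E)"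
      proof (rule nn_integral_cong)
        fix e assume "e \<in> space (count_space E)"
        then have e: "e \<in> E" by simp
        have Te: "\<kappa> T e \<in> hcar HD" unfolding \<kappa>_def by (rule jd_car[OF dom_adj[OF T e]])
        have "\<kappa> (hdiff W (S n) T) e = hadd HD (\<kappa> (S n) e) (\<kappa> (op_scale H (- 1) T) e)"
          unfolding W_simps by (rule \<kappa>_add(2)[OF SW \<kappa>_scale(1)[OF T] e])
        also have "... = hdiff HD (\<kappa> (S n) e) (\<kappa> T e)"
          by (simp add: \<kappa>_scale(2)[OF T e] hdiff_def)
        also have "hnorm HD ... = (if e \<in> F n then 0 else hnorm HD (\<kappa> T e))"
        proof (cases "e \<in> F n")
          case True then show ?thesis using Te by (simp add: \<kappa>_def adj[OF e] flip: hdist_hdiff)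
        next
          case False
          then have "\<kappa> (S n) e = hzero HD" by (simp add: \<kappa>_def adj[OF e] jd_zero)
          then show ?thesis
            using False Te CL2.L2.dist_commute[OF CL2.L2.zero_car Te] by (simp flip: hdist_hdiff)
        qed
        finally show "ennreal ((hnorm HD (\<kappa> (hdiff W (S n) T) e))\<^sup>2) = ennreal ((hnorm HD (\<kappa> T e))\<^sup>2) * indicator (- F n) e"
          by simp
      qed
      finally show ?thesis .
    qed
    moreover have "(\<integral>\<^sup>+e. ennreal ((hnorm HD (\<kappa> T e))\<^sup>2) \<partial>count_space E) < \<infinity>"
      unfolding KE.sqint_norm_nn[OF \<kappa>_car[OF T]] by simp
    ultimately show "(\<lambda>n. ennreal ((hdist W (S n) T)\<^sup>2)) \<longlonglongrightarrow> 0"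
      using tail_sum_tendsto_0[OF _ evF] by simp
  qed
  moreover have "htends H (\<lambda>n. S n x) (T x)" if x: "x \<in> hcar H" for x
    unfolding htends_def
  proof (rule sq_tendsto_0)
    note Tx = bounded_opsD(2)[OF dom_bounded[OF T] x] and Sx = bounded_opsD(2)[OF dom_bounded[OF SW] x]
    show "0 \<le> hdist H (S n x) (T x)" for n using Tx Sx by simp
    have "ennreal ((hdist H (S n x) (T x))\<^sup>2) = (\<integral>\<^sup>+e. ennreal ((cmod (hinner H (T x) e))\<^sup>2) * indicator (- F n) e \<partial>count_space E)" for n
      unfolding hdist_hdiff CL2.L2.parseval_nn[OF E CL2.L2.diff_car[OF Sx Tx], symmetric]
    proof (rule nn_integral_cong)
      fix e assume "e \<in> space (count_space E)"
      then have e: "e \<in> E" by simp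
      have "hinner H (hdiff H (S n x) (T x)) e = hinner H x (op_adj H (S n) e) - hinner H (T x) e"
        using CL2.L2.op_adj_inner[OF dom_bounded[OF SW] x E_car[OF e]]
        by (simp add: CL2.L2.inner_diff_left[OF Sx Tx E_car[OF e]])
      then show "ennreal ((cmod (hinner H (hdiff H (S n x) (T x)) e))\<^sup>2) = ennreal ((cmod (hinner H (T x) e))\<^sup>2) * indicator (- F n) e"
        using x by (cases "e \<in> F n") (simp_all add: adj[OF e] CL2.L2.op_adj_inner[OF dom_bounded[OF T] x E_car[OF e]])
    qed
    moreover have "(\<integral>\<^sup>+e. ennreal ((cmod (hinner H (T x) e))\<^sup>2) \<partial>count_space E) < \<infinity>"
      unfolding CL2.L2.parseval_nn[OF E Tx] by simp
    ultimately show "(\<lambda>n. ennreal ((hdist H (S n x) (T x))\<^sup>2)) \<longlonglongrightarrow> 0"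
      using tail_sum_tendsto_0[OF _ evF] by simp
  qed
  ultimately show ?thesis using S by blast
qed

lemma \<Lambda>_car: "T \<in> WD ==> \<Lambda> T \<in> hcar LL"
  by (rule W.hembed_car) (simp add: W_simps)

lemma \<Lambda>_rk_linear:
  assumes "a \<in> hcar H" "a' \<in> hcar H" "e \<in> DomH" "e' \<in> DomH"
  shows "\<Lambda> (rk H (hadd H a a') e) = hadd LL (\<Lambda> (rk H a e)) (\<Lambda> (rk H a' e))"
    "\<Lambda> (rk H (hscale H c a) e) = hscale LL c (\<Lambda> (rk H a e))"
    "\<Lambda> (rk H a (hadd H e e')) = hadd LL (\<Lambda> (rk H a e)) (\<Lambda> (rk H a e'))"
    "\<Lambda> (rk H a (hscale H c e)) = hscale LL (cnj c) (\<Lambda> (rk H a e))"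
    "\<Lambda> (rk H a (hzero H)) = hzero LL"
proof -
  note c = assms(1,2) DomH_car[OF assms(3)] DomH_car[OF assms(4)]
  note r = rk_dom[OF assms(1,3)] rk_dom[OF assms(2,3)] rk_dom[OF assms(1,4)]
  show "\<Lambda> (rk H (hadd H a a') e) = hadd LL (\<Lambda> (rk H a e)) (\<Lambda> (rk H a' e))"
    using W.hembed_add[of "rk H a e" "rk H a' e"] r by (simp add: W_simps CL2.L2.rk_linear c)
  show "\<Lambda> (rk H (hscale H c a) e) = hscale LL c (\<Lambda> (rk H a e))"
    using W.hembed_scale[of "rk H a e" c] r CL2.L2.rk_linear(2)[OF c(1,1,3)] by (simp add: W_simps)
  show "\<Lambda> (rk H a (hadd H e e')) = hadd LL (\<Lambda> (rk H a e)) (\<Lambda> (rk H a e'))"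
    using W.hembed_add[of "rk H a e" "rk H a e'"] r by (simp add: W_simps CL2.L2.rk_linear c)
  show "\<Lambda> (rk H a (hscale H c e)) = hscale LL (cnj c) (\<Lambda> (rk H a e))"
    using W.hembed_scale[of "rk H a e" "cnj c"] r CL2.L2.rk_linear(4)[OF c(3,3,1)] by (simp add: W_simps)
  have "rk H a (hzero H) = hzero W"
    unfolding W_simps rk_def by (rule restrict_ext) (simp add: c)
  then show "\<Lambda> (rk H a (hzero H)) = hzero LL" by (simp add: W.hembed_zero)
qed

text \<open>Orthogonality to z is extended in four steps: from A to all first vectors, from B to the
  whole domain of D^(1/2), from rank one operators to their span, and from there to the weight
  domain by \<open>finite_rank_approx\<close>.\<close>

lemma \<Lambda>_rk_total:
  assumes A: "htotal H A" and B: "B \<subseteq> DomH" "htotal HD (jd ` B)"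
  shows "htotal LL ((\<lambda>(a, e). \<Lambda> (rk H a e)) ` (A \<times> B))"
  unfolding htotal_def
proof (intro conjI ballI impI)
  interpret L: hilbert LL by (rule W.hilbert_completion)
  have A': "A \<subseteq> hcar H" using A by (simp add: htotal_def)
  note rkc = \<Lambda>_car[OF rk_dom]
  show "(\<lambda>(a, e). \<Lambda> (rk H a e)) ` (A \<times> B) \<subseteq> hcar LL" using A' B(1) by (auto intro!: rkc)
  fix z assume z: "z \<in> hcar LL" and orth: "\<forall>s\<in>(\<lambda>(a, e). \<Lambda> (rk H a e)) ` (A \<times> B). hinner LL z s = 0"
  let ?f = "\<lambda>a e. hinner LL (\<Lambda> (rk H a e)) z"
  have bnd: "cmod (?f a e) \<le> hnorm H a * hnorm HD (jd e) * hnorm LL z" if "a \<in> hcar H" "e \<in> DomH" for a e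
    using L.cauchy_schwarz[OF rkc[OF that] z] rk_dom[OF that] rk_norm[OF that] by (simp add: W.hembed_norm W_simps)
  have f1: "?f a e = 0" if a: "a \<in> hcar H" and e: "e \<in> B" for a e
  proof (rule CL2.L2.functional_eq_zero[of M "\<lambda>a. ?f a e", OF _ _ _ A _ a])
    have e': "e \<in> DomH" using e B by auto
    show "?f (hadd H x y) e = ?f x e + ?f y e" if "x \<in> hcar H" "y \<in> hcar H" for x y
      using that e' z by (simp add: \<Lambda>_rk_linear(1)[OF that e' e'] L.inner_add_left rkc)
    show "?f (hscale H c x) e = c * ?f x e" if "x \<in> hcar H" for c x
      using that e' z by (simp add: \<Lambda>_rk_linear(2)[OF that that e' e'] L.inner_scale_left rkc)
    show "cmod (?f x e) \<le> (hnorm HD (jd e) * hnorm LL z) * hnorm H x" if "x \<in> hcar H" for x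
      using bnd[OF that e'] by (simp add: mult_ac)
    show "?f s e = 0" if s: "s \<in> A" for s
    proof -
      have "hinner LL z (\<Lambda> (rk H s e)) = 0" using orth s e by auto
      then show ?thesis using L.inner_cnj[OF z rkc, of s e] s A' e' by (metis complex_cnj_zero subsetD)
    qed
  qed
  have f2: "?f a e = 0" if a: "a \<in> hcar H" and e: "e \<in> DomH" for a e
  proof -
    \<comment> \<open>The extension in e cannot run over all of the weighted space, because a
      general vector there gives no bounded rank one operator. Span vectors are lifted to
      \<open>DomH\<close>, and the bound in terms of \<open>jd\<close> handles the limit.\<close>
    have span: "\<exists>e'\<in>DomH. jd e' = y \<and> ?f a e' = 0" if "y \<in> hspan HD (jd ` B)" for y
      using that
    proof induction
      case zero
      show ?case by (rule bexI[of _ "hzero H"]) (simp_all add: jd_zero \<Lambda>_rk_linear(5)[OF a a e e] z)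
    next
      case (base s) then show ?case using f1[OF a] B(1) by auto
    next
      case (add x y)
      then obtain u v where uv: "u \<in> DomH" "v \<in> DomH" "jd u = x" "jd v = y" "?f a u = 0" "?f a v = 0" by blast
      then show ?case
        by (intro bexI[of _ "hadd H u v"]) (simp_all add: jd_add \<Lambda>_rk_linear(3)[OF a a] L.inner_add_left rkc a z)
    next
      case (scale x c)
      then obtain u where u: "u \<in> DomH" "jd u = x" "?f a u = 0" by blast
      then show ?case
        by (intro bexI[of _ "hscale H c u"]) (simp_all add: jd_scale \<Lambda>_rk_linear(4)[OF a a u(1) u(1)] L.inner_scale_left rkc a z)
    qed
    obtain X where X: "\<And>n. X n \<in> hspan HD (jd ` B)" "htends HD X (jd e)"
      using CL2.L2.total_approx[OF B(2) jd_car[OF e]] by blast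
    have le: "cmod (?f a e) \<le> hnorm H a * hnorm LL z * hdist HD (X n) (jd e)" for n
    proof -
      obtain u where u: "u \<in> DomH" "jd u = X n" "?f a u = 0" using span[OF X(1)] by blast
      have "?f a (hdiff H u e) = ?f a u - ?f a e"
        using jd_scale(1)[OF e, of "- 1"] u(1) e
        by (simp add: hdiff_def \<Lambda>_rk_linear(3)[OF a a] \<Lambda>_rk_linear(4)[OF a a e e] L.inner_simps rkc a z)
      then have "cmod (?f a e) = cmod (?f a (hdiff H u e))" using u(3) by simp
      also have "... \<le> hnorm H a * hnorm HD (jd (hdiff H u e)) * hnorm LL z" by (rule bnd[OF a jd_diff(1)[OF u(1) e]])
      finally show ?thesis by (simp add: jd_diff(2)[OF u(1) e] hdist_hdiff u(2) mult_ac)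
    qed
    have "(\<lambda>n. hnorm H a * hnorm LL z * hdist HD (X n) (jd e)) \<longlonglongrightarrow> hnorm H a * hnorm LL z * 0"
      using X(2) by (intro tendsto_mult tendsto_const) (simp add: htends_def)
    then have "cmod (?f a e) \<le> hnorm H a * hnorm LL z * 0" by (rule LIMSEQ_le_const) (use le in blast)
    then show ?thesis by simp
  qed
  have f3: "hinner LL (\<Lambda> S) z = 0" if "S \<in> hspan W RK" for S
    using that
  proof induction
    case zero show ?case by (simp add: W.hembed_zero z)
  next
    case (base s) then show ?case using f2 by (auto simp: RK_def)
  next
    case (add x y)
    then show ?case using W.hspan_car[OF _ RK_dom] by (simp add: W.hembed_add L.inner_add_left W.hembed_car z)
  next
    case (scale x c)
    then show ?case using W.hspan_car[OF _ RK_dom] by (simp add: W.hembed_scale L.inner_scale_left W.hembed_car z)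
  qed
  have f4: "hinner LL z (\<Lambda> T) = 0" if T: "T \<in> WD" for T
  proof -
    obtain S where S: "\<And>n. S n \<in> hspan W RK" "htends W S T" using finite_rank_approx[OF T] by blast
    have "htends LL (\<lambda>n. \<Lambda> (S n)) (\<Lambda> T)"
      using S(2) T span_dom[OF S(1)] by (simp add: htends_def W.hembed_dist W_simps)
    then have "(\<lambda>n. hinner LL (\<Lambda> (S n)) z) \<longlonglongrightarrow> hinner LL (\<Lambda> T) z"
      by (intro L.inner_tendsto L.htends_const \<Lambda>_car span_dom S(1) T z)
    then have "hinner LL (\<Lambda> T) z = 0" by (simp add: f3[OF S(1)] LIMSEQ_const_iff)
    then show ?thesis using L.inner_cnj[OF \<Lambda>_car[OF T] z] by simp
  qed
  then show "z = hzero LL"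
    using W.hembed_total z by (simp add: htotal_def W_simps)
qed

lemma separating_DomH:
  "\<exists>A B. countable A \<and> htotal H A \<and> countable B \<and> B \<subseteq> DomH \<and> htotal HD (jd ` B)"
proof -
  obtain F where F: "countable F" "F \<subseteq> sqint M \<C>" "F \<subseteq> sqint D \<C>"
    "htotal H (L2_class M \<C> ` F)" "htotal HD (L2_class D \<C> ` F)"
    using separating by (elim exE conjE)
  have sub: "L2_class M \<C> ` F \<subseteq> DomH" using jd_class(1) F(2,3) by blast
  have "jd ` L2_class M \<C> ` F = L2_class D \<C> ` F"
    unfolding image_image using F(2,3) by (intro image_cong refl) (simp add: jd_class(2) subsetD)
  then show ?thesis
    using F(1,4,5) sub by (intro exI[of _ "L2_class M \<C> ` F"]) simp
qed

lemma separable_LL: "separable_hilbert LL"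
proof -
  obtain A B where AB: "countable A" "htotal H A" "countable B" "B \<subseteq> DomH" "htotal HD (jd ` B)"
    using separating_DomH by (elim exE conjE)
  have "htotal LL ((\<lambda>(a, e). \<Lambda> (rk H a e)) ` (A \<times> B)) \<and> countable ((\<lambda>(a, e). \<Lambda> (rk H a e)) ` (A \<times> B))"
    using \<Lambda>_rk_total[OF AB(2,4,5)] AB(1,3) by (intro conjI countable_image countable_SIGMA) auto
  then show ?thesis
    by (intro separable_hilbert.intro separable_hilbert_axioms.intro W.hilbert_completion exI)
qed

sublocale L: separable_hilbert "hcompletion (weight_space (L2 M \<C>) (trace_weight M d))"
  by (rule separable_LL)

end

section \<open>The Galois map\<close>

lemma unitary_dist:
  assumes "semi_inner_space H" "semi_inner_space K" "hunitary H K U" "x \<in> hcar H" "y \<in> hcar H"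
  shows "hdist K (U x) (U y) = hdist H x y"
proof -
  interpret H: semi_inner_space H by fact
  have "hdiff K (U x) (U y) = U (hdiff H x y)"
    using assms by (simp add: hunitary_def hlinear_def hdiff_def)
  then show ?thesis using assms by (simp add: hdist_hdiff hnorm_def hunitary_def)
qed

text \<open>An abstract L2 limit and a pointwise limit are compared along a subsequence converging
  almost everywhere. Square-integrability of the pointwise limit is part of the conclusion.\<close>

lemma (in L2_space) L2_limit:
  assumes F: "\<And>n. F n \<in> sqint M K" and Y: "Y \<in> hcar (L2 M K)"
    and lim: "htends (L2 M K) (\<lambda>n. L2_class M K (F n)) Y"
    and G: "\<And>x. G x \<in> hcar K" "\<And>x. htends K (\<lambda>n. F n x) (G x)"
  shows "G \<in> sqint M K" "L2_class M K G = Y"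
proof -
  have w: "wmeas (F n)" for n using F[of n] by (simp add: hcar_sqint)
  have "hcauchy (L2 M K) (\<lambda>n. L2_class M K (F n))" by (rule L2.htends_imp_hcauchy[OF L2_class_car[OF F] Y lim])
  then have "hcauchy (sqint_space M K) F" by (simp add: hcauchy_def L2_class_dist F)
  from cauchy_subsequence[OF F this] obtain F' r where r: "strict_mono r" and F': "F' \<in> sqint M K"
    and tF': "htends (sqint_space M K) F F'" and ae: "AE x in M. htends K (\<lambda>n. F (r n) x) (F' x)"
    by (elim exE conjE)
  have ae': "AE x in M. F' x = G x"
    using ae AE_space
  proof eventually_elim
    fix x assume t: "htends K (\<lambda>n. F (r n) x) (F' x)" and x: "x \<in> space M"
    have "htends K (\<lambda>n. F (r n) x) (G x)"
      using LIMSEQ_subseq_LIMSEQ[OF G(2)[unfolded htends_def] r] by (simp add: htends_def comp_def)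
    moreover have "F' x \<in> hcar K" using F' x by (simp add: hcar_sqint wmeas_car)
    ultimately show "F' x = G x"
      by (intro K.htends_unique[OF _ _ G(1) t]) (use wmeas_car[OF w x] in auto)
  qed
  have wG: "wmeas G"
    unfolding wmeas_def
  proof (intro conjI ballI G(1))
    fix h assume h: "h \<in> hcar K"
    show "(\<lambda>x. hinner K (G x) h) \<in> borel_measurable M"
    proof (rule borel_measurable_LIMSEQ_metric)
      show "(\<lambda>x. hinner K (F n x) h) \<in> borel_measurable M" for n using w h by (simp add: wmeas_def)
      show "(\<lambda>n. hinner K (F n x) h) \<longlonglongrightarrow> hinner K (G x) h" if x: "x \<in> space M" for x
        by (intro K.inner_tendsto wmeas_car[OF w x] h G K.htends_const)
    qed
  qed
  have "(\<integral>\<^sup>+x. ennreal ((hnorm K (G x))\<^sup>2) \<partial>M) = (\<integral>\<^sup>+x. ennreal ((hnorm K (F' x))\<^sup>2) \<partial>M)"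
    by (rule nn_integral_cong_AE) (use ae' in eventually_elim, simp)
  then show G': "G \<in> sqint M K" using F' wG by (simp add: hcar_sqint)
  have "L2_class M K F' = L2_class M K G" by (rule L2_class_eq_iff[THEN iffD2, OF F' G' ae'])
  moreover have "htends (L2 M K) (\<lambda>n. L2_class M K (F n)) (L2_class M K F')"
    using tF' by (simp add: htends_def L2_class_dist F F')
  then have "L2_class M K F' = Y"
    by (intro L2.htends_unique[OF L2_class_car[OF F] L2_class_car[OF F'] Y _ lim])
  ultimately show "L2_class M K G = Y" by simp
qed

text \<open>A square-integrable projective representation in abstract form: orthogonality relations
  with Duflo-Moore density d, and totality of the coefficients. The concrete group enters through
  these data.\<close>

locale galois_setup = weight_setup M d
  for M :: "'x measure" and d :: "'x => real" +
  fixes m :: "'g measure" and gmul :: "'g => 'g => 'g" and \<pi> :: "'g => ('x => complex) set => ('x => complex) set"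
  assumes rep: "projective_unitary_rep gmul m H \<pi>"
    and coef_sqint: "X \<in> hcar H ==> Y \<in> DomH ==> (\<lambda>g. hinner H X (\<pi> g Y)) \<in> sqint m \<C>"
    and coef_inner: "X \<in> hcar H ==> Y \<in> DomH ==> X' \<in> hcar H ==> Y' \<in> DomH ==>
      (\<integral>g. hinner H X (\<pi> g Y) * cnj (hinner H X' (\<pi> g Y')) \<partial>m) = hinner H X X' * hinner HD (jd Y') (jd Y)"
    and coef_total: "htotal (L2 m \<C>)
      ((\<lambda>(X, Y). L2_class m \<C> (\<lambda>g. hinner H X (\<pi> g Y))) ` (hcar H \<times> DomH))"
begin

section \<open>Pointwise properties of the Galois map\<close>

lemma RK_I: "a \<in> hcar H ==> e \<in> DomH ==> rk H a e \<in> RK"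
  unfolding RK_def by (rule image_eqI[of _ _ "(a, e)"]) simp_all

lemma pi_bounded: "\<pi> g \<in> bounded_ops H" and pi_unitary: "hunitary H H (\<pi> g)"
  and pi_meas: "x \<in> hcar H ==> y \<in> hcar H ==> (\<lambda>g. hinner H (\<pi> g x) y) \<in> borel_measurable m"
  using rep by (simp_all add: projective_unitary_rep_def)

lemmas pi_car = bounded_opsD(2)[OF pi_bounded]
lemmas adj_pi_car = bounded_opsD(2)[OF CL2.L2.op_adj_bounded[OF pi_bounded]]

lemma pi_inner: "x \<in> hcar H ==> y \<in> hcar H ==> hinner H (\<pi> g x) (\<pi> g y) = hinner H x y"
  using pi_unitary by (simp add: hunitary_def)

lemma pi_norm: "x \<in> hcar H ==> hnorm H (\<pi> g x) = hnorm H x"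
  by (simp add: hnorm_def pi_inner)

lemma adj_pi_norm: "x \<in> hcar H ==> hnorm H (op_adj H (\<pi> g) x) = hnorm H x"
  using pi_norm[OF adj_pi_car, of x g g] CL2.L2.unitary_adj(2)[OF pi_bounded pi_unitary] by simp

lemma Ad_bounded: "S \<in> bounded_ops H ==> op_Ad H (\<pi> g) S \<in> bounded_ops H"
  unfolding op_Ad_def by (intro CL2.L2.op_comp_bounded pi_bounded CL2.L2.op_adj_bounded)

lemma Ad_bound:
  assumes S: "S \<in> bounded_ops H" and le: "\<And>x. x \<in> hcar H ==> hnorm H (S x) \<le> C * hnorm H x" and x: "x \<in> hcar H"
  shows "hnorm H (op_Ad H (\<pi> g) S x) \<le> C * hnorm H x"
  using le[OF adj_pi_car[OF x]] x
  by (simp add: op_Ad_def op_comp_def pi_norm bounded_opsD(2)[OF S] adj_pi_car adj_pi_norm)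

definition Gal :: "(('x => complex) set => ('x => complex) set) => (('x => complex) set => ('x => complex) set) => 'g => _" where
  "Gal S T g = \<Lambda> (op_comp H (op_Ad H (\<pi> g) S) T)"

lemma Ad_comp_dom:
  assumes S: "S \<in> bounded_ops H" and T: "T \<in> WD" shows "op_comp H (op_Ad H (\<pi> g) S) T \<in> WD"
proof -
  obtain C where C: "C \<ge> 0" "\<And>x. x \<in> hcar H ==> hnorm H (S x) \<le> C * hnorm H x"
    using bounded_ops_bound[OF CL2.L2.semi_inner_space_axioms S] by blast
  show ?thesis by (rule W_ideal(1)[OF Ad_bounded[OF S] T C(1)]) (rule Ad_bound[OF S C(2)])
qed

lemma Gal_car: "S \<in> WD ==> T \<in> WD ==> Gal S T g \<in> hcar LL"
  unfolding Gal_def by (intro \<Lambda>_car Ad_comp_dom dom_bounded)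

lemma Gal_linear_left:
  assumes T: "T \<in> WD" shows "hlinear W LL (\<lambda>S. Gal S T g)"
  unfolding hlinear_def
proof (intro conjI ballI allI)
  note Tc = bounded_opsD(2)[OF dom_bounded[OF T]]
  fix S assume "S \<in> hcar W"
  then have S: "S \<in> WD" by (simp add: W_simps)
  note Sb = dom_bounded[OF S]
  show "Gal S T g \<in> hcar LL" by (rule Gal_car[OF S T])
  have eqscale: "op_comp H (op_Ad H (\<pi> g) (hscale W c S)) T = hscale W c (op_comp H (op_Ad H (\<pi> g) S) T)" for c
    unfolding W_simps op_scale_def op_comp_def op_Ad_def
    by (rule restrict_ext) (simp add: Tc adj_pi_car bounded_opsD(2)[OF Sb] bounded_opsD(4)[OF pi_bounded])
  show "Gal (hscale W c S) T g = hscale LL c (Gal S T g)" for c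
    unfolding Gal_def eqscale by (rule W.hembed_scale) (simp_all add: W_simps(1) Ad_comp_dom[OF Sb T])
  fix S' assume "S' \<in> hcar W"
  then have S': "S' \<in> WD" by (simp add: W_simps)
  have eqadd: "op_comp H (op_Ad H (\<pi> g) (hadd W S S')) T = hadd W (op_comp H (op_Ad H (\<pi> g) S) T) (op_comp H (op_Ad H (\<pi> g) S') T)"
    unfolding W_simps op_add_def op_comp_def op_Ad_def
    by (rule restrict_ext)
      (simp add: Tc adj_pi_car bounded_opsD(2)[OF Sb] bounded_opsD(2)[OF dom_bounded[OF S']] bounded_opsD(3)[OF pi_bounded])
  show "Gal (hadd W S S') T g = hadd LL (Gal S T g) (Gal S' T g)"
    unfolding Gal_def eqadd by (rule W.hembed_add) (simp_all add: W_simps(1) Ad_comp_dom[OF Sb T] Ad_comp_dom[OF dom_bounded[OF S'] T])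
qed

lemma Gal_linear_right:
  assumes S: "S \<in> WD" shows "hlinear W LL (\<lambda>T. Gal S T g)"
  unfolding hlinear_def
proof (intro conjI ballI allI)
  note Sb = dom_bounded[OF S]
  note A = bounded_opsD[OF Ad_bounded[OF Sb]]
  fix T assume "T \<in> hcar W"
  then have T: "T \<in> WD" by (simp add: W_simps)
  show "Gal S T g \<in> hcar LL" by (rule Gal_car[OF S T])
  have eqscale: "op_comp H (op_Ad H (\<pi> g) S) (hscale W c T) = hscale W c (op_comp H (op_Ad H (\<pi> g) S) T)" for c
    unfolding W_simps op_scale_def op_comp_def
    by (rule restrict_ext) (simp add: A bounded_opsD(2)[OF dom_bounded[OF T]])
  show "Gal S (hscale W c T) g = hscale LL c (Gal S T g)" for c
    unfolding Gal_def eqscale by (rule W.hembed_scale) (simp_all add: W_simps(1) Ad_comp_dom[OF Sb T])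
  fix T' assume "T' \<in> hcar W"
  then have T': "T' \<in> WD" by (simp add: W_simps)
  have eqadd: "op_comp H (op_Ad H (\<pi> g) S) (hadd W T T') = hadd W (op_comp H (op_Ad H (\<pi> g) S) T) (op_comp H (op_Ad H (\<pi> g) S) T')"
    unfolding W_simps op_add_def op_comp_def
    by (rule restrict_ext) (simp add: A bounded_opsD(2)[OF dom_bounded[OF T]] bounded_opsD(2)[OF dom_bounded[OF T']])
  show "Gal S (hadd W T T') g = hadd LL (Gal S T g) (Gal S T' g)"
    unfolding Gal_def eqadd by (rule W.hembed_add) (simp_all add: W_simps(1) Ad_comp_dom[OF Sb T] Ad_comp_dom[OF Sb T'])
qed

text \<open>For T of rank one, S enters only through its value at a single vector depending on g.
  Strong convergence in S is therefore enough for pointwise convergence.\<close>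

lemma Gal_rk_right:
  assumes S: "S \<in> bounded_ops H" and c: "c \<in> hcar H" and e: "e \<in> DomH"
  shows "Gal S (rk H c e) g = \<Lambda> (rk H (\<pi> g (S (op_adj H (\<pi> g) c))) e)"
proof -
  have "op_comp H (op_Ad H (\<pi> g) S) (rk H c e) = rk H (op_Ad H (\<pi> g) S c) e"
    unfolding op_comp_def rk_def
    by (rule restrict_ext) (simp add: c DomH_car[OF e] bounded_opsD(4)[OF Ad_bounded[OF S] c])
  then show ?thesis using c by (simp add: Gal_def op_Ad_def op_comp_def adj_pi_car)
qed

lemma Gal_rk:
  assumes a: "a \<in> hcar H" and b: "b \<in> DomH" and c: "c \<in> hcar H" and e: "e \<in> DomH"
  shows "Gal (rk H a b) (rk H c e) g = hscale LL (hinner H c (\<pi> g b)) (\<Lambda> (rk H (\<pi> g a) e))"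
proof -
  note bc = DomH_car[OF b]
  have "\<pi> g (rk H a b (op_adj H (\<pi> g) c)) = hscale H (hinner H c (\<pi> g b)) (\<pi> g a)"
    using a bc c by (simp add: rk_def adj_pi_car bounded_opsD(4)[OF pi_bounded] CL2.L2.op_adj_inner'[OF pi_bounded])
  then show ?thesis
    by (simp add: Gal_rk_right[OF CL2.L2.rk_bounded[OF a bc] c e] \<Lambda>_rk_linear(2)[OF pi_car[OF a] pi_car[OF a] e e])
qed

section \<open>Isometry and totality on rank one operators\<close>

sublocale Lm: L2_space "hcompletion (weight_space (L2 M \<C>) (trace_weight M d))" m
  by (rule L2_space.intro[OF separable_LL])

lemma orbit_car: "a \<in> hcar H ==> e \<in> DomH ==> \<Lambda> (rk H (\<pi> g a) e) \<in> hcar LL"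
  by (intro \<Lambda>_car rk_dom pi_car)

lemma orbit_inner:
  assumes "a \<in> hcar H" "e \<in> DomH" "a' \<in> hcar H" "e' \<in> DomH"
  shows "hinner LL (\<Lambda> (rk H (\<pi> g a) e)) (\<Lambda> (rk H (\<pi> g a') e')) = hinner H a a' * hinner HD (jd e') (jd e)"
  using assms by (simp add: W.hembed_inner W_simps(1) rk_dom pi_car rk_inner pi_inner)

lemma orbit_norm: "a \<in> hcar H ==> e \<in> DomH ==> hnorm LL (\<Lambda> (rk H (\<pi> g a) e)) = hnorm H a * hnorm HD (jd e)"
  by (simp add: W.hembed_norm W_simps(1) rk_dom pi_car rk_norm pi_norm)

text \<open>For fixed e and h, the map x \<mapsto> <\<Lambda> |x><e|, h> is a bounded functional and
  hence given by a vector w; weak measurability becomes measurability of the coefficient <\<pi>(g)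
  a, w>.\<close>

lemma orbit_wmeas:
  assumes a: "a \<in> hcar H" and e: "e \<in> DomH" shows "Lm.wmeas (\<lambda>g. \<Lambda> (rk H (\<pi> g a) e))"
  unfolding Lm.wmeas_def
proof (intro conjI ballI orbit_car a e)
  fix h assume h: "h \<in> hcar LL"
  note rc = \<Lambda>_car[OF rk_dom[OF _ e]]
  have "\<exists>w\<in>hcar H. \<forall>x\<in>hcar H. hinner LL (\<Lambda> (rk H x e)) h = hinner H x w"
  proof (rule CL2.L2.riesz)
    show "hinner LL (\<Lambda> (rk H (hadd H x y) e)) h = hinner LL (\<Lambda> (rk H x e)) h + hinner LL (\<Lambda> (rk H y e)) h"
      if "x \<in> hcar H" "y \<in> hcar H" for x y
      using that h by (simp add: \<Lambda>_rk_linear(1)[OF that e e] L.inner_add_left rc)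
    show "hinner LL (\<Lambda> (rk H (hscale H c x) e)) h = c * hinner LL (\<Lambda> (rk H x e)) h" if "x \<in> hcar H" for c x
      using that h by (simp add: \<Lambda>_rk_linear(2)[OF that that e e] L.inner_scale_left rc)
    show "cmod (hinner LL (\<Lambda> (rk H x e)) h) \<le> (hnorm HD (jd e) * hnorm LL h) * hnorm H x" if "x \<in> hcar H" for x
      using L.cauchy_schwarz[OF rc[OF that] h] rk_dom[OF that e] rk_norm[OF that e]
      by (simp add: W.hembed_norm W_simps mult_ac)
  qed
  then obtain w where w: "w \<in> hcar H" "\<And>x. x \<in> hcar H ==> hinner LL (\<Lambda> (rk H x e)) h = hinner H x w" by blast
  show "(\<lambda>g. hinner LL (\<Lambda> (rk H (\<pi> g a) e)) h) \<in> borel_measurable m"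
    by (simp add: w pi_car a pi_meas)
qed

lemma coef_meas: "X \<in> hcar H ==> Y \<in> DomH ==> (\<lambda>g. hinner H X (\<pi> g Y)) \<in> borel_measurable m"
  using coef_sqint by (simp add: sqint_complex_iff)

lemma Gal_rk_sqint:
  assumes a: "a \<in> hcar H" and b: "b \<in> DomH" and c: "c \<in> hcar H" and e: "e \<in> DomH"
  shows "Gal (rk H a b) (rk H c e) \<in> sqint m LL"
  unfolding Lm.hcar_sqint
proof (intro CollectI conjI)
  note [measurable] = coef_meas[OF c b]
  show "Lm.wmeas (Gal (rk H a b) (rk H c e))"
    unfolding Lm.wmeas_def Gal_rk[OF a b c e]
  proof (intro conjI ballI)
    show "hscale LL (hinner H c (\<pi> g b)) (\<Lambda> (rk H (\<pi> g a) e)) \<in> hcar LL" for g by (simp add: orbit_car a e)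
    fix h assume h: "h \<in> hcar LL"
    have "(\<lambda>g. hinner H c (\<pi> g b) * hinner LL (\<Lambda> (rk H (\<pi> g a) e)) h) \<in> borel_measurable m"
      using orbit_wmeas[OF a e] h by (intro borel_measurable_times coef_meas c b) (simp add: Lm.wmeas_def)
    then show "(\<lambda>g. hinner LL (hscale LL (hinner H c (\<pi> g b)) (\<Lambda> (rk H (\<pi> g a) e))) h) \<in> borel_measurable m"
      by (simp add: L.inner_scale_left orbit_car a e h)
  qed
  have "(\<integral>\<^sup>+g. ennreal ((hnorm LL (Gal (rk H a b) (rk H c e) g))\<^sup>2) \<partial>m)
      = (\<integral>\<^sup>+g. ennreal ((cmod (hinner H c (\<pi> g b)))\<^sup>2) * ennreal ((hnorm H a * hnorm HD (jd e))\<^sup>2) \<partial>m)"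
    by (intro nn_integral_cong)
      (simp add: Gal_rk a b c e L.norm_scale orbit_car orbit_norm power_mult_distrib flip: ennreal_mult)
  also have "... = (\<integral>\<^sup>+g. ennreal ((cmod (hinner H c (\<pi> g b)))\<^sup>2) \<partial>m) * ennreal ((hnorm H a * hnorm HD (jd e))\<^sup>2)"
    by (rule nn_integral_multc) measurable
  also have "... < \<infinity>"
    using coef_sqint[OF c b] by (simp add: sqint_complex_iff ennreal_mult_less_top)
  finally show "(\<integral>\<^sup>+g. ennreal ((hnorm LL (Gal (rk H a b) (rk H c e) g))\<^sup>2) \<partial>m) < \<infinity>" .
qed

abbreviation "tens S T \<equiv> elem_tensor LL LL (\<Lambda> S) (\<Lambda> T)"

definition "fam = (\<lambda>(S, T). (tens S T, L2_class m LL (Gal S T))) ` (RK \<times> RK)"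

text \<open>Inner products of the vectors \<Lambda> |\<pi>(g) a><e| do not depend on g, so they
  leave the integral, and the orthogonality relations evaluate the remaining coefficients.\<close>

lemma Gal_isometric:
  assumes a: "a \<in> hcar H" "a' \<in> hcar H" and b: "b \<in> DomH" "b' \<in> DomH"
    and c: "c \<in> hcar H" "c' \<in> hcar H" and e: "e \<in> DomH" "e' \<in> DomH"
  shows "hinner (htensor LL LL) (tens (rk H a b) (rk H c e)) (tens (rk H a' b') (rk H c' e'))
    = hinner (L2 m LL) (L2_class m LL (Gal (rk H a b) (rk H c e))) (L2_class m LL (Gal (rk H a' b') (rk H c' e')))"
proof -
  note s = L.semi_inner_space_axioms
  have "hinner (L2 m LL) (L2_class m LL (Gal (rk H a b) (rk H c e))) (L2_class m LL (Gal (rk H a' b') (rk H c' e')))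
      = (\<integral>g. hinner LL (Gal (rk H a b) (rk H c e) g) (Gal (rk H a' b') (rk H c' e') g) \<partial>m)"
    by (intro Lm.L2_class_inner Gal_rk_sqint a b c e)
  also have "... = (\<integral>g. (hinner H c (\<pi> g b) * cnj (hinner H c' (\<pi> g b'))) * (hinner H a a' * hinner HD (jd e') (jd e)) \<partial>m)"
    by (intro int_cong)
      (simp add: Gal_rk a b c e L.inner_scale_left L.inner_scale_right orbit_car orbit_inner)
  also have "... = (hinner H c c' * hinner HD (jd b') (jd b)) * (hinner H a a' * hinner HD (jd e') (jd e))"
    by (simp only: Bochner_Integration.integral_mult_left_zero coef_inner[OF c(1) b(1) c(2) b(2)])
  finally show ?thesis
    by (simp add: elem_tensor_inner[OF s s] \<Lambda>_car rk_dom a b c e W.hembed_inner W_simps(1) rk_inner)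
qed

text \<open>For fixed a and e, the scalar function g \<mapsto> <f(g), \<Lambda> |\<pi>(g) a><e|> is
  square-integrable and orthogonal to all coefficients, so it vanishes almost everywhere. Countable
  total families of a and e give one null set; off it f(g) is orthogonal to a total set, because the
  unitary \<pi>(g) preserves totality.\<close>

lemma Gal_total: "htotal (L2 m LL) ((\<lambda>(S, T). L2_class m LL (Gal S T)) ` (RK \<times> RK))"
  unfolding htotal_def
proof (intro conjI ballI impI)
  have car: "L2_class m LL (Gal S T) \<in> hcar (L2 m LL)" if "S \<in> RK" "T \<in> RK" for S T
    using that by (auto simp: RK_def intro!: Lm.L2_class_car Gal_rk_sqint)
  then show "(\<lambda>(S, T). L2_class m LL (Gal S T)) ` (RK \<times> RK) \<subseteq> hcar (L2 m LL)" by auto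
  fix z assume z: "z \<in> hcar (L2 m LL)" and orth: "\<forall>s\<in>(\<lambda>(S, T). L2_class m LL (Gal S T)) ` (RK \<times> RK). hinner (L2 m LL) z s = 0"
  obtain f where f: "f \<in> sqint m LL" "z = L2_class m LL f" using Lm.L2_class_ex[OF z] by blast
  have fw: "Lm.wmeas f" and fin: "(\<integral>\<^sup>+g. ennreal ((hnorm LL (f g))\<^sup>2) \<partial>m) < \<infinity>" using f(1) by (simp_all add: Lm.hcar_sqint)
  have zero: "AE g in m. hinner LL (f g) (\<Lambda> (rk H (\<pi> g a) e)) = 0" if a: "a \<in> hcar H" and e: "e \<in> DomH" for a e
  proof -
    let ?h = "\<lambda>g. hinner LL (f g) (\<Lambda> (rk H (\<pi> g a) e))"
    have hm: "?h \<in> borel_measurable m" by (rule Lm.inner_measurable[OF fw orbit_wmeas[OF a e]])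
    note [measurable] = hm Lm.norm_measurable[OF fw]
    have "(\<integral>\<^sup>+g. ennreal ((cmod (?h g))\<^sup>2) \<partial>m)
        \<le> (\<integral>\<^sup>+g. ennreal ((hnorm LL (f g))\<^sup>2) * ennreal ((hnorm H a * hnorm HD (jd e))\<^sup>2) \<partial>m)"
    proof (rule nn_integral_mono)
      fix g assume g: "g \<in> space m"
      have "(cmod (?h g))\<^sup>2 \<le> (hnorm LL (f g) * (hnorm H a * hnorm HD (jd e)))\<^sup>2"
        using L.cauchy_schwarz[OF Lm.wmeas_car[OF fw g] orbit_car[OF a e, of g]]
        by (intro power_mono) (simp_all add: orbit_norm a e)
      then show "ennreal ((cmod (?h g))\<^sup>2) \<le> ennreal ((hnorm LL (f g))\<^sup>2) * ennreal ((hnorm H a * hnorm HD (jd e))\<^sup>2)"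
        by (simp add: power_mult_distrib ennreal_leI flip: ennreal_mult)
    qed
    also have "... = (\<integral>\<^sup>+g. ennreal ((hnorm LL (f g))\<^sup>2) \<partial>m) * ennreal ((hnorm H a * hnorm HD (jd e))\<^sup>2)"
      by (rule nn_integral_multc) measurable
    also have "... < \<infinity>" using fin by (simp add: ennreal_mult_less_top)
    finally have h: "?h \<in> sqint m \<C>" using hm by (simp add: sqint_complex_iff)
    have "hinner (L2 m \<C>) (L2_class m \<C> ?h) (L2_class m \<C> (\<lambda>g. hinner H c (\<pi> g b))) = 0"
      if c: "c \<in> hcar H" and b: "b \<in> DomH" for c b
    proof -
      have S: "rk H a b \<in> RK" "rk H c e \<in> RK"
        by (intro RK_I a b c e)+
      have "hinner (L2 m \<C>) (L2_class m \<C> ?h) (L2_class m \<C> (\<lambda>g. hinner H c (\<pi> g b)))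
          = (\<integral>g. ?h g * cnj (hinner H c (\<pi> g b)) \<partial>m)"
        by (simp add: CL2.L2_class_inner[OF h coef_sqint[OF c b]])
      also have "... = (\<integral>g. hinner LL (f g) (Gal (rk H a b) (rk H c e) g) \<partial>m)"
        by (intro int_cong)
          (simp add: Gal_rk a b c e L.inner_scale_right orbit_car Lm.wmeas_car[OF fw] mult.commute)
      also have "... = hinner (L2 m LL) z (L2_class m LL (Gal (rk H a b) (rk H c e)))"
        unfolding f(2) by (rule Lm.L2_class_inner[OF f(1) Gal_rk_sqint[OF a b c e], symmetric])
      also have "... = 0" using orth S by auto
      finally show ?thesis .
    qed
    then have "L2_class m \<C> ?h = hzero (L2 m \<C>)"
      using coef_total CL2.L2_class_car[OF h] unfolding htotal_def by auto
    then have "(\<integral>\<^sup>+g. ennreal ((cmod (?h g))\<^sup>2) \<partial>m) = 0"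
      using CL2.L2_class_norm[OF h] by simp
    then have "AE g in m. ennreal ((cmod (?h g))\<^sup>2) = 0" by (subst (asm) nn_integral_0_iff_AE) measurable
    then show ?thesis by eventually_elim simp
  qed
  obtain A B where AB: "countable A" "htotal H A" "countable B" "B \<subseteq> DomH" "htotal HD (jd ` B)"
    using separating_DomH by (elim exE conjE)
  have A: "A \<subseteq> hcar H" using AB(2) by (simp add: htotal_def)
  have "AE g in m. \<forall>p\<in>A \<times> B. hinner LL (f g) (\<Lambda> (rk H (\<pi> g (fst p)) (snd p))) = 0"
    by (rule AE_ball_countable[THEN iffD2])
      (use AB(1,3,4) A zero in \<open>auto intro!: countable_SIGMA\<close>)
  then have "AE g in m. ennreal ((hnorm LL (f g))\<^sup>2) = 0"
    using AE_space
  proof eventually_elim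
    fix g assume p: "\<forall>p\<in>A \<times> B. hinner LL (f g) (\<Lambda> (rk H (\<pi> g (fst p)) (snd p))) = 0" and g: "g \<in> space m"
    have tot: "htotal LL ((\<lambda>(a, e). \<Lambda> (rk H a e)) ` (\<pi> g ` A \<times> B))"
      by (rule \<Lambda>_rk_total[OF unitary_image_total[OF CL2.hilbert_L2 CL2.hilbert_L2 pi_unitary AB(2)] AB(4,5)])
    have z0: "hinner LL (f g) s = 0" if "s \<in> (\<lambda>(a, e). \<Lambda> (rk H a e)) ` (\<pi> g ` A \<times> B)" for s
    proof -
      from that obtain q where q: "q \<in> \<pi> g ` A \<times> B" "s = (\<lambda>(a, e). \<Lambda> (rk H a e)) q" by (elim imageE)
      then have q': "fst q \<in> \<pi> g ` A" "snd q \<in> B" by (simp_all add: mem_Times_iff)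
      from q'(1) obtain a where a: "a \<in> A" "fst q = \<pi> g a" by (elim imageE)
      show ?thesis using bspec[OF p, of "(a, snd q)"] a q'(2) by (simp add: q(2) split_beta)
    qed
    have "f g = hzero LL"
      by (rule conjunct2[OF tot[unfolded htotal_def], THEN bspec, THEN mp, OF Lm.wmeas_car[OF fw g]]) (rule ballI, rule z0)
    then show "ennreal ((hnorm LL (f g))\<^sup>2) = 0" by simp
  qed
  then have "(\<integral>\<^sup>+g. ennreal ((hnorm LL (f g))\<^sup>2) \<partial>m) = 0"
    using Lm.norm_measurable[OF fw] by (subst nn_integral_0_iff_AE) measurable
  then have "hnorm (L2 m LL) z = 0" using Lm.L2_class_norm[OF f(1)] by (simp add: f(2))
  then show "z = hzero (L2 m LL)" using Lm.L2.norm_eq_0[OF z] by simp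
qed

lemma unitary_on_rk:
  "\<exists>U. hunitary (htensor LL LL) (L2 m LL) U \<and> (\<forall>S\<in>RK. \<forall>T\<in>RK. U (tens S T) = L2_class m LL (Gal S T))"
proof -
  note s = L.semi_inner_space_axioms
  have RKWD: "S \<in> WD" if "S \<in> RK" for S using RK_dom that by (auto simp: W_simps)
  interpret P: hilbert_pair "htensor LL LL" "L2 m LL" fam
  proof (intro hilbert_pair.intro hilbert_pair_axioms.intro hilbert_htensor[OF s s] Lm.hilbert_L2)
    show "fam \<subseteq> hcar (htensor LL LL) \<times> hcar (L2 m LL)"
      by (auto simp: fam_def RK_def intro!: elem_tensor_car[OF s s] \<Lambda>_car rk_dom Lm.L2_class_car Gal_rk_sqint)
    show "hinner (htensor LL LL) (fst p) (fst q) = hinner (L2 m LL) (snd p) (snd q)" if "p \<in> fam" "q \<in> fam" for p q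
      using that by (auto simp: fam_def RK_def Gal_isometric)
  qed
  have f: "fst ` fam = (\<lambda>(x, y). elem_tensor LL LL x y) ` ((\<Lambda> ` RK) \<times> (\<Lambda> ` RK))" by (force simp: fam_def)
  have g: "snd ` fam = (\<lambda>(S, T). L2_class m LL (Gal S T)) ` (RK \<times> RK)" by (force simp: fam_def)
  have LT: "htotal LL (\<Lambda> ` RK)"
  proof -
    obtain A B where AB: "countable A" "htotal H A" "countable B" "B \<subseteq> DomH" "htotal HD (jd ` B)"
      using separating_DomH by (elim exE conjE)
    have A: "A \<subseteq> hcar H" using AB(2) by (simp add: htotal_def)
    have car: "\<Lambda> ` RK \<subseteq> hcar LL" using \<Lambda>_car[OF RKWD] by (rule image_subsetI)
    show ?thesis
      unfolding htotal_def
    proof (intro conjI ballI impI car)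
      fix z assume "z \<in> hcar LL" "\<forall>s\<in>\<Lambda> ` RK. hinner LL z s = 0"
      then show "z = hzero LL"
        by (intro conjunct2[OF \<Lambda>_rk_total[OF AB(2,4,5), unfolded htotal_def], THEN bspec, THEN mp])
          (use A AB(4) in \<open>auto intro!: RK_I\<close>)
    qed
  qed
  have "\<exists>U. hunitary (htensor LL LL) (L2 m LL) U \<and> (\<forall>p\<in>fam. U (fst p) = snd p)"
    by (rule P.unitary_extension, unfold f g)
      (rule elem_tensor_total_of_total[OF L.hilbert_axioms L.hilbert_axioms LT LT], rule Gal_total)
  then show ?thesis by (elim exE conjE) (intro exI conjI, assumption, force simp: fam_def)
qed

text \<open>One leg of the tensor is frozen: x is the free operator, j x the elementary tensor and f
  x the function it should be sent to. The same extension argument then serves both legs.\<close>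

definition "good U j f x \<longleftrightarrow> f x \<in> sqint m LL \<and> U (j x) = L2_class m LL (f x)"

lemma good_span:
  assumes U: "hunitary (htensor LL LL) (L2 m LL) U" and j: "hlinear W (htensor LL LL) j"
    and f: "\<And>g. hlinear W LL (\<lambda>x. f x g)" and gen: "\<And>x. x \<in> RK ==> good U j f x" and x: "x \<in> hspan W RK"
  shows "good U j f x"
proof -
  have scl: "good U j f (hscale W c x)" if x: "x \<in> hcar W" and g: "good U j f x" for x c
  proof -
    have "f (hscale W c x) = (\<lambda>g. hscale LL c (f x g))" using f x by (auto simp: hlinear_def)
    moreover have "U (j (hscale W c x)) = hscale (L2 m LL) c (U (j x))"
      using U j x by (simp add: hlinear_def hunitary_def)
    ultimately show ?thesis using g Lm.sqint_scale[of "f x" c] Lm.L2_class_scale[of "f x" c] by (simp add: good_def)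
  qed
  show ?thesis
    using x
  proof induction
    case zero
    \<comment> \<open>The zero operator is reached as the scalar multiple by 0 of a member of the
      generating family, so the rule for scalars covers it.\<close>
    let ?r = "rk H (hzero H) (hzero H)"
    have r: "?r \<in> RK" unfolding RK_def by (rule image_eqI[of _ _ "(hzero H, hzero H)"]) (simp_all add: jd_zero)
    have "hscale W 0 ?r = hzero W"
      unfolding W_simps op_scale_def by (rule restrict_ext) (simp add: rk_def)
    then show ?case using scl[OF subsetD[OF RK_dom r] gen[OF r], of 0] by simp
  next
    case (base x) then show ?case by (rule gen)
  next
    case (add x y)
    have xy: "x \<in> hcar W" "y \<in> hcar W" using W.hspan_car[OF _ RK_dom] add.hyps by auto
    have "f (hadd W x y) = (\<lambda>g. hadd LL (f x g) (f y g))" using f xy by (auto simp: hlinear_def)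
    moreover have "U (j (hadd W x y)) = hadd (L2 m LL) (U (j x)) (U (j y))"
      using U j xy by (simp add: hlinear_def hunitary_def)
    ultimately show ?case
      using add.IH Lm.sqint_add[of "f x" "f y"] Lm.L2_class_add[of "f x" "f y"] by (simp add: good_def)
  next
    case (scale x c)
    show ?case by (rule scl[OF W.hspan_car[OF scale.hyps RK_dom] scale.IH])
  qed
qed

text \<open>The unitary keeps distances, so the classes converge; \<open>L2_limit\<close> recognizes
  their limit from the pointwise limits at every g.\<close>

lemma good_limit:
  assumes U: "hunitary (htensor LL LL) (L2 m LL) U" and X: "\<And>n. good U j f (X n)"
    and j: "\<And>n. j (X n) \<in> hcar (htensor LL LL)" "j x \<in> hcar (htensor LL LL)" "htends (htensor LL LL) (\<lambda>n. j (X n)) (j x)"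
    and f: "\<And>g. f x g \<in> hcar LL" "\<And>g. htends LL (\<lambda>n. f (X n) g) (f x g)"
  shows "good U j f x"
proof -
  note s = L.semi_inner_space_axioms
  have T: "semi_inner_space (htensor LL LL)" using hilbert_htensor[OF s s] by (simp add: hilbert_def)
  have "htends (L2 m LL) (\<lambda>n. U (j (X n))) (U (j x))"
    using j by (simp add: htends_def unitary_dist[OF T Lm.L2.semi_inner_space_axioms U])
  then have lim: "htends (L2 m LL) (\<lambda>n. L2_class m LL (f (X n))) (U (j x))" using X by (simp add: good_def)
  have Y: "U (j x) \<in> hcar (L2 m LL)" using U j(2) by (simp add: hunitary_def hlinear_def)
  have F: "f (X n) \<in> sqint m LL" for n using X by (simp add: good_def)
  show ?thesis using Lm.L2_limit[OF F Y lim f] by (simp add: good_def)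
qed

text \<open>
  Two limits: first in \<open>S\<close> with \<open>T\<close> of rank one, where strong convergence of \<open>S\<close> suffices, then in \<open>T\<close>
  with \<open>S\<close> fixed, where boundedness of \<open>S\<close> suffices.
\<close>

lemma good_all:
  assumes U: "hunitary (htensor LL LL) (L2 m LL) U"
    and rk: "\<And>S T. S \<in> RK ==> T \<in> RK ==> U (tens S T) = L2_class m LL (Gal S T)"
    and S: "S \<in> WD" and T: "T \<in> WD"
  shows "Gal S T \<in> sqint m LL" "U (tens S T) = L2_class m LL (Gal S T)"
proof -
  note s = L.semi_inner_space_axioms
  have RKWD: "S \<in> WD" if "S \<in> RK" for S using RK_dom that by (auto simp: W_simps)
  have left: "hlinear W (htensor LL LL) (\<lambda>S. tens S T)" if "T \<in> WD" for T
    using that by (simp add: hlinear_def W_simps(1) elem_tensor_car[OF s s] \<Lambda>_car W.hembed_add W.hembed_scale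
        elem_tensor_add_left[OF s s] elem_tensor_scale_left[OF s s])
  have right: "hlinear W (htensor LL LL) (\<lambda>T. tens S T)"
    using S by (simp add: hlinear_def W_simps(1) elem_tensor_car[OF s s] \<Lambda>_car W.hembed_add W.hembed_scale
        elem_tensor_add_right[OF s s] elem_tensor_scale_right[OF s s])
  have base: "good U (tens S) (Gal S) T" if T: "T \<in> RK" for T
  proof -
    obtain c e where ce: "c \<in> hcar H" "e \<in> DomH" "T = rk H c e" using T by (auto simp: RK_def)
    have "good U (\<lambda>S. tens S T) (\<lambda>S. Gal S T) S" if "S \<in> RK" for S
      using rk[OF that T] that T by (auto simp: good_def RK_def Gal_rk_sqint)
    then have span: "good U (\<lambda>S. tens S T) (\<lambda>S. Gal S T) S" if "S \<in> hspan W RK" for S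
      by (rule good_span[OF U left[OF RKWD[OF T]] Gal_linear_left[OF RKWD[OF T]] _ that])
    obtain X where X: "\<And>n. X n \<in> hspan W RK" "htends W X S" "\<And>x. x \<in> hcar H ==> htends H (\<lambda>n. X n x) (S x)"
      using finite_rank_approx[OF S] by blast
    note XW = span_dom[OF X(1)]
    have "good U (\<lambda>S. tens S T) (\<lambda>S. Gal S T) S"
    proof (rule good_limit[OF U span[OF X(1)]])
      show "tens (X n) T \<in> hcar (htensor LL LL)" "tens S T \<in> hcar (htensor LL LL)" for n
        by (intro elem_tensor_car[OF s s] \<Lambda>_car XW S RKWD T)+
      have "(\<lambda>n. hdist W (X n) S * hnorm LL (\<Lambda> T)) \<longlonglongrightarrow> 0 * hnorm LL (\<Lambda> T)"
        using X(2) by (intro tendsto_mult tendsto_const) (simp add: htends_def)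
      then show "htends (htensor LL LL) (\<lambda>n. tens (X n) T) (tens S T)"
        by (simp add: htends_def elem_tensor_dist_left[OF s s] \<Lambda>_car XW S RKWD[OF T] W.hembed_dist W_simps(1))
      show "Gal S T g \<in> hcar LL" for g by (rule Gal_car[OF S RKWD[OF T]])
      show "htends LL (\<lambda>n. Gal (X n) T g) (Gal S T g)" for g
      proof -
        let ?y = "op_adj H (\<pi> g) c"
        have y: "?y \<in> hcar H" by (rule adj_pi_car[OF ce(1)])
        note Xy = bounded_opsD(2)[OF dom_bounded[OF XW] y] and Sy = bounded_opsD(2)[OF dom_bounded[OF S] y]
        have "hdist LL (Gal (X n) T g) (Gal S T g) = hdist H (X n ?y) (S ?y) * hnorm HD (jd e)" for n
        proof -
          let ?a = "\<pi> g (X n ?y)" and ?b = "\<pi> g (S ?y)"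
          have ab: "?a \<in> hcar H" "?b \<in> hcar H" by (intro pi_car Xy Sy)+
          have "hdiff LL (\<Lambda> (rk H ?a e)) (\<Lambda> (rk H ?b e)) = \<Lambda> (rk H (hdiff H ?a ?b) e)"
            using ab ce(2) by (simp add: hdiff_def \<Lambda>_rk_linear(1,2)[of _ _ e e])
          then have "hdist LL (\<Lambda> (rk H ?a e)) (\<Lambda> (rk H ?b e)) = hdist H ?a ?b * hnorm HD (jd e)"
            using ab ce(2) by (simp add: hdist_hdiff W.hembed_norm W_simps(1) rk_dom rk_norm)
          also have "hdist H ?a ?b = hdist H (X n ?y) (S ?y)"
            by (rule unitary_dist[OF CL2.L2.semi_inner_space_axioms CL2.L2.semi_inner_space_axioms pi_unitary Xy Sy])
          finally show ?thesis
            by (simp add: ce(3) Gal_rk_right[OF dom_bounded[OF XW] ce(1,2)] Gal_rk_right[OF dom_bounded[OF S] ce(1,2)])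
        qed
        moreover have "(\<lambda>n. hdist H (X n ?y) (S ?y) * hnorm HD (jd e)) \<longlonglongrightarrow> 0 * hnorm HD (jd e)"
          using X(3)[OF y] by (intro tendsto_mult tendsto_const) (simp add: htends_def)
        ultimately show ?thesis by (simp add: htends_def)
      qed
    qed
    then show ?thesis by (simp add: good_def)
  qed
  have span: "good U (tens S) (Gal S) T" if "T \<in> hspan W RK" for T
    by (rule good_span[OF U right Gal_linear_right[OF S] base that])
  obtain X where X: "\<And>n. X n \<in> hspan W RK" "htends W X T" using finite_rank_approx[OF T] by blast
  note XW = span_dom[OF X(1)]
  obtain C where C: "C \<ge> 0" "\<And>x. x \<in> hcar H ==> hnorm H (S x) \<le> C * hnorm H x"
    using bounded_ops_bound[OF CL2.L2.semi_inner_space_axioms dom_bounded[OF S]] by blast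
  have "good U (tens S) (Gal S) T"
  proof (rule good_limit[OF U span[OF X(1)]])
    show "tens S (X n) \<in> hcar (htensor LL LL)" "tens S T \<in> hcar (htensor LL LL)" for n
      by (intro elem_tensor_car[OF s s] \<Lambda>_car XW S T)+
    have "(\<lambda>n. hnorm LL (\<Lambda> S) * hdist W (X n) T) \<longlonglongrightarrow> hnorm LL (\<Lambda> S) * 0"
      using X(2) by (intro tendsto_mult tendsto_const) (simp add: htends_def)
    then show "htends (htensor LL LL) (\<lambda>n. tens S (X n)) (tens S T)"
      by (simp add: htends_def elem_tensor_dist_right[OF s s] \<Lambda>_car XW S T W.hembed_dist W_simps(1))
    show "Gal S T g \<in> hcar LL" for g by (rule Gal_car[OF S T])
    show "htends LL (\<lambda>n. Gal S (X n) g) (Gal S T g)" for g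
    proof -
      have le: "hdist LL (Gal S (X n) g) (Gal S T g) \<le> C * hdist W (X n) T" for n
      proof -
        have dW: "hdiff W (X n) T \<in> WD" using W.diff_car[of "X n" T] XW T by (simp add: W_simps(1))
        have "hdiff LL (Gal S (X n) g) (Gal S T g) = Gal S (hdiff W (X n) T) g"
          using Gal_linear_right[OF S, of g] XW T W.scale_car[of T "- 1"] by (simp add: hdiff_def hlinear_def W_simps(1))
        then have "hdist LL (Gal S (X n) g) (Gal S T g) = hnorm W (op_comp H (op_Ad H (\<pi> g) S) (hdiff W (X n) T))"
          using Ad_comp_dom[OF dom_bounded[OF S] dW] by (simp add: hdist_hdiff Gal_def W.hembed_norm W_simps(1))
        also have "... \<le> C * hnorm W (hdiff W (X n) T)"
          by (rule W_ideal(2)[OF Ad_bounded[OF dom_bounded[OF S]] dW C(1)]) (rule Ad_bound[OF dom_bounded[OF S] C(2)])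
        finally show ?thesis by (simp add: hdist_hdiff)
      qed
      have lim: "(\<lambda>n. C * hdist W (X n) T) \<longlonglongrightarrow> C * 0"
        using X(2) by (intro tendsto_mult tendsto_const) (simp add: htends_def)
      show ?thesis
        unfolding htends_def
      proof (rule tendsto_sandwich)
        show "\<forall>\<^sub>F n in sequentially. 0 \<le> hdist LL (Gal S (X n) g) (Gal S T g)"
          by (intro always_eventually allI L.dist_nonneg Gal_car S T XW)
        show "\<forall>\<^sub>F n in sequentially. hdist LL (Gal S (X n) g) (Gal S T g) \<le> C * hdist W (X n) T"
          by (intro always_eventually allI le)
        show "(\<lambda>n. C * hdist W (X n) T) \<longlonglongrightarrow> 0" using lim by simp
      qed (rule tendsto_const)
    qed
  qed
  then show "Gal S T \<in> sqint m LL" "U (tens S T) = L2_class m LL (Gal S T)"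
    by (simp_all add: good_def)
qed

theorem galois: "galois_object gmul m H \<phi> \<pi>"
proof -
  obtain U where UU: "hunitary (htensor LL LL) (L2 m LL) U \<and> (\<forall>S\<in>RK. \<forall>T\<in>RK. U (tens S T) = L2_class m LL (Gal S T))"
    using unitary_on_rk by (elim exE)
  note U = conjunct1[OF UU]
  have rk: "U (tens S T) = L2_class m LL (Gal S T)" if "S \<in> RK" "T \<in> RK" for S T
    by (rule conjunct2[OF UU, THEN bspec, THEN bspec, OF that])
  have G: "gns_space H \<phi> = LL" "gns_map H \<phi> = \<Lambda>" by (simp_all add: gns_space_def gns_map_def fun_eq_iff)
  have n: "hnorm (L2 m LL) (U x) = hnorm (htensor LL LL) x" if "x \<in> hcar (htensor LL LL)" for x
    using U that by (simp add: hnorm_def hunitary_def)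
  have hl: "hlinear (htensor LL LL) (L2 m LL) U" using U by (simp only: hunitary_def)
  have gal: "is_galois_map m H \<phi> \<pi> U"
    unfolding is_galois_map_def Let_def G
  proof (intro conjI ballI hl)
    show "hnorm (L2 m LL) (U x) = hnorm (htensor LL LL) x" if "x \<in> hcar (htensor LL LL)" for x
      by (rule n[OF that])
    fix S T assume S: "S \<in> weight_domain H \<phi>" and T: "T \<in> weight_domain H \<phi>"
    show "(\<lambda>g. \<Lambda> (op_comp H (op_Ad H (\<pi> g) S) T)) \<in> sqint m LL"
      using good_all(1)[OF U rk S T] unfolding Gal_def[abs_def] .
    show "U (tens S T) = L2_class m LL (\<lambda>g. \<Lambda> (op_comp H (op_Ad H (\<pi> g) S) T))"
      using good_all(2)[OF U rk S T] unfolding Gal_def[abs_def] .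
  qed
  show ?thesis unfolding galois_object_def G by (intro conjI exI[of _ U] rep U gal)
qed

end

section \<open>The representation\<close>

context invariant
begin

lemma distr_translate: "distr \<mu> borel (\<lambda>x. g + x) = \<mu>"
proof (rule measure_eqI)
  have m: "(\<lambda>x. g + x) \<in> measurable \<mu> borel" by measurable
  fix A assume "A \<in> sets (distr \<mu> borel (\<lambda>x. g + x))"
  then have A [measurable]: "A \<in> sets borel" by simp
  have "emeasure (distr \<mu> borel (\<lambda>x. g + x)) A = (\<integral>\<^sup>+x. indicator A x \<partial>(distr \<mu> borel (\<lambda>x. g + x)))"
    using A by (intro nn_integral_indicator[symmetric]) simp
  also have "... = (\<integral>\<^sup>+x. indicator A (g + x) \<partial>\<mu>)" by (rule nn_integral_distr[OF m]) measurable
  also have "... = (\<integral>\<^sup>+x. indicator A x \<partial>\<mu>)" by (rule nn_translate) measurable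
  also have "... = emeasure \<mu> A" using A by (intro nn_integral_indicator) simp
  finally show "emeasure (distr \<mu> borel (\<lambda>x. g + x)) A = emeasure \<mu> A" .
qed simp

lemma integral_translate:
  fixes f :: "'g => complex"
  assumes f: "f \<in> borel_measurable borel" shows "(\<integral>x. f (g + x) \<partial>\<mu>) = (\<integral>x. f x \<partial>\<mu>)"
proof -
  have m: "(\<lambda>x. g + x) \<in> measurable \<mu> borel" by measurable
  show ?thesis using integral_distr[OF m f] by (simp add: distr_translate)
qed

lemma AE_translate: assumes "AE x in \<mu>. P x" shows "AE x in \<mu>. P (g + x)"
proof -
  have m: "(\<lambda>x. g + x) \<in> measurable \<mu> borel" by measurable
  show ?thesis by (rule AE_distrD[OF m]) (unfold distr_translate, rule assms)
qed

end

context fourier_setup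
begin

lemma pairing_dual_act: "pairing (dual_act act q \<xi>) v = pairing \<xi> (act (- q) v)"
proof -
  have "continuous_on UNIV (\<lambda>(q, v). act q v)" using action by (simp add: continuous_group_action_def)
  then have "continuous_on UNIV (\<lambda>v. act (- q) v)"
    using continuous_on_compose2[of UNIV "\<lambda>(q, v). act q v" UNIV "\<lambda>v. (- q, v)"] by (simp add: continuous_intros)
  then have "is_character (\<lambda>v. pairing \<xi> (act (- q) v))"
    using is_character_pairing[of \<xi>] continuous_on_compose2[of UNIV "pairing \<xi>" UNIV "\<lambda>v. act (- q) v"]
    by (simp add: is_character_def act_simps)
  then show ?thesis by (simp add: dual_act_def Abs_pdual_inverse)
qed

lemma pairing_eta_add: "pairing (\<eta> (p + q)) v = pairing (\<eta> p) v * pairing (\<eta> q) (act (- p) v)"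
  using eta by (simp add: Z1c_def pairing_plus pairing_dual_act)

lemma pairing_add: "pairing \<xi> (v + w) = pairing \<xi> v * pairing \<xi> w"
  using is_character_pairing[of \<xi>] by (simp add: is_character_def)

end

context cocycle_setup
begin

section \<open>Unitarity, composition law and coefficients of the representation\<close>

abbreviation "\<pi> \<equiv> cocycle_rep \<mu> \<eta> b"
abbreviation "cl \<equiv> L2_class \<mu> \<C>"

text \<open>The representation on functions, where the composition law holds at every point and not
  merely almost everywhere.\<close>

definition twist :: "'q => 'v => ('q => complex) => 'q => complex" where
  "twist q v f = (\<lambda>z. cnj (pairing (\<eta> z) v) * b (- z) q * f (- q + z))"

lemma borel_mu: "f \<in> borel_measurable \<mu> \<longleftrightarrow> f \<in> borel_measurable borel"
  by (rule arg_cong[of _ _ "\<lambda>S. f \<in> S"], rule measurable_cong_sets[OF Q.sets_inv refl])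

text \<open>Applied to \<mu> and to its weighted version, so that one countable family is total in
  both spaces, as \<open>weight_setup\<close> requires.\<close>

lemma base_total:
  assumes sets: "sets N = sets borel" and sq: "\<And>A. A \<in> base ==> indicator A \<in> sqint N \<C>"
  shows "htotal (L2 N \<C>) (L2_class N \<C> ` indicator ` base)"
proof (rule L2_total_of_separating)
  show "indicator ` base \<subseteq> sqint N \<C>" using sq by (rule image_subsetI)
  fix f assume f: "f \<in> sqint N \<C>"
    and zero: "\<And>k. k \<in> indicator ` base ==> (\<integral>x. f x * cnj (k x) \<partial>N) = 0"
  have space: "space N = UNIV" using sets_eq_imp_space_eq[OF sets] by simp
  have eq: "indicator A x *\<^sub>R f x = f x * cnj (indicator A x)" for A x by (simp add: indicator_def)
  show "AE x in N. f x = 0"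
  proof (rule AE_zero_of_pi_system[where G = base and C = base])
    show "sets N = sigma_sets (space N) base" by (simp add: sets space base_sigma)
    show "set_integrable N A f" if "A \<in> base" for A
      using CL2.sqint_inner_integrable[OF f sq[OF that]] by (simp add: set_integrable_def eq)
    show "(LINT x:A|N. f x) = 0" if "A \<in> base" for A
      using zero[OF imageI[OF that]] by (simp add: set_lebesgue_integral_def eq)
  qed (simp_all add: base_Int base_countable base_cover space)
qed

sublocale w: weight_setup \<mu> "duflo_moore_density act \<mu> \<nu>"
proof
  show "dens \<in> borel_measurable \<mu>" by (simp add: borel_mu)
  show "0 < dens q" for q by (rule dens_pos)
  have 1: "indicator A \<in> sqint \<mu> \<C>" if "A \<in> base" for A
    using Dom_Sq[OF base_Dom[OF that]] Sq_sqint by simp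
  have 2: "indicator A \<in> hcar (sqint_space (density \<mu> (\<lambda>x. ennreal (dens x))) \<C>)" if "A \<in> base" for A
    using Dom_sqint[OF base_Dom[OF that]] by simp
  show "\<exists>F. countable F \<and> F \<subseteq> sqint \<mu> \<C> \<and>
      F \<subseteq> hcar (sqint_space (density \<mu> (\<lambda>x. ennreal (dens x))) \<C>) \<and>
      htotal (L2 \<mu> \<C>) (L2_class \<mu> \<C> ` F) \<and>
      htotal (L2 (density \<mu> (\<lambda>x. ennreal (dens x))) \<C>)
        (L2_class (density \<mu> (\<lambda>x. ennreal (dens x))) \<C> ` F)"
    by (intro exI[of _ "indicator ` base"] conjI countable_image base_countable image_subsetI base_total)
      (simp_all add: 1 2)
qed

lemma cl_car: "f \<in> Sq ==> cl f \<in> hcar w.H"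
  by (simp only: Sq_sqint) (rule CL2.L2_class_car)

lemma cl_ex:
  assumes "X \<in> hcar w.H" shows "\<exists>f\<in>Sq. X = cl f"
  using CL2.L2_class_ex[OF assms] by (elim bexE) (rule bexI, assumption, simp add: Sq_sqint)

lemma cl_inner: "f \<in> Sq ==> g \<in> Sq ==> hinner w.H (cl f) (cl g) = (\<integral>z. f z * cnj (g z) \<partial>\<mu>)"
  by (simp add: CL2.L2_class_inner Sq_sqint)

lemma cl_add: "f \<in> Sq ==> g \<in> Sq ==> hadd w.H (cl f) (cl g) = cl (\<lambda>z. f z + g z)"
  and cl_scale: "f \<in> Sq ==> hscale w.H c (cl f) = cl (\<lambda>z. c * f z)"
  by (simp_all add: CL2.L2_class_add CL2.L2_class_scale Sq_sqint)

lemma Sq_add: "f \<in> Sq ==> g \<in> Sq ==> (\<lambda>z. f z + g z) \<in> Sq" and Sq_scale: "f \<in> Sq ==> (\<lambda>z. c * f z) \<in> Sq"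
  using CL2.sqint_add[of f \<mu> g] CL2.sqint_scale[of f \<mu> c] by (simp_all add: Sq_sqint)

lemma twist_Sq:
  assumes f: "f \<in> Sq" shows "twist q v f \<in> Sq"
proof -
  have [measurable]: "f \<in> borel_measurable borel" using f by (simp add: Sq_def)
  have "twist q v f \<in> borel_measurable borel"
    unfolding twist_def by measurable
  moreover have "(\<integral>\<^sup>+z. ennreal ((cmod (f (- q + z)))\<^sup>2) \<partial>\<mu>) < \<infinity>"
    using Sq_translate[OF f, of "- q"] by (simp add: Sq_def)
  ultimately show ?thesis by (simp add: Sq_def twist_def norm_mult)
qed

text \<open>\<open>L2_op\<close> acts on a chosen representative. Left translation preserves null
  sets, so the choice does not affect the class.\<close>

lemma rep_class:
  assumes f: "f \<in> Sq" shows "\<pi> (q, v) (cl f) = cl (twist q v f)"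
proof -
  let ?g = "SOME h. h \<in> cl f"
  have g: "?g \<in> Sq" using CL2.L2_rep(1)[OF cl_car[OF f]] by (simp add: Sq_sqint)
  have "AE z in \<mu>. ?g z = f z" using CL2.L2_class_rep[of f \<mu>] f by (simp add: Sq_sqint)
  then have "AE z in \<mu>. ?g (- q + z) = f (- q + z)" by (rule Q.AE_translate)
  then have ae: "AE z in \<mu>. twist q v ?g z = twist q v f z" by eventually_elim (simp add: twist_def)
  have "cl (twist q v ?g) = cl (twist q v f)"
    using CL2.L2_class_eq_iff[of "twist q v ?g" \<mu> "twist q v f"] twist_Sq[OF g] twist_Sq[OF f] ae by (simp add: Sq_sqint)
  then show ?thesis using cl_car[OF f] by (simp add: L2_op_def twist_def)
qed

lemma rep_coef:
  assumes c: "c \<in> Sq" and e: "e \<in> Sq" shows "hinner w.H (cl c) (\<pi> x (cl e)) = theta (kerTensor c e) x"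
proof (cases x)
  case (Pair q v)
  have "hinner w.H (cl c) (\<pi> x (cl e)) = (\<integral>z. c z * cnj (twist q v e z) \<partial>\<mu>)"
    unfolding Pair rep_class[OF e] by (rule cl_inner[OF c twist_Sq[OF e]])
  then show ?thesis by (simp add: Pair theta_def invF_def kerTensor_def twist_def mult_ac del: cocycle_rep.simps)
qed

lemma unimodular: "cmod z = 1 ==> z * cnj z = 1"
  by (simp flip: complex_norm_square)

lemma rep_inner:
  assumes X: "X \<in> hcar w.H" and Y: "Y \<in> hcar w.H" shows "hinner w.H (\<pi> x X) (\<pi> x Y) = hinner w.H X Y"
proof (cases x)
  case (Pair q v)
  obtain f g where f: "f \<in> Sq" "X = cl f" and g: "g \<in> Sq" "Y = cl g" using cl_ex[OF X] cl_ex[OF Y] by (elim bexE)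
  have [measurable]: "f \<in> borel_measurable borel" "g \<in> borel_measurable borel" using f g by (simp_all add: Sq_def)
  have "hinner w.H (\<pi> x X) (\<pi> x Y) = (\<integral>z. twist q v f z * cnj (twist q v g z) \<partial>\<mu>)"
    unfolding Pair f(2) g(2) rep_class[OF f(1)] rep_class[OF g(1)] by (rule cl_inner[OF twist_Sq[OF f(1)] twist_Sq[OF g(1)]])
  also have "... = (\<integral>z. f (- q + z) * cnj (g (- q + z)) \<partial>\<mu>)"
  proof (intro int_cong)
    fix z
    have "twist q v f z * cnj (twist q v g z)
      = (pairing (\<eta> z) v * cnj (pairing (\<eta> z) v)) * (b (- z) q * cnj (b (- z) q)) * (f (- q + z) * cnj (g (- q + z)))"
      by (simp add: twist_def mult_ac)
    then show "twist q v f z * cnj (twist q v g z) = f (- q + z) * cnj (g (- q + z))" by (simp add: unimodular)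
  qed
  also have "... = (\<integral>z. f z * cnj (g z) \<partial>\<mu>)" by (rule Q.integral_translate[where f = "\<lambda>z. f z * cnj (g z)"]) measurable
  finally show ?thesis by (simp add: f g cl_inner)
qed

lemma rep_linear:
  assumes X: "X \<in> hcar w.H"
  shows "\<pi> x X \<in> hcar w.H" "Y \<in> hcar w.H ==> \<pi> x (hadd w.H X Y) = hadd w.H (\<pi> x X) (\<pi> x Y)"
    "\<pi> x (hscale w.H c X) = hscale w.H c (\<pi> x X)"
proof -
  obtain q v where x: "x = (q, v)" by (cases x)
  obtain f where f: "f \<in> Sq" "X = cl f" using cl_ex[OF X] by (elim bexE)
  note tf = twist_Sq[OF f(1), of q v]
  show "\<pi> x X \<in> hcar w.H" unfolding x f(2) rep_class[OF f(1)] by (rule cl_car[OF tf])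
  show "\<pi> x (hscale w.H c X) = hscale w.H c (\<pi> x X)"
    unfolding x f(2) cl_scale[OF f(1)] rep_class[OF Sq_scale[OF f(1)]] rep_class[OF f(1)] cl_scale[OF tf]
    by (simp add: twist_def mult_ac)
  assume "Y \<in> hcar w.H"
  then obtain g where g: "g \<in> Sq" "Y = cl g" using cl_ex by (elim bexE[OF cl_ex])
  show "\<pi> x (hadd w.H X Y) = hadd w.H (\<pi> x X) (\<pi> x Y)"
    unfolding x f(2) g(2) cl_add[OF f(1) g(1)] rep_class[OF Sq_add[OF f(1) g(1)]] rep_class[OF f(1)]
      rep_class[OF g(1)] cl_add[OF tf twist_Sq[OF g(1)]]
    by (simp add: twist_def ring_distribs)
qed

lemma rep_surj:
  assumes X: "X \<in> hcar w.H" shows "\<exists>Y\<in>hcar w.H. \<pi> x Y = X"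
proof -
  obtain q v where x: "x = (q, v)" by (cases x)
  obtain g where g: "g \<in> Sq" "X = cl g" using cl_ex[OF X] by (elim bexE)
  have [measurable]: "g \<in> borel_measurable borel" using g by (simp add: Sq_def)
  \<comment> \<open>Solves \<open>twist q v f = g\<close> for f: substitute q + z and cancel the two
    phases by their conjugates.\<close>
  let ?f = "\<lambda>z. pairing (\<eta> (q + z)) v * cnj (b (- (q + z)) q) * g (q + z)"
  have "?f \<in> borel_measurable borel" by (intro borel_measurable_times cnj_measurable) measurable
  then have f: "?f \<in> Sq"
    using Sq_translate[OF g(1), of q] by (simp add: Sq_def norm_mult)
  have "twist q v ?f z = (pairing (\<eta> z) v * cnj (pairing (\<eta> z) v)) * (b (- z) q * cnj (b (- z) q)) * g z" for z
    by (simp add: twist_def mult_ac flip: add.assoc)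
  then have "twist q v ?f = g" by (simp add: unimodular fun_eq_iff)
  then have "\<pi> x (cl ?f) = X" by (simp add: x g(2) rep_class[OF f] del: cocycle_rep.simps)
  then show ?thesis using cl_car[OF f] by (rule bexI)
qed

lemma rep_unitary: "hunitary w.H w.H (\<pi> x)"
  unfolding hunitary_def hlinear_def
  by (intro conjI ballI allI rep_linear rep_inner equalityI image_subsetI) (use rep_surj[of _ x] in \<open>auto simp del: cocycle_rep.simps\<close>)

lemma rep_bounded: "\<pi> x \<in> bounded_ops w.H"
proof (rule bounded_opsI[where C = 1])
  show "\<pi> x \<in> extensional (hcar w.H)" by (cases x) (simp add: L2_op_def)
  show "hnorm w.H (\<pi> x X) \<le> 1 * hnorm w.H X" if "X \<in> hcar w.H" for X
    by (simp add: hnorm_def rep_inner[OF that that] del: cocycle_rep.simps)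
qed (rule rep_linear, assumption+)+

text \<open>Evaluate the coboundary identity at (-z, q, q'): it exchanges the product of the two
  values of \<open>b\<close> for one value at q + q', at the cost of the pairing of
  \<open>\<eta> z\<close> with \<open>\<beta> q q'\<close>, which is the contribution of
  \<open>\<beta>\<close> to the group product. The cocycle identity for \<open>\<eta>\<close> at - q
  + z splits the other pairing. The remaining phase does not depend on z.\<close>

lemma twist_twist:
  assumes comp: "psi_cocycle \<eta> \<beta> = coboundary2 b"
  shows "twist q v (twist q' v' f)
    = (\<lambda>z. (cnj (pairing (\<eta> (- q)) v') * b q q') * twist (q + q') (v + act q v' + \<beta> q q') f z)"
proof
  fix z
  have nz: "b p r \<noteq> 0" for p r using norm_b[of p r] by (metis norm_zero zero_neq_one)
  have "psi_cocycle \<eta> \<beta> (- z) q q' = coboundary2 b (- z) q q'" by (simp add: comp)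
  then have "pairing (\<eta> z) (\<beta> q q') * (b (- z) q * b (- z + q) q') = b q q' * b (- z) (q + q')"
    by (simp add: psi_cocycle_def coboundary2_def divide_simps nz)
  then have "(pairing (\<eta> z) (\<beta> q q') * cnj (pairing (\<eta> z) (\<beta> q q'))) * (b (- z) q * b (- z + q) q')
      = cnj (pairing (\<eta> z) (\<beta> q q')) * (b q q' * b (- z) (q + q'))"
    by (metis mult.assoc mult.commute)
  then have bb: "b (- z) q * b (- z + q) q' = cnj (pairing (\<eta> z) (\<beta> q q')) * (b q q' * b (- z) (q + q'))"
    by (simp add: unimodular)
  have z': "- q' + (- q + z) = - (q + q') + z" by (simp only: minus_add add.assoc)
  have "twist q v (twist q' v' f) z = cnj (pairing (\<eta> z) v) * cnj (pairing (\<eta> (- q + z)) v')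
      * (b (- z) q * b (- z + q) q') * f (- (q + q') + z)"
    by (simp add: twist_def z' minus_add[of "- q" z] mult_ac)
  also have "... = (cnj (pairing (\<eta> (- q)) v') * b q q') * twist (q + q') (v + act q v' + \<beta> q q') f z"
    unfolding bb by (simp add: twist_def pairing_eta_add pairing_add mult_ac)
  finally show "twist q v (twist q' v' f) z
      = (cnj (pairing (\<eta> (- q)) v') * b q q') * twist (q + q') (v + act q v' + \<beta> q q') f z" .
qed

lemma rep_projective:
  assumes comp: "psi_cocycle \<eta> \<beta> = coboundary2 b"
  shows "projective_unitary_rep (ext_mult act \<beta>) haarG w.H \<pi>"
  unfolding projective_unitary_rep_def
proof (intro conjI allI ballI rep_bounded rep_unitary)
  fix x y :: "'q \<times> 'v"
  obtain q v q' v' where xy: "x = (q, v)" "y = (q', v')" by (cases x, cases y)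
  let ?\<omega> = "cnj (pairing (\<eta> (- q)) v') * b q q'"
  have "op_comp w.H (\<pi> x) (\<pi> y) = op_scale w.H ?\<omega> (\<pi> (ext_mult act \<beta> x y))"
    unfolding op_comp_def op_scale_def
  proof (rule restrict_ext)
    fix X assume "X \<in> hcar w.H"
    then obtain f where f: "f \<in> Sq" "X = cl f" by (elim bexE[OF cl_ex])
    show "\<pi> x (\<pi> y X) = hscale w.H ?\<omega> (\<pi> (ext_mult act \<beta> x y) X)"
      unfolding xy f(2) ext_mult.simps rep_class[OF f(1)] rep_class[OF twist_Sq[OF f(1)]] cl_scale[OF twist_Sq[OF f(1)]]
        twist_twist[OF comp] ..
  qed
  then show "\<exists>\<omega>. cmod \<omega> = 1 \<and> op_comp w.H (\<pi> x) (\<pi> y) = op_scale w.H \<omega> (\<pi> (ext_mult act \<beta> x y))"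
    by (intro exI[of _ ?\<omega>] conjI) (simp_all add: norm_mult del: cocycle_rep.simps)
next
  fix X Y assume X: "X \<in> hcar w.H" and Y: "Y \<in> hcar w.H"
  obtain f g where f: "f \<in> Sq" "X = cl f" and g: "g \<in> Sq" "Y = cl g" using cl_ex[OF X] cl_ex[OF Y] by (elim bexE)
  have [measurable]: "f \<in> borel_measurable borel" "g \<in> borel_measurable borel" using f g by (simp_all add: Sq_def)
  have "hinner w.H (\<pi> x X) Y = cnj (theta (kerTensor g f) x)" for x
    using CL2.L2.inner_cnj[OF Y rep_linear(1)[OF X], of x] rep_coef[OF g(1) f(1), of x]
    by (simp add: f(2) g(2) del: cocycle_rep.simps)
  moreover have "(\<lambda>x. cnj (theta (kerTensor g f) x)) \<in> borel_measurable haarG"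
    unfolding meas_haarG_iff by (intro cnj_measurable theta_measurable) measurable
  ultimately show "(\<lambda>x. hinner w.H (\<pi> x X) Y) \<in> borel_measurable haarG" by simp
qed

lemma DomH_rep: assumes Y: "Y \<in> w.DomH" shows "w.rp Y \<in> Dom"
  using w.rp(1)[OF w.DomH_car[OF Y]] Y unfolding Sq_sqint[symmetric]
  by (simp add: Dom_def Sq_def w.DomH_def w.wn_def)

text \<open>Coefficients between classes are transforms of product kernels of their representatives,
  so orthogonality and totality carry over from functions.\<close>

lemma galois_setup_rep:
  assumes comp: "psi_cocycle \<eta> \<beta> = coboundary2 b"
  shows "galois_setup \<mu> dens haarG (ext_mult act \<beta>) \<pi>"
proof (intro galois_setup.intro galois_setup_axioms.intro w.weight_setup_axioms rep_projective[OF comp])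
  have rpS: "w.rp X \<in> Sq" "cl (w.rp X) = X" if "X \<in> hcar w.H" for X using w.rp[OF that] by (simp_all add: Sq_sqint)
  have coef: "(\<lambda>g. hinner w.H X (\<pi> g Y)) = theta (kerTensor (w.rp X) (w.rp Y))" if "X \<in> hcar w.H" "Y \<in> w.DomH" for X Y
    using rep_coef[OF rpS(1)[OF that(1)] rpS(1)[OF w.DomH_car[OF that(2)]]]
    by (simp add: rpS(2)[OF that(1)] rpS(2)[OF w.DomH_car[OF that(2)]] fun_eq_iff del: cocycle_rep.simps split_paired_All)
  show "(\<lambda>g. hinner w.H X (\<pi> g Y)) \<in> sqint haarG \<C>" if "X \<in> hcar w.H" "Y \<in> w.DomH" for X Y
    unfolding coef[OF that] by (rule theta_sqint[OF kerTensor_Kern[OF rpS(1)[OF that(1)] DomH_rep[OF that(2)]]])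
  show "(\<integral>g. hinner w.H X (\<pi> g Y) * cnj (hinner w.H X' (\<pi> g Y')) \<partial>haarG) = hinner w.H X X' * hinner w.HD (w.jd Y') (w.jd Y)"
    if "X \<in> hcar w.H" "Y \<in> w.DomH" "X' \<in> hcar w.H" "Y' \<in> w.DomH" for X Y X' Y'
  proof -
    have "(\<integral>g. hinner w.H X (\<pi> g Y) * cnj (hinner w.H X' (\<pi> g Y')) \<partial>haarG)
        = (\<integral>x. theta (kerTensor (w.rp X) (w.rp Y)) x * cnj (theta (kerTensor (w.rp X') (w.rp Y')) x) \<partial>haarG)"
      using fun_cong[OF coef[OF that(1,2)]] fun_cong[OF coef[OF that(3,4)]] by simp
    also have "... = (\<integral>z. w.rp X z * cnj (w.rp X' z) \<partial>\<mu>) * (\<integral>z. w.rp Y' z * cnj (w.rp Y z) \<partial>w.D)"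
      by (rule theta_kerTensor_inner[OF rpS(1)[OF that(1)] rpS(1)[OF that(3)] DomH_rep[OF that(2)] DomH_rep[OF that(4)]])
    also have "(\<integral>z. w.rp X z * cnj (w.rp X' z) \<partial>\<mu>) = hinner w.H X X'"
      using cl_inner[OF rpS(1)[OF that(1)] rpS(1)[OF that(3)]] by (simp add: rpS(2) that)
    finally show ?thesis by (simp only: w.jd_inner[OF that(4,2)])
  qed
  let ?C = "(\<lambda>(X, Y). L2_class haarG \<C> (\<lambda>g. hinner w.H X (\<pi> g Y))) ` (hcar w.H \<times> w.DomH)"
  have car: "?C \<subseteq> hcar (L2 haarG \<C>)"
  proof (rule image_subsetI)
    fix p assume p: "p \<in> hcar w.H \<times> w.DomH"
    then have c: "fst p \<in> hcar w.H" "snd p \<in> w.DomH" by (simp_all add: mem_Times_iff)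
    show "(\<lambda>(X, Y). L2_class haarG \<C> (\<lambda>g. hinner w.H X (\<pi> g Y))) p \<in> hcar (L2 haarG \<C>)"
      unfolding split_beta coef[OF c]
      by (rule CL2.L2_class_car[OF theta_sqint[OF kerTensor_Kern[OF rpS(1)[OF c(1)] DomH_rep[OF c(2)]]]])
  qed
  have sub: "(\<lambda>(c, e). L2_class haarG \<C> (theta (kerTensor c e))) ` (Sq \<times> Dom) \<subseteq> ?C"
  proof (rule image_subsetI)
    fix p assume p: "p \<in> Sq \<times> Dom"
    then have c: "fst p \<in> Sq" "snd p \<in> Dom" by (simp_all add: mem_Times_iff)
    have Y: "cl (snd p) \<in> w.DomH"
      by (rule w.jd_class(1)[OF _ Dom_sqint[OF c(2)]]) (use Dom_Sq[OF c(2)] in \<open>simp add: Sq_sqint\<close>)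
    have "(\<lambda>(c, e). L2_class haarG \<C> (theta (kerTensor c e))) p
        = (\<lambda>(X, Y). L2_class haarG \<C> (\<lambda>g. hinner w.H X (\<pi> g Y))) (cl (fst p), cl (snd p))"
      unfolding split_beta fst_conv snd_conv rep_coef[OF c(1) Dom_Sq[OF c(2)]] ..
    then show "(\<lambda>(c, e). L2_class haarG \<C> (theta (kerTensor c e))) p \<in> ?C"
      by (rule image_eqI) (simp add: cl_car[OF c(1)] Y)
  qed
  show "htotal (L2 haarG \<C>) ?C"
    unfolding htotal_def
  proof (intro conjI car ballI impI)
    fix z assume z: "z \<in> hcar (L2 haarG \<C>)" and 0: "\<forall>s\<in>?C. hinner (L2 haarG \<C>) z s = 0"
    show "z = hzero (L2 haarG \<C>)"
      by (rule conjunct2[OF coefficients_total[unfolded htotal_def], THEN bspec, THEN mp, OF z])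
        (rule ballI, rule bspec[OF 0], rule subsetD[OF sub])
  qed
qed

end

theorem theorem2p2:
  fixes act :: "'q::{topological_group_add, second_countable_topology, t2_space}
      \<Rightarrow> 'v::{topological_ab_group_add, second_countable_topology, t2_space} \<Rightarrow> 'v"
    and \<eta> :: "'q \<Rightarrow> 'v pdual" and \<beta> :: "'q \<Rightarrow> 'q \<Rightarrow> 'v" and b :: "'q \<Rightarrow> 'q \<Rightarrow> complex"
    and \<mu> :: "'q measure" and \<nu> :: "'v measure" and \<sigma> :: "'v pdual measure"
  assumes "locally compact (UNIV :: 'q set)" and "locally compact (UNIV :: 'v set)"
    and "continuous_group_action act"
    and "\<eta> \<in> Z1c act" and "\<beta> \<in> Z2 act" and "compatible_pair \<eta> \<beta>"
    and "left_haar \<mu>" and "left_haar \<nu>" and "left_haar \<sigma>"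
    and "measure_class_iso \<mu> \<sigma> \<eta>"
    and "haar_normalized act \<eta> \<mu> \<nu> \<sigma>" and "fourier_unitary \<nu> \<sigma>"
    and "circle_cochain2 b" and "psi_cocycle \<eta> \<beta> = coboundary2 b"
  shows "galois_object (ext_mult act \<beta>) (ext_haar act \<mu> \<nu>) (L2 \<mu> complex_hspace)
           (trace_weight \<mu> (duflo_moore_density act \<mu> \<nu>)) (cocycle_rep \<mu> \<eta> b)"
proof -
  have "sets \<sigma> = sets borel" using assms(9) by (simp add: left_haar_def)
  then interpret cocycle_setup \<mu> \<nu> act \<sigma> \<eta> b
    by (intro cocycle_setup.intro cocycle_setup_axioms.intro fourier_setup.intro fourier_setup_axioms.intro
        haar_action.intro haar_action_axioms.intro invariant_left_haar assms)
  show ?thesis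
    using galois_setup.galois[OF galois_setup_rep[OF assms(14)]] by (simp only: haarG_def)
qed

end
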